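(* Consider the charged-particle equation $\ddot x=\dot x\times B(x)+E(x)$ in $\mathbb{R}^3$ with $B(x)=\frac1\varepsilon B_0+B_1(x)$, $|B_0|=1$, $0<\varepsilon\ll1$. Let $x^n$ be the numerical solution obtained by applying either the Boris algorithm or the standard variational integrator (both defined in the context) with a step size $h$ satisfying $\varepsilon\le h^2\ll 1$. Assume that the starting velocity $v^0$ is bounded independently of $\varepsilon$ and $h$, and that its component orthogonal to $B_0$, $v^0_\perp=(I-P_0)v^0$, satisfies $|v^0_\perp|\le c_1\varepsilon$ (with $c_1$ independent of $\varepsilon$ and $h$). Assume further that $x^n$ stays in a compact set $K$ for $0\le nh\le T$, with $K$ and $T$ independent of $\varepsilon$ and $h$. Then for an arbitrary truncation index $N\ge2$ there is a decomposition $$x^n=y(t)+(-1)^n z(t)+R_N(t),\qquad t=nh,$$ with the following properties. (a) The functions $y(t)$ and $z(t)$ together with their derivatives (up to order $N$) are bounded as $y=O(1)$, $z=O(h^2)$. They are unique up to $O(\varepsilon^{N+2})$. Moreover, $\dot y\times B_0=O(\varepsilon)$ and $z\cdot B_0=O(h^4)$. (b) The remainder term is bounded by $R_N(t)=O(t^2h^N)$ for $0\le t\le T$. (c) The functions $y_j=P_jy$ ($j=0,\pm1$) and $z_{\pm1}=P_{\pm1}z$ satisfy the differential equations $$\ddot y_0=P_0\bigl(\dot y\times B_1(y)+E(y)\bigr)+O(h^2),$$ $$\dot y_{\pm1}=\pm \mathrm{i}\,\varepsilon P_{\pm1}\bigl(\dot y\times B_1(y)+E(y)\bigr)+O(\varepsilon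 h^2),$$ $$\dot z_{\pm1}=\mp4\mathrm{i}\,\frac{\varepsilon}{h^2}\,z_{\pm1}+O(\varepsilon h^2).$$ The function $z_0=P_0z$ is given by an algebraic expression depending on $y$, $\dot y_0$ and $z_{\pm1}$. (d) Initial values for the differential equations of (c) are given by $$y(0)=x^0+O(h^2),\qquad \dot y_0(0)=P_0v^0+O(h^2),$$ $$z_{\pm1}(0)=\mp\frac{\mathrm{i}h^2}{4\varepsilon}P_{\pm1}\Bigl(v^0\mp\mathrm{i}\,\varepsilon\bigl(P_0v^0\times B_1(x^0)+E(x^0)\bigr)\Bigr)+O(h^4).$$ The constants symbolized by the $O$-notation are independent of $\varepsilon$, $h$ and $n$ with $0\le nh\le T$, but depend on the velocity bound, on bounds of derivatives of $B_1$ and $E$ on the compact set $K$, and on $T$.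
   Context: Setting: $B_0\in\mathbb{R}^3$ is a fixed unit vector; $B_1,E:\mathbb{R}^3\to\mathbb{R}^3$ are smooth with derivatives bounded independently of $\varepsilon$ on bounded subsets of $\mathbb{R}^3$. $B_1=\nabla\times A_1$ with a known vector potential $A_1$ (smooth, with the same kind of bounds), so $B=\nabla\times A$ with $A(x)=-\frac1{2\varepsilon}x\times B_0+A_1(x)$. The starting position $x^0$ is bounded independently of $\varepsilon$ and $h$. The standing step-size regime is $0<\varepsilon\le h^2\ll1$ (i.e. $h$ is at most a sufficiently small constant independent of $\varepsilon$). Projections: the linear map $v\mapsto v\times B_0$ on $\mathbb{C}^3$ has eigenvalues $\mathrm{i},0,-\mathrm{i}$ with normalized eigenvectors $v_1$, $v_0=B_0$, $v_{-1}=\overline{v_1}$; $P_j=v_jv_j^*$ ($j=1,0,-1$) are the orthogonal projections onto the eigenspaces (so $P_0=B_0B_0^\top$). Write $B^n=B(x^n)$, $E^n=E(x^n)$. Boris algorithm (two-step form): $$\frac{x^{n+1}-2x^n+x^{n-1}}{h^2}=\frac{x^{n+1}-x^{n-1}}{2h}\times B^n+E^n .$$ Standard variational integrator: with $A'(x)=(\partial_jA_i(x))_{i,j=1}^3$, $$\frac{x^{n+1}-2x^n+x^{n-1}}{h^2}=A'(x^n)^\top\frac{x^{n+1}-x^{n-1}}{2h}-\frac{A(x^{n+1})-A(x^{n-1})}{2h}+E^n .$$ In both cases the velocity approximation is $v^n=\frac{x^{n+1}-x^{n-1}}{2h}$; the methods are started from given $x^0,v^0$ by requiring the two-step relation for $n=0$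 together with $v^0=\frac{x^1-x^{-1}}{2h}$.
   Formalization: Uniqueness "up to O(ε^{N+2})" fails for general decompositions (add h^N t² B_0 to y); proved instead: unique up to O(h^N), and up to O(ε^{N+2}) among functions solving the modulation equations and matching the initial values up to O(ε^{N+2}). *)

theory Defs
  imports "HOL-Analysis.Analysis"
begin

text \<open>Smooth vector fields on \<open>\<real>\<^sup>3\<close>: iterated partial derivatives and their bounds on balls.\<close>

fun partials :: "3 list \<Rightarrow> (real^3 \<Rightarrow> real^3) \<Rightarrow> real^3 \<Rightarrow> real^3" where
  "partials [] f = f"
| "partials (i # is) f = (\<lambda>x. frechet_derivative (partials is f) (at x) (axis i 1))"

definition smooth :: "(real^3 \<Rightarrow> real^3) \<Rightarrow> bool" where
  "smooth f \<longleftrightarrow> (\<forall>is x. partials is f differentiable (at x))"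

text \<open>\<open>M k r\<close> bounds all partial derivatives of order \<open>k\<close> on the closed ball of radius \<open>r\<close>.\<close>

definition partials_bounded :: "(nat \<Rightarrow> real \<Rightarrow> real) \<Rightarrow> (real^3 \<Rightarrow> real^3) \<Rightarrow> bool" where
  "partials_bounded M f \<longleftrightarrow>
     (\<forall>is r x. norm x \<le> r \<longrightarrow> norm (partials is f x) \<le> M (length is) r)"

definition curl :: "(real^3 \<Rightarrow> real^3) \<Rightarrow> real^3 \<Rightarrow> real^3" where
  "curl A x = (let J = jacobian A (at x)
     in vector [J$3$2 - J$2$3, J$1$3 - J$3$1, J$2$1 - J$1$2])"

text \<open>Standing assumptions on the fields. The bounds \<open>M\<close> are chosen before the fields and before
  \<open>\<epsilon>\<close>, so that the fields may depend on \<open>\<epsilon>\<close> as long as they obey these bounds.\<close>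

definition admissible_fields ::
  "(nat \<Rightarrow> real \<Rightarrow> real) \<Rightarrow> (real^3 \<Rightarrow> real^3) \<Rightarrow> (real^3 \<Rightarrow> real^3) \<Rightarrow> (real^3 \<Rightarrow> real^3) \<Rightarrow> bool" where
  "admissible_fields M A1 B1 E \<longleftrightarrow>
     (\<forall>f \<in> {A1, B1, E}. smooth f \<and> partials_bounded M f) \<and> (\<forall>x. B1 x = curl A1 x)"

definition magnetic :: "real \<Rightarrow> real^3 \<Rightarrow> (real^3 \<Rightarrow> real^3) \<Rightarrow> real^3 \<Rightarrow> real^3" where
  "magnetic \<epsilon> B0 B1 x = (1 / \<epsilon>) *\<^sub>R B0 + B1 x"

definition potential :: "real \<Rightarrow> real^3 \<Rightarrow> (real^3 \<Rightarrow> real^3) \<Rightarrow> real^3 \<Rightarrow> real^3" where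
  "potential \<epsilon> B0 A1 x = - ((1 / (2 * \<epsilon>)) *\<^sub>R (cross3 x B0)) + A1 x"


text \<open>The two-step methods. A numerical solution is indexed by \<open>int\<close> because of the value
  \<open>x (-1)\<close> used for starting.\<close>

definition velocity :: "real \<Rightarrow> (int \<Rightarrow> real^3) \<Rightarrow> int \<Rightarrow> real^3" where
  "velocity h x n = (1 / (2 * h)) *\<^sub>R (x (n + 1) - x (n - 1))"

definition second_difference :: "real \<Rightarrow> (int \<Rightarrow> real^3) \<Rightarrow> int \<Rightarrow> real^3" where
  "second_difference h x n = (1 / h\<^sup>2) *\<^sub>R (x (n + 1) - 2 *\<^sub>R x n + x (n - 1))"

definition boris_step ::
  "real \<Rightarrow> (real^3 \<Rightarrow> real^3) \<Rightarrow> (real^3 \<Rightarrow> real^3) \<Rightarrow> (int \<Rightarrow> real^3) \<Rightarrow> int \<Rightarrow> bool" where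
  "boris_step h B E x n \<longleftrightarrow>
     second_difference h x n = cross3 (velocity h x n) (B (x n)) + E (x n)"

definition variational_step ::
  "real \<Rightarrow> (real^3 \<Rightarrow> real^3) \<Rightarrow> (real^3 \<Rightarrow> real^3) \<Rightarrow> (int \<Rightarrow> real^3) \<Rightarrow> int \<Rightarrow> bool" where
  "variational_step h A E x n \<longleftrightarrow>
     second_difference h x n =
       transpose (jacobian A (at (x n))) *v velocity h x n
       - (1 / (2 * h)) *\<^sub>R (A (x (n + 1)) - A (x (n - 1))) + E (x n)"

datatype integrator = Boris | Variational

fun two_step :: "integrator \<Rightarrow> real \<Rightarrow> real \<Rightarrow> real^3 \<Rightarrow> (real^3 \<Rightarrow> real^3) \<Rightarrow> (real^3 \<Rightarrow> real^3)
    \<Rightarrow> (real^3 \<Rightarrow> real^3) \<Rightarrow> (int \<Rightarrow> real^3) \<Rightarrow> int \<Rightarrow> bool" where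
  "two_step Boris \<epsilon> h B0 A1 B1 E x n = boris_step h (magnetic \<epsilon> B0 B1) E x n"
| "two_step Variational \<epsilon> h B0 A1 B1 E x n = variational_step h (potential \<epsilon> B0 A1) E x n"

text \<open>The relation at \<open>n\<close> determines \<open>x (n + 1)\<close>; it is required whenever \<open>(n + 1) h \<le> T\<close>, that is,
  for all steps that produce approximations on \<open>[0, T]\<close>. The variational integrator is implicit,
  hence this is a property of a sequence and not a recursive definition.\<close>

definition numerical_solution :: "integrator \<Rightarrow> real \<Rightarrow> real \<Rightarrow> real \<Rightarrow> real^3 \<Rightarrow> (real^3 \<Rightarrow> real^3)
    \<Rightarrow> (real^3 \<Rightarrow> real^3) \<Rightarrow> (real^3 \<Rightarrow> real^3) \<Rightarrow> real^3 \<Rightarrow> real^3 \<Rightarrow> (int \<Rightarrow> real^3) \<Rightarrow> bool" where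
  "numerical_solution m T \<epsilon> h B0 A1 B1 E x0 v0 x \<longleftrightarrow>
     x 0 = x0 \<and> velocity h x 0 = v0 \<and>
     (\<forall>n. 0 \<le> n \<and> of_int (n + 1) * h \<le> T \<longrightarrow> two_step m \<epsilon> h B0 A1 B1 E x n)"


text \<open>Projections. In \<open>Ppm v1 s\<close> the sign \<open>s\<close> is \<open>1\<close> or \<open>-1\<close>, and \<open>v1\<close> is the chosen normalized
  eigenvector for the eigenvalue \<open>\<i>\<close>; the result does not depend on this choice.\<close>

definition cvec :: "real^3 \<Rightarrow> complex^3" where
  "cvec x = (\<chi> i. complex_of_real (x $ i))"

definition cnj_vec :: "complex^3 \<Rightarrow> complex^3" where
  "cnj_vec u = (\<chi> i. cnj (u $ i))"

definition ccross :: "complex^3 \<Rightarrow> complex^3 \<Rightarrow> complex^3" where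
  "ccross a b = vector [a$2 * b$3 - a$3 * b$2, a$3 * b$1 - a$1 * b$3, a$1 * b$2 - a$2 * b$1]"

definition outer_proj :: "complex^3 \<Rightarrow> complex^3 \<Rightarrow> complex^3" where
  "outer_proj u w = (\<Sum>i\<in>UNIV. cnj (u $ i) * w $ i) *s u"

definition unit_eigenvector :: "real^3 \<Rightarrow> complex^3 \<Rightarrow> bool" where
  "unit_eigenvector B0 v1 \<longleftrightarrow> norm v1 = 1 \<and> ccross v1 (cvec B0) = \<i> *s v1"

definition Ppm :: "complex^3 \<Rightarrow> int \<Rightarrow> complex^3 \<Rightarrow> complex^3" where
  "Ppm v1 s = outer_proj (if s = 1 then v1 else cnj_vec v1)"

definition P0 :: "real^3 \<Rightarrow> real^3 \<Rightarrow> real^3" where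
  "P0 B0 w = (B0 \<bullet> w) *\<^sub>R B0"


text \<open>Derivatives of functions on \<open>[0, T]\<close>; one-sided at the end points.\<close>

fun deriv_on :: "real \<Rightarrow> nat \<Rightarrow> (real \<Rightarrow> 'a::real_normed_vector) \<Rightarrow> real \<Rightarrow> 'a" where
  "deriv_on T 0 f = f"
| "deriv_on T (Suc k) f = (\<lambda>t. vector_derivative (deriv_on T k f) (at t within {0..T}))"

definition Ck_on :: "real \<Rightarrow> nat \<Rightarrow> (real \<Rightarrow> 'a::real_normed_vector) \<Rightarrow> bool" where
  "Ck_on T N f \<longleftrightarrow>
     (\<forall>k<N. \<forall>t\<in>{0..T}. deriv_on T k f differentiable (at t within {0..T})) \<and>
     continuous_on {0..T} (deriv_on T N f)"

definition coeff_bounds ::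
  "real \<Rightarrow> nat \<Rightarrow> real \<Rightarrow> real \<Rightarrow> (real \<Rightarrow> real^3) \<Rightarrow> (real \<Rightarrow> real^3) \<Rightarrow> bool" where
  "coeff_bounds T N h C y z \<longleftrightarrow> Ck_on T N y \<and> Ck_on T N z \<and>
     (\<forall>k\<le>N. \<forall>t\<in>{0..T}. norm (deriv_on T k y t) \<le> C \<and> norm (deriv_on T k z t) \<le> C * h\<^sup>2)"

definition remainder ::
  "real \<Rightarrow> (int \<Rightarrow> real^3) \<Rightarrow> (real \<Rightarrow> real^3) \<Rightarrow> (real \<Rightarrow> real^3) \<Rightarrow> nat \<Rightarrow> real^3" where
  "remainder h x y z n = x (int n) - (y (real n * h) + (-1) ^ n *\<^sub>R z (real n * h))"

definition remainder_bound ::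
  "real \<Rightarrow> nat \<Rightarrow> real \<Rightarrow> real \<Rightarrow> (int \<Rightarrow> real^3) \<Rightarrow> (real \<Rightarrow> real^3) \<Rightarrow> (real \<Rightarrow> real^3) \<Rightarrow> bool" where
  "remainder_bound T N h C x y z \<longleftrightarrow>
     (\<forall>n. real n * h \<le> T \<longrightarrow> norm (remainder h x y z n) \<le> C * (real n * h)\<^sup>2 * h ^ N)"


text \<open>The modulation system: differential equations for \<open>y\<^sub>0\<close> (second order), \<open>y\<^sub>\<plusminus>\<^sub>1\<close>, \<open>z\<^sub>\<plusminus>\<^sub>1\<close> and
  an algebraic equation for \<open>z\<^sub>0\<close>, with right-hand sides that are functions of the values of
  \<open>(y, \<dot>y\<^sub>0, z\<^sub>1, z\<^sub>-\<^sub>1)\<close>.\<close>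

type_synonym mstate = "(real^3) \<times> (real^3) \<times> (complex^3) \<times> (complex^3)"

record modulation_system =
  y0_rhs :: "mstate \<Rightarrow> real^3"
  y_rhs :: "int \<Rightarrow> mstate \<Rightarrow> complex^3"
  z_rhs :: "int \<Rightarrow> mstate \<Rightarrow> complex^3"
  z0_expr :: "mstate \<Rightarrow> real^3"

definition mstate :: "real \<Rightarrow> real^3 \<Rightarrow> complex^3 \<Rightarrow> (real \<Rightarrow> real^3) \<Rightarrow> (real \<Rightarrow> real^3) \<Rightarrow> real \<Rightarrow> mstate"
  where "mstate T B0 v1 y z t =
    (y t, deriv_on T 1 (\<lambda>u. P0 B0 (y u)) t, Ppm v1 1 (cvec (z t)), Ppm v1 (-1) (cvec (z t)))"

definition locally_lipschitz_system :: "(real \<Rightarrow> real) \<Rightarrow> modulation_system \<Rightarrow> bool" where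
  "locally_lipschitz_system L S \<longleftrightarrow> (\<forall>r.
     (L r)-lipschitz_on (cball 0 r) (y0_rhs S) \<and>
     (L r)-lipschitz_on (cball 0 r) (z0_expr S) \<and>
     (\<forall>s\<in>{1, -1}. (L r)-lipschitz_on (cball 0 r) (y_rhs S s) \<and>
                   (L r)-lipschitz_on (cball 0 r) (z_rhs S s)))"

text \<open>All equations of the system hold on \<open>[0, T]\<close> up to a defect of size \<open>\<delta>\<close>; \<open>\<delta> = 0\<close> means that
  \<open>(y, z)\<close> is a solution.\<close>

definition solves_upto ::
  "real \<Rightarrow> real \<Rightarrow> real^3 \<Rightarrow> complex^3 \<Rightarrow> modulation_system \<Rightarrow> (real \<Rightarrow> real^3) \<Rightarrow> (real \<Rightarrow> real^3) \<Rightarrow> bool"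
  where
  "solves_upto \<delta> T B0 v1 S y z \<longleftrightarrow> (\<forall>t\<in>{0..T}.
     norm (deriv_on T 2 (\<lambda>u. P0 B0 (y u)) t - y0_rhs S (mstate T B0 v1 y z t)) \<le> \<delta> \<and>
     (\<forall>s\<in>{1, -1}.
       norm (deriv_on T 1 (\<lambda>u. Ppm v1 s (cvec (y u))) t - y_rhs S s (mstate T B0 v1 y z t)) \<le> \<delta> \<and>
       norm (deriv_on T 1 (\<lambda>u. Ppm v1 s (cvec (z u))) t - z_rhs S s (mstate T B0 v1 y z t)) \<le> \<delta>) \<and>
     norm (P0 B0 (z t) - z0_expr S (mstate T B0 v1 y z t)) \<le> \<delta>)"

definition close_on :: "real \<Rightarrow> real \<Rightarrow> (real \<Rightarrow> real^3) \<Rightarrow> (real \<Rightarrow> real^3) \<Rightarrow> bool" where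
  "close_on T \<delta> f g \<longleftrightarrow> (\<forall>t\<in>{0..T}. norm (f t - g t) \<le> \<delta>)"

text \<open>Uniqueness, with two meanings that need different rates. Among all coefficient functions with
  \<open>N\<close> bounded derivatives and a remainder \<open>O(t\<^sup>2 h\<^sup>N)\<close>, the pair \<open>(y, z)\<close> is determined up to
  \<open>O(h\<^sup>N)\<close>; this cannot be improved, since \<open>y\<close> may be changed by \<open>h\<^sup>N t\<^sup>2 B0\<close>. As a solution of the
  modulation system with its initial values, known up to \<open>O(\<epsilon>\<^sup>N\<^sup>+\<^sup>2)\<close>, it is determined up to
  \<open>O(\<epsilon>\<^sup>N\<^sup>+\<^sup>2)\<close>. The function \<open>U\<close> maps the constant of the competitor to the resulting constant.\<close>

definition unique_decomposition ::
  "(real \<Rightarrow> real) \<Rightarrow> real \<Rightarrow> nat \<Rightarrow> real \<Rightarrow> (int \<Rightarrow> real^3) \<Rightarrow> (real \<Rightarrow> real^3) \<Rightarrow> (real \<Rightarrow> real^3) \<Rightarrow> bool"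
  where
  "unique_decomposition U T N h x y z \<longleftrightarrow> (\<forall>c y' z'.
     coeff_bounds T N h c y' z' \<and> remainder_bound T N h c x y' z' \<longrightarrow>
     close_on T (U c * h ^ N) y' y \<and> close_on T (U c * h ^ N) z' z)"

definition unique_modulation ::
  "(real \<Rightarrow> real) \<Rightarrow> real \<Rightarrow> nat \<Rightarrow> real \<Rightarrow> real \<Rightarrow> real^3 \<Rightarrow> complex^3 \<Rightarrow> modulation_system
    \<Rightarrow> (real \<Rightarrow> real^3) \<Rightarrow> (real \<Rightarrow> real^3) \<Rightarrow> bool" where
  "unique_modulation U T N \<epsilon> h B0 v1 S y z \<longleftrightarrow> (\<forall>c y' z'.
     coeff_bounds T N h c y' z' \<and>
     solves_upto (c * \<epsilon> ^ (N + 2)) T B0 v1 S y' z' \<and>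
     norm (mstate T B0 v1 y' z' 0 - mstate T B0 v1 y z 0) \<le> c * \<epsilon> ^ (N + 2) \<longrightarrow>
     close_on T (U c * \<epsilon> ^ (N + 2)) y' y \<and> close_on T (U c * \<epsilon> ^ (N + 2)) z' z)"

end

theory Submission
  imports Defs
begin

text \<open>Both methods have the form \<open>x\<^sub>n\<^sub>\<plusminus>\<^sub>1 = x\<^sub>n \<plusminus> h v\<^sub>n + h\<^sup>2 a\<^sub>n / 2\<close> with
  \<open>a\<^sub>n = v\<^sub>n \<times> B\<^sub>0 / \<epsilon> + g(x\<^sub>n, v\<^sub>n, h\<^sup>2 a\<^sub>n)\<close>, where \<open>g\<close> is smooth uniformly in \<open>\<epsilon>\<close> and \<open>h\<close>: the linear part of the
  vector potential contributes exactly the stiff term, and the remaining difference quotient of \<open>A\<^sub>1\<close>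
  is smooth. Inserting \<open>y(t) + (-1)\<^sup>n z(t)\<close> with \<open>(y, z)\<close> on the flow of an unknown vector field turns
  the scheme into a fixed point equation for that vector field, in which step operators become power
  series in the Lie derivative. Writing the components of the field orthogonal to \<open>B\<^sub>0\<close> as \<open>\<epsilon>\<close> times an
  unknown makes the equation a contraction of order \<open>h\<^sup>2\<close> in the formal sense, so finitely many
  iterations from zero leave a residual of arbitrarily high order and no smallness of \<open>h\<^sup>2 / \<epsilon>\<close> is
  needed. The initial values follow from the contraction principle, and a stability estimate, in which
  the orthogonal velocity error is measured relative to \<open>\<epsilon>\<close>, bounds the distance of the numerical
  solution from the modulated curve. Uniqueness of the decomposition comes from repeated use of the
  mean value theorem on grid points of equal parity, uniqueness for the modulation system from
  Gronwall's inequality.\<close>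

section \<open>Smooth families with uniform bounds\<close>

text \<open>The parameters are coupled only by \<epsilon> \<le> h^2, so \<epsilon>/h^2, which sets
  the frequency of z, ranges over (0,1] and no inverse power of \<epsilon> can be paid for with
  powers of h. Every object is therefore a family over all parameters with uniform bounds, and two
  families agree to order m when their difference divided by h^m is again such a family. Each
  iteration differentiates the previous field and thus loses derivatives, which rules out a
  contraction in one fixed norm but is harmless in this calculus. N iterations leave a residual
  O(h^(2N)), and the stability estimate loses no power of h from it. Since N \<ge> 2, 2N \<ge> N+2;
  the initial values are matched exactly and t \<ge> h at all other grid points, whence O(t^2 h^N).
  The size O(h^2) of z is not built into the field. It holds initially because the orthogonal start
  velocity is O(\<epsilon>), and it persists because the equation for z has the invariant subspace z
  = 0. The error terms of size \<epsilon> h^2 and the bound O(h^4) along B0 come from the same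
  vanishing property.\<close>

definition loc_bounded :: "'p set \<Rightarrow> ('p \<Rightarrow> 'a::real_normed_vector \<Rightarrow> 'b::real_normed_vector) \<Rightarrow> bool"
  where "loc_bounded P f \<longleftrightarrow> (\<forall>r. \<exists>C. \<forall>p\<in>P. \<forall>u. norm u \<le> r \<longrightarrow> norm (f p u) \<le> C)"

text \<open>Derivatives are tested in basis directions only. Each is again a family with the same
  domain and codomain, so the recursion never changes type and higher derivatives need no
  multilinear maps.\<close>

primrec sb :: "'p set \<Rightarrow> nat \<Rightarrow> ('p \<Rightarrow> 'a::euclidean_space \<Rightarrow> 'b::real_normed_vector) \<Rightarrow> bool" where
  "sb P 0 f \<longleftrightarrow> loc_bounded P f"
| "sb P (Suc n) f \<longleftrightarrow> loc_bounded P f \<and> (\<forall>p\<in>P. \<forall>u. f p differentiable (at u)) \<and>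
     (\<forall>i\<in>Basis. sb P n (\<lambda>p u. frechet_derivative (f p) (at u) i))"

text \<open>The parameter \<open>p\<close> carries \<open>\<epsilon>\<close>, \<open>h\<close> and the fields; \<open>smf\<close> asserts that all derivatives are bounded on
  bounded sets uniformly in \<open>p\<close>.\<close>

definition smf :: "'p set \<Rightarrow> ('p \<Rightarrow> 'a::euclidean_space \<Rightarrow> 'b::real_normed_vector) \<Rightarrow> bool" where
  "smf P f \<longleftrightarrow> (\<forall>n. sb P n f)"

lemma loc_boundedD:
  assumes "loc_bounded P f"
  obtains C where "C > 0" "\<And>p u. p \<in> P \<Longrightarrow> norm u \<le> r \<Longrightarrow> norm (f p u) \<le> C"
proof -
  obtain C where C: "\<forall>p\<in>P. \<forall>u. norm u \<le> r \<longrightarrow> norm (f p u) \<le> C"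
    using assms unfolding loc_bounded_def by blast
  show thesis
    by (rule that[of "max 1 C"]) (use C in \<open>auto simp: le_max_iff_disj\<close>)
qed

lemma loc_bounded_cong:
  "(\<And>p u. p \<in> P \<Longrightarrow> f p u = g p u) \<Longrightarrow> loc_bounded P f \<longleftrightarrow> loc_bounded P g"
  unfolding loc_bounded_def by auto

lemma sb_cong: "(\<And>p u. p \<in> P \<Longrightarrow> f p u = g p u) \<Longrightarrow> sb P n f \<longleftrightarrow> sb P n g"
proof (induction n arbitrary: f g)
  case 0
  then show ?case using loc_bounded_cong[of P f g] by simp
next
  case (Suc n)
  have eq: "f p = g p" if "p \<in> P" for p using Suc.prems[OF that] by auto
  have "sb P n (\<lambda>p u. frechet_derivative (f p) (at u) i)
    = sb P n (\<lambda>p u. frechet_derivative (g p) (at u) i)" for i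
    by (rule Suc.IH) (simp add: eq)
  moreover have "loc_bounded P f = loc_bounded P g" using loc_bounded_cong[of P f g] Suc.prems by simp
  ultimately show ?case by (auto simp: eq)
qed

lemma sb_loc_bounded: "sb P n f \<Longrightarrow> loc_bounded P f"
  by (cases n) auto

lemma sb_SucD: "sb P (Suc n) f \<Longrightarrow> sb P n f"
  by (induction n arbitrary: f) auto

text \<open>Lets a closed form of the derivative replace \<open>frechet_derivative\<close>; the
  inductive closure proofs enter the successor case through it.\<close>

lemma sb_SucI:
  assumes "loc_bounded P f"
    and der: "\<And>p u. p \<in> P \<Longrightarrow> (f p has_derivative f' p u) (at u)"
    and "\<And>i. i \<in> Basis \<Longrightarrow> sb P n (\<lambda>p u. f' p u i)"
  shows "sb P (Suc n) f"
proof -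
  have "frechet_derivative (f p) (at u) = f' p u" if "p \<in> P" for p u
    using frechet_derivative_at[OF der[OF that]] by simp
  then have "sb P n (\<lambda>p u. frechet_derivative (f p) (at u) i) = sb P n (\<lambda>p u. f' p u i)" for i
    by (intro sb_cong) simp
  then show ?thesis using assms by (auto simp: differentiable_def)
qed

lemma sb_has_derivative:
  "sb P (Suc n) f \<Longrightarrow> p \<in> P \<Longrightarrow> (f p has_derivative frechet_derivative (f p) (at u)) (at u)"
  by (simp add: frechet_derivative_works[symmetric])

lemma sb_const:
  fixes c :: "'p \<Rightarrow> 'b::real_normed_vector"
  assumes "\<And>p. p \<in> P \<Longrightarrow> norm (c p) \<le> C"
  shows "sb P n (\<lambda>p (u::'a::euclidean_space). c p)"
  using assms
proof (induction n arbitrary: c C)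
  case 0
  then show ?case by (auto simp: loc_bounded_def)
next
  case (Suc n)
  show ?case
  proof (rule sb_SucI)
    show "loc_bounded P (\<lambda>p (u::'a). c p)" using Suc.prems by (auto simp: loc_bounded_def)
    show "((\<lambda>u. c p) has_derivative (\<lambda>v. 0)) (at u)" for p and u :: 'a by simp
    show "sb P n (\<lambda>p (u::'a). 0 :: 'b)" by (rule Suc.IH[of "\<lambda>p. 0" 0]) simp
  qed
qed

lemma loc_bounded_add: "loc_bounded P f \<Longrightarrow> loc_bounded P g \<Longrightarrow> loc_bounded P (\<lambda>p u. f p u + g p u)"
  unfolding loc_bounded_def
proof
  fix r assume "\<forall>r. \<exists>C. \<forall>p\<in>P. \<forall>u. norm u \<le> r \<longrightarrow> norm (f p u) \<le> C"
    "\<forall>r. \<exists>C. \<forall>p\<in>P. \<forall>u. norm u \<le> r \<longrightarrow> norm (g p u) \<le> C"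
  then obtain C D where "\<forall>p\<in>P. \<forall>u. norm u \<le> r \<longrightarrow> norm (f p u) \<le> C"
    "\<forall>p\<in>P. \<forall>u. norm u \<le> r \<longrightarrow> norm (g p u) \<le> D" by metis
  then show "\<exists>C. \<forall>p\<in>P. \<forall>u. norm u \<le> r \<longrightarrow> norm (f p u + g p u) \<le> C"
    by (intro exI[of _ "C + D"] ballI allI impI norm_triangle_le add_mono) auto
qed

lemma loc_bounded_bilinear:
  assumes "bounded_bilinear B" "loc_bounded P f" "loc_bounded P g"
  shows "loc_bounded P (\<lambda>p u. B (f p u) (g p u))"
  unfolding loc_bounded_def
proof
  fix r
  obtain K where K: "0 < K" "\<And>a b. norm (B a b) \<le> norm a * norm b * K"
    using bounded_bilinear.pos_bounded[OF assms(1)] by blast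
  obtain C where C: "C > 0" "\<And>p u. p \<in> P \<Longrightarrow> norm u \<le> r \<Longrightarrow> norm (f p u) \<le> C"
    using loc_boundedD[OF assms(2)] by blast
  obtain D where D: "D > 0" "\<And>p u. p \<in> P \<Longrightarrow> norm u \<le> r \<Longrightarrow> norm (g p u) \<le> D"
    using loc_boundedD[OF assms(3)] by blast
  have "norm (B (f p u) (g p u)) \<le> C * D * K" if "p \<in> P" "norm u \<le> r" for p u
    by (rule order_trans[OF K(2)])
      (use C D K that in \<open>intro mult_right_mono mult_mono, auto\<close>)
  then show "\<exists>C. \<forall>p\<in>P. \<forall>u. norm u \<le> r \<longrightarrow> norm (B (f p u) (g p u)) \<le> C" by blast
qed

lemma sb_add: "sb P n f \<Longrightarrow> sb P n g \<Longrightarrow> sb P n (\<lambda>p u. f p u + g p u)"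
proof (induction n arbitrary: f g)
  case 0
  then show ?case by (simp add: loc_bounded_add)
next
  case (Suc n)
  show ?case
  proof (rule sb_SucI)
    show "loc_bounded P (\<lambda>p u. f p u + g p u)" using Suc.prems by (simp add: loc_bounded_add)
    show "((\<lambda>u. f p u + g p u) has_derivative
        (\<lambda>v. frechet_derivative (f p) (at u) v + frechet_derivative (g p) (at u) v)) (at u)"
      if "p \<in> P" for p u
      by (intro has_derivative_add sb_has_derivative[OF Suc.prems(1) that] sb_has_derivative[OF Suc.prems(2) that])
    show "sb P n (\<lambda>p u. frechet_derivative (f p) (at u) i + frechet_derivative (g p) (at u) i)"
      if "i \<in> Basis" for i
      using Suc.prems that by (intro Suc.IH) auto
  qed
qed

lemma sb_sum: "finite I \<Longrightarrow> (\<And>i. i \<in> I \<Longrightarrow> sb P n (f i)) \<Longrightarrow> sb P n (\<lambda>p u. \<Sum>i\<in>I. f i p u)"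
proof (induction I rule: finite_induct)
  case empty
  then show ?case using sb_const[of P "\<lambda>p. 0" 0 n] by simp
next
  case (insert i I)
  then show ?case using sb_add[of P n "f i"] by simp
qed

lemma sb_bilinear:
  assumes B: "bounded_bilinear B"
  shows "sb P n f \<Longrightarrow> sb P n g \<Longrightarrow> sb P n (\<lambda>p u. B (f p u) (g p u))"
proof (induction n arbitrary: f g)
  case 0
  then show ?case using loc_bounded_bilinear[OF B, of P f g] by simp
next
  case (Suc n)
  show ?case
  proof (rule sb_SucI)
    show "loc_bounded P (\<lambda>p u. B (f p u) (g p u))"
      using Suc.prems loc_bounded_bilinear[OF B, of P f g] by simp
    show "((\<lambda>u. B (f p u) (g p u)) has_derivative
        (\<lambda>v. B (f p u) (frechet_derivative (g p) (at u) v) + B (frechet_derivative (f p) (at u) v) (g p u))) (at u)"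
      if "p \<in> P" for p u
      by (rule bounded_bilinear.FDERIV[OF B sb_has_derivative[OF Suc.prems(1) that] sb_has_derivative[OF Suc.prems(2) that]])
    show "sb P n (\<lambda>p u. B (f p u) (frechet_derivative (g p) (at u) i) + B (frechet_derivative (f p) (at u) i) (g p u))"
      if "i \<in> Basis" for i
      using Suc.prems that sb_SucD[OF Suc.prems(1)] sb_SucD[OF Suc.prems(2)]
      by (intro sb_add Suc.IH) auto
  qed
qed

lemma sb_linear:
  assumes L: "bounded_linear L"
  shows "sb P n f \<Longrightarrow> sb P n (\<lambda>p u. L (f p u))"
proof -
  have B: "bounded_bilinear (\<lambda>(c::real) x. c *\<^sub>R L x)"
    using bounded_bilinear.comp[OF bounded_bilinear_scaleR bounded_linear_ident L] by simp
  show "sb P n f \<Longrightarrow> sb P n (\<lambda>p u. L (f p u))"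
    using sb_bilinear[OF B, of P n "\<lambda>p u. 1" f] sb_const[of P "\<lambda>p. 1::real" 1 n] by simp
qed

lemma sb_id: "sb P n (\<lambda>p (u::'a::euclidean_space). u)"
proof (cases n)
  case 0
  then show ?thesis by (auto simp: loc_bounded_def)
next
  case (Suc m)
  show ?thesis unfolding Suc
  proof (rule sb_SucI)
    show "loc_bounded P (\<lambda>p (u::'a). u)" by (auto simp: loc_bounded_def)
    show "((\<lambda>u. u) has_derivative (\<lambda>v. v)) (at u)" for u::'a by simp
    show "sb P m (\<lambda>p (u::'a). i)" for i::'a by (rule sb_const[of _ _ "norm i"]) simp
  qed
qed

lemma loc_bounded_compose:
  assumes "loc_bounded P f" "loc_bounded P g"
  shows "loc_bounded P (\<lambda>p u. f p (g p u))"
  unfolding loc_bounded_def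
proof
  fix r
  obtain D where D: "D > 0" "\<And>p u. p \<in> P \<Longrightarrow> norm u \<le> r \<Longrightarrow> norm (g p u) \<le> D"
    using loc_boundedD[OF assms(2)] by blast
  obtain C where C: "C > 0" "\<And>p u. p \<in> P \<Longrightarrow> norm u \<le> D \<Longrightarrow> norm (f p u) \<le> C"
    using loc_boundedD[OF assms(1)] by blast
  show "\<exists>C. \<forall>p\<in>P. \<forall>u. norm u \<le> r \<longrightarrow> norm (f p (g p u)) \<le> C"
    by (intro exI[of _ C] ballI allI impI C(2) D(2))
qed

lemma linear_Basis_sum:
  fixes L :: "'a::euclidean_space \<Rightarrow> 'b::real_normed_vector"
  assumes "linear L"
  shows "L v = (\<Sum>c\<in>Basis. (v \<bullet> c) *\<^sub>R L c)"
proof -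
  have "L v = L (\<Sum>c\<in>Basis. (v \<bullet> c) *\<^sub>R c)" by (simp add: euclidean_representation)
  also have "\<dots> = (\<Sum>c\<in>Basis. (v \<bullet> c) *\<^sub>R L c)"
    using assms by (simp add: linear_sum linear_scale)
  finally show ?thesis .
qed

text \<open>The chain rule is expanded over the basis of the intermediate space. Every summand pairs
  a derivative of \<open>g\<close> with a first derivative of \<open>f\<close> composed with the
  same \<open>g\<close>, so the induction varies \<open>f\<close> alone.\<close>

lemma sb_compose:
  fixes f :: "'p \<Rightarrow> 'b::euclidean_space \<Rightarrow> 'c::real_normed_vector" and g :: "'p \<Rightarrow> 'a::euclidean_space \<Rightarrow> 'b"
  shows "sb P n f \<Longrightarrow> sb P n g \<Longrightarrow> sb P n (\<lambda>p u. f p (g p u))"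
proof (induction n arbitrary: f)
  case 0
  then show ?case using loc_bounded_compose[of P f g] by simp
next
  case (Suc n)
  let ?f' = "\<lambda>p u. frechet_derivative (f p) (at u)" and ?g' = "\<lambda>p u. frechet_derivative (g p) (at u)"
  show ?case
  proof (rule sb_SucI)
    show "loc_bounded P (\<lambda>p u. f p (g p u))"
      by (rule loc_bounded_compose) (use Suc.prems in auto)
    show "((\<lambda>u. f p (g p u)) has_derivative (\<lambda>v. \<Sum>c\<in>Basis. (?g' p u v \<bullet> c) *\<^sub>R ?f' p (g p u) c)) (at u)"
      if "p \<in> P" for p u
    proof -
      have F: "(f p has_derivative ?f' p (g p u)) (at (g p u))" by (rule sb_has_derivative[OF Suc.prems(1) that])
      have "((\<lambda>u. f p (g p u)) has_derivative (\<lambda>v. ?f' p (g p u) (?g' p u v))) (at u)"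
        by (rule has_derivative_compose[OF sb_has_derivative[OF Suc.prems(2) that] F])
      then show ?thesis
        by (subst (asm) linear_Basis_sum[OF has_derivative_linear[OF F]])
    qed
    show "sb P n (\<lambda>p u. \<Sum>c\<in>Basis. (?g' p u i \<bullet> c) *\<^sub>R ?f' p (g p u) c)" if "i \<in> Basis" for i
    proof (intro sb_sum sb_bilinear[OF bounded_bilinear_scaleR])
      fix c :: 'b assume c: "c \<in> Basis"
      show "sb P n (\<lambda>p u. ?g' p u i \<bullet> c)"
        by (rule sb_linear[OF bounded_linear_inner_left]) (use Suc.prems that in auto)
      show "sb P n (\<lambda>p u. ?f' p (g p u) c)"
        by (rule Suc.IH) (use Suc.prems c sb_SucD[OF Suc.prems(2)] in auto)
    qed auto
  qed
qed

lemma smf_cong: "(\<And>p u. p \<in> P \<Longrightarrow> f p u = g p u) \<Longrightarrow> smf P f \<longleftrightarrow> smf P g"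
  unfolding smf_def using sb_cong by blast

lemma smf_const: "(\<And>p. p \<in> P \<Longrightarrow> norm (c p) \<le> C) \<Longrightarrow> smf P (\<lambda>p u. c p)"
  unfolding smf_def using sb_const by blast

lemma smf_id: "smf P (\<lambda>p u. u)"
  unfolding smf_def using sb_id by blast

lemma smf_add: "smf P f \<Longrightarrow> smf P g \<Longrightarrow> smf P (\<lambda>p u. f p u + g p u)"
  unfolding smf_def using sb_add by blast

lemma smf_sum: "finite I \<Longrightarrow> (\<And>i. i \<in> I \<Longrightarrow> smf P (f i)) \<Longrightarrow> smf P (\<lambda>p u. \<Sum>i\<in>I. f i p u)"
  unfolding smf_def using sb_sum by blast

lemma smf_bilinear: "bounded_bilinear B \<Longrightarrow> smf P f \<Longrightarrow> smf P g \<Longrightarrow> smf P (\<lambda>p u. B (f p u) (g p u))"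
  unfolding smf_def using sb_bilinear by blast

lemma smf_linear: "bounded_linear L \<Longrightarrow> smf P f \<Longrightarrow> smf P (\<lambda>p u. L (f p u))"
  unfolding smf_def using sb_linear by blast

lemma smf_compose:
  fixes f :: "'p \<Rightarrow> 'b::euclidean_space \<Rightarrow> 'c::real_normed_vector" and g :: "'p \<Rightarrow> 'a::euclidean_space \<Rightarrow> 'b"
  shows "smf P f \<Longrightarrow> smf P g \<Longrightarrow> smf P (\<lambda>p u. f p (g p u))"
  unfolding smf_def using sb_compose by blast

lemma smf_scale: "(\<And>p. p \<in> P \<Longrightarrow> \<bar>c p\<bar> \<le> C) \<Longrightarrow> smf P f \<Longrightarrow> smf P (\<lambda>p u. c p *\<^sub>R f p u)"
  by (intro smf_bilinear[OF bounded_bilinear_scaleR] smf_const[of P c C]) auto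

lemma smf_minus: "smf P f \<Longrightarrow> smf P (\<lambda>p u. - f p u)"
  by (rule smf_linear[OF bounded_linear_minus[OF bounded_linear_ident]])

lemma smf_diff: "smf P f \<Longrightarrow> smf P g \<Longrightarrow> smf P (\<lambda>p u. f p u - g p u)"
  using smf_add[of P f "\<lambda>p u. - g p u"] smf_minus[of P g] by simp

lemma smf_loc_bounded: "smf P f \<Longrightarrow> loc_bounded P f"
  unfolding smf_def using sb_loc_bounded by blast

lemma smf_has_derivative:
  "smf P f \<Longrightarrow> p \<in> P \<Longrightarrow> (f p has_derivative frechet_derivative (f p) (at u)) (at u)"
  by (rule sb_has_derivative[of P 0]) (auto simp: smf_def simp del: sb.simps)

lemma smf_frechet: "smf P f \<Longrightarrow> i \<in> Basis \<Longrightarrow> smf P (\<lambda>p u. frechet_derivative (f p) (at u) i)"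
  unfolding smf_def using sb.simps(2)[of P _ f] by blast

lemma smf_Pair:
  fixes f :: "'p \<Rightarrow> 'a::euclidean_space \<Rightarrow> 'b::real_normed_vector" and g :: "'p \<Rightarrow> 'a \<Rightarrow> 'd::real_normed_vector"
  assumes "smf P f" "smf P g"
  shows "smf P (\<lambda>p u. (f p u, g p u))"
proof -
  have "bounded_linear (\<lambda>x::'b. (x, 0::'d))" "bounded_linear (\<lambda>x::'d. (0::'b, x))"
    by (auto intro!: bounded_linear_Pair bounded_linear_ident bounded_linear_zero)
  from smf_add[OF smf_linear[OF this(1) assms(1)] smf_linear[OF this(2) assms(2)]]
  show ?thesis by simp
qed

text \<open>The derivative of \<open>f\<close> along solutions of u' = G(u). Its iterates are the
  time derivatives of f(u(t)), so Taylor expansions along the flow can be written down before any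
  solution is known to exist.\<close>

definition lie :: "('p \<Rightarrow> 'a::euclidean_space \<Rightarrow> 'a) \<Rightarrow> ('p \<Rightarrow> 'a \<Rightarrow> 'b::real_normed_vector) \<Rightarrow> 'p \<Rightarrow> 'a \<Rightarrow> 'b" where
  "lie G f = (\<lambda>p u. frechet_derivative (f p) (at u) (G p u))"

lemma lie_eqI: "(f p has_derivative D) (at u) \<Longrightarrow> lie G f p u = D (G p u)"
  unfolding lie_def using frechet_derivative_at by metis

lemma smf_lie:
  fixes G :: "'p \<Rightarrow> 'a::euclidean_space \<Rightarrow> 'a" and f :: "'p \<Rightarrow> 'a \<Rightarrow> 'b::real_normed_vector"
  assumes f: "smf P f" and G: "smf P G"
  shows "smf P (lie G f)"
proof -
  have "smf P (\<lambda>p u. \<Sum>c\<in>Basis. (G p u \<bullet> c) *\<^sub>R frechet_derivative (f p) (at u) c)"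
    by (intro smf_sum smf_bilinear[OF bounded_bilinear_scaleR] smf_frechet[OF f]
      smf_linear[OF bounded_linear_inner_left] G) auto
  moreover have "lie G f p u = (\<Sum>c\<in>Basis. (G p u \<bullet> c) *\<^sub>R frechet_derivative (f p) (at u) c)"
    if "p \<in> P" for p u
    unfolding lie_def
    by (rule linear_Basis_sum[OF has_derivative_linear[OF smf_has_derivative[OF f that]]])
  ultimately show ?thesis using smf_cong[of P "lie G f" "\<lambda>p u. \<Sum>c\<in>Basis. (G p u \<bullet> c) *\<^sub>R frechet_derivative (f p) (at u) c"] by blast
qed

lemma lie_cong:
  assumes "p \<in> P" "\<And>p u. p \<in> P \<Longrightarrow> f p u = f' p u" "\<And>p u. p \<in> P \<Longrightarrow> G p u = G' p u"
  shows "lie G f p u = lie G' f' p u"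
proof -
  have "f p = f' p" "G p = G' p" using assms by auto
  then show ?thesis by (simp add: lie_def)
qed

lemma lie_add:
  assumes "smf P f" "smf P g" "p \<in> P"
  shows "lie G (\<lambda>p u. f p u + g p u) p u = lie G f p u + lie G g p u"
  using lie_eqI[where G = G and f = "\<lambda>p u. f p u + g p u" and p = p,
    OF has_derivative_add[OF smf_has_derivative[OF assms(1,3)] smf_has_derivative[OF assms(2,3)]]]
  by (simp add: lie_def)

lemma lie_linear:
  assumes "smf P f" "bounded_linear (A p)" "p \<in> P"
  shows "lie G (\<lambda>p u. A p (f p u)) p u = A p (lie G f p u)"
  using lie_eqI[where G = G and f = "\<lambda>p u. A p (f p u)" and p = p,
    OF bounded_linear.has_derivative[OF assms(2) smf_has_derivative[OF assms(1,3)]]]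
  by (simp add: lie_def)

lemma smf_derivative_bound:
  fixes f :: "'p \<Rightarrow> 'a::euclidean_space \<Rightarrow> 'b::real_normed_vector"
  assumes "smf P f"
  obtains C where "C > 0" "\<And>p u v. p \<in> P \<Longrightarrow> norm u \<le> r \<Longrightarrow> norm (frechet_derivative (f p) (at u) v) \<le> C * norm v"
proof -
  have "\<forall>i\<in>Basis. \<exists>C. \<forall>p\<in>P. \<forall>u. norm u \<le> r \<longrightarrow> norm (frechet_derivative (f p) (at u) i) \<le> C"
    using smf_loc_bounded[OF smf_frechet[OF assms]] unfolding loc_bounded_def by blast
  then obtain c where c: "\<And>i p u. i \<in> Basis \<Longrightarrow> p \<in> P \<Longrightarrow> norm u \<le> r \<Longrightarrow>
      norm (frechet_derivative (f p) (at u) i) \<le> c i"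
    by metis
  define C where "C = 1 + (\<Sum>i\<in>Basis. \<bar>c i\<bar>)"
  show thesis
  proof (rule that[of C])
    show "C > 0" unfolding C_def by (simp add: add_pos_nonneg sum_nonneg)
    fix p and u v :: 'a assume pu: "p \<in> P" "norm u \<le> r"
    let ?L = "frechet_derivative (f p) (at u)"
    have "norm (?L v) = norm (\<Sum>i\<in>Basis. (v \<bullet> i) *\<^sub>R ?L i)"
      using linear_Basis_sum[OF has_derivative_linear[OF smf_has_derivative[OF assms pu(1)]]] by metis
    also have "\<dots> \<le> (\<Sum>i\<in>Basis. norm v * \<bar>c i\<bar>)"
    proof (rule sum_norm_le)
      fix i :: 'a assume i: "i \<in> Basis"
      have "norm (?L i) \<le> \<bar>c i\<bar>" using c[OF i pu] by linarith
      then show "norm ((v \<bullet> i) *\<^sub>R ?L i) \<le> norm v * \<bar>c i\<bar>"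
        using Basis_le_norm[OF i, of v] by (auto intro: mult_mono)
    qed
    also have "\<dots> \<le> C * norm v" unfolding C_def
      by (simp add: sum_distrib_left[symmetric] algebra_simps)
    finally show "norm (?L v) \<le> C * norm v" .
  qed
qed

lemma smf_lipschitz:
  fixes f :: "'p \<Rightarrow> 'a::euclidean_space \<Rightarrow> 'b::real_normed_vector"
  assumes "smf P f"
  obtains C where "C > 0"
    "\<And>p u v. p \<in> P \<Longrightarrow> norm u \<le> r \<Longrightarrow> norm v \<le> r \<Longrightarrow> norm (f p u - f p v) \<le> C * norm (u - v)"
proof -
  obtain C where C: "C > 0" "\<And>p u v. p \<in> P \<Longrightarrow> norm u \<le> r \<Longrightarrow> norm (frechet_derivative (f p) (at u) v) \<le> C * norm v"
    using smf_derivative_bound[OF assms] by blast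
  show thesis
  proof (rule that[OF C(1)])
    fix p and u v :: 'a assume a: "p \<in> P" "norm u \<le> r" "norm v \<le> r"
    show "norm (f p u - f p v) \<le> C * norm (u - v)"
    proof (rule differentiable_bound[where S = "cball 0 r" and f' = "\<lambda>x. frechet_derivative (f p) (at x)"])
      show "(f p has_derivative frechet_derivative (f p) (at x)) (at x within cball 0 r)" for x
        using smf_has_derivative[OF assms a(1)] has_derivative_at_withinI by blast
      show "onorm (frechet_derivative (f p) (at x)) \<le> C" if "x \<in> cball 0 r" for x
        by (rule onorm_bound) (use C a that in auto)
    qed (use a in auto)
  qed
qed

text \<open>The quotient stays bounded as \<open>d\<close> tends to zero because \<open>f\<close> is
  Lipschitz on balls and \<open>a - a'\<close> is \<open>d\<close> times a smooth family.
  Differentiating it produces the same kind of quotient for the first derivatives of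
  \<open>f\<close>, with unchanged \<open>a\<close> and \<open>a'\<close>, plus terms without
  division; this closes the induction on the order.\<close>

lemma smf_diff_quotient:
  fixes f :: "'p \<Rightarrow> 'b::euclidean_space \<Rightarrow> 'c::real_normed_vector" and a a' r :: "'p \<Rightarrow> 'a::euclidean_space \<Rightarrow> 'b"
  assumes f: "smf P f" and a: "smf P a" and a': "smf P a'" and r: "smf P r"
    and d: "\<And>p. p \<in> P \<Longrightarrow> d p > 0"
    and eq: "\<And>p u. p \<in> P \<Longrightarrow> a p u = a' p u + d p *\<^sub>R r p u"
  shows "smf P (\<lambda>p u. (1 / d p) *\<^sub>R (f p (a p u) - f p (a' p u)))"
proof -
  have bdd: "loc_bounded P (\<lambda>p u. (1 / d p) *\<^sub>R (f p (a p u) - f p (a' p u)))"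
    if f: "smf P f" for f :: "'p \<Rightarrow> 'b \<Rightarrow> 'c"
    unfolding loc_bounded_def
  proof
    fix \<rho>
    obtain A where A: "\<And>p u. p \<in> P \<Longrightarrow> norm u \<le> \<rho> \<Longrightarrow> norm (a p u) \<le> A"
      using loc_boundedD[OF smf_loc_bounded[OF a]] by blast
    obtain A' where A': "\<And>p u. p \<in> P \<Longrightarrow> norm u \<le> \<rho> \<Longrightarrow> norm (a' p u) \<le> A'"
      using loc_boundedD[OF smf_loc_bounded[OF a']] by blast
    obtain R where R: "\<And>p u. p \<in> P \<Longrightarrow> norm u \<le> \<rho> \<Longrightarrow> norm (r p u) \<le> R"
      using loc_boundedD[OF smf_loc_bounded[OF r]] by blast
    obtain C where C: "C > 0" "\<And>p u v. p \<in> P \<Longrightarrow> norm u \<le> max A A' \<Longrightarrow> norm v \<le> max A A' \<Longrightarrow>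
        norm (f p u - f p v) \<le> C * norm (u - v)"
      using smf_lipschitz[OF f] by blast
    have "norm ((1 / d p) *\<^sub>R (f p (a p u) - f p (a' p u))) \<le> C * R" if "p \<in> P" "norm u \<le> \<rho>" for p u
    proof -
      have "norm (f p (a p u) - f p (a' p u)) \<le> C * norm (a p u - a' p u)"
        by (rule C(2)) (use A A' that in \<open>auto simp: le_max_iff_disj\<close>)
      also have "norm (a p u - a' p u) = d p * norm (r p u)"
        using d[OF that(1)] by (simp add: eq[OF that(1)])
      finally have "norm (f p (a p u) - f p (a' p u)) \<le> C * (d p * norm (r p u))" .
      then have "norm ((1 / d p) *\<^sub>R (f p (a p u) - f p (a' p u))) \<le> C * norm (r p u)"
        using d[OF that(1)] unfolding norm_scaleR by (simp add: divide_le_eq mult_ac)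
      also have "\<dots> \<le> C * R" using C(1) R[OF that] by simp
      finally show ?thesis .
    qed
    then show "\<exists>C. \<forall>p\<in>P. \<forall>u. norm u \<le> \<rho> \<longrightarrow> norm ((1 / d p) *\<^sub>R (f p (a p u) - f p (a' p u))) \<le> C"
      by blast
  qed
  have "sb P n (\<lambda>p u. (1 / d p) *\<^sub>R (f p (a p u) - f p (a' p u)))" if f: "smf P f" for n and f :: "'p \<Rightarrow> 'b \<Rightarrow> 'c"
    using f
  proof (induction n arbitrary: f)
    case 0
    then show ?case using bdd by simp
  next
    case (Suc n)
    let ?D = "\<lambda>c p u. frechet_derivative (f p) (at u) c"
    let ?a = "\<lambda>p u v. frechet_derivative (a p) (at u) v"
    let ?a' = "\<lambda>p u v. frechet_derivative (a' p) (at u) v"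
    let ?r = "\<lambda>p u v. frechet_derivative (r p) (at u) v"
    show ?case
    proof (rule sb_SucI)
      show "loc_bounded P (\<lambda>p u. (1 / d p) *\<^sub>R (f p (a p u) - f p (a' p u)))" using bdd[OF Suc.prems] .
      fix p u assume p: "p \<in> P"
      have lin: "linear (\<lambda>c. ?D c p x)" for x
        using has_derivative_linear[OF smf_has_derivative[OF Suc.prems p]] .
      have ar: "?a p u v = ?a' p u v + d p *\<^sub>R ?r p u v" for v
      proof -
        have "a p = (\<lambda>u. a' p u + d p *\<^sub>R r p u)" using eq[OF p] by auto
        moreover have "((\<lambda>u. a' p u + d p *\<^sub>R r p u) has_derivative (\<lambda>v. ?a' p u v + d p *\<^sub>R ?r p u v)) (at u)"
          by (intro derivative_intros smf_has_derivative[OF a' p] smf_has_derivative[OF r p])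
        ultimately show ?thesis by (metis frechet_derivative_at)
      qed
      have "((\<lambda>u. (1 / d p) *\<^sub>R (f p (a p u) - f p (a' p u))) has_derivative
        (\<lambda>v. (1 / d p) *\<^sub>R (?D (?a p u v) p (a p u) - ?D (?a' p u v) p (a' p u)))) (at u)"
        by (intro derivative_intros has_derivative_compose[OF smf_has_derivative[OF a p] smf_has_derivative[OF Suc.prems p]]
           has_derivative_compose[OF smf_has_derivative[OF a' p] smf_has_derivative[OF Suc.prems p]])
      moreover have "(1 / d p) *\<^sub>R (?D (?a p u v) p (a p u) - ?D (?a' p u v) p (a' p u))
        = (\<Sum>c\<in>Basis. (?a' p u v \<bullet> c) *\<^sub>R ((1 / d p) *\<^sub>R (?D c p (a p u) - ?D c p (a' p u)))
            + (?r p u v \<bullet> c) *\<^sub>R ?D c p (a p u))" (is "?l = ?rr") for v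
      proof -
        have 1: "?D (?a p u v) p (a p u) = ?D (?a' p u v) p (a p u) + d p *\<^sub>R ?D (?r p u v) p (a p u)"
          unfolding ar using lin by (simp add: linear_add linear_scale)
        have "?l = (1 / d p) *\<^sub>R (?D (?a' p u v) p (a p u) - ?D (?a' p u v) p (a' p u)) + ?D (?r p u v) p (a p u)"
          unfolding 1 using d[OF p] by (simp add: algebra_simps)
        also have "\<dots> = (1 / d p) *\<^sub>R ((\<Sum>c\<in>Basis. (?a' p u v \<bullet> c) *\<^sub>R ?D c p (a p u)) -
             (\<Sum>c\<in>Basis. (?a' p u v \<bullet> c) *\<^sub>R ?D c p (a' p u))) + (\<Sum>c\<in>Basis. (?r p u v \<bullet> c) *\<^sub>R ?D c p (a p u))"
          using linear_Basis_sum[OF lin] by metis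
        also have "\<dots> = ?rr"
          by (simp add: sum.distrib sum_subtractf scaleR_sum_right algebra_simps)
        finally show ?thesis .
      qed
      ultimately show "((\<lambda>u. (1 / d p) *\<^sub>R (f p (a p u) - f p (a' p u))) has_derivative
        (\<lambda>v. \<Sum>c\<in>Basis. (?a' p u v \<bullet> c) *\<^sub>R ((1 / d p) *\<^sub>R (?D c p (a p u) - ?D c p (a' p u)))
            + (?r p u v \<bullet> c) *\<^sub>R ?D c p (a p u))) (at u)" by simp
    next
      fix i :: 'a assume i: "i \<in> Basis"
      note aa = smf_frechet[OF a' i] smf_frechet[OF r i]
      have "sb P n (\<lambda>p u. ?a' p u i \<bullet> c)" "sb P n (\<lambda>p u. ?r p u i \<bullet> c)" for c
        using smf_linear[OF bounded_linear_inner_left aa(1)] smf_linear[OF bounded_linear_inner_left aa(2)]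
        unfolding smf_def by auto
      moreover have "sb P n (\<lambda>p u. ?D c p (a p u))" if "c \<in> Basis" for c
        using smf_compose[OF smf_frechet[OF Suc.prems that] a] unfolding smf_def by auto
      ultimately show "sb P n (\<lambda>p u. \<Sum>c\<in>Basis. (?a' p u i \<bullet> c) *\<^sub>R ((1 / d p) *\<^sub>R (?D c p (a p u) - ?D c p (a' p u)))
            + (?r p u i \<bullet> c) *\<^sub>R ?D c p (a p u))"
        by (intro sb_sum sb_add sb_bilinear[OF bounded_bilinear_scaleR] Suc.IH smf_frechet[OF Suc.prems]) auto
    qed
  qed
  then show ?thesis using f unfolding smf_def by blast
qed

section \<open>Smooth families from bounds on iterated partial derivatives\<close>

lemma partials_snoc: "partials (is @ [i]) f = partials is (\<lambda>x. frechet_derivative f (at x) (axis i 1))"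
  by (induction "is") auto

text \<open>\<open>partials\<close> puts the outermost derivative at the head of its list, whereas
  \<open>sb\<close> takes the innermost derivative first; \<open>partials_snoc\<close> reconciles
  the two orders.\<close>

lemma smf_partials:
  assumes "\<And>p. p \<in> P \<Longrightarrow> smooth (f p) \<and> partials_bounded M (f p)"
  shows "smf P f"
proof -
  \<comment> \<open>The bound is generalised to an arbitrary function of order and radius, because
    passing to a first derivative shifts the order by one.\<close>
  have "sb P n f" if "\<And>p is x. p \<in> P \<Longrightarrow> partials is (f p) differentiable (at x)"
      "\<And>p is r x. p \<in> P \<Longrightarrow> norm x \<le> r \<Longrightarrow> norm (partials is (f p) x) \<le> M' (length is) r" for n M' and f :: "'a \<Rightarrow> real^3 \<Rightarrow> real^3"
    using that
  proof (induction n arbitrary: f M')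
    case 0
    then show ?case by (auto simp: loc_bounded_def) (metis list.size(3) partials.simps(1))
  next
    case (Suc n)
    have lb: "loc_bounded P f" unfolding loc_bounded_def
      using Suc.prems(2) by (metis list.size(3) partials.simps(1))
    have d: "f p differentiable (at u)" if "p \<in> P" for p u
      using Suc.prems(1)[OF that, of "[]" u] by simp
    have "sb P n (\<lambda>p u. frechet_derivative (f p) (at u) b)" if b: "b \<in> Basis" for b
    proof -
      obtain i where i: "b = axis i 1" using b by (auto simp: Basis_vec_def)
      show ?thesis unfolding i
      proof (rule Suc.IH[of _ "\<lambda>k. M' (Suc k)"])
        fix p "is" and x :: "real^3" and r assume p: "p \<in> P"
        show "partials is (\<lambda>u. frechet_derivative (f p) (at u) (axis i 1)) differentiable at x"
          using Suc.prems(1)[OF p, of "is @ [i]" x] by (simp add: partials_snoc)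
        show "norm x \<le> r \<Longrightarrow> norm (partials is (\<lambda>u. frechet_derivative (f p) (at u) (axis i 1)) x) \<le> M' (Suc (length is)) r"
          using Suc.prems(2)[OF p, of x r "is @ [i]"] by (simp add: partials_snoc)
      qed
    qed
    then show ?case using lb d by simp
  qed
  moreover have "p \<in> P \<Longrightarrow> partials is (f p) differentiable (at x)"
    "p \<in> P \<Longrightarrow> norm x \<le> r \<Longrightarrow> norm (partials is (f p) x) \<le> M (length is) r" for p "is" x r
    using assms unfolding smooth_def partials_bounded_def by auto
  ultimately show ?thesis unfolding smf_def by blast
qed

section \<open>Taylor expansion, Gronwall and Picard\<close>

lemma vector_derivative_bound:
  fixes f :: "real \<Rightarrow> 'a::real_normed_vector"
  assumes "convex S" and der: "\<And>x. x \<in> S \<Longrightarrow> (f has_vector_derivative f' x) (at x within S)"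
    and bd: "\<And>x. x \<in> S \<Longrightarrow> norm (f' x) \<le> C" and "x \<in> S" "y \<in> S"
  shows "norm (f x - f y) \<le> C * \<bar>x - y\<bar>"
proof -
  have "norm (f x - f y) \<le> C * norm (x - y)"
  proof (rule differentiable_bound[OF \<open>convex S\<close> _ _ \<open>x \<in> S\<close> \<open>y \<in> S\<close>])
    show "(f has_derivative (\<lambda>h. h *\<^sub>R f' x)) (at x within S)" if "x \<in> S" for x
      using der[OF that] by (simp add: has_vector_derivative_def)
    show "onorm (\<lambda>h. h *\<^sub>R f' x) \<le> C" if "x \<in> S" for x
      by (rule onorm_bound)
        (use bd[OF that] norm_ge_zero[of "f' x"] in \<open>auto simp: mult.commute[of C] intro: mult_left_mono simp del: norm_ge_zero\<close>)
  qed
  then show ?thesis by simp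
qed

text \<open>The derivative of the remainder is the remainder of one order less for the shifted chain
  of derivatives. Integrating it over the segment from \<open>a\<close> to \<open>t\<close> costs
  one factor |t - a|; the factorial in the bound is given away.\<close>

lemma taylor_bound:
  fixes \<phi> :: "nat \<Rightarrow> real \<Rightarrow> 'a::real_normed_vector"
  assumes "convex S" "a \<in> S" "t \<in> S"
    and "\<And>k t. k \<le> n \<Longrightarrow> t \<in> S \<Longrightarrow> (\<phi> k has_vector_derivative \<phi> (Suc k) t) (at t within S)"
    and "\<And>t. t \<in> S \<Longrightarrow> norm (\<phi> (Suc n) t) \<le> C"
  shows "norm (\<phi> 0 t - (\<Sum>k\<le>n. ((t - a) ^ k / fact k) *\<^sub>R \<phi> k a)) \<le> C * \<bar>t - a\<bar> ^ Suc n"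
  using assms(3-)
proof (induction n arbitrary: \<phi> t)
  case 0
  then show ?case
    using vector_derivative_bound[OF \<open>convex S\<close>, of "\<phi> 0" "\<phi> 1" C t a] \<open>a \<in> S\<close> by simp
next
  case (Suc n)
  define \<rho> where "\<rho> s = \<phi> 0 s - (\<Sum>k\<le>Suc n. ((s - a) ^ k / fact k) *\<^sub>R \<phi> k a)" for s
  define \<rho>' where "\<rho>' s = \<phi> 1 s - (\<Sum>k\<le>n. ((s - a) ^ k / fact k) *\<^sub>R \<phi> (Suc k) a)" for s
  have C: "C \<ge> 0" using Suc.prems(3)[OF \<open>a \<in> S\<close>] norm_ge_zero order_trans by blast
  let ?I = "closed_segment a t"
  have sub: "?I \<subseteq> S" using \<open>convex S\<close> \<open>a \<in> S\<close> \<open>t \<in> S\<close> by (simp add: closed_segment_subset)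
  have der: "(\<rho> has_vector_derivative \<rho>' s) (at s within ?I)" if "s \<in> ?I" for s
  proof -
    have "((\<lambda>s. ((s - a) ^ Suc k / fact (Suc k)) *\<^sub>R \<phi> (Suc k) a) has_vector_derivative
        ((s - a) ^ k / fact k) *\<^sub>R \<phi> (Suc k) a) (at s within ?I)" for k
    proof -
      have "((\<lambda>s. (s - a) ^ Suc k / fact (Suc k)) has_real_derivative (s - a) ^ k / fact k) (at s within ?I)"
      proof -
        have "((\<lambda>s. (s - a) ^ Suc k) has_real_derivative (1 + real k) * (s - a) ^ k) (at s within ?I)"
        proof -
          have "((\<lambda>s. s - a) has_real_derivative 1 - 0) (at s within ?I)"
            by (intro DERIV_diff DERIV_ident DERIV_const)
          from DERIV_power_Suc[OF this, of k] show ?thesis by simp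
        qed
        from DERIV_cdivide[OF this, of "fact (Suc k)"] show ?thesis by simp
      qed
      then show ?thesis
        using has_vector_derivative_scaleR[of "\<lambda>s. (s - a) ^ Suc k / fact (Suc k)" "(s - a) ^ k / fact k" s ?I
          "\<lambda>_. \<phi> (Suc k) a" 0] by simp
    qed
    then have "((\<lambda>s. \<Sum>k\<le>n. ((s - a) ^ Suc k / fact (Suc k)) *\<^sub>R \<phi> (Suc k) a) has_vector_derivative
        (\<Sum>k\<le>n. ((s - a) ^ k / fact k) *\<^sub>R \<phi> (Suc k) a)) (at s within ?I)"
      by (rule has_vector_derivative_sum)
    moreover have "(\<phi> 0 has_vector_derivative \<phi> 1 s) (at s within ?I)"
      using has_vector_derivative_within_subset[OF Suc.prems(2)[of 0 s] sub] that sub by auto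
    ultimately have "((\<lambda>s. (\<phi> 0 s - \<phi> 0 a) - (\<Sum>k\<le>n. ((s - a) ^ Suc k / fact (Suc k)) *\<^sub>R \<phi> (Suc k) a))
       has_vector_derivative (\<phi> 1 s - 0) - (\<Sum>k\<le>n. ((s - a) ^ k / fact k) *\<^sub>R \<phi> (Suc k) a)) (at s within ?I)"
      by (intro has_vector_derivative_diff has_vector_derivative_const)
    moreover have "\<rho> = (\<lambda>s. (\<phi> 0 s - \<phi> 0 a) - (\<Sum>k\<le>n. ((s - a) ^ Suc k / fact (Suc k)) *\<^sub>R \<phi> (Suc k) a))"
      unfolding \<rho>_def by (subst sum.atMost_Suc_shift) (simp add: fun_eq_iff algebra_simps)
    ultimately show ?thesis unfolding \<rho>'_def by simp
  qed
  have bd: "norm (\<rho>' s) \<le> C * \<bar>t - a\<bar> ^ Suc n" if "s \<in> ?I" for s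
  proof -
    have "norm (\<rho>' s) \<le> C * \<bar>s - a\<bar> ^ Suc n"
      unfolding \<rho>'_def using Suc.IH[of s "\<lambda>k. \<phi> (Suc k)"] Suc.prems that sub by auto
    also have "\<dots> \<le> C * \<bar>t - a\<bar> ^ Suc n"
      using C that by (intro mult_left_mono power_mono) (auto simp: closed_segment_eq_real_ivl split: if_splits)
    finally show ?thesis .
  qed
  have "norm (\<rho> t - \<rho> a) \<le> C * \<bar>t - a\<bar> ^ Suc n * \<bar>t - a\<bar>"
    by (rule vector_derivative_bound[where S = ?I and f' = \<rho>']) (use der bd in auto)
  moreover have "\<rho> a = 0"
    unfolding \<rho>_def by (subst sum.atMost_Suc_shift) simp
  ultimately show ?case unfolding \<rho>_def by (simp add: mult_ac)
qed

text \<open>Identifies the one-sided derivatives with any explicit chain of derivatives; uniqueness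
  of a derivative within [0, T] rests on positive length.\<close>

lemma deriv_on_chain:
  fixes f :: "real \<Rightarrow> 'a::real_normed_vector"
  assumes T: "T > 0"
    and der: "\<And>k t. t \<in> {0..T} \<Longrightarrow> (\<phi> k has_vector_derivative \<phi> (Suc k) t) (at t within {0..T})"
    and eq: "\<And>t. t \<in> {0..T} \<Longrightarrow> f t = \<phi> 0 t"
    and t: "t \<in> {0..T}"
  shows "deriv_on T k f t = \<phi> k t"
    and "(deriv_on T k f has_vector_derivative \<phi> (Suc k) t) (at t within {0..T})"
proof -
  have d: "(deriv_on T k f has_vector_derivative \<phi> (Suc k) t) (at t within {0..T})"
    if "\<And>t. t \<in> {0..T} \<Longrightarrow> deriv_on T k f t = \<phi> k t" "t \<in> {0..T}" for k t
    using has_vector_derivative_transform[of t "{0..T}" "deriv_on T k f" "\<phi> k"] der[OF that(2), of k] that by auto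
  have e: "\<forall>t\<in>{0..T}. deriv_on T k f t = \<phi> k t" for k
  proof (induction k)
    case 0
    then show ?case using eq by simp
  next
    case (Suc k)
    show ?case
    proof
      fix t assume t: "t \<in> {0..T}"
      have "(deriv_on T k f has_vector_derivative \<phi> (Suc k) t) (at t within cbox 0 T)"
        using d[of k t] Suc t by simp
      then show "deriv_on T (Suc k) f t = \<phi> (Suc k) t"
        using vector_derivative_within_cbox[of 0 T t] T t by simp
    qed
  qed
  show "deriv_on T k f t = \<phi> k t" using e t by blast
  show "(deriv_on T k f has_vector_derivative \<phi> (Suc k) t) (at t within {0..T})"
    using d[of k t] e t by blast
qed

lemma Ck_on_chain:
  assumes T: "T > 0"
    and der: "\<And>k t. t \<in> {0..T} \<Longrightarrow> (\<phi> k has_vector_derivative \<phi> (Suc k) t) (at t within {0..T})"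
    and eq: "\<And>t. t \<in> {0..T} \<Longrightarrow> f t = \<phi> 0 t"
  shows "Ck_on T N f"
proof -
  have d: "(deriv_on T k f has_vector_derivative \<phi> (Suc k) t) (at t within {0..T})" if "t \<in> {0..T}" for t k
    using deriv_on_chain(2)[of T \<phi> f t k] assms that by blast
  show ?thesis unfolding Ck_on_def
  proof (intro conjI allI impI ballI)
    show "deriv_on T k f differentiable at t within {0..T}" if "t \<in> {0..T}" for k t
      using differentiableI_vector[OF d[OF that]] .
    show "continuous_on {0..T} (deriv_on T N f)"
      by (rule continuous_on_vector_derivative) (rule d)
  qed
qed

lemma Ck_on_has_vector_derivative:
  assumes "Ck_on T N f" "k < N" "t \<in> {0..T}"
  shows "(deriv_on T k f has_vector_derivative deriv_on T (Suc k) f t) (at t within {0..T})"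
  using assms unfolding Ck_on_def by (auto simp: vector_derivative_works)

text \<open>Estimating the squared norm avoids differentiating the norm at zero.\<close>

lemma gronwall_norm:
  fixes f :: "real \<Rightarrow> 'a::real_inner"
  assumes der: "\<And>t. t \<in> {0..T} \<Longrightarrow> (f has_vector_derivative f' t) (at t within {0..T})"
    and bd: "\<And>t. t \<in> {0..T} \<Longrightarrow> norm (f' t) \<le> A + B * norm (f t)"
    and A: "A \<ge> 0" and B: "B \<ge> 0" and t: "t \<in> {0..T}"
  shows "norm (f t) \<le> (norm (f 0) + A) * exp ((1 + 2 * B) * T)"
proof -
  \<comment> \<open>By 2ab \<le> a^2 + b^2 the derivative of the squared norm is at most (1 + 2B)
    |f|^2 + A^2, hence at most K (|f|^2 + A^2). Adding the constant A^2 therefore makes the weighted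
    quantity nonincreasing.\<close>
  define K where "K = 1 + 2 * B"
  define g where "g s = (f s \<bullet> f s + A\<^sup>2) * exp (- K * s)" for s
  define g' where "g' s = (2 * (f s \<bullet> f' s)) * exp (- K * s) + (f s \<bullet> f s + A\<^sup>2) * (exp (- K * s) * (- K))" for s
  have dg: "(g has_real_derivative g' s) (at s within {0..t})" if "s \<in> {0..t}" for s
  proof -
    have fd: "(f has_vector_derivative f' s) (at s within {0..t})"
      by (rule has_vector_derivative_within_subset[OF der]) (use that t in auto)
    have "((\<lambda>s. f s \<bullet> f s) has_real_derivative 2 * (f s \<bullet> f' s)) (at s within {0..t})"
    proof -
      have "((\<lambda>s. f s \<bullet> f s) has_derivative (\<lambda>h. f s \<bullet> (h *\<^sub>R f' s) + (h *\<^sub>R f' s) \<bullet> f s)) (at s within {0..t})"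
        using fd unfolding has_vector_derivative_def by (intro has_derivative_inner)
      moreover have "(\<lambda>h. f s \<bullet> (h *\<^sub>R f' s) + (h *\<^sub>R f' s) \<bullet> f s) = (*) (2 * (f s \<bullet> f' s))"
        by (auto simp: inner_commute)
      ultimately show ?thesis unfolding has_field_derivative_def by simp
    qed
    then show ?thesis unfolding g_def[abs_def] g'_def
      by (auto intro!: derivative_eq_intros)
  qed
  have "g' s \<le> 0" if "s \<in> {0..t}" for s
  proof -
    have "2 * (f s \<bullet> f' s) \<le> 2 * (norm (f s) * norm (f' s))"
      using norm_cauchy_schwarz[of "f s" "f' s"] by simp
    also have "\<dots> \<le> 2 * (norm (f s) * (A + B * norm (f s)))"
      using bd[of s] that t by (intro mult_left_mono) auto
    also have "\<dots> \<le> (norm (f s))\<^sup>2 + A\<^sup>2 + 2 * B * (norm (f s))\<^sup>2"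
      using sum_squares_bound[of "norm (f s)" A] by (simp add: algebra_simps power2_eq_square)
    also have "\<dots> \<le> K * ((norm (f s))\<^sup>2 + A\<^sup>2)"
      using B by (simp add: K_def algebra_simps)
    finally have "2 * (f s \<bullet> f' s) - K * (f s \<bullet> f s + A\<^sup>2) \<le> 0"
      by (simp add: power2_norm_eq_inner)
    moreover have "g' s = (2 * (f s \<bullet> f' s) - K * (f s \<bullet> f s + A\<^sup>2)) * exp (- K * s)"
      by (simp add: g'_def algebra_simps)
    ultimately show ?thesis by (simp add: mult_nonpos_nonneg)
  qed
  then have "g t \<le> g 0"
  proof (intro DERIV_nonpos_imp_decreasing_open[of 0 t g])
    show "0 \<le> t" using t by simp
    show "\<exists>y. (g has_real_derivative y) (at x) \<and> y \<le> 0" if "\<And>s. s \<in> {0..t} \<Longrightarrow> g' s \<le> 0" "0 < x" "x < t" for x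
      using dg[of x] that by (auto simp: at_within_Icc_at)
    show "continuous_on {0..t} g"
      using dg by (meson DERIV_continuous_on)
  qed
  then have "(f t \<bullet> f t + A\<^sup>2) * exp (- K * t) \<le> f 0 \<bullet> f 0 + A\<^sup>2" by (simp add: g_def)
  then have "f t \<bullet> f t + A\<^sup>2 \<le> (f 0 \<bullet> f 0 + A\<^sup>2) * exp (K * t)"
    by (simp add: exp_minus field_simps)
  then have "(norm (f t))\<^sup>2 \<le> ((norm (f 0))\<^sup>2 + A\<^sup>2) * exp (K * t)"
    by (simp add: power2_norm_eq_inner) (smt (verit) zero_le_power2)
  also have "\<dots> \<le> (norm (f 0) + A)\<^sup>2 * exp (K * t)"
    using A by (intro mult_right_mono) (auto simp: power2_eq_square algebra_simps)
  \<comment> \<open>The exponent is doubled so that the right-hand side is a square and the root can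
    be taken directly.\<close>
  also have "\<dots> \<le> (norm (f 0) + A)\<^sup>2 * (exp (K * T))\<^sup>2"
  proof (intro mult_left_mono)
    have "0 \<le> t" "t \<le> T" "K \<ge> 0" using t B by (auto simp: K_def)
    then have "K * t \<le> K * T" "0 \<le> K * T" by (auto intro: mult_left_mono)
    then have "K * t \<le> 2 * (K * T)" by linarith
    then show "exp (K * t) \<le> (exp (K * T))\<^sup>2" by (simp add: exp_double[symmetric])
  qed auto
  finally have "(norm (f t))\<^sup>2 \<le> ((norm (f 0) + A) * exp (K * T))\<^sup>2" by (simp add: power_mult_distrib)
  then have "norm (f t) \<le> (norm (f 0) + A) * exp (K * T)"
    by (rule power2_le_imp_le) (use A in simp)
  then show ?thesis by (simp only: K_def)
qed

text \<open>Picard iteration; the weight \<open>exp (2 * L * t)\<close> makes every step a contraction by one half.\<close>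

lemma picard:
  fixes F :: "'a::euclidean_space \<Rightarrow> 'a"
  assumes L: "L > 0" and lip: "\<And>x y. norm (F x - F y) \<le> L * norm (x - y)" and T: "T > 0"
  obtains u where "u 0 = u0" "\<And>t. t \<in> {0..T} \<Longrightarrow> (u has_vector_derivative F (u t)) (at t within {0..T})"
proof -
  define U :: "nat \<Rightarrow> real \<Rightarrow> 'a" where "U = rec_nat (\<lambda>t. u0) (\<lambda>n v t. u0 + integral {0..t} (\<lambda>s. F (v s)))"
  have U0: "U 0 = (\<lambda>t. u0)" and US: "U (Suc n) = (\<lambda>t. u0 + integral {0..t} (\<lambda>s. F (U n s)))" for n
    by (auto simp: U_def)
  have contF: "continuous_on S F" for S
    by (rule lipschitz_on_continuous_on[of L]) (use lip L in \<open>auto simp: lipschitz_on_def dist_norm\<close>)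
  have cont: "continuous_on {0..T} (U n)" for n
  proof (induction n)
    case 0
    then show ?case by (simp add: U0)
  next
    case (Suc n)
    have "continuous_on {0..T} (\<lambda>s. F (U n s))"
      using continuous_on_compose[OF Suc contF] by (simp add: o_def)
    then show ?case unfolding US
      by (intro continuous_intros indefinite_integral_continuous_1 integrable_continuous_real)
  qed
  have contFU: "continuous_on {0..t} (\<lambda>s. F (U n s))" if "t \<le> T" for n t
    using continuous_on_compose[OF cont[of n] contF] that
    by (auto simp: o_def intro: continuous_on_subset)
  define B where "B = T * norm (F u0)"
  have B: "B \<ge> 0" using T by (simp add: B_def)
  have step: "norm (U (Suc n) t - U n t) \<le> B * (1/2) ^ n * exp (2 * L * t)" if "t \<in> {0..T}" for n t
    using that
  proof (induction n arbitrary: t)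
    case 0
    have "norm (U 1 t - U 0 t) = t * norm (F u0)"
      using 0 by (simp add: U0 US)
    also have "\<dots> \<le> B * 1" using 0 by (simp add: B_def mult_right_mono)
    also have "\<dots> \<le> B * exp (2 * L * t)" using 0 L B by (intro mult_left_mono) auto
    finally show ?case by simp
  next
    case (Suc n)
    have t: "0 \<le> t" "t \<le> T" using Suc by auto
    \<comment> \<open>The integral of L exp(2 L s) is bounded by half of exp(2 L t); this is the
      contraction factor.\<close>
    have "((\<lambda>s. (B * (1/2) ^ Suc n) * exp (2 * L * s)) has_vector_derivative
        L * (B * (1/2) ^ n * exp (2 * L * s))) (at s within {0..t})" for s
      unfolding has_real_derivative_iff_has_vector_derivative[symmetric]
      by (auto intro!: derivative_eq_intros)
    then have hi: "((\<lambda>s. L * (B * (1/2) ^ n * exp (2 * L * s))) has_integral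
        (B * (1/2) ^ Suc n) * exp (2 * L * t) - (B * (1/2) ^ Suc n) * exp (2 * L * 0)) {0..t}"
      by (intro fundamental_theorem_of_calculus t) auto
    have "U (Suc (Suc n)) t - U (Suc n) t = integral {0..t} (\<lambda>s. F (U (Suc n) s) - F (U n s))"
    proof -
      have i: "(\<lambda>s. F (U k s)) integrable_on {0..t}" for k
        by (intro integrable_continuous_real contFU t)
      have "U (Suc (Suc n)) t - U (Suc n) t
        = integral {0..t} (\<lambda>s. F (U (Suc n) s)) - integral {0..t} (\<lambda>s. F (U n s))"
      proof -
        have 1: "U (Suc k) t = u0 + integral {0..t} (\<lambda>s. F (U k s))" for k by (simp only: US)
        show ?thesis using 1[of "Suc n"] 1[of n] by simp
      qed
      then show ?thesis using Henstock_Kurzweil_Integration.integral_diff[OF i[of "Suc n"] i[of n]] by simp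
    qed
    also have "norm \<dots> \<le> integral {0..t} (\<lambda>s. L * (B * (1/2) ^ n * exp (2 * L * s)))"
    proof (rule integral_norm_bound_integral)
      show "(\<lambda>s. F (U (Suc n) s) - F (U n s)) integrable_on {0..t}"
        by (intro integrable_continuous_real continuous_intros contFU t)
      show "(\<lambda>s. L * (B * (1/2) ^ n * exp (2 * L * s))) integrable_on {0..t}" using hi by blast
      fix s assume s: "s \<in> {0..t}"
      have "norm (F (U (Suc n) s) - F (U n s)) \<le> L * norm (U (Suc n) s - U n s)" by (rule lip)
      also have "\<dots> \<le> L * (B * (1/2) ^ n * exp (2 * L * s))"
        using Suc.IH[of s] s t L by (intro mult_left_mono) auto
      finally show "norm (F (U (Suc n) s) - F (U n s)) \<le> L * (B * (1/2) ^ n * exp (2 * L * s))" .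
    qed
    also have "\<dots> \<le> B * (1/2) ^ Suc n * exp (2 * L * t)"
      using integral_unique[OF hi] B by simp
    finally show ?case .
  qed
  define M where "M n = B * exp (2 * L * T) * (1/2) ^ n" for n
  have MM: "norm (U (Suc n) t - U n t) \<le> M n" if "t \<in> {0..T}" for n t
  proof -
    have "norm (U (Suc n) t - U n t) \<le> B * (1/2) ^ n * exp (2 * L * t)" by (rule step[OF that])
    also have "\<dots> \<le> B * (1/2) ^ n * exp (2 * L * T)"
      using that B L by (intro mult_left_mono) auto
    finally show ?thesis by (simp add: M_def mult_ac)
  qed
  have "summable M" unfolding M_def by (intro summable_mult summable_geometric) simp
  then have "uniform_limit {0..T} (\<lambda>n t. \<Sum>i<n. U (Suc i) t - U i t) (\<lambda>t. \<Sum>i. U (Suc i) t - U i t) sequentially"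
    using MM by (intro Weierstrass_m_test) auto
  moreover have "(\<Sum>i<n. U (Suc i) t - U i t) = U n t - u0" for n t
    by (induction n) (simp_all add: U0)
  ultimately have lim0: "uniform_limit {0..T} (\<lambda>n t. U n t - u0) (\<lambda>t. \<Sum>i. U (Suc i) t - U i t) sequentially"
    by simp
  define u where "u t = u0 + (\<Sum>i. U (Suc i) t - U i t)" for t
  have lim: "uniform_limit {0..T} U u sequentially"
    using uniform_limit_add[OF uniform_limit_const[where c = "\<lambda>_. u0"] lim0]
    by (simp add: u_def[abs_def])
  have cu: "continuous_on {0..T} u"
    by (rule uniform_limit_theorem[OF _ lim]) (use cont in auto)
  have cFu: "continuous_on {0..T} (\<lambda>s. F (u s))"
    using continuous_on_compose[OF cu contF] by (simp add: o_def)
  have limF: "uniform_limit {0..T} (\<lambda>n s. F (U n s)) (\<lambda>s. F (u s)) sequentially"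
  proof (rule uniform_limitI)
    fix e :: real assume "e > 0"
    then have "e / L > 0" using L by simp
    from uniform_limitD[OF lim this]
    show "\<forall>\<^sub>F n in sequentially. \<forall>s\<in>{0..T}. dist (F (U n s)) (F (u s)) < e"
    proof (rule eventually_mono, intro ballI)
      fix n s assume "\<forall>x\<in>{0..T}. dist (U n x) (u x) < e / L" "s \<in> {0..T}"
      then have "L * norm (U n s - u s) < e" using L by (auto simp: dist_norm field_simps)
      then show "dist (F (U n s)) (F (u s)) < e" using lip[of "U n s" "u s"] by (simp add: dist_norm)
    qed
  qed
  have eq: "u t = u0 + integral {0..t} (\<lambda>s. F (u s))" if t: "t \<in> {0..T}" for t
  proof -
    have "uniform_limit {0..t} (\<lambda>n s. F (U n s)) (\<lambda>s. F (u s)) sequentially"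
      using uniform_limit_on_subset[OF limF] t by auto
    then obtain I J where IJ: "\<And>n. ((\<lambda>s. F (U n s)) has_integral I n) {0..t}"
      "((\<lambda>s. F (u s)) has_integral J) {0..t}" "(I \<longlongrightarrow> J) sequentially"
      by (rule uniform_limit_integral) (use contFU t in auto)
    have "I = (\<lambda>n. integral {0..t} (\<lambda>s. F (U n s)))" by (simp add: fun_eq_iff integral_unique[OF IJ(1)])
    then have "(\<lambda>n. U (Suc n) t) \<longlonglongrightarrow> u0 + integral {0..t} (\<lambda>s. F (u s))"
      using IJ integral_unique[OF IJ(2)] unfolding US by (auto intro!: tendsto_intros)
    moreover have "(\<lambda>n. U (Suc n) t) \<longlonglongrightarrow> u t"
      using LIMSEQ_Suc[OF tendsto_uniform_limitI[OF lim t]] .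
    ultimately show ?thesis by (metis LIMSEQ_unique)
  qed
  show thesis
  proof (rule that[of u])
    show "u 0 = u0" using eq[of 0] T by simp
    fix t assume t: "t \<in> {0..T}"
    have "((\<lambda>t. u0 + integral {0..t} (\<lambda>s. F (u s))) has_vector_derivative 0 + F (u t)) (at t within {0..T})"
      by (intro has_vector_derivative_add has_vector_derivative_const integral_has_vector_derivative[OF cFu t])
    then show "(u has_vector_derivative F (u t)) (at t within {0..T})"
      using has_vector_derivative_transform[OF t, of u "\<lambda>t. u0 + integral {0..t} (\<lambda>s. F (u s))"] eq by simp
  qed
qed

text \<open>By the mean value theorem the first derivative is small at points between consecutive pairs
  of nodes, and these points are again separated; this halves the number of nodes.\<close>

lemma small_on_nodes_imp_small:
  fixes \<phi> :: "nat \<Rightarrow> real \<Rightarrow> real"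
  assumes "\<mu> \<ge> 0"
  shows "\<exists>C>0. \<forall>\<phi> s D H a b.
    (\<forall>k<n. \<forall>t\<in>{a..b}. (\<phi> k has_real_derivative \<phi> (Suc k) t) (at t within {a..b})) \<longrightarrow>
    (\<forall>t\<in>{a..b}. \<bar>\<phi> n t\<bar> \<le> D) \<longrightarrow> H > 0 \<longrightarrow> b - a \<le> \<mu> * H \<longrightarrow>
    (\<forall>i<2 ^ n. s i \<in> {a..b} \<and> \<bar>\<phi> 0 (s i)\<bar> \<le> D * H ^ n) \<longrightarrow>
    (\<forall>i. Suc i < 2 ^ n \<longrightarrow> s i + H \<le> s (Suc i)) \<longrightarrow>
    (\<forall>t\<in>{a..b}. \<bar>\<phi> 0 t\<bar> \<le> C * D * H ^ n)"
proof (induction n)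
  case 0
  then show ?case by (intro exI[of _ 1]) auto
next
  case (Suc n)
  then obtain C where C: "C > 0" and IH0: "\<forall>\<phi> s D H a b.
    (\<forall>k<n. \<forall>t\<in>{a..b}. (\<phi> k has_real_derivative \<phi> (Suc k) t) (at t within {a..b})) \<longrightarrow>
    (\<forall>t\<in>{a..b}. \<bar>\<phi> n t\<bar> \<le> D) \<longrightarrow> H > 0 \<longrightarrow> b - a \<le> \<mu> * H \<longrightarrow>
    (\<forall>i<2 ^ n. s i \<in> {a..b} \<and> \<bar>\<phi> 0 (s i)\<bar> \<le> D * H ^ n) \<longrightarrow>
    (\<forall>i. Suc i < 2 ^ n \<longrightarrow> s i + H \<le> s (Suc i)) \<longrightarrow>
    (\<forall>t\<in>{a..b}. \<bar>\<phi> 0 t\<bar> \<le> C * D * H ^ n)"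
    by blast
  have IH: "\<bar>\<phi> 0 t\<bar> \<le> C * D * H ^ n"
    if "\<And>k t. k < n \<Longrightarrow> t \<in> {a..b} \<Longrightarrow> (\<phi> k has_real_derivative \<phi> (Suc k) t) (at t within {a..b})"
      "\<And>t. t\<in>{a..b} \<Longrightarrow> \<bar>\<phi> n t\<bar> \<le> D" "H > 0" "b - a \<le> \<mu> * H"
      "\<And>i. i < 2 ^ n \<Longrightarrow> s i \<in> {a..b} \<and> \<bar>\<phi> 0 (s i)\<bar> \<le> D * H ^ n"
      "\<And>i. Suc i < 2 ^ n \<Longrightarrow> s i + H \<le> s (Suc i)" "t\<in>{a..b}" for a b \<phi> D H s t
    using IH0[THEN spec, of \<phi>, THEN spec, of s, THEN spec, of D, THEN spec, of H, THEN spec, of a, THEN spec, of b]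
      that by blast
  show ?case
  proof (intro exI[of _ "1 + 2 * \<mu> * C"] conjI allI impI ballI)
    show "1 + 2 * \<mu> * C > 0" using C assms by (simp add: add_pos_nonneg)
    fix \<phi> :: "nat \<Rightarrow> real \<Rightarrow> real" and s D H a b t
    assume der: "\<forall>k<Suc n. \<forall>t\<in>{a..b}. (\<phi> k has_real_derivative \<phi> (Suc k) t) (at t within {a..b})"
      and D: "\<forall>t\<in>{a..b}. \<bar>\<phi> (Suc n) t\<bar> \<le> D" and H: "H > 0" and ba: "b - a \<le> \<mu> * H"
      and s: "\<forall>i<2 ^ Suc n. s i \<in> {a..b} \<and> \<bar>\<phi> 0 (s i)\<bar> \<le> D * H ^ Suc n"
      and gap: "\<forall>i. Suc i < 2 ^ Suc n \<longrightarrow> s i + H \<le> s (Suc i)" and t: "t \<in> {a..b}"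
    have D0: "D \<ge> 0" using D t by fastforce
    \<comment> \<open>Nodes are paired as 2i and 2i+1. Two values of size D H^(n+1) at distance at
      least H give a slope of size 2 D H^n, which is why the induction hypothesis is applied with 2
      D.\<close>
    have "\<exists>\<xi>. s (2*i) < \<xi> \<and> \<xi> < s (2*i+1) \<and> \<bar>\<phi> 1 \<xi>\<bar> \<le> 2 * D * H ^ n" if i: "i < 2 ^ n" for i
    proof -
      have lt: "2*i+1 < 2 ^ Suc n" using i by simp
      then have g: "s (2*i) + H \<le> s (2*i+1)" using gap by simp
      have mem: "s (2*i) \<in> {a..b}" "s (2*i+1) \<in> {a..b}"
        and sm: "\<bar>\<phi> 0 (s (2*i))\<bar> \<le> D * H ^ Suc n" "\<bar>\<phi> 0 (s (2*i+1))\<bar> \<le> D * H ^ Suc n"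
        using s lt by auto
      have "\<exists>\<xi>\<in>{s (2*i)<..<s (2*i+1)}. \<phi> 0 (s (2*i+1)) - \<phi> 0 (s (2*i)) = \<phi> 1 \<xi> * (s (2*i+1) - s (2*i))"
      proof (rule mvt_simple)
        show "s (2*i) < s (2*i+1)" using g H by linarith
        fix x assume "s (2*i) \<le> x" "x \<le> s (2*i+1)"
        then have x: "x \<in> {a..b}" using mem by auto
        have "(\<phi> 0 has_real_derivative \<phi> 1 x) (at x within {a..b})" using der x by auto
        then have "(\<phi> 0 has_derivative (*) (\<phi> 1 x)) (at x within {a..b})"
          by (simp add: has_field_derivative_def)
        then show "(\<phi> 0 has_derivative (*) (\<phi> 1 x)) (at x within {s (2*i)..s (2*i+1)})"
          by (rule has_derivative_subset) (use mem in auto)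
      qed
      then obtain \<xi> where \<xi>: "s (2*i) < \<xi>" "\<xi> < s (2*i+1)"
        "\<phi> 0 (s (2*i+1)) - \<phi> 0 (s (2*i)) = \<phi> 1 \<xi> * (s (2*i+1) - s (2*i))" by auto
      have "\<bar>\<phi> 1 \<xi>\<bar> * H \<le> \<bar>\<phi> 1 \<xi>\<bar> * (s (2*i+1) - s (2*i))"
        using g by (intro mult_left_mono) auto
      also have "\<dots> = \<bar>\<phi> 0 (s (2*i+1)) - \<phi> 0 (s (2*i))\<bar>"
        using \<xi> by (simp add: abs_mult)
      also have "\<dots> \<le> 2 * (D * H ^ Suc n)" using sm by linarith
      also have "\<dots> = 2 * D * H ^ n * H" by simp
      finally have "\<bar>\<phi> 1 \<xi>\<bar> \<le> 2 * D * H ^ n" by (rule mult_right_le_imp_le[OF _ H])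
      then show ?thesis using \<xi> by blast
    qed
    then obtain \<xi> where \<xi>: "\<And>i. i < 2 ^ n \<Longrightarrow> s (2*i) < \<xi> i \<and> \<xi> i < s (2*i+1) \<and> \<bar>\<phi> 1 (\<xi> i)\<bar> \<le> 2 * D * H ^ n"
      by metis
    have bd1: "\<bar>\<phi> (Suc 0) x\<bar> \<le> C * (2 * D) * H ^ n" if x: "x \<in> {a..b}" for x
    proof (rule IH[of a b "\<lambda>k. \<phi> (Suc k)" "2 * D" H \<xi> x])
      show "(\<phi> (Suc k) has_real_derivative \<phi> (Suc (Suc k)) t) (at t within {a..b})"
        if "k < n" "t \<in> {a..b}" for k t
        using der that by simp
      show "\<bar>\<phi> (Suc n) t\<bar> \<le> 2 * D" if "t \<in> {a..b}" for t using D D0 that by fastforce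
      show "\<xi> i \<in> {a..b} \<and> \<bar>\<phi> (Suc 0) (\<xi> i)\<bar> \<le> 2 * D * H ^ n" if "i < 2 ^ n" for i
      proof -
        have "s (2*i) \<in> {a..b}" "s (2*i+1) \<in> {a..b}" using s that by auto
        then show ?thesis using \<xi>[OF that] by auto
      qed
      \<comment> \<open>The gap between the nodes 2i+1 and 2i+2 separates consecutive mean value
        points, so these inherit the distance H.\<close>
      show "\<xi> i + H \<le> \<xi> (Suc i)" if "Suc i < 2 ^ n" for i
      proof -
        have "s (2*i+1) + H \<le> s (Suc (2*i+1))" using gap that by simp
        then show ?thesis using \<xi>[of i] \<xi>[of "Suc i"] that by simp
      qed
    qed (use H ba x in auto)
    have s0: "s 0 \<in> {a..b}" "\<bar>\<phi> 0 (s 0)\<bar> \<le> D * H ^ Suc n" using s by auto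
    have "norm (\<phi> 0 t - \<phi> 0 (s 0)) \<le> C * (2 * D) * H ^ n * \<bar>t - s 0\<bar>"
      by (rule vector_derivative_bound[where S = "{a..b}" and f' = "\<phi> (Suc 0)"])
        (use bd1 t s0 der in \<open>auto simp: has_real_derivative_iff_has_vector_derivative[symmetric]\<close>)
    also have "\<dots> \<le> C * (2 * D) * H ^ n * (\<mu> * H)"
      using t s0 ba C D0 H by (intro mult_left_mono) auto
    finally have "\<bar>\<phi> 0 t\<bar> \<le> D * H ^ Suc n + C * (2 * D) * H ^ n * (\<mu> * H)" using s0 by simp
    then show "\<bar>\<phi> 0 t\<bar> \<le> (1 + 2 * \<mu> * C) * D * H ^ Suc n" by (simp add: algebra_simps)
  qed
qed

section \<open>Formal expansions in the step size\<close>

locale step_family =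
  fixes P :: "'p set" and h \<epsilon> :: "'p \<Rightarrow> real"
  assumes h: "\<And>p. p \<in> P \<Longrightarrow> 0 < h p" and h1: "\<And>p. p \<in> P \<Longrightarrow> h p \<le> 1"
    and eps: "\<And>p. p \<in> P \<Longrightarrow> 0 < \<epsilon> p" and eps_le: "\<And>p. p \<in> P \<Longrightarrow> \<epsilon> p \<le> (h p)\<^sup>2"
begin

text \<open>Congruence modulo h^m together with all derivatives: the scaled difference has to be a
  smooth family. A pointwise O(h^m) would not survive a Lie derivative.\<close>

definition eqv :: "nat \<Rightarrow> ('p \<Rightarrow> 'a::euclidean_space \<Rightarrow> 'b::real_normed_vector) \<Rightarrow> ('p \<Rightarrow> 'a \<Rightarrow> 'b) \<Rightarrow> bool" where
  "eqv m f g \<longleftrightarrow> smf P f \<and> smf P g \<and> smf P (\<lambda>p u. (1 / h p ^ m) *\<^sub>R (f p u - g p u))"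

lemma eqv_smf: "eqv m f g \<Longrightarrow> smf P f" "eqv m f g \<Longrightarrow> smf P g"
  by (auto simp: eqv_def)

lemma eqv_refl: "smf P f \<Longrightarrow> eqv m f f"
  using smf_const[of P "\<lambda>_. 0" 0] by (simp add: eqv_def)

lemma eqv_cong:
  assumes "\<And>p u. p \<in> P \<Longrightarrow> f p u = f' p u" "\<And>p u. p \<in> P \<Longrightarrow> g p u = g' p u"
  shows "eqv m f g \<longleftrightarrow> eqv m f' g'"
  unfolding eqv_def
  using smf_cong[of P f f'] smf_cong[of P g g']
    smf_cong[of P "\<lambda>p u. (1 / h p ^ m) *\<^sub>R (f p u - g p u)" "\<lambda>p u. (1 / h p ^ m) *\<^sub>R (f' p u - g' p u)"] assms
  by simp

lemma eqv_zero: "smf P f \<Longrightarrow> smf P g \<Longrightarrow> eqv 0 f g"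
  by (simp add: eqv_def smf_diff)

lemma eqv_linear: "bounded_linear A \<Longrightarrow> eqv m f g \<Longrightarrow> eqv m (\<lambda>p u. A (f p u)) (\<lambda>p u. A (g p u))"
  using smf_linear[of A P f] smf_linear[of A P g] smf_linear[of A P "\<lambda>p u. (1 / h p ^ m) *\<^sub>R (f p u - g p u)"]
  by (simp add: eqv_def linear_simps)

lemma eqv_add: "eqv m f g \<Longrightarrow> eqv m f' g' \<Longrightarrow> eqv m (\<lambda>p u. f p u + f' p u) (\<lambda>p u. g p u + g' p u)"
  unfolding eqv_def
  using smf_add[of P f f'] smf_add[of P g g'] smf_add[of P "\<lambda>p u. (1 / h p ^ m) *\<^sub>R (f p u - g p u)"
      "\<lambda>p u. (1 / h p ^ m) *\<^sub>R (f' p u - g' p u)"]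
  by (simp add: algebra_simps)

lemma eqv_minus: "eqv m f g \<Longrightarrow> eqv m (\<lambda>p u. - f p u) (\<lambda>p u. - g p u)"
  by (rule eqv_linear[OF bounded_linear_minus[OF bounded_linear_ident]])

lemma eqv_diff: "eqv m f g \<Longrightarrow> eqv m f' g' \<Longrightarrow> eqv m (\<lambda>p u. f p u - f' p u) (\<lambda>p u. g p u - g' p u)"
  using eqv_add[OF _ eqv_minus, of m f g f' g'] by simp

lemma eqv_Pair: "eqv m f g \<Longrightarrow> eqv m f' g' \<Longrightarrow> eqv m (\<lambda>p u. (f p u, f' p u)) (\<lambda>p u. (g p u, g' p u))"
  unfolding eqv_def
  using smf_Pair[of P f f'] smf_Pair[of P g g'] smf_Pair[of P "\<lambda>p u. (1 / h p ^ m) *\<^sub>R (f p u - g p u)"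
      "\<lambda>p u. (1 / h p ^ m) *\<^sub>R (f' p u - g' p u)"]
  by simp

lemma eqv_sum:
  "finite I \<Longrightarrow> (\<And>i. i \<in> I \<Longrightarrow> eqv m (f i) (g i)) \<Longrightarrow> eqv m (\<lambda>p u. \<Sum>i\<in>I. f i p u) (\<lambda>p u. \<Sum>i\<in>I. g i p u)"
proof (induction I rule: finite_induct)
  case empty
  then show ?case using eqv_refl[OF smf_const[of P "\<lambda>_. 0" 0]] by simp
next
  case (insert i I)
  then show ?case using eqv_add[of m "f i" "g i"] by simp
qed

lemma eqv_scale:
  assumes c: "\<And>p. p \<in> P \<Longrightarrow> \<bar>c p\<bar> \<le> C * h p ^ k" and f: "eqv m f g"
  shows "eqv (m + k) (\<lambda>p u. c p *\<^sub>R f p u) (\<lambda>p u. c p *\<^sub>R g p u)"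
proof -
  have c1: "\<bar>c p\<bar> \<le> \<bar>C\<bar>" if "p \<in> P" for p
  proof -
    have "\<bar>c p\<bar> \<le> \<bar>C\<bar> * h p ^ k" using c[OF that] h[OF that]
      by (meson abs_ge_self mult_right_mono order_trans zero_le_power less_imp_le)
    also have "\<dots> \<le> \<bar>C\<bar> * 1" using h[OF that] h1[OF that] by (intro mult_left_mono power_le_one) auto
    finally show ?thesis by simp
  qed
  have c2: "\<bar>c p / h p ^ k\<bar> \<le> C" if "p \<in> P" for p
    using c[OF that] h[OF that] by (simp add: divide_le_eq)
  have "smf P (\<lambda>p u. (c p / h p ^ k) *\<^sub>R ((1 / h p ^ m) *\<^sub>R (f p u - g p u)))"
    by (rule smf_scale[OF c2]) (use f in \<open>auto simp: eqv_def\<close>)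
  then show ?thesis using f smf_scale[of P c "\<bar>C\<bar>" f, OF c1] smf_scale[of P c "\<bar>C\<bar>" g, OF c1]
    by (simp add: eqv_def power_add mult.commute scaleR_diff_right[symmetric])
qed

lemma eqv_scale0: "(\<And>p. p \<in> P \<Longrightarrow> \<bar>c p\<bar> \<le> C) \<Longrightarrow> eqv m f g \<Longrightarrow> eqv m (\<lambda>p u. c p *\<^sub>R f p u) (\<lambda>p u. c p *\<^sub>R g p u)"
  using eqv_scale[of c C 0 m f g] by simp

lemma eqv_h2: "eqv m f g \<Longrightarrow> eqv (m + 2) (\<lambda>p u. (h p)\<^sup>2 *\<^sub>R f p u) (\<lambda>p u. (h p)\<^sup>2 *\<^sub>R g p u)"
  by (rule eqv_scale[where C = 1]) auto

text \<open>In the order count a factor \<epsilon> is worth as much as h^2, by the standing relation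
  \<epsilon> \<le> h^2.\<close>

lemma eqv_eps: "eqv m f g \<Longrightarrow> eqv (m + 2) (\<lambda>p u. \<epsilon> p *\<^sub>R f p u) (\<lambda>p u. \<epsilon> p *\<^sub>R g p u)"
  by (rule eqv_scale[where C = 1]) (use eps eps_le in \<open>auto simp: abs_of_pos\<close>)

lemma eqv_weaken: "eqv (m + k) f g \<Longrightarrow> eqv m f g"
proof -
  assume a: "eqv (m + k) f g"
  have "smf P (\<lambda>p u. (h p ^ k) *\<^sub>R ((1 / h p ^ (m + k)) *\<^sub>R (f p u - g p u)))"
    by (rule smf_scale[where C = 1]) (use a h h1 in \<open>auto simp: eqv_def power_le_one less_imp_le\<close>)
  also have "?this \<longleftrightarrow> smf P (\<lambda>p u. (1 / h p ^ m) *\<^sub>R (f p u - g p u))"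
  proof (rule smf_cong)
    fix p u assume "p \<in> P"
    then have "h p ^ k * (1 / h p ^ (m + k)) = 1 / h p ^ m" using h[of p] by (simp add: power_add)
    then show "h p ^ k *\<^sub>R ((1 / h p ^ (m + k)) *\<^sub>R (f p u - g p u)) = (1 / h p ^ m) *\<^sub>R (f p u - g p u)"
      by (simp only: scaleR_scaleR)
  qed
  finally show ?thesis using a by (simp add: eqv_def)
qed

text \<open>An instance of the smooth difference quotient with d = h^m: substituting congruent
  arguments into a smooth family preserves the order.\<close>

lemma eqv_compose:
  assumes "smf P k" "eqv m f g"
  shows "eqv m (\<lambda>p u. k p (f p u)) (\<lambda>p u. k p (g p u))"
proof -
  have s: "smf P f" "smf P g" "smf P (\<lambda>p u. (1 / h p ^ m) *\<^sub>R (f p u - g p u))"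
    using assms(2) by (simp_all add: eqv_def)
  have "smf P (\<lambda>p u. (1 / h p ^ m) *\<^sub>R (k p (f p u) - k p (g p u)))"
  proof (rule smf_diff_quotient[OF assms(1) s(1,2,3)])
    fix p u assume p: "p \<in> P"
    show "0 < h p ^ m" using h[OF p] by simp
    show "f p u = g p u + h p ^ m *\<^sub>R ((1 / h p ^ m) *\<^sub>R (f p u - g p u))"
      using h[OF p] by (simp only: scaleR_scaleR) simp
  qed
  then show ?thesis
    unfolding eqv_def using smf_compose[OF assms(1) s(1)] smf_compose[OF assms(1) s(2)] by simp
qed

text \<open>\<open>lie\<close> is linear in the function and linear in the field, so the scaled
  difference splits, as in the product rule, into the Lie derivatives formed with the two scaled
  differences.\<close>

lemma eqv_lie:
  assumes f: "eqv m f f'" and G: "eqv m G G'"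
  shows "eqv m (lie G f) (lie G' f')"
proof -
  let ?df = "\<lambda>p u. (1 / h p ^ m) *\<^sub>R (f p u - f' p u)" and ?dG = "\<lambda>p u. (1 / h p ^ m) *\<^sub>R (G p u - G' p u)"
  have s: "smf P f" "smf P f'" "smf P G" "smf P G'" "smf P ?df" "smf P ?dG"
    using assms by (auto simp: eqv_def)
  have "smf P (\<lambda>p u. lie G ?df p u + lie ?dG f' p u)"
    by (intro smf_add smf_lie s)
  also have "?this \<longleftrightarrow> smf P (\<lambda>p u. (1 / h p ^ m) *\<^sub>R (lie G f p u - lie G' f' p u))"
  proof (rule smf_cong)
    fix p u assume p: "p \<in> P"
    have d: "(f p has_derivative frechet_derivative (f p) (at u)) (at u)"
      "(f' p has_derivative frechet_derivative (f' p) (at u)) (at u)"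
      by (rule smf_has_derivative[OF s(1) p] smf_has_derivative[OF s(2) p])+
    note lin = has_derivative_linear[OF d(2)]
    have "((\<lambda>u. (1 / h p ^ m) *\<^sub>R (f p u - f' p u)) has_derivative
      (\<lambda>v. (1 / h p ^ m) *\<^sub>R (frechet_derivative (f p) (at u) v - frechet_derivative (f' p) (at u) v))) (at u)"
      by (intro derivative_intros d)
    from lie_eqI[where f = ?df and p = p, OF this, where G = G]
    have e1: "lie G ?df p u = (1 / h p ^ m) *\<^sub>R (lie G f p u - lie G f' p u)" by (simp add: lie_def)
    have e2: "lie ?dG f' p u = (1 / h p ^ m) *\<^sub>R (lie G f' p u - lie G' f' p u)"
      using lin by (simp add: lie_def linear_scale linear_diff)
    show "lie G ?df p u + lie ?dG f' p u = (1 / h p ^ m) *\<^sub>R (lie G f p u - lie G' f' p u)"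
      unfolding e1 e2 by (simp add: scaleR_diff_right)
  qed
  finally show ?thesis
    unfolding eqv_def using smf_lie[OF s(1,3)] smf_lie[OF s(2,4)] by simp
qed

lemma eqv_liepow: "eqv m f f' \<Longrightarrow> eqv m G G' \<Longrightarrow> eqv m ((lie G ^^ k) f) ((lie G' ^^ k) f')"
  by (induction k) (auto intro: eqv_lie)

lemma smf_liepow: "smf P f \<Longrightarrow> smf P G \<Longrightarrow> smf P ((lie G ^^ k) f)"
  by (induction k) (auto intro: smf_lie)

lemma liepow_cong:
  assumes "\<And>p u. p \<in> P \<Longrightarrow> f p u = f' p u" "p \<in> P"
  shows "(lie G ^^ k) f p u = (lie G ^^ k) f' p u"
  using assms(2)
proof (induction k arbitrary: p u)
  case 0
  then show ?case using assms by simp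
next
  case (Suc k)
  then show ?case by (auto intro: lie_cong)
qed

lemma liepow_linear:
  assumes f: "smf P f" and G: "smf P G" and A: "\<And>p. p \<in> P \<Longrightarrow> bounded_linear (A p)" and p: "p \<in> P"
  shows "(lie G ^^ k) (\<lambda>p u. A p (f p u)) p u = A p ((lie G ^^ k) f p u)"
  using p
proof (induction k arbitrary: p u)
  case 0
  then show ?case by simp
next
  case (Suc k)
  have "(lie G ^^ Suc k) (\<lambda>p u. A p (f p u)) p u = lie G (\<lambda>p u. A p ((lie G ^^ k) f p u)) p u"
    using Suc by (auto intro: lie_cong)
  also have "\<dots> = A p ((lie G ^^ Suc k) f p u)"
    using lie_linear[where A = A, OF smf_liepow[OF f G] A[OF Suc.prems] Suc.prems] by simp
  finally show ?case .
qed

lemma liepow_add: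
  assumes f: "smf P f" "smf P f'" and G: "smf P G" and p: "p \<in> P"
  shows "(lie G ^^ k) (\<lambda>p u. f p u + f' p u) p u = (lie G ^^ k) f p u + (lie G ^^ k) f' p u"
  using p
proof (induction k arbitrary: p u)
  case 0
  then show ?case by simp
next
  case (Suc k)
  have "(lie G ^^ Suc k) (\<lambda>p u. f p u + f' p u) p u = lie G (\<lambda>p u. (lie G ^^ k) f p u + (lie G ^^ k) f' p u) p u"
    using Suc by (auto intro: lie_cong)
  also have "\<dots> = (lie G ^^ Suc k) f p u + (lie G ^^ Suc k) f' p u"
    using lie_add[OF smf_liepow[OF f(1) G] smf_liepow[OF f(2) G] Suc.prems] by simp
  finally show ?case .
qed

text \<open>Truncated Taylor series of the central difference quotient and of the second difference
  quotient along the flow of \<open>G\<close>, both expressed through the derivative \<open>f\<close> of the function to which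
  they are applied.\<close>

definition Dp :: "nat \<Rightarrow> ('p \<Rightarrow> 'a::euclidean_space \<Rightarrow> 'a) \<Rightarrow> ('p \<Rightarrow> 'a \<Rightarrow> 'b::real_normed_vector) \<Rightarrow> 'p \<Rightarrow> 'a \<Rightarrow> 'b" where
  "Dp n G f = (\<lambda>p u. \<Sum>j<n. (h p ^ (2 * j) / fact (2 * j + 3)) *\<^sub>R (lie G ^^ (2 * j + 2)) f p u)"

definition Sp :: "nat \<Rightarrow> ('p \<Rightarrow> 'a::euclidean_space \<Rightarrow> 'a) \<Rightarrow> ('p \<Rightarrow> 'a \<Rightarrow> 'b::real_normed_vector) \<Rightarrow> 'p \<Rightarrow> 'a \<Rightarrow> 'b" where
  "Sp n G f = (\<lambda>p u. \<Sum>j<n. (2 * h p ^ (2 * j) / fact (2 * j + 4)) *\<^sub>R (lie G ^^ (2 * j + 2)) f p u)"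

text \<open>If \<open>f\<close> is the derivative of F along \<open>G\<close>, then
  \<open>cdiff\<close> truncates (F(t+h) - F(t-h)) / (2h) and \<open>sdiff\<close> truncates (F(t+h)
  - 2F(t) + F(t-h)) / h^2. The leading terms are split off so that every correction visibly carries
  h^2.\<close>

definition cdiff :: "nat \<Rightarrow> ('p \<Rightarrow> 'a::euclidean_space \<Rightarrow> 'a) \<Rightarrow> ('p \<Rightarrow> 'a \<Rightarrow> 'b::real_normed_vector) \<Rightarrow> 'p \<Rightarrow> 'a \<Rightarrow> 'b" where
  "cdiff n G f = (\<lambda>p u. f p u + (h p)\<^sup>2 *\<^sub>R Dp n G f p u)"

definition sdiff :: "nat \<Rightarrow> ('p \<Rightarrow> 'a::euclidean_space \<Rightarrow> 'a) \<Rightarrow> ('p \<Rightarrow> 'a \<Rightarrow> 'b::real_normed_vector) \<Rightarrow> 'p \<Rightarrow> 'a \<Rightarrow> 'b" where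
  "sdiff n G f = (\<lambda>p u. lie G f p u + (h p)\<^sup>2 *\<^sub>R Sp n G (lie G f) p u)"

lemma h_pow_le: "p \<in> P \<Longrightarrow> \<bar>h p ^ k\<bar> \<le> 1"
  using h[of p] h1[of p] by (simp add: power_abs power_le_one)

lemma coeff_le:
  assumes "p \<in> P" shows "\<bar>h p ^ k / fact l\<bar> \<le> 1" "\<bar>2 * h p ^ k / fact l\<bar> \<le> 2"
proof -
  have f: "(1::real) \<le> fact l" by (rule fact_ge_1)
  have "\<bar>h p ^ k\<bar> / fact l \<le> 1 / 1" by (rule frac_le) (use h_pow_le[OF assms] f in auto)
  then show *: "\<bar>h p ^ k / fact l\<bar> \<le> 1" by simp
  have "\<bar>2 * h p ^ k / fact l\<bar> = 2 * \<bar>h p ^ k / fact l\<bar>" by (simp add: abs_mult)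
  then show "\<bar>2 * h p ^ k / fact l\<bar> \<le> 2" using * by linarith
qed

context
  fixes m :: nat and f f' :: "'p \<Rightarrow> 'a::euclidean_space \<Rightarrow> 'b::real_normed_vector" and G G' :: "'p \<Rightarrow> 'a \<Rightarrow> 'a"
  assumes a: "\<And>k. eqv m ((lie G ^^ k) f) ((lie G' ^^ k) f')"
begin

text \<open>The hypothesis concerns the iterated Lie derivatives and not \<open>f\<close> and
  \<open>G\<close> separately, because for the oscillating coordinate these iterates agree to a
  higher order than the fields do.\<close>

lemma eqv_Dp: "eqv m (Dp n G f) (Dp n G' f')"
  unfolding Dp_def by (rule eqv_sum[OF finite_lessThan], rule eqv_scale0[OF coeff_le(1) a])

lemma eqv_Sp: "eqv m (Sp n G f) (Sp n G' f')"
  unfolding Sp_def by (rule eqv_sum[OF finite_lessThan], rule eqv_scale0[OF coeff_le(2) a])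

end

lemma eqv_Sp_lie:
  assumes "\<And>k. eqv m ((lie G ^^ k) f) ((lie G' ^^ k) f')"
  shows "eqv m (Sp n G (lie G f)) (Sp n G' (lie G' f'))"
proof (rule eqv_Sp)
  show "eqv m ((lie G ^^ k) (lie G f)) ((lie G' ^^ k) (lie G' f'))" for k
    using assms[of "Suc k"] by (simp add: funpow_swap1)
qed

lemma eqv_cdiff:
  assumes a: "\<And>k. eqv m ((lie G ^^ k) f) ((lie G' ^^ k) f')"
  shows "eqv m (cdiff n G f) (cdiff n G' f')"
  unfolding cdiff_def using a[of 0] by (intro eqv_add eqv_weaken[OF eqv_h2] eqv_Dp[OF a]) simp

lemma eqv_sdiff:
  assumes a: "\<And>k. eqv m ((lie G ^^ k) f) ((lie G' ^^ k) f')"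
  shows "eqv m (sdiff n G f) (sdiff n G' f')"
  unfolding sdiff_def using a[of 1] by (intro eqv_add eqv_weaken[OF eqv_h2] eqv_Sp_lie[OF a]) simp

lemma smf_Dp: "smf P f \<Longrightarrow> smf P G \<Longrightarrow> smf P (Dp n G f)"
  by (rule eqv_smf(1)[OF eqv_Dp[OF eqv_refl[OF smf_liepow]]])

lemma smf_Sp: "smf P f \<Longrightarrow> smf P G \<Longrightarrow> smf P (Sp n G f)"
  by (rule eqv_smf(1)[OF eqv_Sp[OF eqv_refl[OF smf_liepow]]])

lemma smf_cdiff: "smf P f \<Longrightarrow> smf P G \<Longrightarrow> smf P (cdiff n G f)"
  by (rule eqv_smf(1)[OF eqv_cdiff[OF eqv_refl[OF smf_liepow]]])

lemma smf_sdiff: "smf P f \<Longrightarrow> smf P G \<Longrightarrow> smf P (sdiff n G f)"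
  by (rule eqv_smf(1)[OF eqv_sdiff[OF eqv_refl[OF smf_liepow]]])

text \<open>Linear maps commute with the truncated series. This is what allows the modulation
  equations to be projected onto B0 and onto its orthogonal plane.\<close>

lemma Dp_linear:
  assumes f: "smf P f" and G: "smf P G" and A: "\<And>p. p \<in> P \<Longrightarrow> bounded_linear (A p)" and p: "p \<in> P"
  shows "Dp n G (\<lambda>p u. A p (f p u)) p u = A p (Dp n G f p u)"
proof -
  have "(lie G ^^ k) (\<lambda>p u. A p (f p u)) p u = A p ((lie G ^^ k) f p u)" for k
    by (rule liepow_linear[where A = A, OF f G A p])
  moreover have "linear (A p)" using bounded_linear.linear[OF A[OF p]] .
  ultimately show ?thesis by (simp only: Dp_def linear_sum linear_scale)
qed

lemma Sp_linear:
  assumes f: "smf P f" and G: "smf P G" and A: "\<And>p. p \<in> P \<Longrightarrow> bounded_linear (A p)" and p: "p \<in> P"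
  shows "Sp n G (\<lambda>p u. A p (f p u)) p u = A p (Sp n G f p u)"
proof -
  have "(lie G ^^ k) (\<lambda>p u. A p (f p u)) p u = A p ((lie G ^^ k) f p u)" for k
    by (rule liepow_linear[where A = A, OF f G A p])
  moreover have "linear (A p)" using bounded_linear.linear[OF A[OF p]] .
  ultimately show ?thesis by (simp only: Sp_def linear_sum linear_scale)
qed

lemma Sp_cong:
  assumes "\<And>p u. p \<in> P \<Longrightarrow> f p u = f' p u" "p \<in> P" shows "Sp n G f p u = Sp n G f' p u"
proof -
  have "(lie G ^^ k) f p u = (lie G ^^ k) f' p u" for k by (rule liepow_cong[OF assms])
  then show ?thesis by (simp only: Sp_def)
qed

lemma Dp_cong:
  assumes "\<And>p u. p \<in> P \<Longrightarrow> f p u = f' p u" "p \<in> P" shows "Dp n G f p u = Dp n G f' p u"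
proof -
  have "(lie G ^^ k) f p u = (lie G ^^ k) f' p u" for k by (rule liepow_cong[OF assms])
  then show ?thesis by (simp only: Dp_def)
qed

lemma cdiff_cong:
  assumes "\<And>p u. p \<in> P \<Longrightarrow> f p u = f' p u" "p \<in> P" shows "cdiff n G f p u = cdiff n G f' p u"
proof -
  have "Dp n G f p u = Dp n G f' p u" by (rule Dp_cong[OF assms])
  then show ?thesis by (simp only: cdiff_def assms)
qed

lemma sdiff_cong:
  assumes "\<And>p u. p \<in> P \<Longrightarrow> f p u = f' p u" "p \<in> P" shows "sdiff n G f p u = sdiff n G f' p u"
proof -
  have e: "lie G f p u = lie G f' p u" if "p \<in> P" for p u
    by (rule lie_cong[OF that assms(1) refl])
  have "Sp n G (lie G f) p u = Sp n G (lie G f') p u" by (rule Sp_cong[OF e assms(2)])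
  then show ?thesis by (simp only: sdiff_def e[OF assms(2)])
qed

lemma cdiff_linear:
  assumes f: "smf P f" and G: "smf P G" and A: "\<And>p. p \<in> P \<Longrightarrow> bounded_linear (A p)" and p: "p \<in> P"
  shows "cdiff n G (\<lambda>p u. A p (f p u)) p u = A p (cdiff n G f p u)"
proof -
  have "Dp n G (\<lambda>p u. A p (f p u)) p u = A p (Dp n G f p u)"
    by (rule Dp_linear[where A = A, OF f G A p])
  then show ?thesis
    unfolding cdiff_def using bounded_linear.linear[OF A[OF p]] by (simp only: linear_add linear_scale)
qed

lemma sdiff_linear:
  assumes f: "smf P f" and G: "smf P G" and A: "\<And>p. p \<in> P \<Longrightarrow> bounded_linear (A p)" and p: "p \<in> P"
  shows "sdiff n G (\<lambda>p u. A p (f p u)) p u = A p (sdiff n G f p u)"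
proof -
  have e: "lie G (\<lambda>p u. A p (f p u)) p u = A p (lie G f p u)" if "p \<in> P" for p u
    using lie_linear[where A = A, OF f A[OF that] that] .
  have "Sp n G (lie G (\<lambda>p u. A p (f p u))) p u = Sp n G (\<lambda>p u. A p (lie G f p u)) p u"
    by (rule Sp_cong[OF e p])
  also have "\<dots> = A p (Sp n G (lie G f) p u)"
    by (rule Sp_linear[where A = A, OF smf_lie[OF f G] G A p])
  finally show ?thesis unfolding sdiff_def e[OF p]
    using bounded_linear.linear[OF A[OF p]] by (simp only: linear_add linear_scale)
qed

lemma cdiff_add:
  assumes f: "smf P f" "smf P f'" and G: "smf P G" and p: "p \<in> P"
  shows "cdiff n G (\<lambda>p u. f p u + f' p u) p u = cdiff n G f p u + cdiff n G f' p u"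
  by (simp only: cdiff_def Dp_def liepow_add[OF f G p] scaleR_add_right sum.distrib) (simp add: algebra_simps)

end

section \<open>The modulation vector field\<close>

text \<open>States are \<open>(y, B\<^sub>0 \<bullet> \<dot>y, z)\<close> with \<open>z\<close> orthogonal to \<open>B\<^sub>0\<close>; the unknowns of the modulation equations are
  \<open>(W, Y, Z, Q)\<close> with \<open>\<dot>y = (B\<^sub>0 \<bullet> \<dot>y) B\<^sub>0 + \<epsilon> Y \<times> B\<^sub>0\<close>, \<open>W\<close> the derivative of \<open>B\<^sub>0 \<bullet> \<dot>y\<close>, \<open>\<epsilon> Z \<times> B\<^sub>0\<close> the correction to
  the rotation of \<open>z\<close>, and \<open>h\<^sup>2 Q\<close> the component of the oscillation along \<open>B\<^sub>0\<close>.\<close>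

type_synonym modst = "(real^3) \<times> real \<times> (real^3)"
type_synonym modfun = "real \<times> (real^3) \<times> (real^3) \<times> real"

lemma lie_bounded_linear: "bounded_linear A \<Longrightarrow> lie G (\<lambda>p u. A u) = (\<lambda>p u. A (G p u))"
proof (intro ext)
  fix p u assume "bounded_linear A"
  from lie_eqI[of "\<lambda>p u. A u", OF bounded_linear.has_derivative[OF this has_derivative_ident]]
  show "lie G (\<lambda>p u. A u) p u = A (G p u)" .
qed

locale modulation = step_family P h \<epsilon> for P :: "'p set" and h \<epsilon> +
  fixes B0 :: "real^3" and g :: "'p \<Rightarrow> (real^3) \<times> (real^3) \<times> (real^3) \<Rightarrow> real^3" and n :: nat
  assumes B0: "norm B0 = 1" and g: "smf P g"
begin

text \<open>A quarter turn on the plane orthogonal to B0, and zero along B0. It plays the part of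
  multiplication by \<plusminus>i on the eigenspaces, and -J J is the orthogonal projection onto the
  plane; the construction thus stays real until the statement is reached.\<close>

definition J :: "real^3 \<Rightarrow> real^3" where "J a = cross3 a B0"

lemma blJ: "bounded_linear J"
  unfolding J_def[abs_def]
  using bounded_bilinear.bounded_linear_left[OF bilinear_conv_bounded_bilinear[THEN iffD1, OF bilinear_cross]] .

lemma linJ: "linear J" using bounded_linear.linear[OF blJ] .

lemma B0B0: "B0 \<bullet> B0 = 1" using B0 by (simp add: norm_eq_1)

lemma JJ: "J (J a) = (B0 \<bullet> a) *\<^sub>R B0 - a"
proof -
  have "J (J a) = - cross3 B0 (cross3 a B0)" by (simp add: J_def cross_skew[of _ B0])
  also have "\<dots> = - ((B0 \<bullet> B0) *\<^sub>R a - (B0 \<bullet> a) *\<^sub>R B0)" by (simp add: Lagrange)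
  finally show ?thesis by (simp add: B0B0)
qed

lemma B0_J: "B0 \<bullet> J a = 0" by (simp add: J_def dot_cross_self)
lemma J_B0: "J (c *\<^sub>R B0) = 0" "J B0 = 0" by (simp_all add: J_def cross_mult_left)
lemma J_simps: "J (a + b) = J a + J b" "J (a - b) = J a - J b" "J (c *\<^sub>R a) = c *\<^sub>R J a" "J (- a) = - J a" "J 0 = 0"
  using linJ by (auto simp: linear_add linear_diff linear_scale linear_neg linear_0)

lemma JJJ: "J (J (J a)) = - J a" by (simp add: JJ[of "J a"] B0_J)

lemma norm_J_le: "norm (J a) \<le> norm a"
proof (rule power2_le_imp_le)
  show "(norm (J a))\<^sup>2 \<le> (norm a)\<^sup>2"
  proof -
    have "(norm (J a))\<^sup>2 + (a \<bullet> B0)\<^sup>2 = (norm a)\<^sup>2"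
      using norm_cross_dot[of a B0] by (simp add: J_def B0)
    then show ?thesis using zero_le_power2[of "a \<bullet> B0"] by linarith
  qed
qed simp

text \<open>A residual may be tested by its B0 component and its image under \<open>J\<close>, which
  is how the equations are solved componentwise.\<close>

lemma norm_le_split: "norm a \<le> \<bar>B0 \<bullet> a\<bar> + norm (J a)"
proof -
  have "a = (B0 \<bullet> a) *\<^sub>R B0 - J (J a)" by (simp add: JJ)
  then have "norm a \<le> norm ((B0 \<bullet> a) *\<^sub>R B0) + norm (J (J a))" by (metis norm_triangle_ineq4)
  also have "\<dots> \<le> \<bar>B0 \<bullet> a\<bar> + norm (J a)" using norm_J_le[of "J a"] B0 by simp
  finally show ?thesis .
qed

text \<open>A quarter of the rotation frequency of z. It is bounded by 1 but may be arbitrarily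
  close to 0, so it is treated as a bounded coefficient and never inverted.\<close>

definition \<kappa> :: "'p \<Rightarrow> real" where "\<kappa> p = \<epsilon> p / (h p)\<^sup>2"

lemma \<kappa>: "p \<in> P \<Longrightarrow> 0 < \<kappa> p \<and> \<kappa> p \<le> 1"
  using eps[of p] eps_le[of p] h[of p] by (simp add: \<kappa>_def)

lemma kappa_pow: "p \<in> P \<Longrightarrow> \<bar>(- (4 * \<kappa> p)) ^ i\<bar> \<le> 4 ^ i"
  using \<kappa>[of p] unfolding power_abs by (intro power_mono) auto

lemma eps_le1: "p \<in> P \<Longrightarrow> \<epsilon> p \<le> 1"
  using eps_le[of p] h[of p] h1[of p] power_le_one[of "h p" 2] by simp

definition "Yc = (\<lambda>(p::'p) (u::modst). fst u)"
definition "Wc = (\<lambda>(p::'p) (u::modst). fst (snd u))"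
definition "Zc = (\<lambda>(p::'p) (u::modst). snd (snd u))"

definition cW :: "('p \<Rightarrow> modst \<Rightarrow> modfun) \<Rightarrow> 'p \<Rightarrow> modst \<Rightarrow> real" where "cW \<Gamma> = (\<lambda>p u. fst (\<Gamma> p u))"
definition cY :: "('p \<Rightarrow> modst \<Rightarrow> modfun) \<Rightarrow> 'p \<Rightarrow> modst \<Rightarrow> real^3" where "cY \<Gamma> = (\<lambda>p u. fst (snd (\<Gamma> p u)))"
definition cZ :: "('p \<Rightarrow> modst \<Rightarrow> modfun) \<Rightarrow> 'p \<Rightarrow> modst \<Rightarrow> real^3" where "cZ \<Gamma> = (\<lambda>p u. fst (snd (snd (\<Gamma> p u))))"
definition cQ :: "('p \<Rightarrow> modst \<Rightarrow> modfun) \<Rightarrow> 'p \<Rightarrow> modst \<Rightarrow> real" where "cQ \<Gamma> = (\<lambda>p u. snd (snd (snd (\<Gamma> p u))))"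

text \<open>The modulation vector field. Its perpendicular components carry the factor \<open>\<epsilon>\<close> explicitly,
  which makes all later estimates uniform as \<open>\<epsilon>\<close> tends to zero with \<open>h\<close> fixed.\<close>

definition vy :: "('p \<Rightarrow> modst \<Rightarrow> modfun) \<Rightarrow> 'p \<Rightarrow> modst \<Rightarrow> real^3" where
  "vy \<Gamma> = (\<lambda>p u. Wc p u *\<^sub>R B0 + \<epsilon> p *\<^sub>R J (cY \<Gamma> p u))"
text \<open>In the odd part of the scheme, -4 z / h^2 from the second difference has to balance
  -(1/\<epsilon>) J z' from the velocity. This gives J z' = 4 \<kappa> z, that is z' = -4 \<kappa> J
  z, and removes the singular terms.\<close>

definition vz :: "('p \<Rightarrow> modst \<Rightarrow> modfun) \<Rightarrow> 'p \<Rightarrow> modst \<Rightarrow> real^3" where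
  "vz \<Gamma> = (\<lambda>p u. (- (4 * \<kappa> p)) *\<^sub>R J (Zc p u) + \<epsilon> p *\<^sub>R J (cZ \<Gamma> p u))"
definition vf :: "('p \<Rightarrow> modst \<Rightarrow> modfun) \<Rightarrow> 'p \<Rightarrow> modst \<Rightarrow> modst" where
  "vf \<Gamma> = (\<lambda>p u. (vy \<Gamma> p u, cW \<Gamma> p u, vz \<Gamma> p u))"

text \<open>The oscillation along B0 is not a state variable; it is determined algebraically by
  \<open>cQ\<close>. The factor h^2 together with \<open>cQ\<close> = O(|z|) will give z . B0 =
  O(h^4).\<close>

definition zt :: "('p \<Rightarrow> modst \<Rightarrow> modfun) \<Rightarrow> 'p \<Rightarrow> modst \<Rightarrow> real^3" where
  "zt \<Gamma> = (\<lambda>p u. Zc p u + (h p)\<^sup>2 *\<^sub>R (cQ \<Gamma> p u *\<^sub>R B0))"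
definition zd :: "('p \<Rightarrow> modst \<Rightarrow> modfun) \<Rightarrow> 'p \<Rightarrow> modst \<Rightarrow> real^3" where
  "zd \<Gamma> = (\<lambda>p u. vz \<Gamma> p u + (h p)\<^sup>2 *\<^sub>R (lie (vf \<Gamma>) (cQ \<Gamma>) p u *\<^sub>R B0))"

definition xs :: "real \<Rightarrow> ('p \<Rightarrow> modst \<Rightarrow> modfun) \<Rightarrow> 'p \<Rightarrow> modst \<Rightarrow> real^3" where
  "xs s \<Gamma> = (\<lambda>p u. Yc p u + s *\<^sub>R zt \<Gamma> p u)"
text \<open>The number \<open>s\<close> is the parity (-1)^n of the grid point. Its neighbours have
  the opposite parity, whence the minus sign at the oscillating part.\<close>

definition vs :: "real \<Rightarrow> ('p \<Rightarrow> modst \<Rightarrow> modfun) \<Rightarrow> 'p \<Rightarrow> modst \<Rightarrow> real^3" where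
  "vs s \<Gamma> = (\<lambda>p u. cdiff n (vf \<Gamma>) (vy \<Gamma>) p u - s *\<^sub>R cdiff n (vf \<Gamma>) (zd \<Gamma>) p u)"
text \<open>This is h^2 times the second difference quotient. Since the parity alternates, z
  contributes z(t+h) + 2 z(t) + z(t-h), whose leading term is 4 z(t) without any factor h^2.\<close>

definition bs :: "real \<Rightarrow> ('p \<Rightarrow> modst \<Rightarrow> modfun) \<Rightarrow> 'p \<Rightarrow> modst \<Rightarrow> real^3" where
  "bs s \<Gamma> = (\<lambda>p u. (h p)\<^sup>2 *\<^sub>R sdiff n (vf \<Gamma>) (vy \<Gamma>) p u
      - s *\<^sub>R (4 *\<^sub>R zt \<Gamma> p u + (h p)\<^sup>2 *\<^sub>R sdiff n (vf \<Gamma>) (zd \<Gamma>) p u))"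
definition gs :: "real \<Rightarrow> ('p \<Rightarrow> modst \<Rightarrow> modfun) \<Rightarrow> 'p \<Rightarrow> modst \<Rightarrow> real^3" where
  "gs s \<Gamma> = (\<lambda>p u. g p (xs s \<Gamma> p u, vs s \<Gamma> p u, bs s \<Gamma> p u))"
text \<open>The force is split into its even and odd part with respect to the parity. Matching the
  two parts separately makes the relation hold at grid points of both parities.\<close>

definition ge :: "('p \<Rightarrow> modst \<Rightarrow> modfun) \<Rightarrow> 'p \<Rightarrow> modst \<Rightarrow> real^3" where
  "ge \<Gamma> = (\<lambda>p u. (1/2) *\<^sub>R (gs 1 \<Gamma> p u + gs (-1) \<Gamma> p u))"
definition go :: "('p \<Rightarrow> modst \<Rightarrow> modfun) \<Rightarrow> 'p \<Rightarrow> modst \<Rightarrow> real^3" where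
  "go \<Gamma> = (\<lambda>p u. (1/2) *\<^sub>R (gs 1 \<Gamma> p u - gs (-1) \<Gamma> p u))"

text \<open>Fixed points of \<open>rhs\<close> solve the formal modulation equations; every application of \<open>rhs\<close> gains
  a factor \<open>h\<^sup>2\<close>.\<close>

definition rhs :: "('p \<Rightarrow> modst \<Rightarrow> modfun) \<Rightarrow> 'p \<Rightarrow> modst \<Rightarrow> modfun" where
  "rhs \<Gamma> = (\<lambda>p u.
     (B0 \<bullet> ge \<Gamma> p u - (h p)\<^sup>2 *\<^sub>R Sp n (vf \<Gamma>) (cW \<Gamma>) p u,
      ge \<Gamma> p u - (h p)\<^sup>2 *\<^sub>R Dp n (vf \<Gamma>) (cY \<Gamma>) p u - \<epsilon> p *\<^sub>R J (sdiff n (vf \<Gamma>) (cY \<Gamma>) p u),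
      4 *\<^sub>R Dp n (vf \<Gamma>) Zc p u - (h p)\<^sup>2 *\<^sub>R Dp n (vf \<Gamma>) (cZ \<Gamma>) p u - sdiff n (vf \<Gamma>) (vz \<Gamma>) p u - go \<Gamma> p u,
      - (1/4) *\<^sub>R ((h p)\<^sup>2 *\<^sub>R sdiff n (vf \<Gamma>) (lie (vf \<Gamma>) (cQ \<Gamma>)) p u + B0 \<bullet> go \<Gamma> p u)))"

lemma rhs_comps:
  "cW (rhs \<Gamma>) p u = B0 \<bullet> ge \<Gamma> p u - (h p)\<^sup>2 *\<^sub>R Sp n (vf \<Gamma>) (cW \<Gamma>) p u"
  "cY (rhs \<Gamma>) p u = ge \<Gamma> p u - (h p)\<^sup>2 *\<^sub>R Dp n (vf \<Gamma>) (cY \<Gamma>) p u - \<epsilon> p *\<^sub>R J (sdiff n (vf \<Gamma>) (cY \<Gamma>) p u)"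
  "cZ (rhs \<Gamma>) p u = 4 *\<^sub>R Dp n (vf \<Gamma>) Zc p u - (h p)\<^sup>2 *\<^sub>R Dp n (vf \<Gamma>) (cZ \<Gamma>) p u - sdiff n (vf \<Gamma>) (vz \<Gamma>) p u - go \<Gamma> p u"
  "cQ (rhs \<Gamma>) p u = - (1/4) *\<^sub>R ((h p)\<^sup>2 *\<^sub>R sdiff n (vf \<Gamma>) (lie (vf \<Gamma>) (cQ \<Gamma>)) p u + B0 \<bullet> go \<Gamma> p u)"
  by (subst cW_def, simp only: rhs_def fst_conv snd_conv)
    (subst cY_def, simp only: rhs_def fst_conv snd_conv,
     subst cZ_def, simp only: rhs_def fst_conv snd_conv,
     subst cQ_def, simp only: rhs_def fst_conv snd_conv)

lemma smf_coords: "smf P Yc" "smf P Wc" "smf P Zc"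
  unfolding Yc_def Wc_def Zc_def
  by (rule smf_linear[OF bounded_linear_fst smf_id],
      rule smf_linear[OF bounded_linear_fst smf_linear[OF bounded_linear_snd smf_id]],
      rule smf_linear[OF bounded_linear_snd smf_linear[OF bounded_linear_snd smf_id]])

lemma lie_coords: "lie (vf \<Gamma>) Yc = vy \<Gamma>" "lie (vf \<Gamma>) Wc = cW \<Gamma>" "lie (vf \<Gamma>) Zc = vz \<Gamma>"
proof -
  show "lie (vf \<Gamma>) Yc = vy \<Gamma>"
    unfolding Yc_def using lie_bounded_linear[OF bounded_linear_fst, of "vf \<Gamma>"] by (simp add: vf_def)
  show "lie (vf \<Gamma>) Wc = cW \<Gamma>"
    unfolding Wc_def using lie_bounded_linear[OF bounded_linear_compose[OF bounded_linear_fst bounded_linear_snd], of "vf \<Gamma>"]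
    by (simp add: vf_def)
  show "lie (vf \<Gamma>) Zc = vz \<Gamma>"
    unfolding Zc_def using lie_bounded_linear[OF bounded_linear_compose[OF bounded_linear_snd bounded_linear_snd], of "vf \<Gamma>"]
    by (simp add: vf_def)
qed

lemma blB0: "bounded_linear (\<lambda>c. c *\<^sub>R B0)" "bounded_linear (\<lambda>a. B0 \<bullet> a)"
  by (rule bounded_linear_scaleR_left, rule bounded_linear_inner_right)

lemma smf_kJZ: "smf P (\<lambda>p u. (- (4 * \<kappa> p)) *\<^sub>R J (Zc p u))"
  by (rule smf_scale[OF _ smf_linear[OF blJ smf_coords(3)], where C = 4]) (use \<kappa> in force)

section \<open>Orders of agreement gained by the modulation equations\<close>

context
  fixes m :: nat and \<Gamma> \<Gamma>' :: "'p \<Rightarrow> modst \<Rightarrow> modfun"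
  assumes G: "eqv m \<Gamma> \<Gamma>'"
begin

lemma eqv_comps: "eqv m (cW \<Gamma>) (cW \<Gamma>')" "eqv m (cY \<Gamma>) (cY \<Gamma>')" "eqv m (cZ \<Gamma>) (cZ \<Gamma>')" "eqv m (cQ \<Gamma>) (cQ \<Gamma>')"
proof -
  note s = eqv_linear[OF bounded_linear_snd G]
  note ss = eqv_linear[OF bounded_linear_snd s]
  show "eqv m (cW \<Gamma>) (cW \<Gamma>')" unfolding cW_def by (rule eqv_linear[OF bounded_linear_fst G])
  show "eqv m (cY \<Gamma>) (cY \<Gamma>')" unfolding cY_def by (rule eqv_linear[OF bounded_linear_fst s])
  show "eqv m (cZ \<Gamma>) (cZ \<Gamma>')" unfolding cZ_def by (rule eqv_linear[OF bounded_linear_fst ss])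
  show "eqv m (cQ \<Gamma>) (cQ \<Gamma>')" unfolding cQ_def by (rule eqv_linear[OF bounded_linear_snd ss])
qed

lemma eqv_vy: "eqv (m + 2) (vy \<Gamma>) (vy \<Gamma>')"
  unfolding vy_def
  by (rule eqv_add[OF eqv_refl[OF smf_linear[OF blB0(1) smf_coords(2)]] eqv_eps[OF eqv_linear[OF blJ eqv_comps(2)]]])

lemma eqv_vz: "eqv (m + 2) (vz \<Gamma>) (vz \<Gamma>')"
  unfolding vz_def by (rule eqv_add[OF eqv_refl[OF smf_kJZ] eqv_eps[OF eqv_linear[OF blJ eqv_comps(3)]]])

text \<open>The y and z components gain two orders through their factor \<epsilon>, but the
  derivative of the parallel velocity carries no such factor, so the field as a whole agrees only to
  order m.\<close>

lemma eqv_vf: "eqv m (vf \<Gamma>) (vf \<Gamma>')"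
  unfolding vf_def by (rule eqv_Pair[OF eqv_weaken[OF eqv_vy] eqv_Pair[OF eqv_comps(1) eqv_weaken[OF eqv_vz]]])

lemma eqv_Lpow: "eqv m f f' \<Longrightarrow> eqv m ((lie (vf \<Gamma>) ^^ k) f) ((lie (vf \<Gamma>') ^^ k) f')"
  by (rule eqv_liepow[OF _ eqv_vf])

end

lemma bl_JK: "bounded_linear (\<lambda>a. c *\<^sub>R (J ^^ i) a)"
proof -
  have "bounded_linear (\<lambda>a. (J ^^ i) a)"
  proof (induction i)
    case 0
    then show ?case by (simp add: bounded_linear_ident)
  next
    case (Suc i)
    then show ?case using bounded_linear_compose[OF blJ Suc] by simp
  qed
  then show ?thesis by (rule bounded_linear_const_scaleR)
qed

text \<open>Iterated derivatives of the oscillating component depend on \<open>\<Gamma>\<close> only through terms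
  with a factor \<open>\<epsilon>\<close>.\<close>

lemma Lpow_Zc:
  assumes G: "eqv m \<Gamma> \<Gamma>'"
  shows "\<exists>R R'. eqv m R R' \<and>
    (\<forall>p\<in>P. \<forall>u. (lie (vf \<Gamma>) ^^ i) Zc p u = ((- (4 * \<kappa> p)) ^ i) *\<^sub>R (J ^^ i) (Zc p u) + \<epsilon> p *\<^sub>R R p u \<and>
      (lie (vf \<Gamma>') ^^ i) Zc p u = ((- (4 * \<kappa> p)) ^ i) *\<^sub>R (J ^^ i) (Zc p u) + \<epsilon> p *\<^sub>R R' p u)"
proof (induction i)
  case 0
  show ?case using eqv_refl[OF smf_const[of P "\<lambda>_. 0" 0]] by (intro exI[of _ "\<lambda>p u. 0"]) simp
next
  case (Suc i)
  then obtain R R' where R: "eqv m R R'" and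
    e: "\<And>p u. p \<in> P \<Longrightarrow> (lie (vf \<Gamma>) ^^ i) Zc p u = ((- (4 * \<kappa> p)) ^ i) *\<^sub>R (J ^^ i) (Zc p u) + \<epsilon> p *\<^sub>R R p u"
      "\<And>p u. p \<in> P \<Longrightarrow> (lie (vf \<Gamma>') ^^ i) Zc p u = ((- (4 * \<kappa> p)) ^ i) *\<^sub>R (J ^^ i) (Zc p u) + \<epsilon> p *\<^sub>R R' p u"
    by blast
  let ?A = "\<lambda>p a. ((- (4 * \<kappa> p)) ^ i) *\<^sub>R (J ^^ i) a"
  have k: "\<bar>(- (4 * \<kappa> p)) ^ i\<bar> \<le> 4 ^ i" if "p \<in> P" for p
    by (rule kappa_pow[OF that])
  have Jpow: "bounded_linear (J ^^ i)" using bl_JK[of 1 i] by simp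
  have sA: "smf P (\<lambda>p u. ?A p (Zc p u))"
    by (rule smf_scale[OF k smf_linear[OF Jpow smf_coords(3)]])
  have bA: "bounded_linear (?A p)" for p by (rule bl_JK)
  have be: "bounded_linear (\<lambda>a::real^3. \<epsilon> p *\<^sub>R a)" for p by (rule bounded_linear_scaleR_right)
  have step: "lie (vf \<Delta>) ((lie (vf \<Delta>) ^^ i) Zc) p u =
      ((- (4 * \<kappa> p)) ^ Suc i) *\<^sub>R (J ^^ Suc i) (Zc p u) + \<epsilon> p *\<^sub>R (?A p (J (cZ \<Delta> p u)) + lie (vf \<Delta>) R p u)"
    if e: "\<And>p u. p \<in> P \<Longrightarrow> (lie (vf \<Delta>) ^^ i) Zc p u = ?A p (Zc p u) + \<epsilon> p *\<^sub>R R p u"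
      and R: "smf P R" and p: "p \<in> P" for R \<Delta> p u
  proof -
    have sR: "smf P (\<lambda>p u. \<epsilon> p *\<^sub>R R p u)"
      by (rule smf_scale[OF _ R, where C = 1]) (use eps eps_le1 in \<open>simp add: abs_of_pos\<close>)
    have "lie (vf \<Delta>) ((lie (vf \<Delta>) ^^ i) Zc) p u = lie (vf \<Delta>) (\<lambda>p u. ?A p (Zc p u) + \<epsilon> p *\<^sub>R R p u) p u"
      by (rule lie_cong[OF p e refl])
    also have "\<dots> = lie (vf \<Delta>) (\<lambda>p u. ?A p (Zc p u)) p u + lie (vf \<Delta>) (\<lambda>p u. \<epsilon> p *\<^sub>R R p u) p u"
      by (rule lie_add[OF sA sR p])
    also have "lie (vf \<Delta>) (\<lambda>p u. ?A p (Zc p u)) p u = ?A p (vz \<Delta> p u)"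
      using lie_linear[of P Zc ?A p "vf \<Delta>" u, OF smf_coords(3) bA p] by (simp add: lie_coords)
    also have "lie (vf \<Delta>) (\<lambda>p u. \<epsilon> p *\<^sub>R R p u) p u = \<epsilon> p *\<^sub>R lie (vf \<Delta>) R p u"
      using lie_linear[of P R "\<lambda>p a. \<epsilon> p *\<^sub>R a" p "vf \<Delta>" u, OF R be p] .
    finally have *: "lie (vf \<Delta>) ((lie (vf \<Delta>) ^^ i) Zc) p u = ?A p (vz \<Delta> p u) + \<epsilon> p *\<^sub>R lie (vf \<Delta>) R p u" .
    have lA: "linear (?A p)" using bounded_linear.linear[OF bA] .
    have "?A p (vz \<Delta> p u) = (- (4 * \<kappa> p)) *\<^sub>R ?A p (J (Zc p u)) + \<epsilon> p *\<^sub>R ?A p (J (cZ \<Delta> p u))"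
      by (simp only: vz_def linear_add[OF lA] linear_scale[OF lA])
    also have "(- (4 * \<kappa> p)) *\<^sub>R ?A p (J (Zc p u)) = ((- (4 * \<kappa> p)) ^ Suc i) *\<^sub>R (J ^^ Suc i) (Zc p u)"
      by (simp add: funpow_swap1)
    finally show ?thesis unfolding * by (simp add: scaleR_add_right)
  qed
  show ?case
  proof (intro exI conjI ballI allI)
    show "eqv m (\<lambda>p u. ?A p (J (cZ \<Gamma> p u)) + lie (vf \<Gamma>) R p u) (\<lambda>p u. ?A p (J (cZ \<Gamma>' p u)) + lie (vf \<Gamma>') R' p u)"
      by (rule eqv_add[OF eqv_scale0[OF k eqv_linear[OF Jpow eqv_linear[OF blJ eqv_comps(3)[OF G]]]] eqv_lie[OF R eqv_vf[OF G]]])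
    fix p u assume p: "p \<in> P"
    show "(lie (vf \<Gamma>) ^^ Suc i) Zc p u = ((- (4 * \<kappa> p)) ^ Suc i) *\<^sub>R (J ^^ Suc i) (Zc p u)
        + \<epsilon> p *\<^sub>R (?A p (J (cZ \<Gamma> p u)) + lie (vf \<Gamma>) R p u)"
      using step[OF e(1) eqv_smf(1)[OF R] p] by simp
    show "(lie (vf \<Gamma>') ^^ Suc i) Zc p u = ((- (4 * \<kappa> p)) ^ Suc i) *\<^sub>R (J ^^ Suc i) (Zc p u)
        + \<epsilon> p *\<^sub>R (?A p (J (cZ \<Gamma>' p u)) + lie (vf \<Gamma>') R' p u)"
      using step[OF e(2) eqv_smf(2)[OF R] p] by simp
  qed
qed

text \<open>The leading parts coincide for both fields, and the rest is multiplied by \<epsilon>,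
  which supplies the two additional orders.\<close>

lemma eqv_Lpow_Zc:
  assumes G: "eqv m \<Gamma> \<Gamma>'"
  shows "eqv (m + 2) ((lie (vf \<Gamma>) ^^ i) Zc) ((lie (vf \<Gamma>') ^^ i) Zc)"
proof -
  obtain R R' where R: "eqv m R R'" and
    e: "\<And>p u. p \<in> P \<Longrightarrow> (lie (vf \<Gamma>) ^^ i) Zc p u = ((- (4 * \<kappa> p)) ^ i) *\<^sub>R (J ^^ i) (Zc p u) + \<epsilon> p *\<^sub>R R p u"
      "\<And>p u. p \<in> P \<Longrightarrow> (lie (vf \<Gamma>') ^^ i) Zc p u = ((- (4 * \<kappa> p)) ^ i) *\<^sub>R (J ^^ i) (Zc p u) + \<epsilon> p *\<^sub>R R' p u"
    using Lpow_Zc[OF G, of i] by blast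
  have k: "\<bar>(- (4 * \<kappa> p)) ^ i\<bar> \<le> 4 ^ i" if "p \<in> P" for p
    by (rule kappa_pow[OF that])
  have Jpow: "bounded_linear (J ^^ i)" using bl_JK[of 1 i] by simp
  have "eqv (m + 2) (\<lambda>p u. ((- (4 * \<kappa> p)) ^ i) *\<^sub>R (J ^^ i) (Zc p u) + \<epsilon> p *\<^sub>R R p u)
     (\<lambda>p u. ((- (4 * \<kappa> p)) ^ i) *\<^sub>R (J ^^ i) (Zc p u) + \<epsilon> p *\<^sub>R R' p u)"
    by (rule eqv_add[OF eqv_refl[OF smf_scale[OF k smf_linear[OF Jpow smf_coords(3)]]] eqv_eps[OF R]])
  then show ?thesis by (subst eqv_cong[OF e(1) e(2)])
qed

lemma vz_Lpow: "(lie (vf \<Gamma>) ^^ k) (vz \<Gamma>) = (lie (vf \<Gamma>) ^^ Suc k) Zc"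
  by (simp add: lie_coords(3)[symmetric] funpow_swap1)

context
  fixes m :: nat and \<Gamma> \<Gamma>' :: "'p \<Rightarrow> modst \<Rightarrow> modfun"
  assumes G: "eqv m \<Gamma> \<Gamma>'"
begin

lemma eqv_zt: "eqv (m + 2) (zt \<Gamma>) (zt \<Gamma>')"
  unfolding zt_def
  by (rule eqv_add[OF eqv_refl[OF smf_coords(3)] eqv_h2[OF eqv_linear[OF blB0(1) eqv_comps(4)[OF G]]]])

lemma eqv_lieQ: "eqv m (lie (vf \<Gamma>) (cQ \<Gamma>)) (lie (vf \<Gamma>') (cQ \<Gamma>'))"
  by (rule eqv_lie[OF eqv_comps(4)[OF G] eqv_vf[OF G]])

lemma eqv_zd: "eqv (m + 2) (zd \<Gamma>) (zd \<Gamma>')"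
  unfolding zd_def
  by (rule eqv_add[OF eqv_vz[OF G] eqv_h2[OF eqv_linear[OF blB0(1) eqv_lieQ]]])

text \<open>Only the correction terms see the field, which agrees to order m; their prefactor h^2
  restores the two orders.\<close>

lemma eqv_cd2: "eqv (m + 2) f f' \<Longrightarrow> eqv (m + 2) (cdiff n (vf \<Gamma>) f) (cdiff n (vf \<Gamma>') f')"
  unfolding cdiff_def by (rule eqv_add[OF _ eqv_h2[OF eqv_Dp[OF eqv_Lpow[OF G eqv_weaken]]]])

lemma eqv_sd: "eqv m f f' \<Longrightarrow> eqv m (sdiff n (vf \<Gamma>) f) (sdiff n (vf \<Gamma>') f')"
  by (rule eqv_sdiff[OF eqv_Lpow[OF G]])

lemma eqv_xs: "eqv (m + 2) (xs s \<Gamma>) (xs s \<Gamma>')"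
  unfolding xs_def by (rule eqv_add[OF eqv_refl[OF smf_coords(1)] eqv_linear[OF bounded_linear_scaleR_right eqv_zt]])

lemma eqv_vs: "eqv (m + 2) (vs s \<Gamma>) (vs s \<Gamma>')"
  unfolding vs_def
  by (rule eqv_diff[OF eqv_cd2[OF eqv_vy[OF G]] eqv_linear[OF bounded_linear_scaleR_right eqv_cd2[OF eqv_zd]]])

lemma eqv_bs: "eqv (m + 2) (bs s \<Gamma>) (bs s \<Gamma>')"
  unfolding bs_def
  by (rule eqv_diff[OF eqv_h2[OF eqv_sd[OF eqv_weaken[OF eqv_vy[OF G]]]]
    eqv_linear[OF bounded_linear_scaleR_right eqv_add[OF eqv_linear[OF bounded_linear_scaleR_right eqv_zt]
      eqv_h2[OF eqv_sd[OF eqv_weaken[OF eqv_zd]]]]]])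

lemma eqv_gs: "eqv (m + 2) (gs s \<Gamma>) (gs s \<Gamma>')"
  unfolding gs_def by (rule eqv_compose[OF g eqv_Pair[OF eqv_xs eqv_Pair[OF eqv_vs eqv_bs]]])

lemma eqv_ge: "eqv (m + 2) (ge \<Gamma>) (ge \<Gamma>')"
  unfolding ge_def by (rule eqv_linear[OF bounded_linear_scaleR_right eqv_add[OF eqv_gs eqv_gs]])

lemma eqv_go: "eqv (m + 2) (go \<Gamma>) (go \<Gamma>')"
  unfolding go_def by (rule eqv_linear[OF bounded_linear_scaleR_right eqv_diff[OF eqv_gs eqv_gs]])

text \<open>This term enters \<open>rhs\<close> without a factor h^2 or \<epsilon>. The gain of two
  orders comes instead from the structure of the iterated derivatives of \<open>Zc\<close>, of which
  \<open>vz\<close> is the first.\<close>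

lemma eqv_sdvz: "eqv (m + 2) (sdiff n (vf \<Gamma>) (vz \<Gamma>)) (sdiff n (vf \<Gamma>') (vz \<Gamma>'))"
  by (rule eqv_sdiff) (unfold vz_Lpow, rule eqv_Lpow_Zc[OF G])

lemma eqv_rhs: "eqv (m + 2) (rhs \<Gamma>) (rhs \<Gamma>')"
proof -
  have W: "eqv (m + 2) (\<lambda>p u. B0 \<bullet> ge \<Gamma> p u - (h p)\<^sup>2 *\<^sub>R Sp n (vf \<Gamma>) (cW \<Gamma>) p u)
      (\<lambda>p u. B0 \<bullet> ge \<Gamma>' p u - (h p)\<^sup>2 *\<^sub>R Sp n (vf \<Gamma>') (cW \<Gamma>') p u)"
    by (rule eqv_diff[OF eqv_linear[OF blB0(2) eqv_ge] eqv_h2[OF eqv_Sp[OF eqv_Lpow[OF G eqv_comps(1)[OF G]]]]])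
  have Y: "eqv (m + 2)
      (\<lambda>p u. ge \<Gamma> p u - (h p)\<^sup>2 *\<^sub>R Dp n (vf \<Gamma>) (cY \<Gamma>) p u - \<epsilon> p *\<^sub>R J (sdiff n (vf \<Gamma>) (cY \<Gamma>) p u))
      (\<lambda>p u. ge \<Gamma>' p u - (h p)\<^sup>2 *\<^sub>R Dp n (vf \<Gamma>') (cY \<Gamma>') p u - \<epsilon> p *\<^sub>R J (sdiff n (vf \<Gamma>') (cY \<Gamma>') p u))"
    by (rule eqv_diff[OF eqv_diff[OF eqv_ge eqv_h2[OF eqv_Dp[OF eqv_Lpow[OF G eqv_comps(2)[OF G]]]]]
       eqv_eps[OF eqv_linear[OF blJ eqv_sd[OF eqv_comps(2)[OF G]]]]])
  have Z: "eqv (m + 2)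
      (\<lambda>p u. 4 *\<^sub>R Dp n (vf \<Gamma>) Zc p u - (h p)\<^sup>2 *\<^sub>R Dp n (vf \<Gamma>) (cZ \<Gamma>) p u - sdiff n (vf \<Gamma>) (vz \<Gamma>) p u - go \<Gamma> p u)
      (\<lambda>p u. 4 *\<^sub>R Dp n (vf \<Gamma>') Zc p u - (h p)\<^sup>2 *\<^sub>R Dp n (vf \<Gamma>') (cZ \<Gamma>') p u - sdiff n (vf \<Gamma>') (vz \<Gamma>') p u - go \<Gamma>' p u)"
    by (rule eqv_diff[OF eqv_diff[OF eqv_diff[OF eqv_linear[OF bounded_linear_scaleR_right eqv_Dp[OF eqv_Lpow_Zc[OF G]]]
        eqv_h2[OF eqv_Dp[OF eqv_Lpow[OF G eqv_comps(3)[OF G]]]]] eqv_sdvz] eqv_go])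
  have Q: "eqv (m + 2)
      (\<lambda>p u. - (1/4) *\<^sub>R ((h p)\<^sup>2 *\<^sub>R sdiff n (vf \<Gamma>) (lie (vf \<Gamma>) (cQ \<Gamma>)) p u + B0 \<bullet> go \<Gamma> p u))
      (\<lambda>p u. - (1/4) *\<^sub>R ((h p)\<^sup>2 *\<^sub>R sdiff n (vf \<Gamma>') (lie (vf \<Gamma>') (cQ \<Gamma>')) p u + B0 \<bullet> go \<Gamma>' p u))"
    by (rule eqv_linear[OF bounded_linear_scaleR_right eqv_add[OF eqv_h2[OF eqv_sd[OF eqv_lieQ]] eqv_linear[OF blB0(2) eqv_go]]])
  show ?thesis unfolding rhs_def by (rule eqv_Pair[OF W eqv_Pair[OF Y eqv_Pair[OF Z Q]]])
qed

end

text \<open>The zero start value satisfies the vanishing conditions at z = 0, which the iteration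
  then preserves.\<close>

definition Gam :: "nat \<Rightarrow> 'p \<Rightarrow> modst \<Rightarrow> modfun" where "Gam k = (rhs ^^ k) (\<lambda>p u. 0)"

lemma smf_Gam: "smf P (Gam k)"
proof (induction k)
  case 0
  show ?case unfolding Gam_def using smf_const[of P "\<lambda>_. 0" 0] by simp
next
  case (Suc k)
  then show ?case using eqv_smf(1)[OF eqv_rhs[OF eqv_refl[OF Suc, of 0]]] by (simp add: Gam_def)
qed

text \<open>At order zero any two smooth families agree, and each application of \<open>rhs\<close>
  adds two orders.\<close>

lemma eqv_Gam: "eqv (2 * k) (Gam k) (rhs (Gam k))"
proof (induction k)
  case 0
  show ?case using eqv_zero[OF smf_Gam[of 0] smf_Gam[of "Suc 0"]] by (simp add: Gam_def)
next
  case (Suc k)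
  show ?case using eqv_rhs[OF Suc] by (simp add: Gam_def)
qed

end

lemma norm_fst_snd_le:
  fixes x :: "'a::real_normed_vector \<times> 'b::real_normed_vector"
  shows fst_le: "norm (fst x) \<le> norm x" and snd_le: "norm (snd x) \<le> norm x"
  using norm_fst_le[of "fst x" "snd x"] norm_snd_le[of "snd x" "fst x"] by simp_all

section \<open>Vanishing of the oscillatory terms at z = 0\<close>

context modulation begin

text \<open>Vanishing for z = 0 turns a bound on a smooth family into a bound proportional to |z|,
  so that the size h^2 of z passes to everything built from it.\<close>

definition van :: "('p \<Rightarrow> modst \<Rightarrow> 'b::real_normed_vector) \<Rightarrow> bool" where
  "van f \<longleftrightarrow> (\<forall>p\<in>P. \<forall>y w. f p (y, w, 0) = 0)"

lemma vanD: "van f \<Longrightarrow> p \<in> P \<Longrightarrow> f p (y, w, 0) = 0"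
  by (simp add: van_def)

lemma van_bound:
  fixes f :: "'p \<Rightarrow> modst \<Rightarrow> 'b::real_normed_vector"
  assumes f: "smf P f" and v: "van f"
  obtains C where "C > 0" "\<And>p u. p \<in> P \<Longrightarrow> norm u \<le> r \<Longrightarrow> norm (f p u) \<le> C * norm (snd (snd u))"
proof -
  obtain C where C: "C > 0" "\<And>p u v. p \<in> P \<Longrightarrow> norm u \<le> r \<Longrightarrow> norm v \<le> r \<Longrightarrow>
      norm (f p u - f p v) \<le> C * norm (u - v)"
    using smf_lipschitz[OF f, of r] by blast
  show thesis
  proof (rule that[OF C(1)])
    fix p and u :: modst assume p: "p \<in> P" and u: "norm u \<le> r"
    obtain y w z where uu: "u = (y, w, z)" by (cases u)
    have "norm (y, w, 0::real^3) \<le> norm (y, w, z)" by (simp add: norm_Pair)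
    then have "norm (y, w, 0::real^3) \<le> r" using u uu by simp
    then have "norm (f p u - f p (y, w, 0)) \<le> C * norm (u - (y, w, 0))" by (rule C(2)[OF p u])
    moreover have "norm (u - (y, w, 0)) = norm z" by (simp add: uu norm_Pair)
    ultimately show "norm (f p u) \<le> C * norm (snd (snd u))" using vanD[OF v p] by (simp add: uu)
  qed
qed

text \<open>At a point with z = 0 the field is tangent to the subspace z = 0. Hence \<open>f\<close>
  is zero on the straight line through the point in the direction of the field, and its derivative
  in that direction is zero.\<close>

lemma van_lie:
  assumes f: "smf P f" and v: "van f" and z: "van (vz \<Gamma>)"
  shows "van (lie (vf \<Gamma>) f)"
  unfolding van_def
proof (intro ballI allI)
  fix p y w assume p: "p \<in> P"
  let ?u = "(y, w, 0) :: modst"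
  let ?D = "frechet_derivative (f p) (at ?u)"
  define a where "a = vy \<Gamma> p ?u"
  define b where "b = cW \<Gamma> p ?u"
  let ?v = "(a, b, 0) :: modst"
  have vf: "vf \<Gamma> p ?u = ?v" using vanD[OF z p] by (simp add: vf_def a_def b_def)
  have l: "((\<lambda>t::real. ?u + t *\<^sub>R ?v) has_derivative (\<lambda>t. t *\<^sub>R ?v)) (at 0)"
    by (auto intro!: derivative_eq_intros)
  have "((\<lambda>t. f p (?u + t *\<^sub>R ?v)) has_derivative (\<lambda>t. ?D (t *\<^sub>R ?v))) (at 0)"
    using has_derivative_compose[OF l, of "f p" ?D] smf_has_derivative[OF f p, of ?u] by simp
  moreover have "(\<lambda>t. f p (?u + t *\<^sub>R ?v)) = (\<lambda>t. 0)" using vanD[OF v p] by simp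
  ultimately have "((\<lambda>t::real. 0) has_derivative (\<lambda>t. ?D (t *\<^sub>R ?v))) (at 0)" by simp
  from has_derivative_unique[OF this has_derivative_const]
  have "?D (1 *\<^sub>R ?v) = 0" by (rule fun_cong)
  then show "lie (vf \<Gamma>) f p ?u = 0" by (simp add: lie_def vf)
qed

lemma van_vz: "van (cZ \<Gamma>) \<Longrightarrow> van (vz \<Gamma>)"
  unfolding van_def vz_def Zc_def by (simp add: J_simps)

lemma van_Zc: "van Zc" by (simp add: van_def Zc_def)

context
  fixes \<Gamma> :: "'p \<Rightarrow> modst \<Rightarrow> modfun" assumes sG: "smf P \<Gamma>"
begin

lemma smf_comps: "smf P (cW \<Gamma>)" "smf P (cY \<Gamma>)" "smf P (cZ \<Gamma>)" "smf P (cQ \<Gamma>)"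
  using eqv_smf(1)[OF eqv_comps(1)[OF eqv_refl[OF sG, of 0]]] eqv_smf(1)[OF eqv_comps(2)[OF eqv_refl[OF sG, of 0]]]
    eqv_smf(1)[OF eqv_comps(3)[OF eqv_refl[OF sG, of 0]]] eqv_smf(1)[OF eqv_comps(4)[OF eqv_refl[OF sG, of 0]]] by simp_all

lemma smf_vf: "smf P (vf \<Gamma>)" by (rule eqv_smf(1)[OF eqv_vf[OF eqv_refl[OF sG, of 0]]])
lemma smf_vy: "smf P (vy \<Gamma>)" by (rule eqv_smf(1)[OF eqv_vy[OF eqv_refl[OF sG, of 0]]])
lemma smf_vz: "smf P (vz \<Gamma>)" by (rule eqv_smf(1)[OF eqv_vz[OF eqv_refl[OF sG, of 0]]])
lemma smf_zt: "smf P (zt \<Gamma>)" by (rule eqv_smf(1)[OF eqv_zt[OF eqv_refl[OF sG, of 0]]])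
lemma smf_zd: "smf P (zd \<Gamma>)" by (rule eqv_smf(1)[OF eqv_zd[OF eqv_refl[OF sG, of 0]]])
lemma smf_lieQ: "smf P (lie (vf \<Gamma>) (cQ \<Gamma>))" by (rule smf_lie[OF smf_comps(4) smf_vf])
lemma smf_xs: "smf P (xs s \<Gamma>)" by (rule eqv_smf(1)[OF eqv_xs[OF eqv_refl[OF sG, of 0]]])
lemma smf_vs: "smf P (vs s \<Gamma>)" by (rule eqv_smf(1)[OF eqv_vs[OF eqv_refl[OF sG, of 0]]])
lemma smf_bs: "smf P (bs s \<Gamma>)" by (rule eqv_smf(1)[OF eqv_bs[OF eqv_refl[OF sG, of 0]]])

lemma lie_zt: "p \<in> P \<Longrightarrow> lie (vf \<Gamma>) (zt \<Gamma>) p u = zd \<Gamma> p u"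
proof -
  assume p: "p \<in> P"
  have bl: "bounded_linear (\<lambda>c. (h p)\<^sup>2 *\<^sub>R (c *\<^sub>R B0))" for p
    by (rule bounded_linear_const_scaleR[OF blB0(1)])
  have s: "smf P (\<lambda>p u. (h p)\<^sup>2 *\<^sub>R (cQ \<Gamma> p u *\<^sub>R B0))"
    by (rule smf_scale[OF h_pow_le smf_linear[OF blB0(1) smf_comps(4)]])
  have "lie (vf \<Gamma>) (zt \<Gamma>) p u = lie (vf \<Gamma>) Zc p u + lie (vf \<Gamma>) (\<lambda>p u. (h p)\<^sup>2 *\<^sub>R (cQ \<Gamma> p u *\<^sub>R B0)) p u"
    unfolding zt_def by (rule lie_add[OF smf_coords(3) s p])
  also have "lie (vf \<Gamma>) (\<lambda>p u. (h p)\<^sup>2 *\<^sub>R (cQ \<Gamma> p u *\<^sub>R B0)) p u = (h p)\<^sup>2 *\<^sub>R (lie (vf \<Gamma>) (cQ \<Gamma>) p u *\<^sub>R B0)"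
    by (rule lie_linear[of P "cQ \<Gamma>" "\<lambda>p c. (h p)\<^sup>2 *\<^sub>R (c *\<^sub>R B0)", OF smf_comps(4) bl p])
  finally show ?thesis by (simp add: lie_coords zd_def)
qed

lemma van_liepow:
  assumes f: "smf P f" and v: "van f" and z: "van (cZ \<Gamma>)"
  shows "van ((lie (vf \<Gamma>) ^^ k) f)"
proof (induction k)
  case 0
  then show ?case using v by simp
next
  case (Suc k)
  then show ?case using van_lie[OF smf_liepow[OF f smf_vf] _ van_vz[OF z], of k] by simp
qed

lemma van_ops:
  assumes f: "smf P f" and v: "van f" and z: "van (cZ \<Gamma>)"
  shows "van (Dp n (vf \<Gamma>) f)" "van (Sp n (vf \<Gamma>) f)" "van (cdiff n (vf \<Gamma>) f)" "van (sdiff n (vf \<Gamma>) f)"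
proof -
  have l: "(lie (vf \<Gamma>) ^^ k) f p (y, w, 0) = 0" if "p \<in> P" for k p y w
    by (rule vanD[OF van_liepow[OF assms] that])
  have l': "(lie (vf \<Gamma>) ^^ k) (lie (vf \<Gamma>) f) p (y, w, 0) = 0" if "p \<in> P" for k p y w
    using l[OF that, of "Suc k"] by (simp add: funpow_swap1)
  show "van (Dp n (vf \<Gamma>) f)" unfolding van_def
  proof (intro ballI allI)
    show "Dp n (vf \<Gamma>) f p (y, w, 0) = 0" if "p \<in> P" for p y w
      by (simp only: Dp_def l[OF that] scaleR_zero_right sum.neutral_const)
  qed
  then show "van (cdiff n (vf \<Gamma>) f)" using v unfolding van_def cdiff_def by simp
  show "van (Sp n (vf \<Gamma>) f)" unfolding van_def
  proof (intro ballI allI)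
    show "Sp n (vf \<Gamma>) f p (y, w, 0) = 0" if "p \<in> P" for p y w
      by (simp only: Sp_def l[OF that] scaleR_zero_right sum.neutral_const)
  qed
  show "van (sdiff n (vf \<Gamma>) f)" unfolding van_def
  proof (intro ballI allI)
    fix p y w assume p: "p \<in> P"
    have "lie (vf \<Gamma>) f p (y, w, 0) = 0" using l[OF p, of 1] by simp
    then show "sdiff n (vf \<Gamma>) f p (y, w, 0) = 0"
      by (simp only: sdiff_def Sp_def l'[OF p] scaleR_zero_right sum.neutral_const add_0)
  qed
qed

end

definition vanG :: "('p \<Rightarrow> modst \<Rightarrow> modfun) \<Rightarrow> bool" where
  "vanG \<Gamma> \<longleftrightarrow> smf P \<Gamma> \<and> van (cZ \<Gamma>) \<and> van (cQ \<Gamma>)"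

lemma van_zt: "vanG \<Gamma> \<Longrightarrow> van (zt \<Gamma>)"
  unfolding van_def vanG_def zt_def Zc_def by simp

lemma van_lieQ: "vanG \<Gamma> \<Longrightarrow> van (lie (vf \<Gamma>) (cQ \<Gamma>))"
  unfolding vanG_def using van_lie[OF smf_comps(4) _ van_vz] by blast

lemma van_zd: "vanG \<Gamma> \<Longrightarrow> van (zd \<Gamma>)"
  using van_lieQ[of \<Gamma>] van_vz[of \<Gamma>] unfolding van_def vanG_def zd_def by simp

text \<open>For z = 0 both parities produce the same arguments of the force, so the odd part
  cancels.\<close>

lemma van_go: 
  assumes G: "vanG \<Gamma>" shows "van (go \<Gamma>)"
  unfolding van_def
proof (intro ballI allI)
  fix p y w assume p: "p \<in> P"
  have sG: "smf P \<Gamma>" and z: "van (cZ \<Gamma>)" using G by (auto simp: vanG_def)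
  note zd = van_ops[OF sG smf_zd[OF sG] van_zd[OF G] z]
  show "go \<Gamma> p (y, w, 0) = 0"
    by (simp add: go_def gs_def xs_def vs_def bs_def vanD[OF van_zt[OF G] p] vanD[OF zd(3) p] vanD[OF zd(4) p])
qed

lemma vanG_rhs:
  assumes G: "vanG \<Gamma>" shows "vanG (rhs \<Gamma>)"
proof -
  have sG: "smf P \<Gamma>" and z: "van (cZ \<Gamma>)" using G by (auto simp: vanG_def)
  have s: "smf P (rhs \<Gamma>)" by (rule eqv_smf(1)[OF eqv_rhs[OF eqv_refl[OF sG, of 0]]])
  have "cZ (rhs \<Gamma>) p (y, w, 0) = 0" "cQ (rhs \<Gamma>) p (y, w, 0) = 0" if p: "p \<in> P" for p y w
    by (simp_all add: rhs_comps vanD[OF van_go[OF G] p]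
      vanD[OF van_ops(1)[OF sG smf_coords(3) van_Zc z] p] vanD[OF van_ops(1)[OF sG smf_comps(3)[OF sG] z z] p]
      vanD[OF van_ops(4)[OF sG smf_vz[OF sG] van_vz[OF z] z] p]
      vanD[OF van_ops(4)[OF sG smf_lieQ[OF sG] van_lieQ[OF G] z] p])
  then show ?thesis using s by (simp add: vanG_def van_def)
qed

lemma vanG_Gam: "vanG (Gam k)"
proof (induction k)
  case 0
  show ?case using smf_Gam[of 0] by (simp add: vanG_def van_def Gam_def cZ_def cQ_def)
next
  case (Suc k)
  then show ?case using vanG_rhs[of "Gam k"] by (simp add: Gam_def)
qed

section \<open>Residual of the two-step relation\<close>

definition res :: "real \<Rightarrow> ('p \<Rightarrow> modst \<Rightarrow> modfun) \<Rightarrow> 'p \<Rightarrow> modst \<Rightarrow> real^3" where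
  "res s \<Gamma> p u = (1 / (h p)\<^sup>2) *\<^sub>R bs s \<Gamma> p u - (1 / \<epsilon> p) *\<^sub>R J (vs s \<Gamma> p u) - gs s \<Gamma> p u"

context
  fixes \<Gamma> :: "'p \<Rightarrow> modst \<Rightarrow> modfun" assumes sG: "smf P \<Gamma>"
begin

lemma B0_vy: "B0 \<bullet> vy \<Gamma> p u = Wc p u" by (simp add: vy_def inner_add_right B0_J B0B0)
lemma J_vy: "J (vy \<Gamma> p u) = \<epsilon> p *\<^sub>R J (J (cY \<Gamma> p u))" by (simp add: vy_def J_simps J_B0)

lemma bl_eJJ: "bounded_linear (\<lambda>a. \<epsilon> p *\<^sub>R J (J a))"
  by (rule bounded_linear_const_scaleR[OF bounded_linear_compose[OF blJ blJ]])

lemma bl_eJ: "bounded_linear (\<lambda>a. c *\<^sub>R J a)"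
  by (rule bounded_linear_const_scaleR[OF blJ])

text \<open>Here and in the following identities the projection is moved inside the difference
  operator, where the explicit form of the field can be inserted and the powers of \<epsilon> and h
  become visible.\<close>

lemma B0_sd_vy: "p \<in> P \<Longrightarrow> B0 \<bullet> sdiff n (vf \<Gamma>) (vy \<Gamma>) p u = cW \<Gamma> p u + (h p)\<^sup>2 *\<^sub>R Sp n (vf \<Gamma>) (cW \<Gamma>) p u"
proof -
  assume p: "p \<in> P"
  have "B0 \<bullet> sdiff n (vf \<Gamma>) (vy \<Gamma>) p u = sdiff n (vf \<Gamma>) (\<lambda>p u. B0 \<bullet> vy \<Gamma> p u) p u"
    by (rule sdiff_linear[of _ _ "\<lambda>p a. B0 \<bullet> a", OF smf_vy[OF sG] smf_vf[OF sG] blB0(2) p, symmetric])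
  also have "(\<lambda>p u. B0 \<bullet> vy \<Gamma> p u) = Wc" by (simp add: B0_vy fun_eq_iff)
  finally show ?thesis by (simp add: sdiff_def lie_coords)
qed

lemma J_sd_vy: "p \<in> P \<Longrightarrow> J (sdiff n (vf \<Gamma>) (vy \<Gamma>) p u) = \<epsilon> p *\<^sub>R J (J (sdiff n (vf \<Gamma>) (cY \<Gamma>) p u))"
proof -
  assume p: "p \<in> P"
  have "J (sdiff n (vf \<Gamma>) (vy \<Gamma>) p u) = sdiff n (vf \<Gamma>) (\<lambda>p u. J (vy \<Gamma> p u)) p u"
    by (rule sdiff_linear[of _ _ "\<lambda>p a. J a", OF smf_vy[OF sG] smf_vf[OF sG] blJ p, symmetric])
  also have "(\<lambda>p u. J (vy \<Gamma> p u)) = (\<lambda>p u. \<epsilon> p *\<^sub>R J (J (cY \<Gamma> p u)))" by (simp add: J_vy fun_eq_iff)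
  also have "sdiff n (vf \<Gamma>) \<dots> p u = \<epsilon> p *\<^sub>R J (J (sdiff n (vf \<Gamma>) (cY \<Gamma>) p u))"
    by (rule sdiff_linear[of _ _ "\<lambda>p a. \<epsilon> p *\<^sub>R J (J a)", OF smf_comps(2)[OF sG] smf_vf[OF sG] bl_eJJ p])
  finally show ?thesis .
qed

lemma J_cd_vy: "p \<in> P \<Longrightarrow> J (cdiff n (vf \<Gamma>) (vy \<Gamma>) p u) = \<epsilon> p *\<^sub>R J (J (cdiff n (vf \<Gamma>) (cY \<Gamma>) p u))"
proof -
  assume p: "p \<in> P"
  have "J (cdiff n (vf \<Gamma>) (vy \<Gamma>) p u) = cdiff n (vf \<Gamma>) (\<lambda>p u. J (vy \<Gamma> p u)) p u"
    by (rule cdiff_linear[of _ _ "\<lambda>p a. J a", OF smf_vy[OF sG] smf_vf[OF sG] blJ p, symmetric])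
  also have "(\<lambda>p u. J (vy \<Gamma> p u)) = (\<lambda>p u. \<epsilon> p *\<^sub>R J (J (cY \<Gamma> p u)))" by (simp add: J_vy fun_eq_iff)
  also have "cdiff n (vf \<Gamma>) \<dots> p u = \<epsilon> p *\<^sub>R J (J (cdiff n (vf \<Gamma>) (cY \<Gamma>) p u))"
    by (rule cdiff_linear[of _ _ "\<lambda>p a. \<epsilon> p *\<^sub>R J (J a)", OF smf_comps(2)[OF sG] smf_vf[OF sG] bl_eJJ p])
  finally show ?thesis .
qed

lemma B0_vz: "B0 \<bullet> vz \<Gamma> p u = 0" by (simp add: vz_def inner_add_right inner_diff_right B0_J)
lemma B0_zd: "B0 \<bullet> zd \<Gamma> p u = (h p)\<^sup>2 *\<^sub>R lie (vf \<Gamma>) (cQ \<Gamma>) p u"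
  by (simp add: zd_def inner_add_right B0_vz B0B0)
lemma J_zd: "J (zd \<Gamma> p u) = J (vz \<Gamma> p u)" by (simp add: zd_def J_simps J_B0)

lemma B0_sd_zd: "p \<in> P \<Longrightarrow> B0 \<bullet> sdiff n (vf \<Gamma>) (zd \<Gamma>) p u = (h p)\<^sup>2 *\<^sub>R sdiff n (vf \<Gamma>) (lie (vf \<Gamma>) (cQ \<Gamma>)) p u"
proof -
  assume p: "p \<in> P"
  have "B0 \<bullet> sdiff n (vf \<Gamma>) (zd \<Gamma>) p u = sdiff n (vf \<Gamma>) (\<lambda>p u. B0 \<bullet> zd \<Gamma> p u) p u"
    by (rule sdiff_linear[of _ _ "\<lambda>p a. B0 \<bullet> a", OF smf_zd[OF sG] smf_vf[OF sG] blB0(2) p, symmetric])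
  also have "(\<lambda>p u. B0 \<bullet> zd \<Gamma> p u) = (\<lambda>p u. (h p)\<^sup>2 *\<^sub>R lie (vf \<Gamma>) (cQ \<Gamma>) p u)" by (simp add: B0_zd fun_eq_iff)
  also have "sdiff n (vf \<Gamma>) \<dots> p u = (h p)\<^sup>2 *\<^sub>R sdiff n (vf \<Gamma>) (lie (vf \<Gamma>) (cQ \<Gamma>)) p u"
    by (rule sdiff_linear[of _ _ "\<lambda>p a. (h p)\<^sup>2 *\<^sub>R a", OF smf_lieQ[OF sG] smf_vf[OF sG] bounded_linear_scaleR_right p])
  finally show ?thesis .
qed

lemma B0_cd_zd: "p \<in> P \<Longrightarrow> B0 \<bullet> cdiff n (vf \<Gamma>) (zd \<Gamma>) p u = (h p)\<^sup>2 *\<^sub>R cdiff n (vf \<Gamma>) (lie (vf \<Gamma>) (cQ \<Gamma>)) p u"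
proof -
  assume p: "p \<in> P"
  have "B0 \<bullet> cdiff n (vf \<Gamma>) (zd \<Gamma>) p u = cdiff n (vf \<Gamma>) (\<lambda>p u. B0 \<bullet> zd \<Gamma> p u) p u"
    by (rule cdiff_linear[of _ _ "\<lambda>p a. B0 \<bullet> a", OF smf_zd[OF sG] smf_vf[OF sG] blB0(2) p, symmetric])
  also have "(\<lambda>p u. B0 \<bullet> zd \<Gamma> p u) = (\<lambda>p u. (h p)\<^sup>2 *\<^sub>R lie (vf \<Gamma>) (cQ \<Gamma>) p u)" by (simp add: B0_zd fun_eq_iff)
  also have "cdiff n (vf \<Gamma>) \<dots> p u = (h p)\<^sup>2 *\<^sub>R cdiff n (vf \<Gamma>) (lie (vf \<Gamma>) (cQ \<Gamma>)) p u"
    by (rule cdiff_linear[of _ _ "\<lambda>p a. (h p)\<^sup>2 *\<^sub>R a", OF smf_lieQ[OF sG] smf_vf[OF sG] bounded_linear_scaleR_right p])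
  finally show ?thesis .
qed

lemma B0_cd_vy: "p \<in> P \<Longrightarrow> B0 \<bullet> cdiff n (vf \<Gamma>) (vy \<Gamma>) p u = cdiff n (vf \<Gamma>) Wc p u"
proof -
  assume p: "p \<in> P"
  have "B0 \<bullet> cdiff n (vf \<Gamma>) (vy \<Gamma>) p u = cdiff n (vf \<Gamma>) (\<lambda>p u. B0 \<bullet> vy \<Gamma> p u) p u"
    by (rule cdiff_linear[of _ _ "\<lambda>p a. B0 \<bullet> a", OF smf_vy[OF sG] smf_vf[OF sG] blB0(2) p, symmetric])
  also have "(\<lambda>p u. B0 \<bullet> vy \<Gamma> p u) = Wc" by (simp add: B0_vy fun_eq_iff)
  finally show ?thesis .
qed

lemma J_sd_zd: "p \<in> P \<Longrightarrow> J (sdiff n (vf \<Gamma>) (zd \<Gamma>) p u) = J (sdiff n (vf \<Gamma>) (vz \<Gamma>) p u)"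
proof -
  assume p: "p \<in> P"
  have "J (sdiff n (vf \<Gamma>) (zd \<Gamma>) p u) = sdiff n (vf \<Gamma>) (\<lambda>p u. J (zd \<Gamma> p u)) p u"
    by (rule sdiff_linear[of _ _ "\<lambda>p a. J a", OF smf_zd[OF sG] smf_vf[OF sG] blJ p, symmetric])
  also have "(\<lambda>p u. J (zd \<Gamma> p u)) = (\<lambda>p u. J (vz \<Gamma> p u))" by (simp add: J_zd fun_eq_iff)
  also have "sdiff n (vf \<Gamma>) \<dots> p u = J (sdiff n (vf \<Gamma>) (vz \<Gamma>) p u)"
    by (rule sdiff_linear[of _ _ "\<lambda>p a. J a", OF smf_vz[OF sG] smf_vf[OF sG] blJ p])
  finally show ?thesis .
qed

lemma J_cd_zd: "p \<in> P \<Longrightarrow> J (cdiff n (vf \<Gamma>) (zd \<Gamma>) p u)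
   = (- (4 * \<kappa> p)) *\<^sub>R J (J (cdiff n (vf \<Gamma>) Zc p u)) + \<epsilon> p *\<^sub>R J (J (cdiff n (vf \<Gamma>) (cZ \<Gamma>) p u))"
proof -
  assume p: "p \<in> P"
  have "J (cdiff n (vf \<Gamma>) (zd \<Gamma>) p u) = cdiff n (vf \<Gamma>) (\<lambda>p u. J (zd \<Gamma> p u)) p u"
    by (rule cdiff_linear[of _ _ "\<lambda>p a. J a", OF smf_zd[OF sG] smf_vf[OF sG] blJ p, symmetric])
  also have "(\<lambda>p u. J (zd \<Gamma> p u)) = (\<lambda>p u. J (vz \<Gamma> p u))" by (simp add: J_zd fun_eq_iff)
  also have "cdiff n (vf \<Gamma>) \<dots> p u = J (cdiff n (vf \<Gamma>) (vz \<Gamma>) p u)"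
    by (rule cdiff_linear[of _ _ "\<lambda>p a. J a", OF smf_vz[OF sG] smf_vf[OF sG] blJ p])
  also have "cdiff n (vf \<Gamma>) (vz \<Gamma>) p u
     = cdiff n (vf \<Gamma>) (\<lambda>p u. (- (4 * \<kappa> p)) *\<^sub>R J (Zc p u)) p u + cdiff n (vf \<Gamma>) (\<lambda>p u. \<epsilon> p *\<^sub>R J (cZ \<Gamma> p u)) p u"
  proof -
    have "smf P (\<lambda>p u. \<epsilon> p *\<^sub>R J (cZ \<Gamma> p u))"
      by (rule smf_scale[OF _ smf_linear[OF blJ smf_comps(3)[OF sG]], where C = 1]) (use eps eps_le1 in \<open>simp add: abs_of_pos\<close>)
    then show ?thesis unfolding vz_def by (rule cdiff_add[OF smf_kJZ _ smf_vf[OF sG] p])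
  qed
  also have "cdiff n (vf \<Gamma>) (\<lambda>p u. (- (4 * \<kappa> p)) *\<^sub>R J (Zc p u)) p u = (- (4 * \<kappa> p)) *\<^sub>R J (cdiff n (vf \<Gamma>) Zc p u)"
    by (rule cdiff_linear[of _ _ "\<lambda>p a. (- (4 * \<kappa> p)) *\<^sub>R J a", OF smf_coords(3) smf_vf[OF sG] bl_eJ p])
  also have "cdiff n (vf \<Gamma>) (\<lambda>p u. \<epsilon> p *\<^sub>R J (cZ \<Gamma> p u)) p u = \<epsilon> p *\<^sub>R J (cdiff n (vf \<Gamma>) (cZ \<Gamma>) p u)"
    by (rule cdiff_linear[of _ _ "\<lambda>p a. \<epsilon> p *\<^sub>R J a", OF smf_comps(3)[OF sG] smf_vf[OF sG] bl_eJ p])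
  finally show ?thesis by (simp only: J_simps)
qed

text \<open>The even and odd parts of the residual, tested by B0 and \<open>J\<close>, reproduce the
  components of \<open>\<Gamma> - rhs \<Gamma>\<close>, up to signs and a factor 4; all terms with
  1/\<epsilon> or 1/h^2 cancel identically. The even part contributes 2 and the odd part 4 + 1 to
  the constant. The condition on \<open>u\<close> makes \<open>cQ\<close> the only source of the B0
  component of the oscillation.\<close>

lemma res_bound:
  assumes p: "p \<in> P" and s: "s = 1 \<or> s = -1" and z: "B0 \<bullet> snd (snd u) = 0"
  shows "norm (res s \<Gamma> p u) \<le> 7 * norm (\<Gamma> p u - rhs \<Gamma> p u)"
proof -
  let ?G = "vf \<Gamma>" and ?\<Delta> = "norm (\<Gamma> p u - rhs \<Gamma> p u)"
  have hp: "h p \<noteq> 0" "\<epsilon> p \<noteq> 0" using h[OF p] eps[OF p] by auto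
  define Rev where "Rev = sdiff n ?G (vy \<Gamma>) p u - (1 / \<epsilon> p) *\<^sub>R J (cdiff n ?G (vy \<Gamma>) p u) - ge \<Gamma> p u"
  define Rod where "Rod = - ((4 / (h p)\<^sup>2) *\<^sub>R zt \<Gamma> p u) - sdiff n ?G (zd \<Gamma>) p u + (1 / \<epsilon> p) *\<^sub>R J (cdiff n ?G (zd \<Gamma>) p u) - go \<Gamma> p u"
  have gs: "gs s \<Gamma> p u = ge \<Gamma> p u + s *\<^sub>R go \<Gamma> p u"
    using s by (auto simp: ge_def go_def scaleR_add_right[symmetric] scaleR_diff_right[symmetric] scaleR_2[symmetric] algebra_simps simp del: scaleR_add_right scaleR_diff_right)
  have bs: "(1 / (h p)\<^sup>2) *\<^sub>R bs s \<Gamma> p u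
     = sdiff n ?G (vy \<Gamma>) p u - s *\<^sub>R ((4 / (h p)\<^sup>2) *\<^sub>R zt \<Gamma> p u + sdiff n ?G (zd \<Gamma>) p u)"
    using hp by (simp add: bs_def algebra_simps)
  have "res s \<Gamma> p u = Rev + s *\<^sub>R Rod"
    unfolding res_def bs gs Rev_def Rod_def vs_def by (simp add: J_simps algebra_simps)
  then have n0: "norm (res s \<Gamma> p u) \<le> norm Rev + norm Rod"
    using s norm_triangle_ineq[of Rev Rod] norm_triangle_ineq4[of Rev Rod] by auto
  have d: "\<bar>cW \<Gamma> p u - cW (rhs \<Gamma>) p u\<bar> \<le> ?\<Delta>" "norm (cY \<Gamma> p u - cY (rhs \<Gamma>) p u) \<le> ?\<Delta>"
    "norm (cZ \<Gamma> p u - cZ (rhs \<Gamma>) p u) \<le> ?\<Delta>" "\<bar>cQ \<Gamma> p u - cQ (rhs \<Gamma>) p u\<bar> \<le> ?\<Delta>"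
  proof -
    let ?d = "\<Gamma> p u - rhs \<Gamma> p u"
    have a: "norm (fst ?d) \<le> norm ?d" "norm (snd ?d) \<le> norm ?d" by (rule fst_le, rule snd_le)
    have b: "norm (fst (snd ?d)) \<le> norm ?d" "norm (snd (snd ?d)) \<le> norm ?d"
      using a(2) fst_le[of "snd ?d"] snd_le[of "snd ?d"] by linarith+
    have c: "norm (fst (snd (snd ?d))) \<le> norm ?d" "norm (snd (snd (snd ?d))) \<le> norm ?d"
      using b(2) fst_le[of "snd (snd ?d)"] snd_le[of "snd (snd ?d)"] by linarith+
    show "\<bar>cW \<Gamma> p u - cW (rhs \<Gamma>) p u\<bar> \<le> ?\<Delta>" "norm (cY \<Gamma> p u - cY (rhs \<Gamma>) p u) \<le> ?\<Delta>"
      "norm (cZ \<Gamma> p u - cZ (rhs \<Gamma>) p u) \<le> ?\<Delta>" "\<bar>cQ \<Gamma> p u - cQ (rhs \<Gamma>) p u\<bar> \<le> ?\<Delta>"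
      using a(1) b(1) c by (simp_all add: cW_def cY_def cZ_def cQ_def)
  qed
  have e1: "B0 \<bullet> Rev = cW \<Gamma> p u - cW (rhs \<Gamma>) p u"
    unfolding Rev_def rhs_comps by (simp add: inner_diff_right B0_J B0_sd_vy[OF p])
  \<comment> \<open>Two facts absorb 1/\<epsilon>: the orthogonal part of \<open>vy\<close> carries
    the factor \<epsilon>, and J J J = -J.\<close>
  have "J ((1 / \<epsilon> p) *\<^sub>R J (cdiff n ?G (vy \<Gamma>) p u)) = - J (cdiff n ?G (cY \<Gamma>) p u)"
    unfolding J_cd_vy[OF p] J_simps JJJ using hp by simp
  then have e2: "J Rev = J (cY \<Gamma> p u - cY (rhs \<Gamma>) p u)"
    unfolding Rev_def rhs_comps J_simps(2) J_sd_vy[OF p] by (simp add: J_simps cdiff_def)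
  have e3: "B0 \<bullet> Rod = - 4 * (cQ \<Gamma> p u - cQ (rhs \<Gamma>) p u)"
  proof -
    have "B0 \<bullet> zt \<Gamma> p u = (h p)\<^sup>2 * cQ \<Gamma> p u"
      using z by (simp add: zt_def Zc_def inner_add_right B0B0)
    then have "B0 \<bullet> ((4 / (h p)\<^sup>2) *\<^sub>R zt \<Gamma> p u) = 4 * cQ \<Gamma> p u" using hp by simp
    then show ?thesis
      unfolding Rod_def rhs_comps inner_diff_right inner_add_right inner_minus_right B0_sd_zd[OF p]
      by (simp add: B0_J add_divide_distrib)
  qed
  have e4: "J Rod = J (cZ (rhs \<Gamma>) p u - cZ \<Gamma> p u)"
  proof -
    have "J (zt \<Gamma> p u) = J (Zc p u)" by (simp add: zt_def J_simps J_B0)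
    moreover have "J ((1 / \<epsilon> p) *\<^sub>R J (cdiff n ?G (zd \<Gamma>) p u))
       = (4 / (h p)\<^sup>2) *\<^sub>R J (Zc p u) + 4 *\<^sub>R J (Dp n ?G Zc p u) - J (cdiff n ?G (cZ \<Gamma>) p u)"
    proof -
      have "J ((1 / \<epsilon> p) *\<^sub>R J (cdiff n ?G (zd \<Gamma>) p u))
         = (4 * \<kappa> p / \<epsilon> p) *\<^sub>R J (cdiff n ?G Zc p u) - J (cdiff n ?G (cZ \<Gamma>) p u)"
        unfolding J_cd_zd[OF p] J_simps JJJ using hp by (simp add: scaleR_add_right scaleR_diff_right)
      \<comment> \<open>The resulting term (4/h^2) J z cancels the one from the second difference;
        only the correction 4 \<open>Dp\<close> of \<open>Zc\<close> survives, which is the first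
        term of the Z component of \<open>rhs\<close>.\<close>
      also have "4 * \<kappa> p / \<epsilon> p = 4 / (h p)\<^sup>2" using hp by (simp add: \<kappa>_def)
      also have "(4 / (h p)\<^sup>2) *\<^sub>R J (cdiff n ?G Zc p u) = (4 / (h p)\<^sup>2) *\<^sub>R J (Zc p u) + 4 *\<^sub>R J (Dp n ?G Zc p u)"
        unfolding cdiff_def J_simps using hp by (simp add: scaleR_add_right)
      finally show ?thesis .
    qed
    ultimately show ?thesis
      unfolding Rod_def rhs_comps by (simp add: J_simps J_sd_zd[OF p] cdiff_def)
  qed
  have "norm Rev \<le> ?\<Delta> + ?\<Delta>"
    using norm_le_split[of Rev] norm_J_le[of "cY \<Gamma> p u - cY (rhs \<Gamma>) p u"] d unfolding e1 e2 by linarith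
  moreover have "norm Rod \<le> 4 * ?\<Delta> + ?\<Delta>"
    using norm_le_split[of Rod] norm_J_le[of "cZ (rhs \<Gamma>) p u - cZ \<Gamma> p u"] d unfolding e3 e4
    by (simp add: norm_minus_commute abs_mult)
  ultimately show ?thesis using n0 by linarith
qed

end

text \<open>For \<sigma> = \<plusminus>1 the odd powers of the Taylor polynomial collect in the
  central difference and the even ones in the second difference. Raising n by one adds the orders
  2n+3 and 2n+4.\<close>

lemma taylor_sum:
  fixes f :: "'p \<Rightarrow> 'a::euclidean_space \<Rightarrow> 'b::real_normed_vector"
  assumes "\<sigma> = 1 \<or> \<sigma> = -1"
  shows "f p u + (\<sigma> * h p) *\<^sub>R cdiff n G (lie G f) p u + ((h p)\<^sup>2 / 2) *\<^sub>R sdiff n G (lie G f) p u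
    = (\<Sum>k\<le>2*n+2. ((\<sigma> * h p) ^ k / fact k) *\<^sub>R (lie G ^^ k) f p u)"
proof (induction n)
  case 0
  have a: "(\<Sum>k\<le>2*0+2. a k) = a 0 + a 1 + a 2" for a :: "nat \<Rightarrow> 'b"
    by (simp add: numeral_2_eq_2)
  have "(\<sigma> * h p)\<^sup>2 = (h p)\<^sup>2" using assms by auto
  moreover have "(lie G ^^ 2) f = lie G (lie G f)" by (simp add: numeral_2_eq_2)
  ultimately show ?case unfolding a by (simp add: cdiff_def sdiff_def Dp_def Sp_def)
next
  case (Suc n)
  have s: "\<sigma> ^ (2 * n + 3) = \<sigma>" "\<sigma> ^ (2 * n + 4) = 1" using assms by auto
  have l1: "(lie G ^^ (k + 1)) f' = (lie G ^^ k) (lie G f')" for k and f' :: "'p \<Rightarrow> 'a \<Rightarrow> 'b"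
    by (simp add: funpow_swap1)
  have "2 * n + 3 = (2 * n + 2) + 1" "2 * n + 4 = (2 * n + 2) + 1 + 1" by auto
  then have l: "(lie G ^^ (2 * n + 2)) (lie G f) = (lie G ^^ (2 * n + 3)) f"
    "(lie G ^^ (2 * n + 2)) (lie G (lie G f)) = (lie G ^^ (2 * n + 4)) f"
    by (simp_all only: l1)
  have D: "cdiff (Suc n) G (lie G f) p u = cdiff n G (lie G f) p u
      + (h p ^ (2 * n + 2) / fact (2 * n + 3)) *\<^sub>R (lie G ^^ (2 * n + 3)) f p u"
    unfolding cdiff_def Dp_def sum.lessThan_Suc l scaleR_add_right
    by (simp add: power_add mult_ac power2_eq_square)
  have S: "sdiff (Suc n) G (lie G f) p u = sdiff n G (lie G f) p u
      + (2 * h p ^ (2 * n + 2) / fact (2 * n + 4)) *\<^sub>R (lie G ^^ (2 * n + 4)) f p u"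
    unfolding sdiff_def Sp_def sum.lessThan_Suc l scaleR_add_right
    by (simp add: power_add mult_ac power2_eq_square)
  have "(\<Sum>k\<le>2*Suc n+2. ((\<sigma> * h p) ^ k / fact k) *\<^sub>R (lie G ^^ k) f p u)
    = (\<Sum>k\<le>2*n+2. ((\<sigma> * h p) ^ k / fact k) *\<^sub>R (lie G ^^ k) f p u)
      + ((\<sigma> * h p) ^ (2*n+3) / fact (2*n+3)) *\<^sub>R (lie G ^^ (2*n+3)) f p u
      + ((\<sigma> * h p) ^ (2*n+4) / fact (2*n+4)) *\<^sub>R (lie G ^^ (2*n+4)) f p u"
  proof -
    have e: "2 * Suc n + 2 = Suc (Suc (2 * n + 2))" "Suc (2 * n + 3) = 2 * n + 4" "Suc (2 * n + 2) = 2 * n + 3" by auto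
    show ?thesis unfolding e(1) sum.atMost_Suc by (simp only: e(2,3))
  qed
  also have "((\<sigma> * h p) ^ (2*n+3) / fact (2*n+3)) = (\<sigma> * h p) * (h p ^ (2 * n + 2) / fact (2 * n + 3))"
    unfolding power_mult_distrib s by (simp add: power_add power3_eq_cube power2_eq_square)
  also have "((\<sigma> * h p) ^ (2*n+4) / fact (2*n+4)) = ((h p)\<^sup>2 / 2) * (2 * h p ^ (2 * n + 2) / fact (2 * n + 4))"
    unfolding power_mult_distrib s by (simp add: power_add power4_eq_xxxx power2_eq_square)
  finally show ?case unfolding D S Suc.IH[symmetric] by (simp add: algebra_simps)
qed

end

section \<open>Stability of the two-step recursion\<close>

text \<open>A discrete Gronwall inequality; the index bound \<open>m\<close> is kept because the
  recursion will be known only inside the numerical interval.\<close>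

lemma linear_recursion_bound:
  fixes E :: "nat \<Rightarrow> real"
  assumes "\<And>n. Suc n < m \<Longrightarrow> E (Suc n) \<le> a * E n + b" "a \<ge> 1" "b \<ge> 0" "n < m"
  shows "E n \<le> a ^ n * (E 0 + real n * b)"
  using assms(4)
proof (induction n)
  case 0
  then show ?case by simp
next
  case (Suc n)
  have "E (Suc n) \<le> a * E n + b" using assms(1) Suc.prems by simp
  also have "\<dots> \<le> a * (a ^ n * (E 0 + real n * b)) + a ^ Suc n * b"
  proof (rule add_mono)
    show "a * E n \<le> a * (a ^ n * (E 0 + real n * b))"
      using Suc assms by (intro mult_left_mono) auto
    show "b \<le> a ^ Suc n * b"
      using mult_right_mono[OF one_le_power[OF assms(2)] assms(3), of "Suc n"] by simp
  qed
  also have "\<dots> = a ^ Suc n * (E 0 + real (Suc n) * b)" by (simp add: algebra_simps)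
  finally show ?case .
qed

context modulation begin

lemma abs_B0: "\<bar>B0 \<bullet> a\<bar> \<le> norm a"
  using Cauchy_Schwarz_ineq2[of B0 a] B0 by simp

text \<open>The perpendicular velocity error is measured in units of \<open>\<epsilon>\<close>. Up to the defect \<open>\<psi>\<close> it is
  slaved to the remaining errors, and \<open>\<psi>\<close> changes sign in every step up to \<open>O(h)\<close>, so that no
  inverse power of \<open>\<epsilon>\<close> enters.\<close>

lemma stability:
  fixes e f c \<gamma> :: "nat \<Rightarrow> real^3"
  assumes hh: "0 < hh" "hh \<le> 1" and ee: "0 < ee" "ee \<le> hh\<^sup>2" and L: "L \<ge> 1" "L * hh \<le> 1/16"
    and r: "r \<ge> 0" and d: "d \<ge> 0"
    and st1: "\<And>n. n < m \<Longrightarrow> norm (e (Suc n) - (e n + hh *\<^sub>R f n + (hh\<^sup>2/2) *\<^sub>R c n)) \<le> d"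
    and st2: "\<And>n. Suc n < m \<Longrightarrow> norm (e n - (e (Suc n) - hh *\<^sub>R f (Suc n) + (hh\<^sup>2/2) *\<^sub>R c (Suc n))) \<le> d"
    and c: "\<And>n. n < m \<Longrightarrow> c n = (1 / ee) *\<^sub>R J (f n) + \<gamma> n"
    and \<gamma>: "\<And>n. n < m \<Longrightarrow> norm (\<gamma> n) \<le> L * (norm (e n) + norm (f n) + hh\<^sup>2 * norm (c n)) + r"
    and e0: "e 0 = 0" and f0: "f 0 = 0" and T: "real m * hh \<le> T"
  shows "norm (e m) \<le> (2 * exp (44 * L * T) * (2 + 46 * T) + 7) * (r + d / hh ^ 3)"
proof -
  \<comment> \<open>Since -J J projects orthogonally to B0, the velocity error decomposes as f =
    \<phi>0 B0 + ee \<phi>; this is the scaling of the orthogonal part by \<epsilon>.\<close>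
  define \<phi> where "\<phi> n = - ((1 / ee) *\<^sub>R J (J (f n)))" for n
  define \<phi>0 where "\<phi>0 n = B0 \<bullet> f n" for n
  \<comment> \<open>By J J \<phi> = -\<phi> this is -J c, the turned acceleration error. Its average
    over two consecutive steps is governed by an increment of J f, which is of size
    \<epsilon>.\<close>
  define \<psi> where "\<psi> n = \<phi> n - J (\<gamma> n)" for n
  define E where "E n = norm (e n) + \<bar>\<phi>0 n\<bar> + norm (\<psi> n)" for n
  have E0: "E n \<ge> 0" for n by (simp add: E_def)
  have fdec: "f n = \<phi>0 n *\<^sub>R B0 + ee *\<^sub>R \<phi> n" for n
    using ee by (simp add: \<phi>_def \<phi>0_def JJ)
  have J\<phi>: "J (f n) = ee *\<^sub>R J (\<phi> n)" for n
    unfolding fdec[of n] by (simp add: J_simps J_B0)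
  have JJ\<phi>: "J (J (\<phi> n)) = - \<phi> n" for n
    unfolding JJ by (simp add: \<phi>_def B0_J)
  have cn: "c n = J (\<phi> n) + \<gamma> n" if "n < m" for n
    using c[OF that] ee by (simp add: J\<phi>)
  have hh2: "hh\<^sup>2 \<le> hh" using hh by (simp add: power2_eq_square mult_left_le_one_le)
  have Lee: "L * ee \<le> 1/16" "L * hh\<^sup>2 \<le> 1/16"
  proof -
    have "L * ee \<le> L * hh\<^sup>2" "L * hh\<^sup>2 \<le> L * hh" using ee hh2 L by (auto intro: mult_left_mono)
    then show "L * ee \<le> 1/16" "L * hh\<^sup>2 \<le> 1/16" using L by linarith+
  qed
  have nf: "norm (f n) \<le> \<bar>\<phi>0 n\<bar> + ee * norm (\<phi> n)" for n
    unfolding fdec[of n] by (rule order_trans[OF norm_triangle_ineq]) (use B0 ee in simp)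
  have nc: "norm (c n) \<le> norm (\<phi> n) + norm (\<gamma> n)" if "n < m" for n
    unfolding cn[OF that] using norm_triangle_ineq[of "J (\<phi> n)" "\<gamma> n"] norm_J_le[of "\<phi> n"] by linarith
  have n\<phi>: "norm (\<phi> n) \<le> norm (\<psi> n) + norm (\<gamma> n)" for n
    using norm_triangle_ineq[of "\<psi> n" "J (\<gamma> n)"] norm_J_le[of "\<gamma> n"] by (simp add: \<psi>_def)
  have LE: "L * norm (e n) + L * \<bar>\<phi>0 n\<bar> + L * norm (\<psi> n) = L * E n" for n
    by (simp add: E_def algebra_simps)
  have Lpos: "norm (\<psi> n) \<le> L * norm (\<psi> n)" "E n \<le> L * E n" for n
    using L mult_right_mono[of 1 L "norm (\<psi> n)"] mult_right_mono[of 1 L "E n"] E0[of n] by auto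
  have L0: "0 \<le> L * norm (e n)" "0 \<le> L * \<bar>\<phi>0 n\<bar>" for n using L by auto
  \<comment> \<open>The bound on \<gamma> involves c, and c involves \<gamma>. The coefficients
    1/16, which stem from L h \<le> 1/16, are small enough for both to be absorbed on the
    left.\<close>
  have aux1: "v \<le> 2 * t + 2 * r" if "v \<le> a + b + (1/16) * k + (1/16) * (k + v) + r" "k \<le> l + v" "l \<le> l'"
      "0 \<le> a" "0 \<le> b" "0 \<le> l" "a + b + l' = t" "0 \<le> r" for v a b k l l' t r :: real
  proof -
    have "13 * v \<le> 16 * a + 16 * b + 2 * l + 16 * r" using that(1,2) by (simp add: field_simps)
    then show ?thesis using that(3-) by linarith
  qed
  have aux2: "k \<le> 3 * t + 2 * r" if "v \<le> 2 * t + 2 * r" "k \<le> l + v" "l \<le> l'" "0 \<le> a" "0 \<le> b" "a + b + l' = t"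
    for v a b k l l' t r :: real
    using that by linarith
  have ng: "norm (\<gamma> n) \<le> 2 * (L * E n) + 2 * r" and np: "norm (\<phi> n) \<le> 3 * (L * E n) + 2 * r" if n: "n < m" for n
  proof -
    have "L * (norm (e n) + norm (f n) + hh\<^sup>2 * norm (c n))
      \<le> L * (norm (e n) + (\<bar>\<phi>0 n\<bar> + ee * norm (\<phi> n)) + hh\<^sup>2 * (norm (\<phi> n) + norm (\<gamma> n)))"
      using nf nc[OF n] L by (intro mult_left_mono add_mono) auto
    also have "\<dots> = L * norm (e n) + L * \<bar>\<phi>0 n\<bar> + (L * ee) * norm (\<phi> n) + (L * hh\<^sup>2) * (norm (\<phi> n) + norm (\<gamma> n))"
      by (simp add: algebra_simps)
    also have "\<dots> \<le> L * norm (e n) + L * \<bar>\<phi>0 n\<bar> + (1/16) * norm (\<phi> n) + (1/16) * (norm (\<phi> n) + norm (\<gamma> n))"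
      using Lee by (intro add_mono mult_right_mono) auto
    finally have "norm (\<gamma> n) \<le> L * norm (e n) + L * \<bar>\<phi>0 n\<bar> + (1/16) * norm (\<phi> n) + (1/16) * (norm (\<phi> n) + norm (\<gamma> n)) + r"
      using \<gamma>[OF n] by linarith
    then show g: "norm (\<gamma> n) \<le> 2 * (L * E n) + 2 * r"
      by (rule aux1[OF _ n\<phi> Lpos(1) L0 norm_ge_zero LE r])
    show "norm (\<phi> n) \<le> 3 * (L * E n) + 2 * r"
      by (rule aux2[OF g n\<phi> Lpos(1) L0 LE])
  qed
  have ne: "norm (e (Suc n)) \<le> norm (e n) + hh * (9 * (L * E n) + 6 * r) + d" if n: "n < m" for n
  proof -
    let ?x = "e n + hh *\<^sub>R f n + (hh\<^sup>2/2) *\<^sub>R c n"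
    have "norm (e (Suc n)) \<le> norm ?x + d"
      using norm_triangle_ineq[of ?x "e (Suc n) - ?x"] st1[OF n] by simp
    also have "norm ?x \<le> norm (e n) + hh * norm (f n) + (hh\<^sup>2/2) * norm (c n)"
      using norm_triangle_ineq[of "e n + hh *\<^sub>R f n" "(hh\<^sup>2/2) *\<^sub>R c n"] norm_triangle_ineq[of "e n" "hh *\<^sub>R f n"] hh by simp
    also have "hh * norm (f n) \<le> hh * (\<bar>\<phi>0 n\<bar> + norm (\<phi> n))"
    proof -
      have "ee \<le> 1" using ee hh2 hh by linarith
      then have "ee * norm (\<phi> n) \<le> norm (\<phi> n)" using ee by (simp add: mult_left_le_one_le)
      then show ?thesis using nf[of n] hh by (intro mult_left_mono) auto
    qed
    also have "(hh\<^sup>2/2) * norm (c n) \<le> hh * (norm (\<phi> n) + norm (\<gamma> n))"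
      using nc[OF n] hh hh2 by (intro mult_mono) auto
    finally have "norm (e (Suc n)) \<le> norm (e n) + hh * (\<bar>\<phi>0 n\<bar> + 2 * norm (\<phi> n) + norm (\<gamma> n)) + d"
      by (simp add: algebra_simps)
    also have "hh * (\<bar>\<phi>0 n\<bar> + 2 * norm (\<phi> n) + norm (\<gamma> n)) \<le> hh * (9 * (L * E n) + 6 * r)"
    proof (intro mult_left_mono)
      have "\<bar>\<phi>0 n\<bar> \<le> E n" by (simp add: E_def)
      then show "\<bar>\<phi>0 n\<bar> + 2 * norm (\<phi> n) + norm (\<gamma> n) \<le> 9 * (L * E n) + 6 * r"
        using ng[OF n] np[OF n] Lpos(2)[of n] by linarith
    qed (use hh in simp)
    finally show ?thesis by simp
  qed
  have step: "E (Suc n) \<le> E n + hh * (16 * (L * E n) + 7 * (L * E (Suc n)) + 16 * r) + 7 * (d / hh\<^sup>2)"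
    if sn: "Suc n < m" for n
  proof -
    have n: "n < m" using sn by simp
    \<comment> \<open>Adding the forward and the backward relation eliminates the positions: the
      increment of f is the trapezoidal rule for c, up to a defect of size 2 d / h.\<close>
    define w where "w = f (Suc n) - f n - (hh / 2) *\<^sub>R (c n + c (Suc n))"
    have "hh *\<^sub>R w = hh *\<^sub>R f (Suc n) - hh *\<^sub>R f n - (hh\<^sup>2/2) *\<^sub>R c n - (hh\<^sup>2/2) *\<^sub>R c (Suc n)"
      unfolding w_def by (simp add: scaleR_diff_right scaleR_add_right power2_eq_square)
    then have "hh *\<^sub>R w = (e (Suc n) - (e n + hh *\<^sub>R f n + (hh\<^sup>2/2) *\<^sub>R c n))
      + (e n - (e (Suc n) - hh *\<^sub>R f (Suc n) + (hh\<^sup>2/2) *\<^sub>R c (Suc n)))"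
      by simp
    then have "hh * norm w \<le> d + d"
      using norm_triangle_mono[OF st1[OF n] st2[OF sn]] hh by (metis abs_of_pos norm_scaleR)
    then have nw: "norm w \<le> 2 * (d / hh)" using hh by (simp add: field_simps)
    have fS: "f (Suc n) = f n + (hh / 2) *\<^sub>R (c n + c (Suc n)) + w" by (simp add: w_def)
    have dh: "d \<le> d / hh\<^sup>2" "d / hh \<le> d / hh\<^sup>2"
    proof -
      have k: "a \<le> a / hh" if "a \<ge> 0" for a using hh that by (simp add: le_divide_eq mult_left_le)
      have "d / hh\<^sup>2 = d / hh / hh" by (simp add: power2_eq_square)
      then show "d \<le> d / hh\<^sup>2" "d / hh \<le> d / hh\<^sup>2" using k[of d] k[of "d / hh"] d hh by auto
    qed
    have p0: "\<bar>\<phi>0 (Suc n)\<bar> \<le> \<bar>\<phi>0 n\<bar> + hh * (L * E n + L * E (Suc n) + 2 * r) + 2 * (d / hh\<^sup>2)"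
    proof -
      have "\<phi>0 (Suc n) = \<phi>0 n + (hh / 2) * (B0 \<bullet> \<gamma> n + B0 \<bullet> \<gamma> (Suc n)) + B0 \<bullet> w"
        unfolding \<phi>0_def by (subst fS) (simp add: inner_add_right cn[OF n] cn[OF sn] B0_J)
      moreover have "\<bar>(hh / 2) * (B0 \<bullet> \<gamma> n + B0 \<bullet> \<gamma> (Suc n))\<bar> \<le> (hh/2) * (norm (\<gamma> n) + norm (\<gamma> (Suc n)))"
        using hh abs_B0[of "\<gamma> n"] abs_B0[of "\<gamma> (Suc n)"] by (auto simp: abs_mult intro!: mult_left_mono)
      moreover have "(hh/2) * (norm (\<gamma> n) + norm (\<gamma> (Suc n))) \<le> (hh/2) * (2 * (L * E n + L * E (Suc n) + 2 * r))"
        using hh ng[OF n] ng[OF sn] by (intro mult_left_mono) auto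
      moreover have "(hh/2) * (2 * (L * E n + L * E (Suc n) + 2 * r)) = hh * (L * E n + L * E (Suc n) + 2 * r)" by simp
      ultimately show ?thesis using abs_B0[of w] nw dh by linarith
    qed
    have ps: "norm (\<psi> (Suc n)) \<le> norm (\<psi> n) + hh * (6 * (L * E n) + 6 * (L * E (Suc n)) + 8 * r) + 4 * (d / hh\<^sup>2)"
    proof -
      have "J (f (Suc n)) = J (f n) + (hh / 2) *\<^sub>R (J (c n) + J (c (Suc n))) + J w"
        by (subst fS) (simp add: J_simps)
      then have "ee *\<^sub>R J (\<phi> (Suc n)) = ee *\<^sub>R J (\<phi> n) - (hh / 2) *\<^sub>R (\<psi> n + \<psi> (Suc n)) + J w"
        by (simp add: J\<phi> cn[OF n] cn[OF sn] J_simps JJ\<phi> \<psi>_def algebra_simps)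
      \<comment> \<open>The right-hand side carries ee \<le> hh^2 and the left-hand side only hh, so
        after division the sum \<psi>(n) + \<psi>(n+1) is O(h) and \<psi> changes sign up to that
        error.\<close>
      then have h1: "(hh / 2) *\<^sub>R (\<psi> n + \<psi> (Suc n)) = ee *\<^sub>R (J (\<phi> n) - J (\<phi> (Suc n))) + J w"
        by (simp add: algebra_simps)
      have "(hh / 2) * norm (\<psi> n + \<psi> (Suc n)) = norm ((hh / 2) *\<^sub>R (\<psi> n + \<psi> (Suc n)))" using hh by simp
      also have "\<dots> \<le> ee * (norm (\<phi> n) + norm (\<phi> (Suc n))) + norm w"
        unfolding h1
        by (rule order_trans[OF norm_triangle_ineq])
          (use ee norm_triangle_ineq4[of "J (\<phi> n)" "J (\<phi> (Suc n))"] norm_J_le[of "\<phi> n"] norm_J_le[of "\<phi> (Suc n)"]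
            norm_J_le[of w] in \<open>auto intro!: add_mono mult_left_mono\<close>)
      also have "\<dots> \<le> hh\<^sup>2 * (3 * (L * E n) + 3 * (L * E (Suc n)) + 4 * r) + 2 * (d / hh)"
      proof -
        have a: "norm (\<phi> n) + norm (\<phi> (Suc n)) \<le> 3 * (L * E n) + 3 * (L * E (Suc n)) + 4 * r"
          using np[OF n] np[OF sn] by linarith
        show ?thesis by (rule add_mono[OF mult_mono[OF ee(2) a] nw]) auto
      qed
      finally have "(2 / hh) * ((hh / 2) * norm (\<psi> n + \<psi> (Suc n)))
          \<le> (2 / hh) * (hh\<^sup>2 * (3 * (L * E n) + 3 * (L * E (Suc n)) + 4 * r) + 2 * (d / hh))"
        using hh by (intro mult_left_mono) auto
      also have "\<dots> = hh * (6 * (L * E n) + 6 * (L * E (Suc n)) + 8 * r) + 4 * (d / hh\<^sup>2)"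
        using hh by (simp add: distrib_left power2_eq_square)
      finally have "norm (\<psi> n + \<psi> (Suc n)) \<le> hh * (6 * (L * E n) + 6 * (L * E (Suc n)) + 8 * r) + 4 * (d / hh\<^sup>2)"
        using hh by simp
      then show ?thesis using norm_triangle_ineq4[of "\<psi> n + \<psi> (Suc n)" "\<psi> n"] by simp
    qed
    have ES: "E (Suc n) = norm (e (Suc n)) + \<bar>\<phi>0 (Suc n)\<bar> + norm (\<psi> (Suc n))" by (simp only: E_def)
    have "E (Suc n) \<le> (norm (e n) + hh * (9 * (L * E n) + 6 * r) + d)
        + (\<bar>\<phi>0 n\<bar> + hh * (L * E n + L * E (Suc n) + 2 * r) + 2 * (d / hh\<^sup>2))
        + (norm (\<psi> n) + hh * (6 * (L * E n) + 6 * (L * E (Suc n)) + 8 * r) + 4 * (d / hh\<^sup>2))"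
      by (subst ES) (rule add_mono[OF add_mono[OF ne[OF n] p0] ps])
    also have "\<dots> = E n + (hh * (9 * (L * E n) + 6 * r) + hh * (L * E n + L * E (Suc n) + 2 * r)
        + hh * (6 * (L * E n) + 6 * (L * E (Suc n)) + 8 * r)) + (d + 2 * (d / hh\<^sup>2) + 4 * (d / hh\<^sup>2))"
    proof -
      have "norm (e n) + A + d + (\<bar>\<phi>0 n\<bar> + B + D1) + (norm (\<psi> n) + C + D2) = E n + (A + B + C) + (d + D1 + D2)"
        for A B C D1 D2 by (simp add: E_def)
      then show ?thesis .
    qed
    also have "hh * (9 * (L * E n) + 6 * r) + hh * (L * E n + L * E (Suc n) + 2 * r)
        + hh * (6 * (L * E n) + 6 * (L * E (Suc n)) + 8 * r) = hh * (16 * (L * E n) + 7 * (L * E (Suc n)) + 16 * r)"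
      by (simp add: algebra_simps)
    finally show ?thesis using dh by linarith
  qed
  define x where "x = L * hh"
  have x: "0 \<le> x" "x \<le> 1/16" using L hh by (auto simp: x_def)
  define q where "q = 16 * hh * r + 7 * (d / hh\<^sup>2)"
  have q: "q \<ge> 0" using hh r d by (simp add: q_def)
  \<comment> \<open>The step inequality contains E at the new index. For x \<le> 1/16 the factor 1 +
    14 x dominates the inverse of 1 - 7 x, and (1 + 16 x)(1 + 14 x) \<le> 1 + 44 x.\<close>
  have rec: "E (Suc n) \<le> (1 + 44 * x) * E n + 2 * q" if sn: "Suc n < m" for n
  proof -
    have s: "E (Suc n) * (1 - 7 * x) \<le> (1 + 16 * x) * E n + q"
      using step[OF sn] by (simp add: x_def q_def algebra_simps)
    have xx: "x * x \<le> x * (1/16)" using x by (intro mult_left_mono) auto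
    have "1 \<le> (1 - 7 * x) * (1 + 14 * x)" using xx x by (simp add: algebra_simps)
    then have "E (Suc n) \<le> E (Suc n) * ((1 - 7 * x) * (1 + 14 * x))"
      using E0[of "Suc n"] mult_left_mono by fastforce
    also have "\<dots> = (E (Suc n) * (1 - 7 * x)) * (1 + 14 * x)" by simp
    also have "\<dots> \<le> ((1 + 16 * x) * E n + q) * (1 + 14 * x)"
      using s x by (intro mult_right_mono) auto
    also have "\<dots> = ((1 + 16 * x) * (1 + 14 * x)) * E n + (1 + 14 * x) * q" by (simp add: algebra_simps)
    also have "\<dots> \<le> (1 + 44 * x) * E n + 2 * q"
    proof (intro add_mono mult_right_mono)
      show "(1 + 16 * x) * (1 + 14 * x) \<le> 1 + 44 * x" using xx x by (simp add: algebra_simps)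
    qed (use x q E0 in auto)
    finally show ?thesis .
  qed
  show ?thesis
  proof (cases m)
    case 0
    have "T \<ge> 0" using T hh 0 by simp
    then show ?thesis using e0 0 r d hh by simp
  next
    \<comment> \<open>The force bound holds only at indices below m. Thus E is controlled up to k =
      m - 1, and the last position follows from a single forward step.\<close>
    case (Suc k)
    have k: "k < m" "0 < m" using Suc by auto
    have "\<phi> 0 = 0" "\<phi>0 0 = 0" by (simp_all add: \<phi>_def \<phi>0_def f0 J_simps)
    moreover have "norm (\<gamma> 0) \<le> 2 * r"
    proof -
      have "norm (\<gamma> 0) \<le> (L * hh\<^sup>2) * norm (\<gamma> 0) + r"
        using \<gamma>[OF k(2)] cn[OF k(2)] \<open>\<phi> 0 = 0\<close> e0 f0 by (simp add: J_simps)
      also have "(L * hh\<^sup>2) * norm (\<gamma> 0) \<le> (1/16) * norm (\<gamma> 0)" using Lee by (intro mult_right_mono) auto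
      finally show ?thesis using r by simp
    qed
    ultimately have E00: "E 0 \<le> 2 * r"
      using norm_J_le[of "\<gamma> 0"] by (simp add: E_def e0 \<psi>_def)
    define D where "D = r + d / hh ^ 3"
    have D: "r \<le> D" "d / hh ^ 3 \<le> D" "D \<ge> 0" using r d hh by (auto simp: D_def)
    have T0: "T \<ge> 0" using T hh by (smt (verit) mult_nonneg_nonneg of_nat_0_le_iff)
    have kT: "real k * hh \<le> T" using T hh Suc by (simp add: algebra_simps)
    \<comment> \<open>One factor h is set aside for the summation over at most T/h steps, so the
      local defect d finally appears as d / h^3. The number 46 is 32 + 14.\<close>
    have qD: "2 * q \<le> hh * (46 * D)"
    proof -
      have "d / hh\<^sup>2 = hh * (d / hh ^ 3)" using hh by (simp add: power2_eq_square power3_eq_cube)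
      then have "2 * q = hh * (32 * r + 14 * (d / hh ^ 3))" by (simp add: q_def algebra_simps)
      also have "\<dots> \<le> hh * (46 * D)" using D hh by (intro mult_left_mono) auto
      finally show ?thesis .
    qed
    have "E k \<le> (1 + 44 * x) ^ k * (E 0 + real k * (2 * q))"
      by (rule linear_recursion_bound[where E = E and m = m]) (use rec k x q in auto)
    also have "\<dots> \<le> exp (44 * L * T) * (2 * D + 46 * T * D)"
    proof (rule mult_mono)
      have "(1 + 44 * x) ^ k \<le> exp (44 * x) ^ k"
        using x by (intro power_mono) (auto simp: exp_ge_add_one_self)
      also have "\<dots> = exp (44 * L * (real k * hh))" by (simp add: exp_of_nat_mult[symmetric] x_def algebra_simps)
      also have "\<dots> \<le> exp (44 * L * T)" using kT L by simp
      finally show "(1 + 44 * x) ^ k \<le> exp (44 * L * T)" .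
      have "real k * (2 * q) \<le> real k * (hh * (46 * D))" using qD by (intro mult_left_mono) auto
      also have "\<dots> = (real k * hh) * (46 * D)" by simp
      also have "\<dots> \<le> T * (46 * D)" using kT D by (intro mult_right_mono) auto
      finally have "real k * (2 * q) \<le> 46 * T * D" by simp
      moreover have "E 0 \<le> 2 * D" using E00 D by linarith
      ultimately show "E 0 + real k * (2 * q) \<le> 2 * D + 46 * T * D" by linarith
      show "0 \<le> E 0 + real k * (2 * q)" using E0[of 0] q by simp
    qed simp
    finally have Ek: "E k \<le> exp (44 * L * T) * (2 + 46 * T) * D" by (simp add: algebra_simps)
    have ek: "norm (e k) \<le> E k" by (simp add: E_def)
    have "norm (e m) \<le> norm (e k) + hh * (9 * (L * E k) + 6 * r) + d" using ne[OF k(1)] Suc by simp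
    also have "hh * (9 * (L * E k) + 6 * r) \<le> E k + 6 * r"
    proof -
      have "hh * (9 * (L * E k)) = 9 * x * E k" by (simp add: x_def)
      also have "\<dots> \<le> 1 * E k" using x E0[of k] by (intro mult_right_mono) auto
      finally have "hh * (9 * (L * E k)) \<le> E k" by simp
      moreover have "hh * (6 * r) \<le> 1 * (6 * r)" using hh r by (intro mult_right_mono) auto
      ultimately show ?thesis by (simp add: algebra_simps)
    qed
    also have "d \<le> d / hh ^ 3"
    proof -
      have "hh ^ 3 \<le> 1" using hh by (simp add: power_le_one)
      then show ?thesis using hh d by (simp add: le_divide_eq mult_left_le)
    qed
    finally have "norm (e m) \<le> 2 * E k + 6 * r + d / hh ^ 3" using ek by linarith
    also have "\<dots> \<le> 2 * (exp (44 * L * T) * (2 + 46 * T) * D) + 6 * D + D" using Ek D by linarith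
    finally show ?thesis by (simp add: D_def algebra_simps)
  qed
qed

end

section \<open>Tracking of the numerical solution\<close>

lemma norm_state_le: "norm (u :: modst) \<le> norm (fst u) + \<bar>fst (snd u)\<bar> + norm (snd (snd u))"
proof -
  have "norm u \<le> norm (fst u) + norm (snd u)" using norm_Pair_le[of "fst u" "snd u"] by simp
  also have "norm (snd u) \<le> norm (fst (snd u)) + norm (snd (snd u))"
    using norm_Pair_le[of "fst (snd u)" "snd (snd u)"] by simp
  finally show ?thesis by simp
qed

lemma norm_state_comps:
  fixes u :: modst
  shows "norm (fst u) \<le> norm u" "\<bar>fst (snd u)\<bar> \<le> norm u" "norm (snd (snd u)) \<le> norm u"
proof -
  show "norm (fst u) \<le> norm u" by (rule fst_le)
  show "\<bar>fst (snd u)\<bar> \<le> norm u" using fst_le[of "snd u"] snd_le[of u] by simp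
  show "norm (snd (snd u)) \<le> norm u" using snd_le[of "snd u"] snd_le[of u] by linarith
qed

section \<open>Estimates along solutions of the modulation field\<close>

context step_family begin

lemma eqv_bound:
  fixes f f' :: "'p \<Rightarrow> 'a::euclidean_space \<Rightarrow> 'b::real_normed_vector"
  assumes "eqv m f f'"
  obtains C where "C > 0" "\<And>p u. p \<in> P \<Longrightarrow> norm u \<le> r \<Longrightarrow> norm (f p u - f' p u) \<le> C * h p ^ m"
proof -
  obtain C where C: "C > 0" "\<And>p u. p \<in> P \<Longrightarrow> norm u \<le> r \<Longrightarrow> norm ((1 / h p ^ m) *\<^sub>R (f p u - f' p u)) \<le> C"
    using assms loc_boundedD[of P "\<lambda>p u. (1 / h p ^ m) *\<^sub>R (f p u - f' p u)" r] smf_loc_bounded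
    unfolding eqv_def by blast
  show thesis
  proof (rule that[OF C(1)])
    fix p and u :: 'a assume pu: "p \<in> P" "norm u \<le> r"
    have "norm (f p u - f' p u) / h p ^ m \<le> C" using C(2)[OF pu] h[OF pu(1)] unfolding norm_scaleR by simp
    then show "norm (f p u - f' p u) \<le> C * h p ^ m" using h[OF pu(1)] by (simp add: divide_le_eq)
  qed
qed

lemma smf_bound:
  assumes "smf P f"
  obtains C where "C > 0" "\<And>p u. p \<in> P \<Longrightarrow> norm u \<le> r \<Longrightarrow> norm (f p u) \<le> C"
  using loc_boundedD[OF smf_loc_bounded[OF assms], of r thesis] by blast

definition sol :: "('p \<Rightarrow> 'a::euclidean_space \<Rightarrow> 'a) \<Rightarrow> 'p \<Rightarrow> real \<Rightarrow> (real \<Rightarrow> 'a) \<Rightarrow> bool" where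
  "sol G p \<tau> u \<longleftrightarrow> (\<forall>t\<in>{0..\<tau>}. (u has_vector_derivative G p (u t)) (at t within {0..\<tau>}))"

lemma sol_chain:
  fixes f :: "'p \<Rightarrow> 'a::euclidean_space \<Rightarrow> 'b::real_normed_vector"
  assumes u: "sol G p \<tau> u" and f: "smf P f" and p: "p \<in> P" and t: "t \<in> {0..\<tau>}"
  shows "((\<lambda>t. f p (u t)) has_vector_derivative lie G f p (u t)) (at t within {0..\<tau>})"
proof -
  note d = smf_has_derivative[OF f p, of "u t"]
  have "(u has_derivative (\<lambda>s. s *\<^sub>R G p (u t))) (at t within {0..\<tau>})"
    using u t by (simp add: sol_def has_vector_derivative_def)
  from has_derivative_compose[OF this d]
  have "((\<lambda>t. f p (u t)) has_derivative (\<lambda>s. frechet_derivative (f p) (at (u t)) (s *\<^sub>R G p (u t)))) (at t within {0..\<tau>})" .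
  moreover have "frechet_derivative (f p) (at (u t)) (s *\<^sub>R G p (u t)) = s *\<^sub>R lie G f p (u t)" for s
    unfolding lie_def using linear_scale[OF has_derivative_linear[OF d]] .
  ultimately show ?thesis by (simp add: has_vector_derivative_def)
qed

lemma sol_chain_pow:
  fixes f :: "'p \<Rightarrow> 'a::euclidean_space \<Rightarrow> 'b::real_normed_vector"
  assumes u: "sol G p \<tau> u" and f: "smf P f" and G: "smf P G" and p: "p \<in> P" and t: "t \<in> {0..\<tau>}"
  shows "((\<lambda>t. (lie G ^^ k) f p (u t)) has_vector_derivative (lie G ^^ Suc k) f p (u t)) (at t within {0..\<tau>})"
  using sol_chain[OF u smf_liepow[OF f G] p t, of k] by simp

end

context modulation begin

text \<open>The constant bounds an iterated Lie derivative on a ball, so it is independent of the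
  solution and its interval. The Taylor polynomial has degree 2n+2, which leaves h^(2n+3).\<close>

lemma taylor_along:
  fixes f :: "'p \<Rightarrow> 'a::euclidean_space \<Rightarrow> 'b::real_normed_vector"
  assumes f: "smf P f" and G: "smf P G"
  obtains C where "C > 0" "\<And>p \<tau> u t \<sigma>. p \<in> P \<Longrightarrow> sol G p \<tau> u \<Longrightarrow> (\<And>t. t \<in> {0..\<tau>} \<Longrightarrow> norm (u t) \<le> r) \<Longrightarrow>
      t \<in> {0..\<tau>} \<Longrightarrow> \<sigma> = 1 \<or> \<sigma> = -1 \<Longrightarrow> t + \<sigma> * h p \<in> {0..\<tau>} \<Longrightarrow>
      norm (f p (u (t + \<sigma> * h p)) - (f p (u t) + (\<sigma> * h p) *\<^sub>R cdiff n G (lie G f) p (u t)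
         + ((h p)\<^sup>2 / 2) *\<^sub>R sdiff n G (lie G f) p (u t))) \<le> C * h p ^ (2 * n + 3)"
proof -
  obtain C where C: "C > 0" "\<And>p u. p \<in> P \<Longrightarrow> norm u \<le> r \<Longrightarrow> norm ((lie G ^^ (2 * n + 3)) f p u) \<le> C"
    using smf_bound[OF smf_liepow[OF f G]] by blast
  show thesis
  proof (rule that[OF C(1)])
    fix p \<tau> u t \<sigma> assume p: "p \<in> P" and u: "sol G p \<tau> u" and r: "\<And>t. t \<in> {0..\<tau>} \<Longrightarrow> norm (u t) \<le> r"
      and t: "t \<in> {0..\<tau>}" and \<sigma>: "\<sigma> = 1 \<or> \<sigma> = -1" and th: "t + \<sigma> * h p \<in> {0..\<tau>}"
    have A: "norm ((\<lambda>k t. (lie G ^^ k) f p (u t)) 0 (t + \<sigma> * h p)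
        - (\<Sum>k\<le>2*n+2. ((t + \<sigma> * h p - t) ^ k / fact k) *\<^sub>R (\<lambda>k t. (lie G ^^ k) f p (u t)) k t))
      \<le> C * \<bar>t + \<sigma> * h p - t\<bar> ^ Suc (2 * n + 2)"
    proof (rule taylor_bound[where S = "{0..\<tau>}"])
      fix k s assume s: "s \<in> {0..\<tau>}"
      show "((\<lambda>t. (lie G ^^ k) f p (u t)) has_vector_derivative (lie G ^^ Suc k) f p (u s)) (at s within {0..\<tau>})"
        by (rule sol_chain_pow[OF u f G p s])
      have "Suc (2 * n + 2) = 2 * n + 3" by simp
      then show "norm ((lie G ^^ Suc (2 * n + 2)) f p (u s)) \<le> C" using C(2)[OF p r[OF s]] by metis
    qed (use t th in auto)
    have e: "t + \<sigma> * h p - t = \<sigma> * h p" "\<bar>\<sigma> * h p\<bar> = h p" "Suc (2 * n + 2) = 2 * n + 3"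
      using \<sigma> h[OF p] by auto
    show "norm (f p (u (t + \<sigma> * h p)) - (f p (u t) + (\<sigma> * h p) *\<^sub>R cdiff n G (lie G f) p (u t)
         + ((h p)\<^sup>2 / 2) *\<^sub>R sdiff n G (lie G f) p (u t))) \<le> C * h p ^ (2 * n + 3)"
      using A by (simp only: taylor_sum[OF \<sigma>] e funpow_0)
  qed
qed

end

text \<open>\<open>lead\<close> identifies the force with v \<times> B1 + E up to h^2 + |b|, where b
  stands for h^2 times the acceleration. In \<open>lip\<close> the first argument triple is
  restricted only through x and its neighbours x \<plusminus> h v + b/2: compactness controls
  numerical positions, but not numerical velocities or accelerations.\<close>

locale two_step_modulation = modulation P h \<epsilon> B0 g n for P :: "'p set" and h \<epsilon> B0 g n +
  fixes Bf Ef :: "'p \<Rightarrow> real^3 \<Rightarrow> real^3"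
  assumes Bf: "smf P Bf" and Ef: "smf P Ef" and n1: "n \<ge> 1"
    and lead: "\<exists>C>0. \<forall>p\<in>P. \<forall>x v b. norm x \<le> R \<and> norm v \<le> R \<and> norm b \<le> R \<longrightarrow>
      norm (g p (x, v, b) - (cross3 v (Bf p x) + Ef p x)) \<le> C * ((h p)\<^sup>2 + norm b)"
    and lip: "\<exists>C>0. \<forall>p\<in>P. \<forall>x v b x' v' b'.
      norm x \<le> R \<and> norm (x + h p *\<^sub>R v + (1/2) *\<^sub>R b) \<le> R \<and> norm (x - h p *\<^sub>R v + (1/2) *\<^sub>R b) \<le> R \<and>
      norm x' \<le> R \<and> norm v' \<le> R \<and> norm b' \<le> R \<longrightarrow>
      norm (g p (x, v, b) - g p (x', v', b')) \<le> C * (norm (x - x') + norm (v - v') + norm (b - b'))"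
begin

abbreviation "\<Gamma> \<equiv> Gam n"
abbreviation "G \<equiv> vf \<Gamma>"

definition Fo :: "'p \<Rightarrow> (real^3) \<times> (real^3) \<Rightarrow> real^3" where
  "Fo p yv = cross3 (snd yv) (Bf p (fst yv)) + Ef p (fst yv)"

lemma smf_Fo: "smf P Fo"
proof -
  have f: "smf P (\<lambda>p (yv :: (real^3) \<times> (real^3)). fst yv)" "smf P (\<lambda>p (yv :: (real^3) \<times> (real^3)). snd yv)"
    by (rule smf_linear[OF bounded_linear_fst smf_id], rule smf_linear[OF bounded_linear_snd smf_id])
  have "smf P (\<lambda>p (yv :: (real^3) \<times> (real^3)). cross3 (snd yv) (Bf p (fst yv)) + Ef p (fst yv))"
    by (rule smf_add[OF smf_bilinear[OF bilinear_conv_bounded_bilinear[THEN iffD1, OF bilinear_cross] f(2) smf_compose[OF Bf f(1)]]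
      smf_compose[OF Ef f(1)]])
  then show ?thesis unfolding Fo_def[abs_def] .
qed

lemma sG: "smf P \<Gamma>" by (rule smf_Gam)
lemma vG: "vanG \<Gamma>" by (rule vanG_Gam)
lemma vZ: "van (cZ \<Gamma>)" and vQ: "van (cQ \<Gamma>)" using vG by (auto simp: vanG_def)

lemma h_le: "p \<in> P \<Longrightarrow> k \<le> l \<Longrightarrow> h p ^ l \<le> h p ^ k"
  using h[of p] h1[of p] by (intro power_decreasing) auto

lemma fixed_point_defect:
  obtains C where "C > 0" "\<And>p u. p \<in> P \<Longrightarrow> norm u \<le> r \<Longrightarrow> norm (\<Gamma> p u - rhs \<Gamma> p u) \<le> C * h p ^ (2 * n)"
  using eqv_bound[OF eqv_Gam[of n], of r thesis] by blast

text \<open>If z = O(h^2), the three arguments of the force differ from y, y' and 0 by O(h^2) for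
  either parity. The averaged force is then v \<times> B1 + E up to O(h^2), the remaining terms of
  \<open>rhs\<close> carry h^2 or \<epsilon>, and the fixed point defect h^(2n) is at most h^2
  because n \<ge> 1.\<close>

lemma lead_est:
  assumes A: "A \<ge> 0"
  obtains C where "C > 0" "\<And>p u. p \<in> P \<Longrightarrow> norm u \<le> r \<Longrightarrow> norm (snd (snd u)) \<le> A * (h p)\<^sup>2 \<Longrightarrow>
      \<bar>cW \<Gamma> p u - B0 \<bullet> Fo p (fst u, vy \<Gamma> p u)\<bar> \<le> C * (h p)\<^sup>2 \<and>
      norm (cY \<Gamma> p u - Fo p (fst u, vy \<Gamma> p u)) \<le> C * (h p)\<^sup>2"
proof -
  note zd = van_ops[OF sG smf_zd[OF sG] van_zd[OF vG] vZ]
  note sF = smf_vf[OF sG]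
  obtain c1 where c1: "c1 > 0" "\<And>p u. p \<in> P \<Longrightarrow> norm u \<le> r \<Longrightarrow> norm (Dp n G (vy \<Gamma>) p u) \<le> c1"
    using smf_bound[OF smf_Dp[OF smf_vy[OF sG] sF]] by blast
  obtain c2 where c2: "c2 > 0" "\<And>p u. p \<in> P \<Longrightarrow> norm u \<le> r \<Longrightarrow> norm (sdiff n G (vy \<Gamma>) p u) \<le> c2"
    using smf_bound[OF smf_sdiff[OF smf_vy[OF sG] sF]] by blast
  obtain c3 where c3: "c3 > 0" "\<And>p u. p \<in> P \<Longrightarrow> norm u \<le> r \<Longrightarrow> norm (zt \<Gamma> p u) \<le> c3 * norm (snd (snd u))"
    using van_bound[OF smf_zt[OF sG] van_zt[OF vG], of r] by blast
  obtain c4 where c4: "c4 > 0" "\<And>p u. p \<in> P \<Longrightarrow> norm u \<le> r \<Longrightarrow> norm (cdiff n G (zd \<Gamma>) p u) \<le> c4 * norm (snd (snd u))"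
    using van_bound[OF smf_cdiff[OF smf_zd[OF sG] sF] zd(3), of r] by blast
  obtain c5 where c5: "c5 > 0" "\<And>p u. p \<in> P \<Longrightarrow> norm u \<le> r \<Longrightarrow> norm (sdiff n G (zd \<Gamma>) p u) \<le> c5"
    using smf_bound[OF smf_sdiff[OF smf_zd[OF sG] sF]] by blast
  obtain c6 where c6: "c6 > 0" "\<And>p u. p \<in> P \<Longrightarrow> norm u \<le> r \<Longrightarrow> norm (Sp n G (cW \<Gamma>) p u) \<le> c6"
    using smf_bound[OF smf_Sp[OF smf_comps(1)[OF sG] sF]] by blast
  obtain c7 where c7: "c7 > 0" "\<And>p u. p \<in> P \<Longrightarrow> norm u \<le> r \<Longrightarrow> norm (Dp n G (cY \<Gamma>) p u) \<le> c7"
    using smf_bound[OF smf_Dp[OF smf_comps(2)[OF sG] sF]] by blast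
  obtain c8 where c8: "c8 > 0" "\<And>p u. p \<in> P \<Longrightarrow> norm u \<le> r \<Longrightarrow> norm (sdiff n G (cY \<Gamma>) p u) \<le> c8"
    using smf_bound[OF smf_sdiff[OF smf_comps(2)[OF sG] sF]] by blast
  obtain c9 where c9: "c9 > 0" "\<And>p u. p \<in> P \<Longrightarrow> norm u \<le> r \<Longrightarrow> norm (\<Gamma> p u - rhs \<Gamma> p u) \<le> c9 * h p ^ (2 * n)"
    using fixed_point_defect[of r] by blast
  obtain c10 where c10: "c10 > 0" "\<And>p u. p \<in> P \<Longrightarrow> norm u \<le> r \<Longrightarrow> norm (vy \<Gamma> p u) \<le> c10"
    using smf_bound[OF smf_vy[OF sG]] by blast
  define a where "a = 1 + c3 * A + c1 + c4 * A + c2 + 4 * (c3 * A) + c5"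
  have nn: "c3 * A \<ge> 0" "c4 * A \<ge> 0" using c3 c4 A by auto
  have a1: "a \<ge> 1" unfolding a_def using nn c1(1) c2(1) c5(1) by linarith
  define R where "R = \<bar>r\<bar> + c10 + a"
  obtain l1 where l1: "l1 > 0" "\<And>p x v b. p \<in> P \<Longrightarrow> norm x \<le> R \<Longrightarrow> norm v \<le> R \<Longrightarrow> norm b \<le> R \<Longrightarrow>
      norm (g p (x, v, b) - Fo p (x, v)) \<le> l1 * ((h p)\<^sup>2 + norm b)"
    using lead[of R] unfolding Fo_def by auto
  obtain l2 where l2: "l2 > 0" "\<And>p u v. p \<in> P \<Longrightarrow> norm u \<le> R + R \<Longrightarrow> norm v \<le> R + R \<Longrightarrow> norm (Fo p u - Fo p v) \<le> l2 * norm (u - v)"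
    using smf_lipschitz[OF smf_Fo, of "R + R"] by blast
  define C where "C = l1 * (1 + a) + l2 * (a + a) + c6 + c7 + c8 + c9"
  show thesis
  proof (rule that[of C])
    have "l1 * (1 + a) > 0" "l2 * (a + a) > 0" using l1(1) l2(1) a1 by auto
    then show C0: "C > 0" using c6(1) c7(1) c8(1) c9(1) unfolding C_def by linarith
    fix p and u :: modst assume p: "p \<in> P" and u: "norm u \<le> r" and z: "norm (snd (snd u)) \<le> A * (h p)\<^sup>2"
    let ?h = "(h p)\<^sup>2" and ?y = "fst u" and ?v = "vy \<Gamma> p u"
    have hp: "0 \<le> ?h" "?h \<le> 1" using h[OF p] h1[OF p] by (auto simp: power_le_one)
    have mz: "c * norm (snd (snd u)) \<le> (c * A) * ?h" if "c > 0" for c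
      using mult_left_mono[OF z less_imp_le[OF that]] by (simp only: mult.assoc)
    have zt: "norm (zt \<Gamma> p u) \<le> (c3 * A) * ?h"
      by (rule order_trans[OF c3(2)[OF p u] mz[OF c3(1)]])
    have cdz: "norm (cdiff n G (zd \<Gamma>) p u) \<le> (c4 * A) * ?h"
      by (rule order_trans[OF c4(2)[OF p u] mz[OF c4(1)]])
    have ah: "k * ?h \<le> a * ?h" if "k \<le> a" for k using that hp by (simp add: mult_right_mono)
    have gs: "norm (gs s \<Gamma> p u - Fo p (?y, ?v)) \<le> (l1 * (1 + a) + l2 * (a + a)) * ?h" if s: "s = 1 \<or> s = -1" for s
    proof -
      have X: "norm (xs s \<Gamma> p u - ?y) \<le> a * ?h"
      proof -
        have "norm (xs s \<Gamma> p u - ?y) = norm (zt \<Gamma> p u)" using s by (auto simp: xs_def Yc_def)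
        moreover have "c3 * A \<le> a" unfolding a_def using nn c1(1) c2(1) c5(1) by linarith
        ultimately show ?thesis using zt ah[of "c3 * A"] by linarith
      qed
      have V: "norm (vs s \<Gamma> p u - ?v) \<le> a * ?h"
      proof -
        have eq: "vs s \<Gamma> p u - ?v = ?h *\<^sub>R Dp n G (vy \<Gamma>) p u - s *\<^sub>R cdiff n G (zd \<Gamma>) p u"
          by (simp add: vs_def cdiff_def[of _ _ "vy \<Gamma>"])
        have "norm (vs s \<Gamma> p u - ?v) \<le> ?h * norm (Dp n G (vy \<Gamma>) p u) + norm (cdiff n G (zd \<Gamma>) p u)"
          unfolding eq using s by (intro order_trans[OF norm_triangle_ineq4]) auto
        also have "\<dots> \<le> ?h * c1 + (c4 * A) * ?h"
          by (rule add_mono[OF mult_left_mono[OF c1(2)[OF p u] hp(1)] cdz])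
        also have "\<dots> = (c1 + c4 * A) * ?h" by (simp add: algebra_simps)
        also have "\<dots> \<le> a * ?h" by (rule ah, unfold a_def) (use nn c1(1) c2(1) c5(1) in linarith)
        finally show ?thesis .
      qed
      have B: "norm (bs s \<Gamma> p u) \<le> a * ?h"
      proof -
        have "norm (bs s \<Gamma> p u) \<le> ?h * norm (sdiff n G (vy \<Gamma>) p u) + norm (4 *\<^sub>R zt \<Gamma> p u + ?h *\<^sub>R sdiff n G (zd \<Gamma>) p u)"
          unfolding bs_def using s by (intro order_trans[OF norm_triangle_ineq4]) auto
        moreover have "norm (4 *\<^sub>R zt \<Gamma> p u + ?h *\<^sub>R sdiff n G (zd \<Gamma>) p u) \<le> 4 * norm (zt \<Gamma> p u) + ?h * norm (sdiff n G (zd \<Gamma>) p u)"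
          by (rule order_trans[OF norm_triangle_ineq]) simp
        ultimately have "norm (bs s \<Gamma> p u) \<le> ?h * norm (sdiff n G (vy \<Gamma>) p u) + (4 * norm (zt \<Gamma> p u) + ?h * norm (sdiff n G (zd \<Gamma>) p u))"
          by linarith
        also have "\<dots> \<le> ?h * c2 + (4 * ((c3 * A) * ?h) + ?h * c5)"
          by (rule add_mono[OF mult_left_mono[OF c2(2)[OF p u] hp(1)] add_mono[OF mult_left_mono[OF zt] mult_left_mono[OF c5(2)[OF p u] hp(1)]]])
            simp
        also have "\<dots> = (c2 + 4 * (c3 * A) + c5) * ?h" by (simp add: algebra_simps)
        also have "\<dots> \<le> a * ?h" by (rule ah, unfold a_def) (use nn c1(1) c2(1) c5(1) in linarith)
        finally show ?thesis by simp
      qed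
      have aR: "a * ?h \<le> a" using hp a1 by (simp add: mult_left_le)
      have y: "norm ?y \<le> \<bar>r\<bar>" "norm ?v \<le> c10" using fst_le[of u] u c10(2)[OF p u] by linarith+
      have Rs: "norm (xs s \<Gamma> p u) \<le> R" "norm (vs s \<Gamma> p u) \<le> R" "norm (bs s \<Gamma> p u) \<le> R" "norm ?y \<le> R" "norm ?v \<le> R"
      proof -
        have "norm (xs s \<Gamma> p u) \<le> norm ?y + norm (xs s \<Gamma> p u - ?y)" "norm (vs s \<Gamma> p u) \<le> norm ?v + norm (vs s \<Gamma> p u - ?v)"
          using norm_triangle_ineq[of ?y "xs s \<Gamma> p u - ?y"] norm_triangle_ineq[of ?v "vs s \<Gamma> p u - ?v"] by simp_all
        then show "norm (xs s \<Gamma> p u) \<le> R" "norm (vs s \<Gamma> p u) \<le> R" "norm (bs s \<Gamma> p u) \<le> R" "norm ?y \<le> R" "norm ?v \<le> R"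
          using X V B aR y c10(1) a1 unfolding R_def by linarith+
      qed
      have pr: "norm (a, b) \<le> R + R" if "norm a \<le> R" "norm b \<le> R" for a b :: "real^3"
        using norm_Pair_le[of a b] that by linarith
      have "norm (gs s \<Gamma> p u - Fo p (xs s \<Gamma> p u, vs s \<Gamma> p u)) \<le> l1 * (?h + norm (bs s \<Gamma> p u))"
        unfolding gs_def by (rule l1(2)[OF p Rs(1-3)])
      also have "\<dots> \<le> l1 * (?h + a * ?h)" by (rule mult_left_mono[OF add_left_mono[OF B] less_imp_le[OF l1(1)]])
      finally have 1: "norm (gs s \<Gamma> p u - Fo p (xs s \<Gamma> p u, vs s \<Gamma> p u)) \<le> l1 * (?h + a * ?h)" .
      have "norm (Fo p (xs s \<Gamma> p u, vs s \<Gamma> p u) - Fo p (?y, ?v)) \<le> l2 * norm ((xs s \<Gamma> p u, vs s \<Gamma> p u) - (?y, ?v))"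
        by (rule l2(2)[OF p pr[OF Rs(1,2)] pr[OF Rs(4,5)]])
      also have "\<dots> \<le> l2 * (a * ?h + a * ?h)"
      proof (rule mult_left_mono)
        show "norm ((xs s \<Gamma> p u, vs s \<Gamma> p u) - (?y, ?v)) \<le> a * ?h + a * ?h"
          using norm_Pair_le[of "xs s \<Gamma> p u - ?y" "vs s \<Gamma> p u - ?v"] X V unfolding diff_Pair by linarith
      qed (use l2(1) in simp)
      finally have 2: "norm (Fo p (xs s \<Gamma> p u, vs s \<Gamma> p u) - Fo p (?y, ?v)) \<le> l2 * (a * ?h + a * ?h)" .
      have "norm (gs s \<Gamma> p u - Fo p (?y, ?v)) \<le> l1 * (?h + a * ?h) + l2 * (a * ?h + a * ?h)"
        using norm_triangle_ineq[of "gs s \<Gamma> p u - Fo p (xs s \<Gamma> p u, vs s \<Gamma> p u)" "Fo p (xs s \<Gamma> p u, vs s \<Gamma> p u) - Fo p (?y, ?v)"]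
          1 2 by simp
      then show ?thesis by (simp add: algebra_simps)
    qed
    have ge: "norm (ge \<Gamma> p u - Fo p (?y, ?v)) \<le> (l1 * (1 + a) + l2 * (a + a)) * ?h"
    proof -
      let ?F = "Fo p (?y, ?v)"
      have avg: "(1/2) *\<^sub>R (a + b) - c = (1/2) *\<^sub>R ((a - c) + (b - c))" for a b c :: "real^3"
        using scaleR_left.add[of "1/2" "1/2" c] by (simp add: scaleR_add_right scaleR_diff_right)
      have "ge \<Gamma> p u - ?F = (1/2) *\<^sub>R ((gs 1 \<Gamma> p u - ?F) + (gs (-1) \<Gamma> p u - ?F))"
        unfolding ge_def by (rule avg)
      then have "norm (ge \<Gamma> p u - ?F) = (1/2) * norm ((gs 1 \<Gamma> p u - ?F) + (gs (-1) \<Gamma> p u - ?F))"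
        by (simp only: norm_scaleR)
      moreover have "norm ((gs 1 \<Gamma> p u - ?F) + (gs (-1) \<Gamma> p u - ?F)) \<le> norm (gs 1 \<Gamma> p u - ?F) + norm (gs (-1) \<Gamma> p u - ?F)"
        by (rule norm_triangle_ineq)
      ultimately show ?thesis using gs[of 1] gs[of "-1"] by linarith
    qed
    have df: "norm (\<Gamma> p u - rhs \<Gamma> p u) \<le> c9 * ?h"
      by (rule order_trans[OF c9(2)[OF p u] mult_left_mono[OF h_le[OF p]]]) (use n1 c9(1) in auto)
    have e: "\<epsilon> p \<le> ?h" "0 < \<epsilon> p" using eps_le[OF p] eps[OF p] by auto
    let ?d = "\<Gamma> p u - rhs \<Gamma> p u"
    have dW: "\<bar>cW \<Gamma> p u - cW (rhs \<Gamma>) p u\<bar> \<le> norm ?d" using fst_le[of ?d] by (simp add: cW_def)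
    have dY: "norm (cY \<Gamma> p u - cY (rhs \<Gamma>) p u) \<le> norm ?d"
      using fst_le[of "snd ?d"] snd_le[of ?d] by (simp add: cY_def)
    have 6: "norm (?h *\<^sub>R Sp n G (cW \<Gamma>) p u) \<le> c6 * ?h" using mult_left_mono[OF c6(2)[OF p u] hp(1)] unfolding norm_scaleR mult.commute[of c6] by simp
    have 7: "norm (?h *\<^sub>R Dp n G (cY \<Gamma>) p u) \<le> c7 * ?h" using mult_left_mono[OF c7(2)[OF p u] hp(1)] unfolding norm_scaleR mult.commute[of c7] by simp
    have 8: "norm (\<epsilon> p *\<^sub>R J (sdiff n G (cY \<Gamma>) p u)) \<le> c8 * ?h"
    proof -
      have "norm (\<epsilon> p *\<^sub>R J (sdiff n G (cY \<Gamma>) p u)) = \<epsilon> p * norm (J (sdiff n G (cY \<Gamma>) p u))" using e by simp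
      also have "\<dots> \<le> ?h * c8"
        using mult_mono[OF e(1) order_trans[OF norm_J_le c8(2)[OF p u]] hp(1)] by simp
      finally show ?thesis by (simp add: mult.commute)
    qed
    have CC: "C * ?h = (l1 * (1 + a) + l2 * (a + a)) * ?h + c6 * ?h + c7 * ?h + c8 * ?h + c9 * ?h"
      by (simp add: C_def algebra_simps)
    have pos: "0 \<le> c6 * ?h" "0 \<le> c7 * ?h" "0 \<le> c8 * ?h" using c6 c7 c8 hp by auto
    have "\<bar>cW \<Gamma> p u - B0 \<bullet> Fo p (?y, ?v)\<bar> \<le> C * ?h"
    proof -
      have "cW \<Gamma> p u - B0 \<bullet> Fo p (?y, ?v) = (cW \<Gamma> p u - cW (rhs \<Gamma>) p u) + B0 \<bullet> (ge \<Gamma> p u - Fo p (?y, ?v)) - ?h *\<^sub>R Sp n G (cW \<Gamma>) p u"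
        by (simp add: rhs_comps inner_diff_right)
      then show ?thesis using dW df abs_B0[of "ge \<Gamma> p u - Fo p (?y, ?v)"] ge 6 pos unfolding CC real_norm_def by linarith
    qed
    moreover have "norm (cY \<Gamma> p u - Fo p (?y, ?v)) \<le> C * ?h"
    proof -
      let ?b = "ge \<Gamma> p u - Fo p (?y, ?v)" and ?c = "?h *\<^sub>R Dp n G (cY \<Gamma>) p u" and ?e = "\<epsilon> p *\<^sub>R J (sdiff n G (cY \<Gamma>) p u)"
      have eq: "cY \<Gamma> p u - Fo p (?y, ?v) = (cY \<Gamma> p u - cY (rhs \<Gamma>) p u) + ?b - ?c - ?e"
        by (simp add: rhs_comps)
      have tri: "norm (a + b - c - e) \<le> norm a + norm b + norm c + norm e" for a b c e :: "real^3"
        using norm_triangle_ineq4[of "a + b - c" e] norm_triangle_ineq4[of "a + b" c] norm_triangle_ineq[of a b] by linarith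
      have "norm (cY \<Gamma> p u - Fo p (?y, ?v)) \<le> norm (cY \<Gamma> p u - cY (rhs \<Gamma>) p u) + norm ?b + norm ?c + norm ?e"
        unfolding eq by (rule tri)
      then show ?thesis using dY df ge 7 8 pos unfolding CC by linarith
    qed
    ultimately show "\<bar>cW \<Gamma> p u - B0 \<bullet> Fo p (?y, ?v)\<bar> \<le> C * ?h \<and> norm (cY \<Gamma> p u - Fo p (?y, ?v)) \<le> C * ?h" ..
  qed
qed

text \<open>The z component of the field lies in the image of \<open>J\<close>, so B0 . z is a
  constant of motion.\<close>

lemma B0_z_invariant:
  assumes u: "sol G p \<tau> u" and p: "p \<in> P" and 0: "B0 \<bullet> snd (snd (u 0)) = 0" and t: "t \<in> {0..\<tau>}"
  shows "B0 \<bullet> snd (snd (u t)) = 0"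
proof -
  have s: "smf P (\<lambda>p u. B0 \<bullet> Zc p u)" by (rule smf_linear[OF blB0(2) smf_coords(3)])
  have l: "lie G (\<lambda>p u. B0 \<bullet> Zc p u) p w = 0" for w
    using lie_linear[of P Zc "\<lambda>p a. B0 \<bullet> a" p G w, OF smf_coords(3) blB0(2) p] by (simp add: lie_coords B0_vz[OF sG])
  have "norm (B0 \<bullet> Zc p (u t) - B0 \<bullet> Zc p (u 0)) \<le> 0 * \<bar>t - 0\<bar>"
    by (rule vector_derivative_bound[where S = "{0..\<tau>}" and f' = "\<lambda>_. 0"])
      (use sol_chain[OF u s p] l t in auto)
  then show ?thesis using 0 by (simp add: Zc_def)
qed

text \<open>The grid values of the oscillating curve satisfy the two-step relation up to the residual and
  the Taylor remainders, so that the stability estimate applies.\<close>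

lemma tracking:
  assumes T: "T > 0"
  obtains C h0 where "C > 0" "h0 > 0" "\<And>p \<tau> u x v a m. p \<in> P \<Longrightarrow> h p \<le> h0 \<Longrightarrow> \<tau> \<le> T \<Longrightarrow> sol G p \<tau> u \<Longrightarrow>
    (\<And>t. t \<in> {0..\<tau>} \<Longrightarrow> norm (u t) \<le> r) \<Longrightarrow> B0 \<bullet> snd (snd (u 0)) = 0 \<Longrightarrow>
    (\<And>n. real (Suc n) * h p \<le> T \<Longrightarrow> x (Suc n) = x n + h p *\<^sub>R v n + ((h p)\<^sup>2/2) *\<^sub>R a n) \<Longrightarrow>
    (\<And>n. real (Suc (Suc n)) * h p \<le> T \<Longrightarrow> x n = x (Suc n) - h p *\<^sub>R v (Suc n) + ((h p)\<^sup>2/2) *\<^sub>R a (Suc n)) \<Longrightarrow>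
    (\<And>n. real (Suc n) * h p \<le> T \<Longrightarrow> a n = (1 / \<epsilon> p) *\<^sub>R J (v n) + g p (x n, v n, (h p)\<^sup>2 *\<^sub>R a n)) \<Longrightarrow>
    (\<And>n. real n * h p \<le> T \<Longrightarrow> norm (x n) \<le> R) \<Longrightarrow>
    norm (x 0 - h p *\<^sub>R v 0 + ((h p)\<^sup>2/2) *\<^sub>R a 0) \<le> R \<Longrightarrow>
    x 0 = xs 1 \<Gamma> p (u 0) \<Longrightarrow> v 0 = vs 1 \<Gamma> p (u 0) \<Longrightarrow> real m * h p \<le> \<tau> \<Longrightarrow>
    norm (x m - xs ((-1) ^ m) \<Gamma> p (u (real m * h p))) \<le> C * h p ^ (2 * n)"
proof -
  note sF = smf_vf[OF sG]
  obtain k1 where k1: "k1 > 0" "\<And>p \<tau> u t \<sigma>. p \<in> P \<Longrightarrow> sol G p \<tau> u \<Longrightarrow> (\<And>t. t \<in> {0..\<tau>} \<Longrightarrow> norm (u t) \<le> r) \<Longrightarrow>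
      t \<in> {0..\<tau>} \<Longrightarrow> \<sigma> = 1 \<or> \<sigma> = -1 \<Longrightarrow> t + \<sigma> * h p \<in> {0..\<tau>} \<Longrightarrow>
      norm (Yc p (u (t + \<sigma> * h p)) - (Yc p (u t) + (\<sigma> * h p) *\<^sub>R cdiff n G (lie G Yc) p (u t)
         + ((h p)\<^sup>2 / 2) *\<^sub>R sdiff n G (lie G Yc) p (u t))) \<le> k1 * h p ^ (2 * n + 3)"
    using taylor_along[OF smf_coords(1) sF, of r] by blast
  obtain k2 where k2: "k2 > 0" "\<And>p \<tau> u t \<sigma>. p \<in> P \<Longrightarrow> sol G p \<tau> u \<Longrightarrow> (\<And>t. t \<in> {0..\<tau>} \<Longrightarrow> norm (u t) \<le> r) \<Longrightarrow>
      t \<in> {0..\<tau>} \<Longrightarrow> \<sigma> = 1 \<or> \<sigma> = -1 \<Longrightarrow> t + \<sigma> * h p \<in> {0..\<tau>} \<Longrightarrow>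
      norm (zt \<Gamma> p (u (t + \<sigma> * h p)) - (zt \<Gamma> p (u t) + (\<sigma> * h p) *\<^sub>R cdiff n G (lie G (zt \<Gamma>)) p (u t)
         + ((h p)\<^sup>2 / 2) *\<^sub>R sdiff n G (lie G (zt \<Gamma>)) p (u t))) \<le> k2 * h p ^ (2 * n + 3)"
    using taylor_along[OF smf_zt[OF sG] sF, of r] by blast
  obtain k3 where k3: "k3 > 0" "\<And>p u. p \<in> P \<Longrightarrow> norm u \<le> r \<Longrightarrow> norm (\<Gamma> p u - rhs \<Gamma> p u) \<le> k3 * h p ^ (2 * n)"
    using fixed_point_defect[of r] by blast
  obtain b1 where b1: "b1 > 0" "\<And>p u s. s = 1 \<or> s = -1 \<Longrightarrow> p \<in> P \<Longrightarrow> norm u \<le> r \<Longrightarrow>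
      norm (xs s \<Gamma> p u) \<le> b1 \<and> norm (vs s \<Gamma> p u) \<le> b1 \<and> norm (bs s \<Gamma> p u) \<le> b1"
  proof -
    have "\<exists>C>0. \<forall>p\<in>P. \<forall>u. norm u \<le> r \<longrightarrow> norm (xs s \<Gamma> p u) \<le> C \<and> norm (vs s \<Gamma> p u) \<le> C \<and> norm (bs s \<Gamma> p u) \<le> C" for s
    proof -
      have s: "smf P (\<lambda>p u. (xs s \<Gamma> p u, vs s \<Gamma> p u, bs s \<Gamma> p u))"
        by (rule smf_Pair[OF smf_xs[OF sG] smf_Pair[OF smf_vs[OF sG] smf_bs[OF sG]]])
      obtain C where C: "C > 0" "\<And>p u. p \<in> P \<Longrightarrow> norm u \<le> r \<Longrightarrow> norm (xs s \<Gamma> p u, vs s \<Gamma> p u, bs s \<Gamma> p u) \<le> C"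
        using smf_bound[OF s, of r] by blast
      have "norm a \<le> norm (a, b, c)" "norm b \<le> norm (a, b, c)" "norm c \<le> norm (a, b, c)" for a b c :: "real^3"
        using fst_le[of "(a,b,c)"] snd_le[of "(a,b,c)"] fst_le[of "(b,c)"] snd_le[of "(b,c)"] by simp_all
      then show ?thesis using C by (meson order_trans)
    qed
    then obtain C where C: "\<And>s. C s > 0" "\<And>s p u. p \<in> P \<Longrightarrow> norm u \<le> r \<Longrightarrow>
        norm (xs s \<Gamma> p u) \<le> C s \<and> norm (vs s \<Gamma> p u) \<le> C s \<and> norm (bs s \<Gamma> p u) \<le> C s" by metis
    show thesis
    proof (rule that[of "max (C 1) (C (-1))"])
      show "0 < max (C 1) (C (- 1))" using C(1)[of 1] by simp
      fix p and u :: modst and s :: real assume "s = 1 \<or> s = -1" "p \<in> P" "norm u \<le> r"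
      then show "norm (xs s \<Gamma> p u) \<le> max (C 1) (C (-1)) \<and> norm (vs s \<Gamma> p u) \<le> max (C 1) (C (-1)) \<and> norm (bs s \<Gamma> p u) \<le> max (C 1) (C (-1))"
        using C(2)[of p u s] by (auto simp: le_max_iff_disj)
    qed
  qed
  define RR where "RR = max R b1"
  obtain l where l: "l > 0" "\<And>p x v b x' v' b'. p \<in> P \<Longrightarrow> norm x \<le> RR \<Longrightarrow> norm (x + h p *\<^sub>R v + (1/2) *\<^sub>R b) \<le> RR \<Longrightarrow>
      norm (x - h p *\<^sub>R v + (1/2) *\<^sub>R b) \<le> RR \<Longrightarrow> norm x' \<le> RR \<Longrightarrow> norm v' \<le> RR \<Longrightarrow> norm b' \<le> RR \<Longrightarrow>
      norm (g p (x, v, b) - g p (x', v', b')) \<le> l * (norm (x - x') + norm (v - v') + norm (b - b'))"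
    using lip[of RR] by blast
  define L where "L = max 1 l"
  define D where "D = 2 * exp (44 * L * T) * (2 + 46 * T) + 7"
  define C where "C = D * (7 * k3 + (k1 + k2))"
  have L1: "L \<ge> 1" by (simp add: L_def)
  have D: "D > 0" using T by (simp add: D_def add_pos_pos)
  show thesis
  \<comment> \<open>This threshold is the smallness condition L h \<le> 1/16 of the stability
    estimate.\<close>
  proof (rule that[of C "1 / (16 * L)"])
    show "C > 0" using D k1 k2 k3 by (simp add: C_def)
    show "1 / (16 * L) > 0" using L1 by simp
    fix p \<tau> u and x v a :: "nat \<Rightarrow> real^3" and m
    assume p: "p \<in> P" and hh0: "h p \<le> 1 / (16 * L)" and \<tau>: "\<tau> \<le> T" and u: "sol G p \<tau> u"
      and r: "\<And>t. t \<in> {0..\<tau>} \<Longrightarrow> norm (u t) \<le> r" and z0: "B0 \<bullet> snd (snd (u 0)) = 0"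
      and x1: "\<And>n. real (Suc n) * h p \<le> T \<Longrightarrow> x (Suc n) = x n + h p *\<^sub>R v n + ((h p)\<^sup>2/2) *\<^sub>R a n"
      and x2: "\<And>n. real (Suc (Suc n)) * h p \<le> T \<Longrightarrow> x n = x (Suc n) - h p *\<^sub>R v (Suc n) + ((h p)\<^sup>2/2) *\<^sub>R a (Suc n)"
      and aa: "\<And>n. real (Suc n) * h p \<le> T \<Longrightarrow> a n = (1 / \<epsilon> p) *\<^sub>R J (v n) + g p (x n, v n, (h p)\<^sup>2 *\<^sub>R a n)"
      and xR: "\<And>n. real n * h p \<le> T \<Longrightarrow> norm (x n) \<le> R"
      and xm: "norm (x 0 - h p *\<^sub>R v 0 + ((h p)\<^sup>2/2) *\<^sub>R a 0) \<le> R"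
      and i: "x 0 = xs 1 \<Gamma> p (u 0)" "v 0 = vs 1 \<Gamma> p (u 0)" and m: "real m * h p \<le> \<tau>"
    note hp = h[OF p] h1[OF p] eps[OF p] eps_le[OF p]
    define s :: "nat \<Rightarrow> real" where "s k = (-1) ^ k" for k
    have s: "s k = 1 \<or> s k = -1" "s (Suc k) = - s k" for k by (cases "even k") (auto simp: s_def)
    define U where "U k = u (real k * h p)" for k
    have tk: "real k * h p \<in> {0..\<tau>}" if "k \<le> m" for k
    proof -
      have "real k * h p \<le> real m * h p" using that hp by (intro mult_right_mono) auto
      then have "real k * h p \<le> \<tau>" using m by linarith
      then show ?thesis using hp by simp
    qed
    have tT: "real k * h p \<le> T" if "k \<le> m" for k using tk[OF that] \<tau> by auto
    have Ur: "norm (U k) \<le> r" if "k \<le> m" for k using r[OF tk[OF that]] by (simp add: U_def)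
    have UB: "B0 \<bullet> snd (snd (U k)) = 0" if "k \<le> m" for k
      unfolding U_def by (rule B0_z_invariant[OF u p z0 tk[OF that]])
    define e where "e k = x k - xs (s k) \<Gamma> p (U k)" for k
    define f where "f k = v k - vs (s k) \<Gamma> p (U k)" for k
    define c where "c k = a k - (1 / (h p)\<^sup>2) *\<^sub>R bs (s k) \<Gamma> p (U k)" for k
    \<comment> \<open>Chosen so that the error relation of the stability estimate holds exactly. The
      force difference is covered by the Lipschitz condition, the residual by the fixed point
      defect.\<close>
    define \<gamma> where "\<gamma> k = g p (x k, v k, (h p)\<^sup>2 *\<^sub>R a k) - gs (s k) \<Gamma> p (U k) - res (s k) \<Gamma> p (U k)" for k
    let ?d = "(k1 + k2) * h p ^ (2 * n + 3)"
    let ?r = "7 * k3 * h p ^ (2 * n)"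
    have lzt: "lie G (zt \<Gamma>) p w = zd \<Gamma> p w" for w by (rule lie_zt[OF sG p])
    have cdz: "cdiff n G (lie G (zt \<Gamma>)) p w = cdiff n G (zd \<Gamma>) p w" "sdiff n G (lie G (zt \<Gamma>)) p w = sdiff n G (zd \<Gamma>) p w" for w
      by (rule cdiff_cong[OF lie_zt[OF sG] p], assumption, rule sdiff_cong[OF lie_zt[OF sG] p])
    \<comment> \<open>One step in either direction flips the parity, hence \<open>- s k\<close> at
      the neighbouring point. The defect is the sum of the Taylor remainders of y and of the full
      oscillation.\<close>
    have tay: "norm (xs (- s k) \<Gamma> p (u (real k * h p + \<sigma> * h p)) - (xs (s k) \<Gamma> p (U k) + (\<sigma> * h p) *\<^sub>R vs (s k) \<Gamma> p (U k)
        + (1/2) *\<^sub>R bs (s k) \<Gamma> p (U k))) \<le> ?d"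
      if k: "k \<le> m" and \<sigma>: "\<sigma> = 1 \<or> \<sigma> = -1" and t: "real k * h p + \<sigma> * h p \<in> {0..\<tau>}" for k \<sigma>
    proof -
      define t' where "t' = real k * h p + \<sigma> * h p"
      let ?Y = "Yc p (u t') - (Yc p (U k) + (\<sigma> * h p) *\<^sub>R cdiff n G (vy \<Gamma>) p (U k) + ((h p)\<^sup>2 / 2) *\<^sub>R sdiff n G (vy \<Gamma>) p (U k))"
      let ?Z = "zt \<Gamma> p (u t') - (zt \<Gamma> p (U k) + (\<sigma> * h p) *\<^sub>R cdiff n G (zd \<Gamma>) p (U k) + ((h p)\<^sup>2 / 2) *\<^sub>R sdiff n G (zd \<Gamma>) p (U k))"
      have Y: "norm ?Y \<le> k1 * h p ^ (2 * n + 3)"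
        using k1(2)[OF p u r tk[OF k] \<sigma> t] by (simp add: lie_coords U_def t'_def)
      have Z: "norm ?Z \<le> k2 * h p ^ (2 * n + 3)"
        using k2(2)[OF p u r tk[OF k] \<sigma> t] by (simp add: cdz U_def t'_def)
      have eq: "xs (- s k) \<Gamma> p (u t') - (xs (s k) \<Gamma> p (U k) + (\<sigma> * h p) *\<^sub>R vs (s k) \<Gamma> p (U k) + (1/2) *\<^sub>R bs (s k) \<Gamma> p (U k))
        = ?Y - s k *\<^sub>R ?Z"
      proof -
        have id: "y' + (- q) *\<^sub>R z' - ((y + q *\<^sub>R z) + c *\<^sub>R (dy - q *\<^sub>R dz) + (1/2) *\<^sub>R (H *\<^sub>R sy - q *\<^sub>R (4 *\<^sub>R z + H *\<^sub>R sz)))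
          = (y' - (y + c *\<^sub>R dy + (H / 2) *\<^sub>R sy)) - q *\<^sub>R (z' - (z + c *\<^sub>R dz + (H / 2) *\<^sub>R sz))"
          for y y' z z' dy dz sy sz :: "real^3" and q c H :: real
        proof -
          have "(1/2) *\<^sub>R (q *\<^sub>R (4 *\<^sub>R z)) = q *\<^sub>R z + q *\<^sub>R z" by (simp add: scaleR_left.add[symmetric])
          then show ?thesis by (simp add: scaleR_add_right scaleR_diff_right algebra_simps)
        qed
        show ?thesis unfolding xs_def vs_def bs_def by (rule id)
      qed
      have "norm (s k *\<^sub>R ?Z) = norm ?Z" using s(1)[of k] by auto
      then have "norm (?Y - s k *\<^sub>R ?Z) \<le> norm ?Y + norm ?Z"
        using norm_triangle_ineq4[of ?Y "s k *\<^sub>R ?Z"] by linarith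
      also have "\<dots> \<le> k1 * h p ^ (2 * n + 3) + k2 * h p ^ (2 * n + 3)" by (rule add_mono[OF Y Z])
      finally show ?thesis unfolding t'_def[symmetric] eq distrib_right .
    qed
    have hc: "(h p)\<^sup>2 *\<^sub>R a k - bs (s k) \<Gamma> p (U k) = (h p)\<^sup>2 *\<^sub>R c k" for k
      using hp by (simp add: c_def scaleR_diff_right)
    have hc2: "((h p)\<^sup>2/2) *\<^sub>R c k = ((h p)\<^sup>2/2) *\<^sub>R a k - (1/2) *\<^sub>R bs (s k) \<Gamma> p (U k)" for k
      using hp by (simp add: c_def scaleR_diff_right)
    have "norm (e m) \<le> D * (?r + ?d / h p ^ 3)"
      unfolding D_def
    proof (rule stability[where hh = "h p" and ee = "\<epsilon> p" and e = e and f = f and c = c and \<gamma> = \<gamma> and r = ?r and d = ?d])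
      show "0 < h p" "h p \<le> 1" "0 < \<epsilon> p" "\<epsilon> p \<le> (h p)\<^sup>2" by (fact hp)+
      show "1 \<le> L" by (fact L1)
      show "L * h p \<le> 1 / 16" using hh0 L1 by (simp add: field_simps)
      show "0 \<le> ?r" "0 \<le> ?d" using k1 k2 k3 hp by auto
      show "real m * h p \<le> T" using m \<tau> by simp
      show "e 0 = 0" "f 0 = 0" using i by (auto simp: e_def f_def s_def U_def)
      fix k assume k: "k < m"
      have k1T: "real (Suc k) * h p \<le> T" using tT[of "Suc k"] k by simp
      have Sk: "real k * h p + 1 * h p = real (Suc k) * h p" by (simp add: algebra_simps)
      show "norm (e (Suc k) - (e k + h p *\<^sub>R f k + ((h p)\<^sup>2 / 2) *\<^sub>R c k)) \<le> ?d"
      proof -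
        have "e (Suc k) - (e k + h p *\<^sub>R f k + ((h p)\<^sup>2 / 2) *\<^sub>R c k)
          = - (xs (- s k) \<Gamma> p (U (Suc k)) - (xs (s k) \<Gamma> p (U k) + (1 * h p) *\<^sub>R vs (s k) \<Gamma> p (U k) + (1/2) *\<^sub>R bs (s k) \<Gamma> p (U k)))"
          unfolding hc2 by (simp add: e_def f_def x1[OF k1T] s(2) scaleR_diff_right)
        then show ?thesis using tay[of k 1] k tk[of "Suc k"] Sk by (simp add: U_def norm_minus_commute)
      qed
      have Uk: "norm (U k) \<le> r" using Ur k by simp
      have a: "(1 / (h p)\<^sup>2) *\<^sub>R bs (s k) \<Gamma> p (U k) = (1 / \<epsilon> p) *\<^sub>R J (vs (s k) \<Gamma> p (U k)) + gs (s k) \<Gamma> p (U k) + res (s k) \<Gamma> p (U k)"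
        by (simp add: res_def)
      show "c k = (1 / \<epsilon> p) *\<^sub>R J (f k) + \<gamma> k"
        unfolding c_def a f_def \<gamma>_def J_simps by (subst aa[OF k1T]) (simp add: scaleR_diff_right)
      have nres: "norm (res (s k) \<Gamma> p (U k)) \<le> ?r"
      proof -
        have "norm (res (s k) \<Gamma> p (U k)) \<le> 7 * norm (\<Gamma> p (U k) - rhs \<Gamma> p (U k))"
          by (rule res_bound[OF sG p s(1) UB]) (use k in simp)
        also have "\<dots> \<le> 7 * (k3 * h p ^ (2 * n))" by (rule mult_left_mono[OF k3(2)[OF p Uk]]) simp
        finally show ?thesis by (simp only: mult.assoc)
      qed
      have xh: "norm (xs (s k) \<Gamma> p (U k)) \<le> RR" "norm (vs (s k) \<Gamma> p (U k)) \<le> RR" "norm (bs (s k) \<Gamma> p (U k)) \<le> RR"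
        using b1(2)[OF s(1)[of k] p Uk] by (auto simp: RR_def)
      have xk: "norm (x k) \<le> RR" "norm (x (Suc k)) \<le> RR"
        using xR[of k] xR[of "Suc k"] k1T tT[of k] k by (auto simp: RR_def)
      have half: "(1/2) *\<^sub>R ((h p)\<^sup>2 *\<^sub>R a k) = ((h p)\<^sup>2/2) *\<^sub>R a k" by simp
      have xp: "norm (x k + h p *\<^sub>R v k + (1/2) *\<^sub>R ((h p)\<^sup>2 *\<^sub>R a k)) \<le> RR"
        using xk(2) x1[OF k1T] unfolding half by simp
      have xmm: "norm (x k - h p *\<^sub>R v k + (1/2) *\<^sub>R ((h p)\<^sup>2 *\<^sub>R a k)) \<le> RR"
      \<comment> \<open>For positive k the left neighbour is an earlier grid value. For k = 0 it is
        the artificial value at -1, whose bound is a separate hypothesis.\<close>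
      proof (cases k)
        case 0
        then show ?thesis using xm unfolding half by (simp add: RR_def)
      next
        case (Suc j)
        then have "norm (x j) \<le> R" using xR[of j] tT[of j] k by simp
        moreover have "x j = x k - h p *\<^sub>R v k + ((h p)\<^sup>2/2) *\<^sub>R a k" using x2[of j] k1T Suc by simp
        ultimately show ?thesis unfolding half by (simp add: RR_def)
      qed
      have "norm (g p (x k, v k, (h p)\<^sup>2 *\<^sub>R a k) - gs (s k) \<Gamma> p (U k))
        \<le> l * (norm (e k) + norm (f k) + norm ((h p)\<^sup>2 *\<^sub>R c k))"
        using l(2)[OF p xk(1) xp xmm xh] unfolding gs_def e_def f_def hc .
      also have "\<dots> \<le> L * (norm (e k) + norm (f k) + norm ((h p)\<^sup>2 *\<^sub>R c k))"
        by (intro mult_right_mono) (auto simp: L_def)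
      finally show "norm (\<gamma> k) \<le> L * (norm (e k) + norm (f k) + (h p)\<^sup>2 * norm (c k)) + ?r"
        unfolding \<gamma>_def using nres norm_triangle_ineq4[of "g p (x k, v k, (h p)\<^sup>2 *\<^sub>R a k) - gs (s k) \<Gamma> p (U k)" "res (s k) \<Gamma> p (U k)"]
        by simp
    next
      fix k assume k: "Suc k < m"
      have k2T: "real (Suc (Suc k)) * h p \<le> T" using tT[of "Suc (Suc k)"] k by simp
      have Sk: "real (Suc k) * h p + (-1) * h p = real k * h p" by (simp add: algebra_simps)
      have "e k - (e (Suc k) - h p *\<^sub>R f (Suc k) + ((h p)\<^sup>2 / 2) *\<^sub>R c (Suc k))
          = - (xs (- s (Suc k)) \<Gamma> p (U k) - (xs (s (Suc k)) \<Gamma> p (U (Suc k)) + ((-1) * h p) *\<^sub>R vs (s (Suc k)) \<Gamma> p (U (Suc k)) + (1/2) *\<^sub>R bs (s (Suc k)) \<Gamma> p (U (Suc k))))"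
        unfolding hc2 e_def f_def by (subst x2[OF k2T]) (simp add: s(2)[of k] scaleR_diff_right)
      then show "norm (e k - (e (Suc k) - h p *\<^sub>R f (Suc k) + ((h p)\<^sup>2 / 2) *\<^sub>R c (Suc k))) \<le> ?d"
        using tay[of "Suc k" "-1"] k tk[of k] Sk by (simp add: U_def norm_minus_commute)
    qed
    also have "?d / h p ^ 3 = (k1 + k2) * h p ^ (2 * n)" using hp by (simp add: power_add)
    also have "D * (?r + (k1 + k2) * h p ^ (2 * n)) = C * h p ^ (2 * n)" by (simp add: C_def algebra_simps)
    finally show "norm (x m - xs ((-1) ^ m) \<Gamma> p (u (real m * h p))) \<le> C * h p ^ (2 * n)"
      by (simp add: e_def s_def U_def)
  qed
qed

end

section \<open>Initial values and existence of the modulated flow\<close>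

lemma norm_cross3_le: "norm (cross3 a b) \<le> norm a * norm b"
proof (rule power2_le_imp_le)
  show "(norm (cross3 a b))\<^sup>2 \<le> (norm a * norm b)\<^sup>2"
    using norm_cross_dot[of a b] zero_le_power2[of "a \<bullet> b"] by linarith
qed simp

context two_step_modulation begin

lemma h2_le: "p \<in> P \<Longrightarrow> (h p)\<^sup>2 \<le> h p"
  using h_le[of p 1 2] by simp

text \<open>The regular part of the orthogonal start velocity after division by \<epsilon>:
  \<open>J (vs 1)\<close> equals \<epsilon> J J (Xi + (4/h^2) z). To leading order it is the force
  at the initial point.\<close>

definition Xi :: "'p \<Rightarrow> modst \<Rightarrow> real^3" where
  "Xi = (\<lambda>p u. cdiff n G (cY \<Gamma>) p u + 4 *\<^sub>R Dp n G Zc p u - cdiff n G (cZ \<Gamma>) p u)"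

text \<open>The discrepancy, divided by h^2, between the B0 component of the numerical start
  velocity and the state coordinate B0 . y'.\<close>

definition Om :: "'p \<Rightarrow> modst \<Rightarrow> real" where
  "Om = (\<lambda>p u. Dp n G Wc p u - cdiff n G (lie G (cQ \<Gamma>)) p u)"

lemma smf_Xi: "smf P Xi"
  unfolding Xi_def
  by (rule smf_diff[OF smf_add[OF smf_cdiff[OF smf_comps(2)[OF sG] smf_vf[OF sG]]
      smf_linear[OF bounded_linear_scaleR_right smf_Dp[OF smf_coords(3) smf_vf[OF sG]]]]
      smf_cdiff[OF smf_comps(3)[OF sG] smf_vf[OF sG]]])

lemma smf_Om: "smf P Om"
  unfolding Om_def
  by (rule smf_diff[OF smf_Dp[OF smf_coords(2) smf_vf[OF sG]] smf_cdiff[OF smf_lieQ[OF sG] smf_vf[OF sG]]])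

lemma J_vs1:
  assumes p: "p \<in> P"
  shows "J (vs 1 \<Gamma> p u) = \<epsilon> p *\<^sub>R J (J (Xi p u + (4 / (h p)\<^sup>2) *\<^sub>R Zc p u))"
proof -
  have hp: "h p \<noteq> 0" using h[OF p] by simp
  have k: "4 * \<kappa> p = \<epsilon> p * (4 / (h p)\<^sup>2)" by (simp add: \<kappa>_def)
  let ?c = "4 / (h p)\<^sup>2"
  have "?c *\<^sub>R cdiff n G Zc p u = ?c *\<^sub>R Zc p u + 4 *\<^sub>R Dp n G Zc p u"
    using hp by (simp add: cdiff_def scaleR_add_right)
  then have e: "Xi p u + ?c *\<^sub>R Zc p u = cdiff n G (cY \<Gamma>) p u + ?c *\<^sub>R cdiff n G Zc p u - cdiff n G (cZ \<Gamma>) p u"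
    by (simp add: Xi_def)
  have "J (vs 1 \<Gamma> p u) = J (cdiff n G (vy \<Gamma>) p u) - J (cdiff n G (zd \<Gamma>) p u)"
    by (simp add: vs_def J_simps)
  then show ?thesis
    unfolding J_cd_vy[OF sG p] J_cd_zd[OF sG p] e k J_simps
    by (simp add: scaleR_add_right scaleR_diff_right)
qed

text \<open>Solving x(0) = x0 and v(0) = v0 for the initial state gives u = (x0, B0 . v0, 0) + h^2
  (constant + smooth function of u), a contraction for small h. The constant part contains the
  orthogonal velocity divided by \<epsilon>, which is bounded exactly by the hypothesis on v0; this
  is the origin of z(0) = O(h^2).\<close>

lemma init:
  assumes R0: "R0 \<ge> 0" and Cv: "Cv \<ge> 0" and c1: "c1 \<ge> 0"
  obtains C h0 where "C > 0" "h0 > 0" "\<And>p x0 v0. p \<in> P \<Longrightarrow> h p \<le> h0 \<Longrightarrow> norm x0 \<le> R0 \<Longrightarrow> norm v0 \<le> Cv \<Longrightarrow>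
    norm (v0 - (B0 \<bullet> v0) *\<^sub>R B0) \<le> c1 * \<epsilon> p \<Longrightarrow>
    \<exists>u0. norm (u0 - (x0, B0 \<bullet> v0, 0)) \<le> C * (h p)\<^sup>2 \<and> B0 \<bullet> snd (snd u0) = 0 \<and>
      xs 1 \<Gamma> p u0 = x0 \<and> vs 1 \<Gamma> p u0 = v0 \<and>
      snd (snd u0) = ((h p)\<^sup>2 / 4) *\<^sub>R J (J (Xi p u0) - (1 / \<epsilon> p) *\<^sub>R (v0 - (B0 \<bullet> v0) *\<^sub>R B0))"
proof -
  define S0 where "S0 = (\<lambda>p (u::modst). (- ((1/4) *\<^sub>R J (J (Xi p u)) + cQ \<Gamma> p u *\<^sub>R B0), - Om p u, (1/4) *\<^sub>R J (J (Xi p u))))"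
  have sJ: "smf P (\<lambda>p u. (1/4) *\<^sub>R J (J (Xi p u)))"
    by (rule smf_linear[OF bounded_linear_scaleR_right smf_linear[OF blJ smf_linear[OF blJ smf_Xi]]])
  have sS0: "smf P S0" unfolding S0_def
    by (rule smf_Pair[OF smf_minus[OF smf_add[OF sJ smf_linear[OF blB0(1) smf_comps(4)[OF sG]]]] smf_Pair[OF smf_minus[OF smf_Om] sJ]])
  define r0 where "r0 = R0 + Cv + 1"
  obtain k1 where k1: "k1 > 0" "\<And>p u. p \<in> P \<Longrightarrow> norm u \<le> r0 \<Longrightarrow> norm (S0 p u) \<le> k1"
    using smf_bound[OF sS0, of r0] by blast
  obtain k2 where k2: "k2 > 0" "\<And>p u v. p \<in> P \<Longrightarrow> norm u \<le> r0 \<Longrightarrow> norm v \<le> r0 \<Longrightarrow> norm (S0 p u - S0 p v) \<le> k2 * norm (u - v)"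
    using smf_lipschitz[OF sS0, of r0] by blast
  \<comment> \<open>Under C h \<le> 1 the part k1 + c1 keeps the unit ball around the centre
    invariant and 2 k2 makes the contraction factor at most 1/2.\<close>
  define C where "C = k1 + c1 + 2 * k2"
  have C: "C > 0" "k1 + c1 \<le> C" "2 * k2 \<le> C" using k1(1) k2(1) c1 by (auto simp: C_def)
  show thesis
  proof (rule that[of C "1 / C"])
    show "C > 0" "1 / C > 0" using C by auto
    fix p and x0 v0 :: "real^3" assume p: "p \<in> P" and hC: "h p \<le> 1 / C" and x0: "norm x0 \<le> R0" and v0: "norm v0 \<le> Cv"
      and vp: "norm (v0 - (B0 \<bullet> v0) *\<^sub>R B0) \<le> c1 * \<epsilon> p"
    let ?h = "(h p)\<^sup>2"
    define \<eta> where "\<eta> = (1 / \<epsilon> p) *\<^sub>R (v0 - (B0 \<bullet> v0) *\<^sub>R B0)"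
    have hp: "0 < ?h" "C * ?h \<le> 1"
    proof -
      have "C * ?h \<le> C * h p" using h2_le[OF p] C by (intro mult_left_mono) auto
      also have "\<dots> \<le> 1" using hC C by (simp add: field_simps)
      finally show "C * ?h \<le> 1" .
    qed (use h[OF p] in simp)
    have n\<eta>: "norm \<eta> \<le> c1" using vp eps[OF p] by (simp add: \<eta>_def divide_le_eq)
    define s\<eta> where "s\<eta> = ((1/4) *\<^sub>R J \<eta>, 0::real, - ((1/4) *\<^sub>R J \<eta>))"
    have ns: "norm s\<eta> \<le> c1"
      using norm_state_le[of s\<eta>] norm_J_le[of \<eta>] n\<eta> c1 by (simp add: s\<eta>_def)
    define ctr where "ctr = (x0, B0 \<bullet> v0, 0::real^3)"
    have nctr: "norm ctr \<le> R0 + Cv"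
      using norm_state_le[of ctr] x0 v0 abs_B0[of v0] by (simp add: ctr_def)
    define F where "F u = ctr + ?h *\<^sub>R (s\<eta> + S0 p u)" for u
    have inr: "norm u \<le> r0" if "u \<in> cball ctr 1" for u
      using that nctr norm_triangle_ineq2[of u ctr] by (simp add: dist_norm norm_minus_commute r0_def)
    have Fb: "norm (F u - ctr) \<le> C * ?h" if "u \<in> cball ctr 1" for u
    proof -
      have "norm (s\<eta> + S0 p u) \<le> C"
        using norm_triangle_ineq[of s\<eta> "S0 p u"] ns k1(2)[OF p inr[OF that]] C by linarith
      then show ?thesis using hp mult_left_mono[of "norm (s\<eta> + S0 p u)" C ?h] by (simp add: F_def mult.commute)
    qed
    have "\<exists>!u. u \<in> cball ctr 1 \<and> F u = u"
    proof (rule Banach_fix[where c = "1/2"])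
      show "complete (cball ctr 1)" by (simp add: complete_eq_closed)
      show "cball ctr 1 \<noteq> {}" by simp
      show "F ` cball ctr 1 \<subseteq> cball ctr 1"
      proof (rule image_subsetI)
        fix u assume "u \<in> cball ctr 1"
        then have "norm (F u - ctr) \<le> 1" using Fb[of u] hp(2) by linarith
        then show "F u \<in> cball ctr 1" by (simp add: dist_norm norm_minus_commute)
      qed
      fix u v assume u: "u \<in> cball ctr 1" and v: "v \<in> cball ctr 1"
      have "F u - F v = ?h *\<^sub>R (S0 p u - S0 p v)" by (simp add: F_def scaleR_diff_right[symmetric])
      then have "norm (F u - F v) = ?h * norm (S0 p u - S0 p v)" using hp by simp
      also have "\<dots> \<le> ?h * (k2 * norm (u - v))"
        by (rule mult_left_mono[OF k2(2)[OF p inr[OF u] inr[OF v]]]) (use hp in simp)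
      also have "\<dots> = (k2 * ?h) * norm (u - v)" by simp
      also have "\<dots> \<le> (1/2) * norm (u - v)"
      proof (rule mult_right_mono)
        have "2 * k2 * ?h \<le> C * ?h" using C(3) hp by (intro mult_right_mono) auto
        then show "k2 * ?h \<le> 1/2" using hp(2) by linarith
      qed simp
      finally show "dist (F u) (F v) \<le> 1/2 * dist u v" by (simp add: dist_norm)
    qed auto
    then obtain u0 where u0: "u0 \<in> cball ctr 1" "F u0 = u0" by blast
    have z: "snd (snd u0) = (?h / 4) *\<^sub>R J (J (Xi p u0) - \<eta>)"
      by (subst u0(2)[symmetric]) (simp add: F_def ctr_def s\<eta>_def S0_def J_simps scaleR_diff_right scaleR_add_right algebra_simps)
    have w: "fst (snd u0) = B0 \<bullet> v0 - ?h * Om p u0"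
      by (subst u0(2)[symmetric]) (simp add: F_def ctr_def s\<eta>_def S0_def)
    have "fst u0 = x0 + ?h *\<^sub>R ((1/4) *\<^sub>R J \<eta> + - ((1/4) *\<^sub>R J (J (Xi p u0)) + cQ \<Gamma> p u0 *\<^sub>R B0))"
      by (subst u0(2)[symmetric]) (simp add: F_def ctr_def s\<eta>_def S0_def)
    then have y: "fst u0 = x0 - snd (snd u0) - ?h *\<^sub>R (cQ \<Gamma> p u0 *\<^sub>R B0)"
      unfolding z by (simp add: J_simps scaleR_diff_right scaleR_add_right algebra_simps)
    have "xs 1 \<Gamma> p u0 = x0" by (simp add: xs_def zt_def Yc_def Zc_def y)
    moreover have "vs 1 \<Gamma> p u0 = v0"
    proof -
      have "B0 \<bullet> vs 1 \<Gamma> p u0 = cdiff n G Wc p u0 - ?h * cdiff n G (lie G (cQ \<Gamma>)) p u0"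
        by (simp add: vs_def inner_diff_right B0_cd_vy[OF sG p] B0_cd_zd[OF sG p])
      also have "\<dots> = fst (snd u0) + ?h * Om p u0"
      proof -
        have "Wc p u0 = fst (snd u0)" by (simp add: Wc_def)
        then show ?thesis by (simp add: cdiff_def[of n G Wc] Om_def algebra_simps)
      qed
      finally have b: "B0 \<bullet> (vs 1 \<Gamma> p u0 - v0) = 0" by (simp add: w inner_diff_right)
      have zz: "(4 / ?h) *\<^sub>R Zc p u0 = J (J (Xi p u0)) - J \<eta>"
        using hp by (simp add: Zc_def z J_simps)
      have "J (vs 1 \<Gamma> p u0) = \<epsilon> p *\<^sub>R J \<eta>"
        unfolding J_vs1[OF p] zz J_simps JJJ by simp
      also have "\<dots> = J v0" using eps[OF p] by (simp add: \<eta>_def J_simps J_B0)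
      finally have "J (vs 1 \<Gamma> p u0 - v0) = 0" by (simp add: J_simps)
      then show ?thesis using norm_le_split[of "vs 1 \<Gamma> p u0 - v0"] b by simp
    qed
    moreover have "B0 \<bullet> snd (snd u0) = 0" unfolding z by (simp add: B0_J)
    moreover have "norm (u0 - ctr) \<le> C * ?h" using Fb[OF u0(1)] u0(2) by simp
    ultimately show "\<exists>u0. norm (u0 - (x0, B0 \<bullet> v0, 0)) \<le> C * (h p)\<^sup>2 \<and> B0 \<bullet> snd (snd u0) = 0 \<and>
      xs 1 \<Gamma> p u0 = x0 \<and> vs 1 \<Gamma> p u0 = v0 \<and>
      snd (snd u0) = ((h p)\<^sup>2 / 4) *\<^sub>R J (J (Xi p u0) - (1 / \<epsilon> p) *\<^sub>R (v0 - (B0 \<bullet> v0) *\<^sub>R B0))"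
      using z unfolding ctr_def \<eta>_def by blast
  qed
qed

text \<open>The vector field is cut off outside a ball to obtain a global solution. The numerical solution
  stays in a compact set and is tracked by the solution as long as the latter stays in the ball,
  hence it never leaves the ball.\<close>

lemma flow_exists:
  assumes T: "T > 0" and R0: "R0 \<ge> 0" and Cv: "Cv \<ge> 0" and c1: "c1 \<ge> 0"
  obtains r C h0 where "r > 0" "C > 0" "h0 > 0" "\<And>p x v a. p \<in> P \<Longrightarrow> h p \<le> h0 \<Longrightarrow>
    (\<And>n. real (Suc n) * h p \<le> T \<Longrightarrow> x (Suc n) = x n + h p *\<^sub>R v n + ((h p)\<^sup>2/2) *\<^sub>R a n) \<Longrightarrow>
    (\<And>n. real (Suc (Suc n)) * h p \<le> T \<Longrightarrow> x n = x (Suc n) - h p *\<^sub>R v (Suc n) + ((h p)\<^sup>2/2) *\<^sub>R a (Suc n)) \<Longrightarrow>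
    (\<And>n. real (Suc n) * h p \<le> T \<Longrightarrow> a n = (1 / \<epsilon> p) *\<^sub>R J (v n) + g p (x n, v n, (h p)\<^sup>2 *\<^sub>R a n)) \<Longrightarrow>
    (\<And>n. real n * h p \<le> T \<Longrightarrow> norm (x n) \<le> R0) \<Longrightarrow> norm (v 0) \<le> Cv \<Longrightarrow>
    norm (v 0 - (B0 \<bullet> v 0) *\<^sub>R B0) \<le> c1 * \<epsilon> p \<Longrightarrow>
    \<exists>u. sol G p T u \<and> (\<forall>t\<in>{0..T}. norm (u t) \<le> r \<and> norm (snd (snd (u t))) \<le> C * (h p)\<^sup>2 \<and> B0 \<bullet> snd (snd (u t)) = 0) \<and>
      norm (u 0 - (x 0, B0 \<bullet> v 0, 0)) \<le> C * (h p)\<^sup>2 \<and> xs 1 \<Gamma> p (u 0) = x 0 \<and>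
      snd (snd (u 0)) = ((h p)\<^sup>2 / 4) *\<^sub>R J (J (Xi p (u 0)) - (1 / \<epsilon> p) *\<^sub>R (v 0 - (B0 \<bullet> v 0) *\<^sub>R B0)) \<and>
      (\<forall>m. real m * h p \<le> T \<longrightarrow> norm (x m - xs ((-1) ^ m) \<Gamma> p (u (real m * h p))) \<le> C * h p ^ (2 * n))"
proof -
  \<comment> \<open>Three units are added to the radius of the compact set: one for the tracking
    error, one for the oscillation and one for the drift of y between grid points.\<close>
  define \<rho> where "\<rho> = R0 + 3"
  obtain M0 where M0: "M0 > 0" "\<And>p y. p \<in> P \<Longrightarrow> norm y \<le> \<rho> \<Longrightarrow> norm (Ef p y) \<le> M0"
    using smf_bound[OF Ef, of \<rho>] by blast
  \<comment> \<open>Bounds the parallel velocity by its initial value and T times M0 + 1. The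
    constant M0 depends on \<rho> only, so r can be fixed before any constant that depends on the
    ball of radius r; this avoids a circular choice.\<close>
  define wb where "wb = Cv + 1 + (M0 + 1) * T"
  define r where "r = \<rho> + wb + 2"
  have wb: "wb > 0" using Cv M0(1) T by (simp add: wb_def add_nonneg_pos)
  have r0: "r > 0" using R0 wb by (simp add: r_def \<rho>_def)
  obtain Ci hi where Ci: "Ci > 0" "hi > 0" and init: "\<And>p x0 v0. p \<in> P \<Longrightarrow> h p \<le> hi \<Longrightarrow> norm x0 \<le> R0 \<Longrightarrow> norm v0 \<le> Cv \<Longrightarrow>
    norm (v0 - (B0 \<bullet> v0) *\<^sub>R B0) \<le> c1 * \<epsilon> p \<Longrightarrow>
    \<exists>u0. norm (u0 - (x0, B0 \<bullet> v0, 0)) \<le> Ci * (h p)\<^sup>2 \<and> B0 \<bullet> snd (snd u0) = 0 \<and>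
      xs 1 \<Gamma> p u0 = x0 \<and> vs 1 \<Gamma> p u0 = v0 \<and>
      snd (snd u0) = ((h p)\<^sup>2 / 4) *\<^sub>R J (J (Xi p u0) - (1 / \<epsilon> p) *\<^sub>R (v0 - (B0 \<bullet> v0) *\<^sub>R B0))"
    using init[OF R0 Cv c1] by blast
  obtain Ct ht where Ct: "Ct > 0" "ht > 0" and track: "\<And>p \<tau> u x v a m. p \<in> P \<Longrightarrow> h p \<le> ht \<Longrightarrow> \<tau> \<le> T \<Longrightarrow> sol G p \<tau> u \<Longrightarrow>
    (\<And>t. t \<in> {0..\<tau>} \<Longrightarrow> norm (u t) \<le> r) \<Longrightarrow> B0 \<bullet> snd (snd (u 0)) = 0 \<Longrightarrow>
    (\<And>n. real (Suc n) * h p \<le> T \<Longrightarrow> x (Suc n) = x n + h p *\<^sub>R v n + ((h p)\<^sup>2/2) *\<^sub>R a n) \<Longrightarrow>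
    (\<And>n. real (Suc (Suc n)) * h p \<le> T \<Longrightarrow> x n = x (Suc n) - h p *\<^sub>R v (Suc n) + ((h p)\<^sup>2/2) *\<^sub>R a (Suc n)) \<Longrightarrow>
    (\<And>n. real (Suc n) * h p \<le> T \<Longrightarrow> a n = (1 / \<epsilon> p) *\<^sub>R J (v n) + g p (x n, v n, (h p)\<^sup>2 *\<^sub>R a n)) \<Longrightarrow>
    (\<And>n. real n * h p \<le> T \<Longrightarrow> norm (x n) \<le> R0 + 2 * Cv) \<Longrightarrow>
    norm (x 0 - h p *\<^sub>R v 0 + ((h p)\<^sup>2/2) *\<^sub>R a 0) \<le> R0 + 2 * Cv \<Longrightarrow>
    x 0 = xs 1 \<Gamma> p (u 0) \<Longrightarrow> v 0 = vs 1 \<Gamma> p (u 0) \<Longrightarrow> real m * h p \<le> \<tau> \<Longrightarrow>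
    norm (x m - xs ((-1) ^ m) \<Gamma> p (u (real m * h p))) \<le> Ct * h p ^ (2 * n)"
    using tracking[OF T, of r "R0 + 2 * Cv"] by blast
  obtain Cz where Cz: "Cz > 0" "\<And>p u. p \<in> P \<Longrightarrow> norm u \<le> r \<Longrightarrow> norm (vz \<Gamma> p u) \<le> Cz * norm (snd (snd u))"
    using van_bound[OF smf_vz[OF sG] van_vz[OF vZ], of r] by blast
  \<comment> \<open>The initial bound on z multiplied by its Gronwall growth factor over
    [0, T].\<close>
  define A where "A = Ci * exp ((1 + 2 * Cz) * T)"
  have A: "A > 0" using Ci by (simp add: A_def)
  obtain Cl where Cl: "Cl > 0" "\<And>p u. p \<in> P \<Longrightarrow> norm u \<le> r \<Longrightarrow> norm (snd (snd u)) \<le> A * (h p)\<^sup>2 \<Longrightarrow>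
      \<bar>cW \<Gamma> p u - B0 \<bullet> Fo p (fst u, vy \<Gamma> p u)\<bar> \<le> Cl * (h p)\<^sup>2 \<and>
      norm (cY \<Gamma> p u - Fo p (fst u, vy \<Gamma> p u)) \<le> Cl * (h p)\<^sup>2"
    using lead_est[of A r] A by (metis less_imp_le)
  obtain c3 where c3: "c3 > 0" "\<And>p u. p \<in> P \<Longrightarrow> norm u \<le> r \<Longrightarrow> norm (zt \<Gamma> p u) \<le> c3 * norm (snd (snd u))"
    using van_bound[OF smf_zt[OF sG] van_zt[OF vG], of r] by blast
  obtain c4 where c4: "c4 > 0" "\<And>p u. p \<in> P \<Longrightarrow> norm u \<le> r \<Longrightarrow> norm (vy \<Gamma> p u) \<le> c4"
    using smf_bound[OF smf_vy[OF sG], of r] by blast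
  obtain c5 where c5: "c5 > 0" "\<And>p u. p \<in> P \<Longrightarrow> norm u \<le> r \<Longrightarrow> norm (cY \<Gamma> p u) \<le> c5"
    using smf_bound[OF smf_comps(2)[OF sG], of r] by blast
  obtain c6 where c6: "c6 > 0" "\<And>p u. p \<in> P \<Longrightarrow> norm u \<le> r \<Longrightarrow> norm (Bf p u) \<le> c6"
    using smf_bound[OF Bf, of r] by blast
  define k where "k = 1 + Ct + c3 * A + c4 + (Cl + c5 * c6) + A + Ci"
  have pos: "c3 * A > 0" "c5 * c6 > 0" using c3 A c5 c6 by auto
  have kk: "Ct \<le> k" "c3 * A \<le> k" "c4 \<le> k" "Cl + c5 * c6 \<le> k" "A \<le> k" "Ci \<le> k" "0 < k"
    unfolding k_def using Ct(1) pos c4(1) Cl(1) A Ci(1) by linarith+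
  \<comment> \<open>The bound 1/k reduces every error term below to at most 1, and h \<le> T
    guarantees that the first step is part of the numerical solution.\<close>
  define h0 where "h0 = min (min hi ht) (min T (1 / k))"
  define C where "C = A + Ci + Ct"
  show thesis
  proof (rule that[of r C h0])
    show "r > 0" by (fact r0)
    show "C > 0" using A Ci Ct by (simp add: C_def)
    show "h0 > 0" using Ci Ct T kk by (simp add: h0_def)
    fix p and x v a :: "nat \<Rightarrow> real^3"
    assume p: "p \<in> P" and hh0: "h p \<le> h0"
      and x1: "\<And>n. real (Suc n) * h p \<le> T \<Longrightarrow> x (Suc n) = x n + h p *\<^sub>R v n + ((h p)\<^sup>2/2) *\<^sub>R a n"
      and x2: "\<And>n. real (Suc (Suc n)) * h p \<le> T \<Longrightarrow> x n = x (Suc n) - h p *\<^sub>R v (Suc n) + ((h p)\<^sup>2/2) *\<^sub>R a (Suc n)"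
      and aa: "\<And>n. real (Suc n) * h p \<le> T \<Longrightarrow> a n = (1 / \<epsilon> p) *\<^sub>R J (v n) + g p (x n, v n, (h p)\<^sup>2 *\<^sub>R a n)"
      and xR: "\<And>n. real n * h p \<le> T \<Longrightarrow> norm (x n) \<le> R0" and v0: "norm (v 0) \<le> Cv"
      and vp: "norm (v 0 - (B0 \<bullet> v 0) *\<^sub>R B0) \<le> c1 * \<epsilon> p"
    let ?h = "(h p)\<^sup>2"
    have hs: "h p \<le> hi" "h p \<le> ht" "h p \<le> T" "h p \<le> 1 / k" using hh0 by (auto simp: h0_def)
    have hp: "0 < h p" "h p \<le> 1" "0 < ?h" "?h \<le> h p" using h[OF p] h1[OF p] h2_le[OF p] by auto
    have kh: "k * h p \<le> 1" using hs kk by (simp add: field_simps)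
    have kc: "c * h p \<le> 1" "c * ?h \<le> 1" if "0 < c" "c \<le> k" for c
    proof -
      have "c * h p \<le> k * h p" "c * ?h \<le> c * h p" using mult_right_mono[OF that(2) less_imp_le[OF hp(1)]] mult_left_mono[OF hp(4) less_imp_le[OF that(1)]] .
      then show "c * h p \<le> 1" "c * ?h \<le> 1" using kh by linarith+
    qed
    have x0: "norm (x 0) \<le> R0" using xR[of 0] T by simp
    obtain u0 where u0: "norm (u0 - (x 0, B0 \<bullet> v 0, 0)) \<le> Ci * ?h" "B0 \<bullet> snd (snd u0) = 0"
      "xs 1 \<Gamma> p u0 = x 0" "vs 1 \<Gamma> p u0 = v 0"
      "snd (snd u0) = (?h / 4) *\<^sub>R J (J (Xi p u0) - (1 / \<epsilon> p) *\<^sub>R (v 0 - (B0 \<bullet> v 0) *\<^sub>R B0))"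
      using init[OF p hs(1) x0 v0 vp] by blast
    have u0c: "norm (fst u0 - x 0) \<le> Ci * ?h" "\<bar>fst (snd u0) - B0 \<bullet> v 0\<bar> \<le> Ci * ?h" "norm (snd (snd u0)) \<le> Ci * ?h"
      using norm_state_comps[of "u0 - (x 0, B0 \<bullet> v 0, 0)"] u0(1) by auto
    have Ci1: "Ci * ?h \<le> 1" by (rule kc(2)[OF Ci(1) kk(6)])
    have w0: "\<bar>fst (snd u0)\<bar> \<le> Cv + 1" using u0c(2) Ci1 abs_B0[of "v 0"] v0 by linarith
    \<comment> \<open>Since x(-1) = x(1) - 2 h v(0) and h \<le> 1, the artificial left neighbour
      exceeds the radius R0 by at most 2 Cv.\<close>
    have xm: "norm (x 0 - h p *\<^sub>R v 0 + (?h/2) *\<^sub>R a 0) \<le> R0 + 2 * Cv"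
    proof -
      have T1: "real (Suc 0) * h p \<le> T" using hs by simp
      have e: "x 0 - h p *\<^sub>R v 0 + (?h/2) *\<^sub>R a 0 = x (Suc 0) - (h p *\<^sub>R v 0 + h p *\<^sub>R v 0)"
        unfolding x1[OF T1] by simp
      have "norm (h p *\<^sub>R v 0) \<le> 1 * Cv" unfolding norm_scaleR using hp(1,2) v0 by (intro mult_mono) (auto simp: abs_of_pos)
      then have "norm (h p *\<^sub>R v 0 + h p *\<^sub>R v 0) \<le> 2 * Cv"
        using norm_triangle_ineq[of "h p *\<^sub>R v 0" "h p *\<^sub>R v 0"] by linarith
      then show ?thesis unfolding e
        using norm_triangle_ineq4[of "x (Suc 0)" "h p *\<^sub>R v 0 + h p *\<^sub>R v 0"] xR[OF T1] by linarith
    qed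
    have xR': "norm (x n) \<le> R0 + 2 * Cv" if "real n * h p \<le> T" for n using xR[OF that] Cv by linarith
    \<comment> \<open>The bootstrap: a solution bounded by r on [0, \<tau>] is in fact strictly
      inside the ball.\<close>
    have apriori: "norm (u t) < r \<and> norm (snd (snd (u t))) \<le> A * ?h"
      if \<tau>: "\<tau> \<le> T" and u: "sol G p \<tau> u" and ur: "\<And>t. t \<in> {0..\<tau>} \<Longrightarrow> norm (u t) \<le> r" and ui: "u 0 = u0"
        and t: "t \<in> {0..\<tau>}" for \<tau> u t
    proof -
      have zb: "norm (snd (snd (u s))) \<le> A * ?h" if s: "s \<in> {0..\<tau>}" for s
      proof -
        have "norm (Zc p (u s)) \<le> (norm (Zc p (u 0)) + 0) * exp ((1 + 2 * Cz) * \<tau>)"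
        proof (rule gronwall_norm[where f' = "\<lambda>s. vz \<Gamma> p (u s)"])
          show "((\<lambda>t. Zc p (u t)) has_vector_derivative vz \<Gamma> p (u s)) (at s within {0..\<tau>})" if "s \<in> {0..\<tau>}" for s
            using sol_chain[OF u smf_coords(3) p that] by (simp add: lie_coords)
          show "norm (vz \<Gamma> p (u s)) \<le> 0 + Cz * norm (Zc p (u s))" if "s \<in> {0..\<tau>}" for s
            using Cz(2)[OF p ur[OF that]] by (simp add: Zc_def)
        qed (use Cz s in auto)
        also have "\<dots> \<le> (Ci * ?h) * exp ((1 + 2 * Cz) * T)"
        proof (rule mult_mono)
          show "norm (Zc p (u 0)) + 0 \<le> Ci * ?h" using u0c(3) by (simp add: Zc_def ui)
          have "(1 + 2 * Cz) * \<tau> \<le> (1 + 2 * Cz) * T" using \<tau> Cz(1) by (intro mult_left_mono) auto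
          then show "exp ((1 + 2 * Cz) * \<tau>) \<le> exp ((1 + 2 * Cz) * T)" by simp
        qed (use Ci in auto)
        finally show ?thesis by (simp add: Zc_def A_def mult_ac)
      qed
      \<comment> \<open>The position is read off from the numerical solution at the last grid point
        before s, where tracking applies; the size of \<open>vy\<close> covers the rest of the
        step.\<close>
      have yb: "norm (fst (u s)) \<le> \<rho>" if s: "s \<in> {0..\<tau>}" for s
      proof -
        define m where "m = nat \<lfloor>s / h p\<rfloor>"
        have sh: "0 \<le> s / h p" using s hp(1) by simp
        have m1: "real m \<le> s / h p" "s / h p < real m + 1" unfolding m_def using sh by linarith+
        have m: "real m * h p \<le> s" "s < (real m + 1) * h p" using m1 hp(1) by (simp_all add: field_simps)
        have ms: "real m * h p \<in> {0..\<tau>}" using m(1) s hp(1) by auto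
        have mT: "real m * h p \<le> T" using ms \<tau> by auto
        define q where "q = u (real m * h p)"
        have qr: "norm q \<le> r" unfolding q_def by (rule ur[OF ms])
        have tr: "norm (x m - xs ((-1) ^ m) \<Gamma> p q) \<le> Ct * h p ^ (2 * n)"
          unfolding q_def
          by (rule track[OF p hs(2) \<tau> u ur _ x1 x2 aa xR' xm]) (use ui u0 ms in auto)
        have "Ct * h p ^ (2 * n) \<le> Ct * h p ^ 1" using Ct(1) h_le[OF p, of 1 "2 * n"] n1 by (intro mult_left_mono) auto
        also have "\<dots> \<le> 1" using kc(1)[OF Ct(1) kk(1)] by simp
        finally have tr1: "norm (x m - xs ((-1) ^ m) \<Gamma> p q) \<le> 1" using tr by linarith
        have "norm (zt \<Gamma> p q) \<le> c3 * norm (snd (snd q))" by (rule c3(2)[OF p qr])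
        also have "\<dots> \<le> c3 * (A * ?h)" using zb[OF ms] c3(1) unfolding q_def by (intro mult_left_mono) auto
        also have "\<dots> \<le> 1" using kc(2)[OF pos(1) kk(2)] by simp
        finally have "norm ((-1) ^ m *\<^sub>R zt \<Gamma> p q) \<le> 1" by (simp add: norm_power)
        then have "norm (Yc p q) \<le> norm (xs ((-1) ^ m) \<Gamma> p q) + 1"
          using norm_triangle_ineq4[of "xs ((-1) ^ m) \<Gamma> p q" "(-1) ^ m *\<^sub>R zt \<Gamma> p q"] by (simp add: xs_def)
        moreover have "norm (xs ((-1) ^ m) \<Gamma> p q) \<le> norm (x m) + 1"
          using tr1 norm_triangle_ineq4[of "x m" "x m - xs ((-1) ^ m) \<Gamma> p q"] by simp
        ultimately have yq: "norm (Yc p q) \<le> R0 + 2" using xR[OF mT] by linarith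
        have "norm (Yc p (u s) - Yc p (u (real m * h p))) \<le> c4 * \<bar>s - real m * h p\<bar>"
        proof (rule vector_derivative_bound[where S = "{0..\<tau>}" and f' = "\<lambda>s. vy \<Gamma> p (u s)"])
          show "((\<lambda>t. Yc p (u t)) has_vector_derivative vy \<Gamma> p (u s)) (at s within {0..\<tau>})" if "s \<in> {0..\<tau>}" for s
            using sol_chain[OF u smf_coords(1) p that] by (simp add: lie_coords)
          show "norm (vy \<Gamma> p (u s)) \<le> c4" if "s \<in> {0..\<tau>}" for s by (rule c4(2)[OF p ur[OF that]])
        qed (use s ms in auto)
        also have "\<dots> \<le> c4 * h p" using m c4(1) by (intro mult_left_mono) (auto simp: algebra_simps)
        also have "\<dots> \<le> 1" by (rule kc(1)[OF c4(1) kk(3)])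
        finally show ?thesis
          using yq norm_triangle_ineq2[of "Yc p (u s)" "Yc p q"] unfolding q_def by (simp add: Yc_def \<rho>_def)
      qed
      have Wb: "\<bar>cW \<Gamma> p (u s)\<bar> \<le> M0 + 1" if s: "s \<in> {0..\<tau>}" for s
      proof -
        let ?y = "fst (u s)" and ?v = "vy \<Gamma> p (u s)"
        note us = ur[OF s]
        have l: "\<bar>cW \<Gamma> p (u s) - B0 \<bullet> Fo p (?y, ?v)\<bar> \<le> Cl * ?h" using Cl(2)[OF p us zb[OF s]] by blast
        \<comment> \<open>The parallel velocity drops out of the triple product with B0, so the
          magnetic force along B0 is O(\<epsilon>) however large that velocity is. Only the electric
          field remains at leading order.\<close>
        have "B0 \<bullet> Fo p (?y, ?v) = B0 \<bullet> cross3 (\<epsilon> p *\<^sub>R J (cY \<Gamma> p (u s))) (Bf p ?y) + B0 \<bullet> Ef p ?y"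
          by (simp add: Fo_def vy_def inner_add_right cross_add_left cross_mult_left dot_cross_self)
        moreover have "\<bar>B0 \<bullet> cross3 (\<epsilon> p *\<^sub>R J (cY \<Gamma> p (u s))) (Bf p ?y)\<bar> \<le> (c5 * c6) * ?h"
        proof -
          have yr: "norm ?y \<le> r" using fst_le[of "u s"] us by linarith
          have "\<bar>B0 \<bullet> cross3 (\<epsilon> p *\<^sub>R J (cY \<Gamma> p (u s))) (Bf p ?y)\<bar> \<le> norm (\<epsilon> p *\<^sub>R J (cY \<Gamma> p (u s))) * norm (Bf p ?y)"
            by (rule order_trans[OF abs_B0 norm_cross3_le])
          also have "\<dots> \<le> (?h * c5) * c6"
          proof (rule mult_mono)
            show "norm (\<epsilon> p *\<^sub>R J (cY \<Gamma> p (u s))) \<le> ?h * c5"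
              using mult_mono[OF eps_le[OF p] order_trans[OF norm_J_le c5(2)[OF p us]]] eps[OF p] by simp
            show "norm (Bf p ?y) \<le> c6" by (rule c6(2)[OF p yr])
          qed (use c5 in auto)
          finally show ?thesis by (simp add: mult_ac)
        qed
        moreover have "\<bar>B0 \<bullet> Ef p ?y\<bar> \<le> M0" by (rule order_trans[OF abs_B0 M0(2)[OF p yb[OF s]]])
        moreover have "Cl * ?h + (c5 * c6) * ?h \<le> 1"
          using kc(2)[OF _ kk(4)] Cl(1) pos by (simp add: algebra_simps)
        ultimately show ?thesis using l by linarith
      qed
      have "norm (Wc p (u t) - Wc p (u 0)) \<le> (M0 + 1) * \<bar>t - 0\<bar>"
      proof (rule vector_derivative_bound[where S = "{0..\<tau>}" and f' = "\<lambda>s. cW \<Gamma> p (u s)"])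
        show "((\<lambda>t. Wc p (u t)) has_vector_derivative cW \<Gamma> p (u s)) (at s within {0..\<tau>})" if "s \<in> {0..\<tau>}" for s
          using sol_chain[OF u smf_coords(2) p that] by (simp add: lie_coords)
        show "norm (cW \<Gamma> p (u s)) \<le> M0 + 1" if "s \<in> {0..\<tau>}" for s using Wb[OF that] by simp
      qed (use t in auto)
      moreover have "(M0 + 1) * \<bar>t - 0\<bar> \<le> (M0 + 1) * T" using t \<tau> M0(1) by (intro mult_left_mono) auto
      ultimately have "\<bar>fst (snd (u t)) - fst (snd u0)\<bar> \<le> (M0 + 1) * T" by (simp add: Wc_def ui)
      then have "\<bar>fst (snd (u t))\<bar> \<le> wb" using w0 unfolding wb_def by linarith
      moreover have "A * ?h \<le> 1" by (rule kc(2)[OF A kk(5)])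
      ultimately have "norm (u t) < r"
        using norm_state_le[of "u t"] yb[OF t] zb[OF t] unfolding r_def by linarith
      then show ?thesis using zb[OF t] by blast
    qed
    obtain Lf where Lf: "Lf > 0" "\<And>p u v. p \<in> P \<Longrightarrow> norm u \<le> r \<Longrightarrow> norm v \<le> r \<Longrightarrow> norm (G p u - G p v) \<le> Lf * norm (u - v)"
      using smf_lipschitz[OF smf_vf[OF sG], of r] by blast
    \<comment> \<open>Nearest-point projection onto the ball is 1-Lipschitz and is the identity
      inside, so the cut-off field is globally Lipschitz and unchanged where the solution is
      wanted.\<close>
    let ?cp = "closest_point (cball (0::modst) r)"
    have cp: "norm (?cp w) \<le> r" for w using closest_point_in_set[of "cball (0::modst) r" w] r0 by simp
    have cpl: "norm (?cp w - ?cp w') \<le> norm (w - w')" for w w'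
      using closest_point_lipschitz[of "cball (0::modst) r" w w'] r0 by (simp add: dist_norm)
    have lipF: "norm (G p (?cp w) - G p (?cp w')) \<le> Lf * norm (w - w')" for w w'
      using Lf(2)[OF p cp cp, of w w'] mult_left_mono[OF cpl[of w w'] less_imp_le[OF Lf(1)]] by linarith
    obtain u where u: "u 0 = u0" "\<And>t. t \<in> {0..T} \<Longrightarrow> (u has_vector_derivative G p (?cp (u t))) (at t within {0..T})"
      using picard[of Lf "\<lambda>w. G p (?cp w)" T u0, OF Lf(1) lipF T] by blast
    have cu: "continuous_on {0..T} u" using u(2) by (rule continuous_on_vector_derivative)
    have solr: "sol G p \<tau> u" if "\<tau> \<le> T" "\<And>t. t \<in> {0..\<tau>} \<Longrightarrow> norm (u t) \<le> r" for \<tau>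
      unfolding sol_def
    proof
      fix t assume t: "t \<in> {0..\<tau>}"
      have "?cp (u t) = u t" by (rule closest_point_self) (use that(2)[OF t] in simp)
      then have "(u has_vector_derivative G p (u t)) (at t within {0..T})" using u(2)[of t] t that(1) by auto
      then show "(u has_vector_derivative G p (u t)) (at t within {0..\<tau>})"
        by (rule has_vector_derivative_within_subset) (use that(1) in auto)
    qed
    \<comment> \<open>At the first time when the norm reaches r the curve still solves the original
      equation, and the strict a priori bound at that time is contradicted.\<close>
    have stay: "norm (u t) \<le> r" if t: "t \<in> {0..T}" for t
    proof (rule ccontr)
      assume "\<not> norm (u t) \<le> r"
      define S where "S = {0..T} \<inter> u -` (- ball 0 r)"
      have "closed S" unfolding S_def by (rule continuous_closed_preimage[OF cu]) auto
      moreover have "bounded S"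
        by (rule bounded_subset[OF compact_imp_bounded[OF compact_Icc[of 0 T]]]) (auto simp: S_def)
      ultimately have "compact S" by (simp add: compact_eq_bounded_closed)
      moreover have "t \<in> S" using t \<open>\<not> norm (u t) \<le> r\<close> by (simp add: S_def)
      ultimately obtain \<tau> where \<tau>: "\<tau> \<in> S" "\<And>s. s \<in> S \<Longrightarrow> \<tau> \<le> s" using compact_attains_inf[of S] by blast
      have \<tau>T: "0 \<le> \<tau>" "\<tau> \<le> T" "r \<le> norm (u \<tau>)" using \<tau>(1) by (auto simp: S_def)
      have n0: "norm (u 0) \<le> r"
      proof -
        have "norm u0 < r" using norm_state_le[of u0] w0 u0c Ci1 x0 norm_triangle_ineq2[of "fst u0" "x 0"] M0(1) T
          unfolding r_def \<rho>_def wb_def by (smt (verit) mult_nonneg_nonneg)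
        then show ?thesis using u(1) by simp
      qed
      have "\<exists>s\<ge>0. s \<le> \<tau> \<and> norm (u s) = r"
        by (rule IVT') (use n0 \<tau>T cu in \<open>auto intro!: continuous_intros intro: continuous_on_subset\<close>)
      then obtain s where s: "0 \<le> s" "s \<le> \<tau>" "norm (u s) = r" by blast
      then have "s \<in> S" using \<tau>T by (simp add: S_def)
      then have eq: "norm (u \<tau>) = r" using \<tau>(2)[of s] s by auto
      have le: "norm (u s) \<le> r" if "s \<in> {0..\<tau>}" for s
      proof (rule ccontr)
        assume n: "\<not> norm (u s) \<le> r"
        then have "s \<in> S" using that \<tau>T by (simp add: S_def)
        then have "s = \<tau>" using \<tau>(2) that by force
        then show False using n eq by simp
      qed
      show False using apriori[OF \<tau>T(2) solr[OF \<tau>T(2) le] le u(1), of \<tau>] \<tau>T eq by auto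
    qed
    have su: "sol G p T u" by (rule solr) (use stay in auto)
    have "norm (u t) \<le> r \<and> norm (snd (snd (u t))) \<le> C * ?h \<and> B0 \<bullet> snd (snd (u t)) = 0" if t: "t \<in> {0..T}" for t
    proof -
      have "A * ?h \<le> C * ?h" using Ci Ct hp by (intro mult_right_mono) (auto simp: C_def)
      moreover have "norm (snd (snd (u t))) \<le> A * ?h" using apriori[OF order_refl su stay u(1) t] by blast
      moreover have "B0 \<bullet> snd (snd (u t)) = 0" by (rule B0_z_invariant[OF su p _ t]) (simp only: u(1) u0(2))
      ultimately show ?thesis using stay[OF t] by linarith
    qed
    moreover have "norm (u 0 - (x 0, B0 \<bullet> v 0, 0)) \<le> C * ?h"
    proof -
      have "Ci * ?h \<le> C * ?h" using A Ct hp by (intro mult_right_mono) (auto simp: C_def)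
      then show ?thesis using u0(1) unfolding u(1) by linarith
    qed
    moreover have "norm (x m - xs ((-1) ^ m) \<Gamma> p (u (real m * h p))) \<le> C * h p ^ (2 * n)" if m: "real m * h p \<le> T" for m
    proof -
      have "norm (x m - xs ((-1) ^ m) \<Gamma> p (u (real m * h p))) \<le> Ct * h p ^ (2 * n)"
        by (rule track[OF p hs(2) order_refl su stay _ x1 x2 aa xR' xm]) (use u u0 m in auto)
      also have "\<dots> \<le> C * h p ^ (2 * n)" using A Ci hp by (intro mult_right_mono) (auto simp: C_def)
      finally show ?thesis .
    qed
    ultimately show "\<exists>u. sol G p T u \<and> (\<forall>t\<in>{0..T}. norm (u t) \<le> r \<and> norm (snd (snd (u t))) \<le> C * (h p)\<^sup>2 \<and> B0 \<bullet> snd (snd (u t)) = 0) \<and>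
      norm (u 0 - (x 0, B0 \<bullet> v 0, 0)) \<le> C * (h p)\<^sup>2 \<and> xs 1 \<Gamma> p (u 0) = x 0 \<and>
      snd (snd (u 0)) = ((h p)\<^sup>2 / 4) *\<^sub>R J (J (Xi p (u 0)) - (1 / \<epsilon> p) *\<^sub>R (v 0 - (B0 \<bullet> v 0) *\<^sub>R B0)) \<and>
      (\<forall>m. real m * h p \<le> T \<longrightarrow> norm (x m - xs ((-1) ^ m) \<Gamma> p (u (real m * h p))) \<le> C * h p ^ (2 * n))"
      using su u0(3,5) u(1) by (intro exI[of _ u]) auto
  qed
qed

end

section \<open>Eigenspace projections and uniqueness\<close>

lemma bounded_linear_cvec: "bounded_linear cvec"
  unfolding linear_conv_bounded_linear[symmetric]
  by (rule linearI) (simp_all add: cvec_def vec_eq_iff scaleR_conv_of_real[where 'a = complex])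

lemma bounded_linear_Ppm: "bounded_linear (Ppm v1 s)"
  unfolding linear_conv_bounded_linear[symmetric] Ppm_def outer_proj_def
  by (rule linearI)
    (simp_all add: vec_eq_iff sum.distrib distrib_left distrib_right scaleR_conv_of_real[where 'a = complex] sum_distrib_left sum_distrib_right mult_ac)

lemma bounded_linear_Ppm_cvec: "bounded_linear (\<lambda>a. Ppm v1 s (cvec a))"
  by (rule bounded_linear_compose[OF bounded_linear_Ppm bounded_linear_cvec])

lemma bounded_linear_P0: "bounded_linear (P0 B0)"
  unfolding P0_def[abs_def]
  by (rule bounded_linear_compose[OF bounded_linear_scaleR_left bounded_linear_inner_right])

text \<open>For a real vector the projections onto the two conjugate eigenspaces are conjugate to
  each other, so their sum is real and taking real parts loses nothing.\<close>

definition rpart :: "complex^3 \<Rightarrow> complex^3 \<Rightarrow> real^3" where "rpart a b = (\<chi> i. Re ((a + b) $ i))"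

lemma bounded_linear_rpart: "bounded_linear (\<lambda>q. rpart (fst q) (snd q))"
  unfolding linear_conv_bounded_linear[symmetric] rpart_def
  by (rule linearI) (simp_all add: vec_eq_iff algebra_simps)

lemma norm_rpart_le: "norm (rpart a b) \<le> norm a + norm b"
proof -
  have "norm (rpart a b) \<le> norm (a + b)"
    unfolding norm_vec_def by (rule L2_set_mono) (auto simp: rpart_def intro: abs_Re_le_cmod[of "_ + _", simplified])
  then show ?thesis using norm_triangle_ineq[of a b] by linarith
qed

context
  fixes B0 :: "real^3" and v1 :: "complex^3"
  assumes B0: "norm B0 = 1" and v1: "unit_eigenvector B0 v1"
begin

lemma eigen_components:
  "v1$2 * complex_of_real (B0$3) - v1$3 * complex_of_real (B0$2) = \<i> * v1$1"
  "v1$3 * complex_of_real (B0$1) - v1$1 * complex_of_real (B0$3) = \<i> * v1$2"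
  "v1$1 * complex_of_real (B0$2) - v1$2 * complex_of_real (B0$1) = \<i> * v1$3"
proof -
  have "ccross v1 (cvec B0) = \<i> *s v1" using v1 by (simp add: unit_eigenvector_def)
  then have e: "ccross v1 (cvec B0) $ k = (\<i> *s v1) $ k" for k by simp
  show "v1$2 * complex_of_real (B0$3) - v1$3 * complex_of_real (B0$2) = \<i> * v1$1"
    "v1$3 * complex_of_real (B0$1) - v1$1 * complex_of_real (B0$3) = \<i> * v1$2"
    "v1$1 * complex_of_real (B0$2) - v1$2 * complex_of_real (B0$1) = \<i> * v1$3"
    using e[of 1] e[of 2] e[of 3] by (simp_all add: ccross_def cvec_def)
qed

lemma cross3_nth:
  "cross3 a b $ 1 = a$2 * b$3 - a$3 * b$2" "cross3 a b $ 2 = a$3 * b$1 - a$1 * b$3" "cross3 a b $ 3 = a$1 * b$2 - a$2 * b$1"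
  by (simp_all add: cross3_def)

text \<open>The map a \<times> B0 is skew-adjoint, so inside the inner product it can be moved onto
  the eigenvector, where it acts by the eigenvalue. The conjugate eigenvector covers s = -1.\<close>

lemma Ppm_cross3:
  assumes s: "s \<in> {1, -1}"
  shows "Ppm v1 s (cvec (cross3 a B0)) = (of_int s * \<i>) *s Ppm v1 s (cvec a)"
proof -
  have c: "cnj (v1$2) * complex_of_real (B0$3) - cnj (v1$3) * complex_of_real (B0$2) = - \<i> * cnj (v1$1)"
    "cnj (v1$3) * complex_of_real (B0$1) - cnj (v1$1) * complex_of_real (B0$3) = - \<i> * cnj (v1$2)"
    "cnj (v1$1) * complex_of_real (B0$2) - cnj (v1$2) * complex_of_real (B0$1) = - \<i> * cnj (v1$3)"
    using eigen_components[THEN arg_cong[where f = cnj]] by simp_all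
  have key: "w$1 * (complex_of_real (cross3 a B0 $ 1)) + w$2 * (complex_of_real (cross3 a B0 $ 2)) + w$3 * (complex_of_real (cross3 a B0 $ 3))
      = - q * (w$1 * complex_of_real (a$1) + w$2 * complex_of_real (a$2) + w$3 * complex_of_real (a$3))"
    if "w$2 * complex_of_real (B0$3) - w$3 * complex_of_real (B0$2) = q * w$1"
      "w$3 * complex_of_real (B0$1) - w$1 * complex_of_real (B0$3) = q * w$2"
      "w$1 * complex_of_real (B0$2) - w$2 * complex_of_real (B0$1) = q * w$3" for w :: "complex^3" and q
  proof -
    have "w$1 * (complex_of_real (cross3 a B0 $ 1)) + w$2 * (complex_of_real (cross3 a B0 $ 2)) + w$3 * (complex_of_real (cross3 a B0 $ 3))
      = - (complex_of_real (a$1) * (w$2 * complex_of_real (B0$3) - w$3 * complex_of_real (B0$2))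
         + complex_of_real (a$2) * (w$3 * complex_of_real (B0$1) - w$1 * complex_of_real (B0$3))
         + complex_of_real (a$3) * (w$1 * complex_of_real (B0$2) - w$2 * complex_of_real (B0$1)))"
      unfolding cross3_nth by (simp add: algebra_simps)
    then show ?thesis unfolding that by (simp add: algebra_simps)
  qed
  have k1: "(\<Sum>i\<in>UNIV. cnj (v1$i) * cvec (cross3 a B0) $ i) = \<i> * (\<Sum>i\<in>UNIV. cnj (v1$i) * cvec a $ i)"
    using key[of "\<chi> i. cnj (v1$i)" "- \<i>"] c by (simp add: sum_3 cvec_def)
  have k2: "(\<Sum>i\<in>UNIV. v1$i * cvec (cross3 a B0) $ i) = - \<i> * (\<Sum>i\<in>UNIV. v1$i * cvec a $ i)"
    using key[of v1 \<i>] eigen_components by (simp add: sum_3 cvec_def)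
  show ?thesis using s k1 k2
    by (auto simp: Ppm_def outer_proj_def cnj_vec_def vector_smult_assoc)
qed

text \<open>Write v1 = p + i q. Then p \<times> B0 = -q and q \<times> B0 = p, so p and q are
  orthogonal, span the plane orthogonal to B0 and both have squared norm 1/2. The two projections
  add up to 2 (p . a) p + 2 (q . a) q.\<close>

lemma Ppm_sum: "rpart (Ppm v1 1 (cvec a)) (Ppm v1 (-1) (cvec a)) = a - (B0 \<bullet> a) *\<^sub>R B0"
proof -
  define p q :: "real^3" where "p = (\<chi> i. Re (v1$i))" and "q = (\<chi> i. Im (v1$i))"
  have Jp: "cross3 p B0 = - q"
    using eigen_components[THEN arg_cong[where f = Re]]
    by (simp add: vec_eq_iff forall_3 cross3_nth p_def q_def)
  have Jq: "cross3 q B0 = p"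
    using eigen_components[THEN arg_cong[where f = Im]]
    by (simp add: vec_eq_iff forall_3 cross3_nth p_def q_def)
  have ort: "p \<bullet> B0 = 0" "q \<bullet> B0 = 0" "p \<bullet> q = 0"
  proof -
    show "p \<bullet> B0 = 0" unfolding Jq[symmetric] by (simp add: dot_cross_self)
    have "(- q) \<bullet> B0 = 0" unfolding Jp[symmetric] by (simp add: dot_cross_self)
    then show "q \<bullet> B0 = 0" by simp
    have "p \<bullet> (- q) = 0" unfolding Jp[symmetric] by (simp add: dot_cross_self)
    then show "p \<bullet> q = 0" by simp
  qed
  have "(norm p)\<^sup>2 = (norm q)\<^sup>2"
    using norm_cross_dot[of q B0] unfolding Jq by (simp add: ort B0)
  moreover have "(norm p)\<^sup>2 + (norm q)\<^sup>2 = 1"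
  proof -
    have "(norm v1)\<^sup>2 = 1" using v1 by (simp add: unit_eigenvector_def)
    then have "v1 \<bullet> v1 = 1" by (simp add: power2_norm_eq_inner)
    then show ?thesis unfolding power2_norm_eq_inner
      by (simp add: inner_vec_def sum_3 p_def q_def inner_complex_def power2_eq_square algebra_simps)
  qed
  ultimately have pp: "p \<bullet> p = 1/2" "q \<bullet> q = 1/2" by (auto simp: power2_norm_eq_inner)
  have pq: "cross3 p q = (1/2) *\<^sub>R B0"
  proof -
    have "cross3 p q = - cross3 p (cross3 p B0)" by (simp add: Jp)
    then show ?thesis by (simp add: Lagrange ort pp)
  qed
  \<comment> \<open>The defect of the expansion is orthogonal to p, q and B0. By the Lagrange
    identity its cross product with p \<times> q, a multiple of B0, vanishes, and a vector both
    orthogonal and parallel to B0 is zero.\<close>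
  define d where "d = a - (B0 \<bullet> a) *\<^sub>R B0 - (2 * (p \<bullet> a)) *\<^sub>R p - (2 * (q \<bullet> a)) *\<^sub>R q"
  have BB: "B0 \<bullet> B0 = 1" using B0 by (simp add: norm_eq_1)
  have d0: "d \<bullet> B0 = 0" "d \<bullet> p = 0" "d \<bullet> q = 0"
  proof -
    have ort': "B0 \<bullet> p = 0" "B0 \<bullet> q = 0" "q \<bullet> p = 0" using ort by (simp_all add: inner_commute)
    show "d \<bullet> B0 = 0" "d \<bullet> p = 0" "d \<bullet> q = 0"
      unfolding d_def inner_diff_left inner_scaleR_left ort ort' pp BB inner_commute[of a] by simp_all
  qed
  have "cross3 d (cross3 p q) = 0" by (simp add: Lagrange d0)
  then have "cross3 d B0 = 0" by (simp add: pq cross_mult_right)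
  then have "(norm d)\<^sup>2 = 0" using norm_cross_dot[of d B0] by (simp add: d0 B0)
  then have "d = 0" by simp
  moreover have "rpart (Ppm v1 1 (cvec a)) (Ppm v1 (-1) (cvec a)) = (2 * (p \<bullet> a)) *\<^sub>R p + (2 * (q \<bullet> a)) *\<^sub>R q"
    by (simp add: vec_eq_iff rpart_def Ppm_def outer_proj_def cnj_vec_def cvec_def p_def q_def inner_vec_def sum_3 algebra_simps)
  ultimately show ?thesis by (simp add: d_def algebra_simps)
qed

lemma split_P0_Ppm: "a = P0 B0 a + rpart (Ppm v1 1 (cvec a)) (Ppm v1 (-1) (cvec a))"
  unfolding Ppm_sum P0_def by simp

lemma norm_P0_le: "norm (P0 B0 a) \<le> norm a"
  using Cauchy_Schwarz_ineq2[of B0 a] B0 by (simp add: P0_def)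

end

section \<open>Uniqueness of the decomposition and of the modulation solution\<close>

lemma deriv_on_linear:
  fixes A :: "'a::real_normed_vector \<Rightarrow> 'b::real_normed_vector"
  assumes T: "T > 0" and A: "bounded_linear A"
    and der: "\<And>j t. j < N \<Longrightarrow> t \<in> {0..T} \<Longrightarrow> (deriv_on T j f has_vector_derivative deriv_on T (Suc j) f t) (at t within {0..T})"
    and k: "k \<le> N" and t: "t \<in> {0..T}"
  shows "deriv_on T k (\<lambda>s. A (f s)) t = A (deriv_on T k f t)"
    and "k < N \<Longrightarrow> (deriv_on T k (\<lambda>s. A (f s)) has_vector_derivative A (deriv_on T (Suc k) f t)) (at t within {0..T})"
proof -
  have d: "(deriv_on T k (\<lambda>s. A (f s)) has_vector_derivative A (deriv_on T (Suc k) f t)) (at t within {0..T})"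
    if "k < N" "t \<in> {0..T}" "\<And>t. t \<in> {0..T} \<Longrightarrow> deriv_on T k (\<lambda>s. A (f s)) t = A (deriv_on T k f t)" for k t
    using has_vector_derivative_transform[OF that(2) that(3) bounded_linear.has_vector_derivative[OF A der[OF that(1,2)]]] by simp
  have "\<forall>t\<in>{0..T}. k \<le> N \<longrightarrow> deriv_on T k (\<lambda>s. A (f s)) t = A (deriv_on T k f t)" for k
  proof (induction k)
    case 0
    then show ?case by simp
  next
    case (Suc k)
    show ?case
    proof (intro ballI impI)
      fix t assume t: "t \<in> {0..T}" and kN: "Suc k \<le> N"
      have "(deriv_on T k (\<lambda>s. A (f s)) has_vector_derivative A (deriv_on T (Suc k) f t)) (at t within cbox 0 T)"
        using d[of k t] Suc t kN by simp
      then show "deriv_on T (Suc k) (\<lambda>s. A (f s)) t = A (deriv_on T (Suc k) f t)"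
        using vector_derivative_within_cbox[of 0 T t] T t by simp
    qed
  qed
  then show "deriv_on T k (\<lambda>s. A (f s)) t = A (deriv_on T k f t)"
    and "k < N \<Longrightarrow> (deriv_on T k (\<lambda>s. A (f s)) has_vector_derivative A (deriv_on T (Suc k) f t)) (at t within {0..T})"
    using k t d[of k t] by auto
qed

text \<open>Interpolation on every second grid point, at either parity \<open>q\<close>.\<close>

lemma small_on_grid:
  assumes T: "T > 0"
  obtains K h0 where "K > 0" "h0 > 0" "\<And>\<phi> D h q t. 0 < h \<Longrightarrow> h \<le> h0 \<Longrightarrow> q < 2 \<Longrightarrow>
    (\<And>k t. k < N \<Longrightarrow> t \<in> {0..T} \<Longrightarrow> (\<phi> k has_real_derivative \<phi> (Suc k) t) (at t within {0..T})) \<Longrightarrow>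
    (\<And>t. t \<in> {0..T} \<Longrightarrow> \<bar>\<phi> N t\<bar> \<le> D) \<Longrightarrow>
    (\<And>n. real n * h \<le> T \<Longrightarrow> n mod 2 = q \<Longrightarrow> \<bar>\<phi> 0 (real n * h)\<bar> \<le> D * h ^ N) \<Longrightarrow>
    t \<in> {0..T} \<Longrightarrow> \<bar>\<phi> (0::nat) t\<bar> \<le> K * D * h ^ N"
proof -
  \<comment> \<open>A window of length W h contains 2^N nodes of spacing 2h, including the offset h
    for odd parity, and still leaves room for the rounding of its left end.\<close>
  define W :: real where "W = 2 ^ (N + 1) + 2"
  have W: "W \<ge> 4"
    using one_le_power[of "2::real" N] by (simp add: W_def)
  obtain C where C: "C > 0" and I0: "\<forall>\<phi> s D H a b.
    (\<forall>k<N. \<forall>t\<in>{a..b}. (\<phi> k has_real_derivative \<phi> (Suc k) t) (at t within {a..b})) \<longrightarrow>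
    (\<forall>t\<in>{a..b}. \<bar>\<phi> N t\<bar> \<le> D) \<longrightarrow> H > 0 \<longrightarrow> b - a \<le> W * H \<longrightarrow>
    (\<forall>i<2 ^ N. s i \<in> {a..b} \<and> \<bar>\<phi> 0 (s i)\<bar> \<le> D * H ^ N) \<longrightarrow>
    (\<forall>i. Suc i < 2 ^ N \<longrightarrow> s i + H \<le> s (Suc i)) \<longrightarrow>
    (\<forall>t\<in>{a..b}. \<bar>\<phi> (0::nat) t\<bar> \<le> C * D * H ^ N)"
    using small_on_nodes_imp_small[of W N] W by auto
  show thesis
  proof (rule that[of "C * 2 ^ N" "T / W"])
    show "C * 2 ^ N > 0" "T / W > 0" using C T W by auto
    fix \<phi> :: "nat \<Rightarrow> real \<Rightarrow> real" and D h :: real and q :: nat and t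
    assume h: "0 < h" "h \<le> T / W" and q: "q < 2"
      and der: "\<And>k t. k < N \<Longrightarrow> t \<in> {0..T} \<Longrightarrow> (\<phi> k has_real_derivative \<phi> (Suc k) t) (at t within {0..T})"
      and D: "\<And>t. t \<in> {0..T} \<Longrightarrow> \<bar>\<phi> N t\<bar> \<le> D"
      and sm: "\<And>n. real n * h \<le> T \<Longrightarrow> n mod 2 = q \<Longrightarrow> \<bar>\<phi> 0 (real n * h)\<bar> \<le> D * h ^ N"
      and t: "t \<in> {0..T}"
    have D0: "D \<ge> 0" using D[OF t] by linarith
    have Wh: "W * h \<le> T" using h W by (simp add: field_simps)
    \<comment> \<open>Close to the right end point the window is shifted to the left, so that all
      its nodes stay in [0, T].\<close>
    define \<tau> where "\<tau> = min t (T - W * h)"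
    have \<tau>: "0 \<le> \<tau>" "\<tau> \<le> t" "\<tau> \<le> T - W * h" using t Wh by (auto simp: \<tau>_def)
    define j where "j = nat \<lfloor>\<tau> / (2 * h)\<rfloor>"
    have "0 \<le> \<tau> / (2 * h)" using \<tau> h by simp
    then have j1: "real j \<le> \<tau> / (2 * h)" "\<tau> / (2 * h) < real j + 1" unfolding j_def by linarith+
    define a where "a = real j * (2 * h)"
    have a: "0 \<le> a" "a \<le> \<tau>" "\<tau> < a + 2 * h" using j1 h by (auto simp: a_def field_simps)
    define b where "b = min T (a + W * (2 * h))"
    have sub: "{a..b} \<subseteq> {0..T}" using a by (auto simp: b_def)
    have W2: "W * (2 * h) = W * h + W * h" "4 * h \<le> W * h" using W h by (auto simp: algebra_simps)
    have tb: "t \<in> {a..b}"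
    proof -
      have "t \<le> a + W * (2 * h)"
      proof (cases "t \<le> T - W * h")
        case True
        then have "\<tau> = t" by (simp add: \<tau>_def)
        then show ?thesis using a W2 h by linarith
      next
        case False
        then have "\<tau> = T - W * h" by (simp add: \<tau>_def)
        moreover have "t \<le> T" using t by simp
        ultimately show ?thesis using a W2 h by linarith
      qed
      then show ?thesis using t \<tau> a by (auto simp: b_def)
    qed
    define s where "s i = real (2 * (j + i) + q) * h" for i :: nat
    have sa: "s i = a + real i * (2 * h) + real q * h" for i by (simp add: s_def a_def algebra_simps)
    have sb: "s i \<in> {a..b}" "s i \<le> T" if i: "i < 2 ^ N" for i
    proof -
      have "real i + 1 \<le> 2 ^ N" using i by (metis Suc_eq_plus1 Suc_leI of_nat_1 of_nat_add of_nat_le_iff of_nat_numeral of_nat_power)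
      then have "real i * (2 * h) \<le> (2 ^ N - 1) * (2 * h)" using h by (intro mult_right_mono) auto
      moreover have "real q * h \<le> 1 * h" using q h by (intro mult_right_mono) auto
      moreover have "(2 ^ N - 1) * (2 * h) = W * h - 4 * h" by (simp add: W_def algebra_simps)
      ultimately have le: "s i \<le> a + (W * h - 3 * h)" unfolding sa by linarith
      then show "s i \<le> T" using a \<tau> h by linarith
      moreover have "a \<le> s i" unfolding sa using h by simp
      moreover have "s i \<le> a + W * (2 * h)" using le W2 h by linarith
      ultimately show "s i \<in> {a..b}" by (simp add: b_def)
    qed
    have "\<bar>\<phi> 0 t\<bar> \<le> C * D * (2 * h) ^ N"
    proof (rule I0[THEN spec, of \<phi>, THEN spec, of s, THEN spec, of D, THEN spec, of "2 * h", THEN spec, of a, THEN spec, of b,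
          THEN mp, THEN mp, THEN mp, THEN mp, THEN mp, THEN mp, THEN bspec])
      show "\<forall>k<N. \<forall>t\<in>{a..b}. (\<phi> k has_real_derivative \<phi> (Suc k) t) (at t within {a..b})"
        using der sub by (meson DERIV_subset subsetD)
      show "\<forall>t\<in>{a..b}. \<bar>\<phi> N t\<bar> \<le> D" using D sub by blast
      show "2 * h > 0" using h by simp
      show "b - a \<le> W * (2 * h)" by (simp add: b_def)
      show "\<forall>i<2 ^ N. s i \<in> {a..b} \<and> \<bar>\<phi> 0 (s i)\<bar> \<le> D * (2 * h) ^ N"
      proof (intro allI impI conjI)
        fix i :: nat assume i: "i < 2 ^ N"
        show "s i \<in> {a..b}" by (rule sb(1)[OF i])
        have "\<bar>\<phi> 0 (s i)\<bar> \<le> D * h ^ N"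
          unfolding s_def
        proof (rule sm)
          show "real (2 * (j + i) + q) * h \<le> T" using sb(2)[OF i] unfolding s_def .
          show "(2 * (j + i) + q) mod 2 = q" using q by presburger
        qed
        also have "\<dots> \<le> D * (2 * h) ^ N" using D0 h by (intro mult_left_mono power_mono) auto
        finally show "\<bar>\<phi> 0 (s i)\<bar> \<le> D * (2 * h) ^ N" .
      qed
      show "\<forall>i. Suc i < 2 ^ N \<longrightarrow> s i + 2 * h \<le> s (Suc i)" by (simp add: sa algebra_simps)
      show "t \<in> {a..b}" by (rule tb)
    qed
    then show "\<bar>\<phi> 0 t\<bar> \<le> C * 2 ^ N * D * h ^ N" by (simp add: power_mult_distrib mult_ac)
  qed
qed

text \<open>At grid points of one parity both decompositions represent the same numerical value, so
  the difference of y + \<sigma> z is O(h^N) there. Its N-th derivative is bounded, and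
  interpolation extends the estimate to all t. Half the sum and half the difference over \<sigma> =
  \<plusminus>1 recover y and z.\<close>

lemma unique_decomposition_of_bounds:
  assumes T: "T > 0"
  obtains K h0 where "K > 0" "h0 > 0" "\<And>C h x y z. 0 < h \<Longrightarrow> h \<le> h0 \<Longrightarrow> h \<le> 1 \<Longrightarrow>
    coeff_bounds T N h C y z \<Longrightarrow> remainder_bound T N h C x y z \<Longrightarrow>
    unique_decomposition (\<lambda>c. K * (c + C)) T N h x y z"
proof -
  obtain K0 h0 where K0: "K0 > 0" "h0 > 0" and G: "\<And>\<phi> D h q t. 0 < h \<Longrightarrow> h \<le> h0 \<Longrightarrow> q < 2 \<Longrightarrow>
    (\<And>k t. k < N \<Longrightarrow> t \<in> {0..T} \<Longrightarrow> (\<phi> k has_real_derivative \<phi> (Suc k) t) (at t within {0..T})) \<Longrightarrow>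
    (\<And>t. t \<in> {0..T} \<Longrightarrow> \<bar>\<phi> N t\<bar> \<le> D) \<Longrightarrow>
    (\<And>n. real n * h \<le> T \<Longrightarrow> n mod 2 = q \<Longrightarrow> \<bar>\<phi> 0 (real n * h)\<bar> \<le> D * h ^ N) \<Longrightarrow>
    t \<in> {0..T} \<Longrightarrow> \<bar>\<phi> (0::nat) t\<bar> \<le> K0 * D * h ^ N"
    using small_on_grid[OF T, of N] by blast
  \<comment> \<open>The summand 2 covers the N-th derivatives of y and z, since h^2 \<le> 1, and the
    summand T^2 the factor t^2 in the two remainder bounds.\<close>
  define E where "E = 2 + T\<^sup>2"
  have E: "E \<ge> 2" by (simp add: E_def)
  show thesis
  proof (rule that[of "3 * K0 * E" h0])
    show "3 * K0 * E > 0" "h0 > 0" using K0 E by auto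
    fix C h :: real and x y z
    assume h: "0 < h" "h \<le> h0" "h \<le> 1" and cb: "coeff_bounds T N h C y z" and rb: "remainder_bound T N h C x y z"
    show "unique_decomposition (\<lambda>c. 3 * K0 * E * (c + C)) T N h x y z"
      unfolding unique_decomposition_def
    proof (intro allI impI)
      fix c y' z' assume "coeff_bounds T N h c y' z' \<and> remainder_bound T N h c x y' z'"
      then have cb': "coeff_bounds T N h c y' z'" and rb': "remainder_bound T N h c x y' z'" by auto
      have T0: "0 \<in> {0..T}" using T by simp
      have cC: "c \<ge> 0" "C \<ge> 0"
        using cb cb' T0 norm_ge_zero order_trans unfolding coeff_bounds_def by (metis le0)+
      have h2: "h\<^sup>2 \<le> 1" using h by (simp add: power_le_one)
      define w where "w \<sigma> k t = (deriv_on T k y' t + \<sigma> *\<^sub>R deriv_on T k z' t) - (deriv_on T k y t + \<sigma> *\<^sub>R deriv_on T k z t)"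
        for \<sigma> :: real and k t
      have dw: "(w \<sigma> k has_vector_derivative w \<sigma> (Suc k) t) (at t within {0..T})" if "k < N" "t \<in> {0..T}" for \<sigma> k t
      proof -
        have d: "(deriv_on T k f has_vector_derivative deriv_on T (Suc k) f t) (at t within {0..T})"
          if "f \<in> {y, z, y', z'}" for f
          using Ck_on_has_vector_derivative[of T N f k t] cb cb' that \<open>k < N\<close> \<open>t \<in> {0..T}\<close> unfolding coeff_bounds_def by auto
        have bl: "bounded_linear (\<lambda>a::real^3. \<sigma> *\<^sub>R a)" by (rule bounded_linear_scaleR_right)
        show ?thesis unfolding w_def[abs_def]
          by (intro has_vector_derivative_diff has_vector_derivative_add bounded_linear.has_vector_derivative[OF bl] d) auto
      qed
      have tri: "norm ((a + b) - (c + d)) \<le> norm a + norm b + norm c + norm d" for a b c d :: "real^3"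
        by (rule order_trans[OF norm_triangle_ineq4]) (use norm_triangle_ineq[of a b] norm_triangle_ineq[of c d] in linarith)
      have close: "norm (w \<sigma> 0 t) \<le> 3 * (K0 * (E * (c + C)) * h ^ N)" if \<sigma>: "\<sigma> = 1 \<or> \<sigma> = -1" and t: "t \<in> {0..T}" for \<sigma> t
      proof -
        have nw: "norm (w \<sigma> N s) \<le> E * (c + C)" if s: "s \<in> {0..T}" for s
        proof -
          have b: "norm (deriv_on T N y s) \<le> C" "norm (deriv_on T N z s) \<le> C * h\<^sup>2"
            "norm (deriv_on T N y' s) \<le> c" "norm (deriv_on T N z' s) \<le> c * h\<^sup>2"
            using cb cb' s unfolding coeff_bounds_def by auto
          have "C * h\<^sup>2 \<le> C" "c * h\<^sup>2 \<le> c" using cC h2 by (auto intro: mult_left_le)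
          moreover have "norm (\<sigma> *\<^sub>R deriv_on T N z s) = norm (deriv_on T N z s)" "norm (\<sigma> *\<^sub>R deriv_on T N z' s) = norm (deriv_on T N z' s)"
            using \<sigma> by auto
          ultimately have "norm (w \<sigma> N s) \<le> 2 * (c + C)"
            using b tri[of "deriv_on T N y' s" "\<sigma> *\<^sub>R deriv_on T N z' s" "deriv_on T N y s" "\<sigma> *\<^sub>R deriv_on T N z s"]
            unfolding w_def by (smt (verit))
          also have "\<dots> \<le> E * (c + C)" using E cC by (intro mult_right_mono) auto
          finally show ?thesis .
        qed
        define q :: nat where "q = (if \<sigma> = 1 then 0 else 1)"
        have ng: "norm (w \<sigma> 0 (real n * h)) \<le> (E * (c + C)) * h ^ N" if n: "real n * h \<le> T" "n mod 2 = q" for n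
        proof -
          have sg: "(-1) ^ n = \<sigma>"
          proof (cases "even n")
            case True
            then have "q = 0" using n by simp
            then show ?thesis using True by (simp add: q_def split: if_splits)
          next
            case False
            then have "q = 1" using n by (metis mod2_eq_if)
            then show ?thesis using False \<sigma> by (auto simp: q_def split: if_splits)
          qed
          have "w \<sigma> 0 (real n * h) = remainder h x y z n - remainder h x y' z' n"
            by (simp add: w_def remainder_def sg)
          moreover have "norm (remainder h x y z n - remainder h x y' z' n) \<le> C * (real n * h)\<^sup>2 * h ^ N + c * (real n * h)\<^sup>2 * h ^ N"
            using rb rb' n unfolding remainder_bound_def by (intro order_trans[OF norm_triangle_ineq4] add_mono) auto
          moreover have "C * (real n * h)\<^sup>2 * h ^ N + c * (real n * h)\<^sup>2 * h ^ N = (c + C) * (real n * h)\<^sup>2 * h ^ N"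
            by (simp add: algebra_simps)
          moreover have "(c + C) * (real n * h)\<^sup>2 * h ^ N \<le> (c + C) * E * h ^ N"
          proof -
            have "(real n * h)\<^sup>2 \<le> T\<^sup>2" using n h by (intro power_mono) auto
            then have "(real n * h)\<^sup>2 \<le> E" unfolding E_def by linarith
            then show ?thesis using cC h by (intro mult_right_mono mult_left_mono) auto
          qed
          ultimately show ?thesis by (simp add: mult_ac)
        qed
        have comp: "\<bar>w \<sigma> 0 t $ i\<bar> \<le> K0 * (E * (c + C)) * h ^ N" for i
        proof (rule G[where \<phi> = "\<lambda>k t. w \<sigma> k t $ i" and q = q])
          show "((\<lambda>t. w \<sigma> k t $ i) has_real_derivative w \<sigma> (Suc k) t $ i) (at t within {0..T})" if "k < N" "t \<in> {0..T}" for k t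
            unfolding has_real_derivative_iff_has_vector_derivative
            by (rule bounded_linear.has_vector_derivative[OF bounded_linear_vec_nth dw[OF that]])
          show "\<bar>w \<sigma> N t $ i\<bar> \<le> E * (c + C)" if "t \<in> {0..T}" for t
            by (rule order_trans[OF component_le_norm_cart nw[OF that]])
          show "\<bar>w \<sigma> 0 (real n * h) $ i\<bar> \<le> E * (c + C) * h ^ N" if "real n * h \<le> T" "n mod 2 = q" for n
            by (rule order_trans[OF component_le_norm_cart ng[OF that]])
        qed (use h t in \<open>auto simp: q_def\<close>)
        have "norm (w \<sigma> 0 t) \<le> (\<Sum>i\<in>UNIV. \<bar>w \<sigma> 0 t $ i\<bar>)" by (rule norm_le_l1_cart)
        also have "\<dots> \<le> (\<Sum>i\<in>(UNIV::3 set). K0 * (E * (c + C)) * h ^ N)" by (intro sum_mono comp)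
        finally show ?thesis by simp
      qed
      have yz: "norm (y' t - y t) \<le> 3 * K0 * E * (c + C) * h ^ N" "norm (z' t - z t) \<le> 3 * K0 * E * (c + C) * h ^ N"
        if t: "t \<in> {0..T}" for t
      proof -
        let ?X = "3 * (K0 * (E * (c + C)) * h ^ N)"
        have a: "norm (w 1 0 t) \<le> ?X" "norm (w (-1) 0 t) \<le> ?X" using close t by auto
        have "y' t - y t = (1/2) *\<^sub>R (w 1 0 t + w (-1) 0 t)" "z' t - z t = (1/2) *\<^sub>R (w 1 0 t - w (-1) 0 t)"
          by (simp_all add: w_def vec_eq_iff field_simps)
        then have "norm (y' t - y t) = (1/2) * norm (w 1 0 t + w (-1) 0 t)" "norm (z' t - z t) = (1/2) * norm (w 1 0 t - w (-1) 0 t)"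
          by (simp_all only: norm_scaleR)
        then have "norm (y' t - y t) \<le> ?X" "norm (z' t - z t) \<le> ?X"
          using a norm_triangle_ineq[of "w 1 0 t" "w (-1) 0 t"] norm_triangle_ineq4[of "w 1 0 t" "w (-1) 0 t"] by linarith+
        then show "norm (y' t - y t) \<le> 3 * K0 * E * (c + C) * h ^ N" "norm (z' t - z t) \<le> 3 * K0 * E * (c + C) * h ^ N"
          by (simp_all only: mult.assoc)
      qed
      show "close_on T (3 * K0 * E * (c + C) * h ^ N) y' y \<and> close_on T (3 * K0 * E * (c + C) * h ^ N) z' z"
        unfolding close_on_def using yz by blast
    qed
  qed
qed

lemma norm_quad_le:
  fixes a :: "'a::real_normed_vector" and b :: "'b::real_normed_vector" and c :: "'c::real_normed_vector" and d :: "'d::real_normed_vector"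
  shows "norm (a, b, c, d) \<le> norm a + norm b + norm c + norm d"
    and "norm a \<le> norm (a, b, c, d)" "norm b \<le> norm (a, b, c, d)" "norm c \<le> norm (a, b, c, d)" "norm d \<le> norm (a, b, c, d)"
proof -
  show "norm (a, b, c, d) \<le> norm a + norm b + norm c + norm d"
    using norm_Pair_le[of a "(b, c, d)"] norm_Pair_le[of b "(c, d)"] norm_Pair_le[of c d] by linarith
  show "norm a \<le> norm (a, b, c, d)" by (rule norm_fst_le)
  have 1: "norm (b, c, d) \<le> norm (a, b, c, d)" by (rule norm_snd_le)
  show "norm b \<le> norm (a, b, c, d)" using 1 norm_fst_le[of b "(c, d)"] by linarith
  have 2: "norm (c, d) \<le> norm (a, b, c, d)" using 1 norm_snd_le[of "(c, d)" b] by linarith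
  show "norm c \<le> norm (a, b, c, d)" using 2 norm_fst_le[of c d] by linarith
  show "norm d \<le> norm (a, b, c, d)" using 2 norm_snd_le[of d c] by linarith
qed

text \<open>Gronwall's inequality for the difference of two state curves. Of y', the part along B0
  belongs to the state, and the parts P(\<plusminus>1) are supplied by the equations; z is
  reassembled from its projections in the state and the algebraic equation for its B0 part.\<close>

lemma unique_modulation_of_lipschitz:
  assumes T: "T > 0" and N: "N \<ge> 2" and B0: "norm B0 = 1" and v1: "unit_eigenvector B0 v1"
  obtains U where "\<And>\<epsilon> h S y z. 0 < \<epsilon> \<Longrightarrow> 0 < h \<Longrightarrow> h \<le> 1 \<Longrightarrow> locally_lipschitz_system L S \<Longrightarrow>
    coeff_bounds T N h C y z \<Longrightarrow> solves_upto 0 T B0 v1 S y z \<Longrightarrow> unique_modulation U T N \<epsilon> h B0 v1 S y z"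
proof -
  obtain K1 where K1: "K1 > 0" "\<And>a. norm (Ppm v1 1 (cvec a)) \<le> norm a * K1"
    using bounded_linear.pos_bounded[OF bounded_linear_Ppm_cvec] by blast
  obtain K2 where K2: "K2 > 0" "\<And>a. norm (Ppm v1 (-1) (cvec a)) \<le> norm a * K2"
    using bounded_linear.pos_bounded[OF bounded_linear_Ppm_cvec] by blast
  \<comment> \<open>A ball containing both state curves. Its radius depends on the constant of the
    competitor, and so does the Lipschitz constant; therefore the result is a function of
    \<open>c\<close>.\<close>
  define r where "r c = (2 + K1 + K2) * (c + C)" for c
  define l where "l c = max 0 (L (r c))" for c
  \<comment> \<open>The factor 6 is one initial error plus five defects: one for y'' along B0 and
    two each for y and z in the eigenspaces. The same count gives 1 + 5 \<open>l c\<close>.\<close>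
  define X where "X c = 6 * exp ((1 + 2 * (1 + 5 * l c)) * T)" for c
  show thesis
  proof (rule that[of "\<lambda>c. ((l c + 3) * X c + 1) * c"])
    fix \<epsilon> h :: real and S and y z :: "real \<Rightarrow> real^3"
    assume \<epsilon>: "0 < \<epsilon>" and h: "0 < h" "h \<le> 1" and S: "locally_lipschitz_system L S"
      and cb: "coeff_bounds T N h C y z" and sol: "solves_upto 0 T B0 v1 S y z"
    show "unique_modulation (\<lambda>c. ((l c + 3) * X c + 1) * c) T N \<epsilon> h B0 v1 S y z"
      unfolding unique_modulation_def
    proof (intro allI impI)
      fix c :: real and y' z' :: "real \<Rightarrow> real^3"
      assume a: "coeff_bounds T N h c y' z' \<and> solves_upto (c * \<epsilon> ^ (N + 2)) T B0 v1 S y' z' \<and>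
        norm (mstate T B0 v1 y' z' 0 - mstate T B0 v1 y z 0) \<le> c * \<epsilon> ^ (N + 2)"
      then have cb': "coeff_bounds T N h c y' z'" by blast
      define \<delta> where "\<delta> = c * \<epsilon> ^ (N + 2)"
      have sol': "solves_upto \<delta> T B0 v1 S y' z'" and ini: "norm (mstate T B0 v1 y' z' 0 - mstate T B0 v1 y z 0) \<le> \<delta>"
        using a by (auto simp: \<delta>_def)
      have T0: "0 \<in> {0..T}" using T by simp
      have cC: "c \<ge> 0" "C \<ge> 0"
        using cb cb' T0 norm_ge_zero order_trans unfolding coeff_bounds_def by (metis le0)+
      have \<delta>: "\<delta> \<ge> 0" using cC \<epsilon> by (simp add: \<delta>_def)
      have h2: "h\<^sup>2 \<le> 1" using h by (simp add: power_le_one)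
      have dv: "(deriv_on T j f has_vector_derivative deriv_on T (Suc j) f t) (at t within {0..T})"
        if "f \<in> {y, z, y', z'}" "j < N" "t \<in> {0..T}" for f j t
        using Ck_on_has_vector_derivative[of T N f j t] cb cb' that unfolding coeff_bounds_def by auto
      have P0d: "deriv_on T k (\<lambda>u. P0 B0 (f u)) t = P0 B0 (deriv_on T k f t)"
        "k < N \<Longrightarrow> (deriv_on T k (\<lambda>u. P0 B0 (f u)) has_vector_derivative P0 B0 (deriv_on T (Suc k) f t)) (at t within {0..T})"
        if "f \<in> {y, z, y', z'}" "t \<in> {0..T}" "k \<le> N" for f t k
        using deriv_on_linear[OF T bounded_linear_P0 dv[OF that(1)] that(3,2)] by auto
      have Pd: "deriv_on T k (\<lambda>u. Ppm v1 s (cvec (f u))) t = Ppm v1 s (cvec (deriv_on T k f t))"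
        "k < N \<Longrightarrow> (deriv_on T k (\<lambda>u. Ppm v1 s (cvec (f u))) has_vector_derivative Ppm v1 s (cvec (deriv_on T (Suc k) f t))) (at t within {0..T})"
        if "f \<in> {y, z, y', z'}" "t \<in> {0..T}" "k \<le> N" for f t k s
        using deriv_on_linear[OF T bounded_linear_Ppm_cvec[of v1 s] dv[OF that(1)] that(3,2)] by auto
      let ?m = "\<lambda>t. mstate T B0 v1 y z t" and ?m' = "\<lambda>t. mstate T B0 v1 y' z' t"
      have mb: "norm (mstate T B0 v1 f q t) \<le> (2 + K1 + K2) * k"
        if cb: "coeff_bounds T N h k f q" and fq: "f \<in> {y, z, y', z'}" "q \<in> {y, z, y', z'}" and t: "t \<in> {0..T}" and k: "k \<ge> 0" for f q k t
      proof -
        have b: "norm (f t) \<le> k" "norm (deriv_on T 1 f t) \<le> k" "norm (q t) \<le> k * h\<^sup>2"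
        proof -
          have all: "norm (deriv_on T j f t) \<le> k \<and> norm (deriv_on T j q t) \<le> k * h\<^sup>2" if "j \<le> N" for j
            using cb t that unfolding coeff_bounds_def by blast
          show "norm (f t) \<le> k" "norm (deriv_on T 1 f t) \<le> k" "norm (q t) \<le> k * h\<^sup>2"
            using all[of 0] all[of 1] N by simp_all
        qed
        have q: "norm (q t) \<le> k" using b(3) mult_left_le[OF h2 k] by linarith
        have "deriv_on T 1 (\<lambda>u. P0 B0 (f u)) t = P0 B0 (deriv_on T 1 f t)" by (rule P0d(1)) (use fq t N in auto)
        then have "norm (mstate T B0 v1 f q t) \<le> norm (f t) + norm (P0 B0 (deriv_on T 1 f t)) + norm (Ppm v1 1 (cvec (q t))) + norm (Ppm v1 (-1) (cvec (q t)))"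
          unfolding mstate_def by (simp only:) (rule norm_quad_le(1))
        also have "\<dots> \<le> k + k + k * K1 + k * K2"
        proof (intro add_mono)
          show "norm (P0 B0 (deriv_on T 1 f t)) \<le> k" by (rule order_trans[OF norm_P0_le[OF B0 v1] b(2)])
          show "norm (Ppm v1 1 (cvec (q t))) \<le> k * K1" by (rule order_trans[OF K1(2)]) (use q K1 in auto)
          show "norm (Ppm v1 (-1) (cvec (q t))) \<le> k * K2" by (rule order_trans[OF K2(2)]) (use q K2 in auto)
        qed (rule b)
        finally show ?thesis by (simp add: algebra_simps)
      qed
      have kpos: "2 + K1 + K2 \<ge> 0" using K1 K2 by simp
      have mr: "?m t \<in> cball 0 (r c)" "?m' t \<in> cball 0 (r c)" if t: "t \<in> {0..T}" for t
      proof -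
        have "(2 + K1 + K2) * C \<le> r c" "(2 + K1 + K2) * c \<le> r c" unfolding r_def using kpos cC by (intro mult_left_mono; simp)+
        moreover have "norm (?m t) \<le> (2 + K1 + K2) * C" by (rule mb[OF cb _ _ t cC(2)]) auto
        moreover have "norm (?m' t) \<le> (2 + K1 + K2) * c" by (rule mb[OF cb' _ _ t cC(1)]) auto
        ultimately show "?m t \<in> cball 0 (r c)" "?m' t \<in> cball 0 (r c)" unfolding mem_cball_0 by linarith+
      qed
      define f where "f t = ?m' t - ?m t" for t
      have lp: "norm (F (?m' t) - F (?m t)) \<le> l c * norm (f t)" if "(L (r c))-lipschitz_on (cball 0 (r c)) F" "t \<in> {0..T}"
        for F :: "mstate \<Rightarrow> 'w::real_normed_vector" and t
      proof -
        have "norm (F (?m' t) - F (?m t)) \<le> L (r c) * norm (f t)"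
          using lipschitz_onD[OF that(1) mr(2,1)[OF that(2)]] by (simp add: dist_norm f_def)
        also have "\<dots> \<le> l c * norm (f t)" by (intro mult_right_mono) (auto simp: l_def)
        finally show ?thesis .
      qed
      have Ls: "(L (r c))-lipschitz_on (cball 0 (r c)) (y0_rhs S)" "(L (r c))-lipschitz_on (cball 0 (r c)) (z0_expr S)"
        "s \<in> {1, -1} \<Longrightarrow> (L (r c))-lipschitz_on (cball 0 (r c)) (y_rhs S s)" "s \<in> {1, -1} \<Longrightarrow> (L (r c))-lipschitz_on (cball 0 (r c)) (z_rhs S s)" for s
        using S unfolding locally_lipschitz_system_def by blast+
      have diff: "norm (x' - x) \<le> l c * norm (f t) + \<delta>"
        if "norm (x - F (?m t)) \<le> 0" "norm (x' - F (?m' t)) \<le> \<delta>" "(L (r c))-lipschitz_on (cball 0 (r c)) F" "t \<in> {0..T}"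
        for x x' :: "'w::real_normed_vector" and F t
      proof -
        have "x' - x = (x' - F (?m' t)) + (F (?m' t) - F (?m t))" using that(1) by simp
        then have "norm (x' - x) \<le> norm (x' - F (?m' t)) + norm (F (?m' t) - F (?m t))" by (simp only: norm_triangle_ineq)
        then show ?thesis using that(2) lp[OF that(3,4)] by linarith
      qed
      define d where "d k q q' t = deriv_on T k q' t - deriv_on T k q t" for k and q q' :: "real \<Rightarrow> real^3" and t
      define f' where "f' t = (d 1 y y' t, P0 B0 (d 2 y y' t), Ppm v1 1 (cvec (d 1 z z' t)), Ppm v1 (-1) (cvec (d 1 z z' t)))" for t
      have yin: "y \<in> {y, z, y', z'}" and zin: "z \<in> {y, z, y', z'}" and y'in: "y' \<in> {y, z, y', z'}" and z'in: "z' \<in> {y, z, y', z'}"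
        by simp_all
      have Pdiff: "Ppm v1 s (cvec (a - b)) = Ppm v1 s (cvec a) - Ppm v1 s (cvec b)" for s a b
        using bounded_linear.linear[OF bounded_linear_Ppm_cvec, of v1 s] by (rule linear_diff)
      have P0diff: "P0 B0 (a - b) = P0 B0 a - P0 B0 b" for a b
        using bounded_linear.linear[OF bounded_linear_P0, of B0] by (rule linear_diff)
      have comps: "norm (d 0 y y' t) \<le> norm (f t)" "norm (P0 B0 (d 1 y y' t)) \<le> norm (f t)"
        "norm (Ppm v1 1 (cvec (d 0 z z' t))) \<le> norm (f t)" "norm (Ppm v1 (-1) (cvec (d 0 z z' t))) \<le> norm (f t)" if t: "t \<in> {0..T}" for t
      proof -
        have e: "f t = (d 0 y y' t, P0 B0 (d 1 y y' t), Ppm v1 1 (cvec (d 0 z z' t)), Ppm v1 (-1) (cvec (d 0 z z' t)))"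
          using P0d(1)[of y t 1] P0d(1)[of y' t 1] t N by (simp add: f_def mstate_def d_def Pdiff P0diff)
        show "norm (d 0 y y' t) \<le> norm (f t)" "norm (P0 B0 (d 1 y y' t)) \<le> norm (f t)"
          "norm (Ppm v1 1 (cvec (d 0 z z' t))) \<le> norm (f t)" "norm (Ppm v1 (-1) (cvec (d 0 z z' t))) \<le> norm (f t)"
          unfolding e by (rule norm_quad_le)+
      qed
      have P2: "norm (P0 B0 (d 2 y y' t)) \<le> l c * norm (f t) + \<delta>" if t: "t \<in> {0..T}" for t
      proof -
        have e: "deriv_on T 2 (\<lambda>u. P0 B0 (q u)) t = P0 B0 (deriv_on T 2 q t)" if "q \<in> {y, z, y', z'}" for q
          by (rule P0d(1)[OF that t]) (use N in simp)
        have s1: "norm (deriv_on T 2 (\<lambda>u. P0 B0 (y u)) t - y0_rhs S (?m t)) \<le> 0" using sol t unfolding solves_upto_def by blast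
        have s2: "norm (deriv_on T 2 (\<lambda>u. P0 B0 (y' u)) t - y0_rhs S (?m' t)) \<le> \<delta>" using sol' t unfolding solves_upto_def by blast
        show ?thesis unfolding d_def P0diff
          by (rule diff[OF s1[unfolded e[of y, OF yin]] s2[unfolded e[of y', OF y'in]] Ls(1) t])
      qed
      have Py: "norm (Ppm v1 s (cvec (d 1 y y' t))) \<le> l c * norm (f t) + \<delta>" if t: "t \<in> {0..T}" and s: "s \<in> {1, -1}" for t s
      proof -
        have e: "deriv_on T 1 (\<lambda>u. Ppm v1 s (cvec (q u))) t = Ppm v1 s (cvec (deriv_on T 1 q t))" if "q \<in> {y, z, y', z'}" for q
          by (rule Pd(1)[OF that t]) (use N in simp)
        have s1: "norm (deriv_on T 1 (\<lambda>u. Ppm v1 s (cvec (y u))) t - y_rhs S s (?m t)) \<le> 0" using sol t s unfolding solves_upto_def by blast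
        have s2: "norm (deriv_on T 1 (\<lambda>u. Ppm v1 s (cvec (y' u))) t - y_rhs S s (?m' t)) \<le> \<delta>" using sol' t s unfolding solves_upto_def by blast
        show ?thesis unfolding d_def Pdiff
          by (rule diff[OF s1[unfolded e[of y, OF yin]] s2[unfolded e[of y', OF y'in]] Ls(3)[OF s] t])
      qed
      have Pz: "norm (Ppm v1 s (cvec (d 1 z z' t))) \<le> l c * norm (f t) + \<delta>" if t: "t \<in> {0..T}" and s: "s \<in> {1, -1}" for t s
      proof -
        have e: "deriv_on T 1 (\<lambda>u. Ppm v1 s (cvec (q u))) t = Ppm v1 s (cvec (deriv_on T 1 q t))" if "q \<in> {y, z, y', z'}" for q
          by (rule Pd(1)[OF that t]) (use N in simp)
        have s1: "norm (deriv_on T 1 (\<lambda>u. Ppm v1 s (cvec (z u))) t - z_rhs S s (?m t)) \<le> 0" using sol t s unfolding solves_upto_def by blast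
        have s2: "norm (deriv_on T 1 (\<lambda>u. Ppm v1 s (cvec (z' u))) t - z_rhs S s (?m' t)) \<le> \<delta>" using sol' t s unfolding solves_upto_def by blast
        show ?thesis unfolding d_def Pdiff
          by (rule diff[OF s1[unfolded e[of z, OF zin]] s2[unfolded e[of z', OF z'in]] Ls(4)[OF s] t])
      qed
      have Pz0: "norm (P0 B0 (d 0 z z' t)) \<le> l c * norm (f t) + \<delta>" if t: "t \<in> {0..T}" for t
      proof -
        have s1: "norm (P0 B0 (z t) - z0_expr S (?m t)) \<le> 0" using sol t unfolding solves_upto_def by blast
        have s2: "norm (P0 B0 (z' t) - z0_expr S (?m' t)) \<le> \<delta>" using sol' t unfolding solves_upto_def by blast
        show ?thesis unfolding d_def P0diff deriv_on.simps(1) by (rule diff[OF s1 s2 Ls(2) t])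
      qed
      have full: "norm a \<le> norm (P0 B0 a) + (norm (Ppm v1 1 (cvec a)) + norm (Ppm v1 (-1) (cvec a)))" for a
        by (subst split_P0_Ppm[OF B0 v1, of a], rule order_trans[OF norm_triangle_ineq add_left_mono[OF norm_rpart_le]])
      have fb: "norm (f t) \<le> X c * \<delta>" if t: "t \<in> {0..T}" for t
      proof -
        have "norm (f t) \<le> (norm (f 0) + 5 * \<delta>) * exp ((1 + 2 * (1 + 5 * l c)) * T)"
        proof (rule gronwall_norm[where f' = f'])
          show "(f has_vector_derivative f' t) (at t within {0..T})" if t: "t \<in> {0..T}" for t
          proof -
            have m: "(mstate T B0 v1 q w has_vector_derivative (deriv_on T 1 q t, P0 B0 (deriv_on T 2 q t),
                Ppm v1 1 (cvec (deriv_on T 1 w t)), Ppm v1 (-1) (cvec (deriv_on T 1 w t)))) (at t within {0..T})"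
              if "q \<in> {y, z, y', z'}" "w \<in> {y, z, y', z'}" for q w
            proof -
              have "(q has_vector_derivative deriv_on T 1 q t) (at t within {0..T})" using dv[OF that(1) _ t, of 0] N by simp
              moreover have "(deriv_on T 1 (\<lambda>u. P0 B0 (q u)) has_vector_derivative P0 B0 (deriv_on T 2 q t)) (at t within {0..T})"
                using P0d(2)[OF that(1) t, of 1] N by (simp add: numeral_2_eq_2)
              moreover have "((\<lambda>u. Ppm v1 s (cvec (w u))) has_vector_derivative Ppm v1 s (cvec (deriv_on T 1 w t))) (at t within {0..T})" for s
                using Pd(2)[OF that(2) t, of 0] N by simp
              ultimately show ?thesis unfolding mstate_def[abs_def] by (intro has_vector_derivative_Pair)
            qed
            show ?thesis
              using has_vector_derivative_diff[OF m[of y' z'] m[of y z]] unfolding f_def[abs_def] f'_def d_def Pdiff P0diff by simp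
          qed
          show "norm (f' t) \<le> 5 * \<delta> + (1 + 5 * l c) * norm (f t)" if t: "t \<in> {0..T}" for t
          proof -
            have "norm (d 1 y y' t) \<le> norm (f t) + ((l c * norm (f t) + \<delta>) + (l c * norm (f t) + \<delta>))"
              using full[of "d 1 y y' t"] comps(2)[OF t] Py[OF t, of 1] Py[OF t, of "-1"] by simp
            moreover have "norm (f' t) \<le> norm (d 1 y y' t) + norm (P0 B0 (d 2 y y' t)) + norm (Ppm v1 1 (cvec (d 1 z z' t))) + norm (Ppm v1 (-1) (cvec (d 1 z z' t)))"
              unfolding f'_def by (rule norm_quad_le)
            moreover have "(1 + 5 * l c) * norm (f t) = norm (f t) + 5 * (l c * norm (f t))" by (simp add: algebra_simps)
            ultimately show ?thesis using P2[OF t] Pz[OF t, of 1] Pz[OF t, of "-1"] by simp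
          qed
        qed (use \<delta> t in \<open>auto simp: l_def\<close>)
        also have "\<dots> \<le> (6 * \<delta>) * exp ((1 + 2 * (1 + 5 * l c)) * T)"
          using ini by (intro mult_right_mono) (auto simp: f_def)
        finally show ?thesis by (simp add: X_def mult_ac)
      qed
      have l0: "l c \<ge> 0" "X c \<ge> 0" by (auto simp: l_def X_def)
      have U: "((l c + 3) * X c + 1) * c * \<epsilon> ^ (N + 2) = (l c + 3) * (X c * \<delta>) + \<delta>" by (simp add: \<delta>_def algebra_simps)
      have fin: "norm (y' t - y t) \<le> ((l c + 3) * X c + 1) * c * \<epsilon> ^ (N + 2)" "norm (z' t - z t) \<le> ((l c + 3) * X c + 1) * c * \<epsilon> ^ (N + 2)"
        if t: "t \<in> {0..T}" for t
      proof -
        have p: "0 \<le> X c * \<delta>" "0 \<le> l c * (X c * \<delta>)" using l0 \<delta> by auto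
        have e: "(l c + 3) * (X c * \<delta>) = l c * (X c * \<delta>) + 3 * (X c * \<delta>)" by (simp add: algebra_simps)
        have "norm (y' t - y t) \<le> X c * \<delta>" using comps(1)[OF t] fb[OF t] by (simp add: d_def)
        then show "norm (y' t - y t) \<le> ((l c + 3) * X c + 1) * c * \<epsilon> ^ (N + 2)" unfolding U e using p \<delta> by linarith
        have "l c * norm (f t) \<le> l c * (X c * \<delta>)" using fb[OF t] l0 by (intro mult_left_mono) auto
        moreover have "norm (d 0 z z' t) \<le> (l c * norm (f t) + \<delta>) + (norm (f t) + norm (f t))"
          using full[of "d 0 z z' t"] Pz0[OF t] comps(3,4)[OF t] by linarith
        ultimately have "norm (z' t - z t) \<le> l c * (X c * \<delta>) + \<delta> + 2 * (X c * \<delta>)"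
          using fb[OF t] by (simp add: d_def)
        then show "norm (z' t - z t) \<le> ((l c + 3) * X c + 1) * c * \<epsilon> ^ (N + 2)" unfolding U e using p by linarith
      qed
      then show "close_on T (((l c + 3) * X c + 1) * c * \<epsilon> ^ (N + 2)) y' y \<and> close_on T (((l c + 3) * X c + 1) * c * \<epsilon> ^ (N + 2)) z' z"
        unfolding close_on_def by blast
    qed
  qed
qed

section \<open>The Boris algorithm and the variational integrator\<close>

text \<open>The basis directions are Lipschitz separately, and expanding \<open>v\<close> in the
  basis makes the estimate linear in |v|.\<close>

lemma smf_derivative_lipschitz:
  fixes f :: "'p \<Rightarrow> 'a::euclidean_space \<Rightarrow> 'b::real_normed_vector"
  assumes f: "smf P f"
  obtains C where "C > 0" "\<And>p u u' v. p \<in> P \<Longrightarrow> norm u \<le> r \<Longrightarrow> norm u' \<le> r \<Longrightarrow>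
    norm (frechet_derivative (f p) (at u) v - frechet_derivative (f p) (at u') v) \<le> C * norm (u - u') * norm v"
proof -
  have "\<forall>i\<in>Basis. \<exists>C. \<forall>p\<in>P. \<forall>u u'. norm u \<le> r \<longrightarrow> norm u' \<le> r \<longrightarrow>
      norm (frechet_derivative (f p) (at u) i - frechet_derivative (f p) (at u') i) \<le> C * norm (u - u')"
  proof
    fix i :: 'a assume i: "i \<in> Basis"
    obtain C where "C > 0" "\<And>p u u'. p \<in> P \<Longrightarrow> norm u \<le> r \<Longrightarrow> norm u' \<le> r \<Longrightarrow>
      norm (frechet_derivative (f p) (at u) i - frechet_derivative (f p) (at u') i) \<le> C * norm (u - u')"
      by (rule smf_lipschitz[OF smf_frechet[OF f i], of r]) blast
    then show "\<exists>C. \<forall>p\<in>P. \<forall>u u'. norm u \<le> r \<longrightarrow> norm u' \<le> r \<longrightarrow>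
      norm (frechet_derivative (f p) (at u) i - frechet_derivative (f p) (at u') i) \<le> C * norm (u - u')" by blast
  qed
  then obtain c where c: "\<And>i p u u'. i \<in> Basis \<Longrightarrow> p \<in> P \<Longrightarrow> norm u \<le> r \<Longrightarrow> norm u' \<le> r \<Longrightarrow>
      norm (frechet_derivative (f p) (at u) i - frechet_derivative (f p) (at u') i) \<le> c i * norm (u - u')"
    by metis
  define C where "C = 1 + (\<Sum>i\<in>Basis. \<bar>c i\<bar>)"
  show thesis
  proof (rule that[of C])
    show "C > 0" unfolding C_def by (simp add: add_pos_nonneg sum_nonneg)
    fix p and u u' v :: 'a assume p: "p \<in> P" and u: "norm u \<le> r" "norm u' \<le> r"
    let ?L = "frechet_derivative (f p) (at u)" and ?L' = "frechet_derivative (f p) (at u')"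
    have lin: "linear (frechet_derivative (f p) (at x))" for x
      by (rule has_derivative_linear[OF smf_has_derivative[OF f p]])
    have "?L v - ?L' v = (\<Sum>i\<in>Basis. (v \<bullet> i) *\<^sub>R (?L i - ?L' i))"
      by (subst (1 2) linear_Basis_sum[OF lin]) (simp add: sum_subtractf scaleR_diff_right)
    also have "norm \<dots> \<le> (\<Sum>i\<in>Basis. \<bar>c i\<bar> * (norm (u - u') * norm v))"
    proof (rule sum_norm_le)
      fix i :: 'a assume i: "i \<in> Basis"
      have "norm (?L i - ?L' i) \<le> c i * norm (u - u')" by (rule c[OF i p u])
      also have "\<dots> \<le> \<bar>c i\<bar> * norm (u - u')" by (rule mult_right_mono) auto
      finally have "norm ((v \<bullet> i) *\<^sub>R (?L i - ?L' i)) \<le> norm v * (\<bar>c i\<bar> * norm (u - u'))"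
        unfolding norm_scaleR real_norm_def using Basis_le_norm[OF i, of v] by (intro mult_mono) auto
      then show "norm ((v \<bullet> i) *\<^sub>R (?L i - ?L' i)) \<le> \<bar>c i\<bar> * (norm (u - u') * norm v)"
        by (simp only: mult_ac)
    qed
    also have "\<dots> = (\<Sum>i\<in>Basis. \<bar>c i\<bar>) * (norm (u - u') * norm v)" by (rule sum_distrib_right[symmetric])
    also have "\<dots> \<le> C * (norm (u - u') * norm v)" unfolding C_def by (rule mult_right_mono) auto
    finally show "norm (?L v - ?L' v) \<le> C * norm (u - u') * norm v" by (simp only: mult.assoc)
  qed
qed

lemma jacobian_mult:
  fixes f :: "real^3 \<Rightarrow> real^3"
  assumes "f differentiable at x"
  shows "jacobian f (at x) *v v = frechet_derivative f (at x) v"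
  by (rule fun_cong[OF frechet_derivative_at[OF jacobian_works[THEN iffD1, OF assms]]])

lemma inner_transpose_jacobian:
  fixes f :: "real^3 \<Rightarrow> real^3"
  assumes "f differentiable at x"
  shows "(transpose (jacobian f (at x)) *v v) \<bullet> w = v \<bullet> frechet_derivative f (at x) w"
  unfolding transpose_matrix_vector dot_lmul_matrix jacobian_mult[OF assms] ..

text \<open>The skew part of the Jacobian acts as a cross product with the curl. This is what turns
  the force of the variational integrator into v \<times> B1 at leading order.\<close>

lemma curl_identity:
  fixes f :: "real^3 \<Rightarrow> real^3"
  assumes "f differentiable at x"
  shows "transpose (jacobian f (at x)) *v v - frechet_derivative f (at x) v = cross3 v (curl f x)"
  unfolding jacobian_mult[OF assms, symmetric]
  by (simp add: vec_eq_iff forall_3 matrix_vector_mult_def transpose_def sum_3 curl_def Let_def cross3_def algebra_simps)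

lemma two_step_identities:
  fixes x :: "int \<Rightarrow> real^3"
  assumes h: "h > 0"
  shows "x (n + 1) = x n + h *\<^sub>R velocity h x n + (h\<^sup>2 / 2) *\<^sub>R second_difference h x n"
    and "x (n - 1) = x n - h *\<^sub>R velocity h x n + (h\<^sup>2 / 2) *\<^sub>R second_difference h x n"
  using h by (simp_all add: velocity_def second_difference_def vec_eq_iff field_simps)

text \<open>The linear part of the potential is skew in x, so the transposed Jacobian and the
  difference quotient contribute one half of the stiff term each, without discretisation
  error.\<close>

lemma variational_potential:
  fixes A1 :: "real^3 \<Rightarrow> real^3"
  assumes A: "A1 differentiable at x" and \<epsilon>: "\<epsilon> > 0" and h: "h > 0"
  shows "transpose (jacobian (potential \<epsilon> B0 A1) (at x)) *v v
      - (1 / (2 * h)) *\<^sub>R (potential \<epsilon> B0 A1 (q + h *\<^sub>R v) - potential \<epsilon> B0 A1 (q - h *\<^sub>R v))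
    = (1 / \<epsilon>) *\<^sub>R cross3 v B0 + (transpose (jacobian A1 (at x)) *v v - (1 / (2 * h)) *\<^sub>R (A1 (q + h *\<^sub>R v) - A1 (q - h *\<^sub>R v)))"
proof -
  have blc: "bounded_linear (\<lambda>y. cross3 y B0)"
    using bilinear_cross bilinear_conv_bounded_bilinear bounded_bilinear.bounded_linear_left by blast
  have d: "(potential \<epsilon> B0 A1 has_derivative (\<lambda>w. - ((1 / (2 * \<epsilon>)) *\<^sub>R cross3 w B0) + frechet_derivative A1 (at x) w)) (at x)"
    unfolding potential_def[abs_def]
    by (intro has_derivative_add has_derivative_minus has_derivative_scaleR_right bounded_linear_imp_has_derivative[OF blc]
      frechet_derivative_works[THEN iffD1, OF A])
  have f: "frechet_derivative (potential \<epsilon> B0 A1) (at x) = (\<lambda>w. - ((1 / (2 * \<epsilon>)) *\<^sub>R cross3 w B0) + frechet_derivative A1 (at x) w)"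
    using frechet_derivative_at[OF d] by simp
  have pd: "potential \<epsilon> B0 A1 differentiable at x" using d by (auto simp: differentiable_def)
  have T: "transpose (jacobian (potential \<epsilon> B0 A1) (at x)) *v v = (1 / (2 * \<epsilon>)) *\<^sub>R cross3 v B0 + transpose (jacobian A1 (at x)) *v v"
  proof (rule euclidean_eqI)
    fix i :: "real^3" assume "i \<in> Basis"
    have "v \<bullet> cross3 i B0 = - (cross3 v B0 \<bullet> i)"
      by (simp add: cross3_def inner_vec_def sum_3 algebra_simps)
    then show "(transpose (jacobian (potential \<epsilon> B0 A1) (at x)) *v v) \<bullet> i
      = ((1 / (2 * \<epsilon>)) *\<^sub>R cross3 v B0 + transpose (jacobian A1 (at x)) *v v) \<bullet> i"
      unfolding inner_add_left inner_transpose_jacobian[OF A] inner_transpose_jacobian[OF pd] f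
      by (simp add: inner_add_right inner_diff_right)
  qed
  have D: "(1 / (2 * h)) *\<^sub>R (potential \<epsilon> B0 A1 (q + h *\<^sub>R v) - potential \<epsilon> B0 A1 (q - h *\<^sub>R v))
    = (1 / (2 * h)) *\<^sub>R (A1 (q + h *\<^sub>R v) - A1 (q - h *\<^sub>R v)) - (1 / (2 * \<epsilon>)) *\<^sub>R cross3 v B0"
    using h \<epsilon> by (simp add: potential_def cross3_def vec_eq_iff forall_3 field_simps)
  have "(1 / \<epsilon>) *\<^sub>R cross3 v B0 = (1 / (2 * \<epsilon>)) *\<^sub>R cross3 v B0 + (1 / (2 * \<epsilon>)) *\<^sub>R cross3 v B0"
    using \<epsilon> by (simp add: scaleR_left_distrib[symmetric] field_simps)
  then show ?thesis unfolding T D by simp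
qed

section \<open>Forces of the two methods as smooth families\<close>

locale fields = step_family P h \<epsilon> for P :: "'p set" and h \<epsilon> +
  fixes B0 :: "real^3" and Af Bf Ef :: "'p \<Rightarrow> real^3 \<Rightarrow> real^3"
  assumes B0: "norm B0 = 1" and Af: "smf P Af" and Bf: "smf P Bf" and Ef: "smf P Ef"
    and curl: "\<And>p x. p \<in> P \<Longrightarrow> Bf p x = curl (Af p) x"
begin

definition boris_force :: "'p \<Rightarrow> (real^3) \<times> (real^3) \<times> (real^3) \<Rightarrow> real^3" where
  "boris_force p = (\<lambda>(x, v, b). cross3 v (Bf p x) + Ef p x)"

text \<open>With b equal to h^2 times the second difference, the two evaluation points are the
  neighbouring grid positions. The implicit term of the scheme becomes an explicit function of (x,
  v, b).\<close>

definition dquot :: "'p \<Rightarrow> (real^3) \<times> (real^3) \<times> (real^3) \<Rightarrow> real^3" where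
  "dquot p = (\<lambda>(x, v, b). (1 / (2 * h p)) *\<^sub>R (Af p (x + (1/2) *\<^sub>R b + h p *\<^sub>R v) - Af p (x + (1/2) *\<^sub>R b - h p *\<^sub>R v)))"

definition variational_force :: "'p \<Rightarrow> (real^3) \<times> (real^3) \<times> (real^3) \<Rightarrow> real^3" where
  "variational_force p = (\<lambda>(x, v, b). transpose (jacobian (Af p) (at x)) *v v - dquot p (x, v, b) + Ef p x)"

lemma Af_diff: "p \<in> P \<Longrightarrow> Af p differentiable at x"
  using smf_has_derivative[OF Af] unfolding differentiable_def by blast

lemma blcross: "bounded_bilinear cross3"
  using bilinear_cross bilinear_conv_bounded_bilinear by blast

lemma smf_proj:
  "smf P (\<lambda>p (u :: (real^3) \<times> (real^3) \<times> (real^3)). fst u)"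
  "smf P (\<lambda>p (u :: (real^3) \<times> (real^3) \<times> (real^3)). fst (snd u))"
  "smf P (\<lambda>p (u :: (real^3) \<times> (real^3) \<times> (real^3)). snd (snd u))"
  by (rule smf_linear[OF bounded_linear_fst smf_id],
    rule smf_linear[OF bounded_linear_fst smf_linear[OF bounded_linear_snd smf_id]],
    rule smf_linear[OF bounded_linear_snd smf_linear[OF bounded_linear_snd smf_id]])

lemma smf_boris_force: "smf P boris_force"
proof -
  have "smf P (\<lambda>p (u :: (real^3) \<times> (real^3) \<times> (real^3)). cross3 (fst (snd u)) (Bf p (fst u)) + Ef p (fst u))"
    by (rule smf_add[OF smf_bilinear[OF blcross smf_proj(2) smf_compose[OF Bf smf_proj(1)]] smf_compose[OF Ef smf_proj(1)]])
  then show ?thesis unfolding boris_force_def[abs_def] case_prod_beta' .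
qed

lemma transpose_jacobian_sum:
  assumes "p \<in> P"
  shows "transpose (jacobian (Af p) (at x)) *v v = (\<Sum>i\<in>Basis. (frechet_derivative (Af p) (at x) i \<bullet> v) *\<^sub>R i)"
  by (subst euclidean_representation[of "transpose (jacobian (Af p) (at x)) *v v", symmetric]) (simp only: inner_transpose_jacobian[OF Af_diff[OF assms]] inner_commute[of v])

lemma smf_variational_force: "smf P variational_force"
proof -
  have t: "smf P (\<lambda>p (u :: (real^3) \<times> (real^3) \<times> (real^3)). transpose (jacobian (Af p) (at (fst u))) *v fst (snd u))" (is "smf P ?t")
  proof -
    have "smf P (\<lambda>p (u :: (real^3) \<times> (real^3) \<times> (real^3)). \<Sum>i\<in>Basis. (frechet_derivative (Af p) (at (fst u)) i \<bullet> fst (snd u)) *\<^sub>R i)"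
      by (intro smf_sum smf_linear[OF bounded_linear_scaleR_left] smf_bilinear[OF bounded_bilinear_inner]
        smf_compose[OF smf_frechet[OF Af] smf_proj(1)] smf_proj(2)) auto
    then show ?thesis by (subst smf_cong[OF transpose_jacobian_sum]) auto
  qed
  let ?q = "\<lambda>p (u :: (real^3) \<times> (real^3) \<times> (real^3)). fst u + (1/2) *\<^sub>R snd (snd u)"
  have hv: "smf P (\<lambda>p (u :: (real^3) \<times> (real^3) \<times> (real^3)). h p *\<^sub>R fst (snd u))"
    by (rule smf_scale[where C = 1, OF _ smf_proj(2)]) (use h h1 in \<open>auto simp: abs_of_pos\<close>)
  have q: "smf P ?q" by (rule smf_add[OF smf_proj(1) smf_linear[OF bounded_linear_scaleR_right smf_proj(3)]])
  have "smf P (\<lambda>p u. (1 / h p) *\<^sub>R (Af p (?q p u + h p *\<^sub>R fst (snd u)) - Af p (?q p u - h p *\<^sub>R fst (snd u))))"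
    by (rule smf_diff_quotient[where d = h, OF Af smf_add[OF q hv] smf_diff[OF q hv] smf_linear[OF bounded_linear_scaleR_right smf_proj(2)]])
      (use h in \<open>auto simp: vec_eq_iff algebra_simps\<close>)
  then have d: "smf P (\<lambda>p u. (1/2) *\<^sub>R ((1 / h p) *\<^sub>R (Af p (?q p u + h p *\<^sub>R fst (snd u)) - Af p (?q p u - h p *\<^sub>R fst (snd u)))))"
    by (rule smf_linear[OF bounded_linear_scaleR_right])
  have "smf P (\<lambda>p u. ?t p u - (1/2) *\<^sub>R ((1 / h p) *\<^sub>R (Af p (?q p u + h p *\<^sub>R fst (snd u)) - Af p (?q p u - h p *\<^sub>R fst (snd u)))) + Ef p (fst u))"
    by (rule smf_add[OF smf_diff[OF t d] smf_compose[OF Ef smf_proj(1)]])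
  then show ?thesis
    unfolding variational_force_def[abs_def] dquot_def case_prod_beta' by (simp add: mult.commute)
qed

text \<open>The difference of the magnetic terms is split as (v - v') \<times> B(x) + v' \<times>
  (B(x) - B(x')), so the velocity without a bound occurs only in the difference v - v'.\<close>

lemma boris_lip:
  "\<exists>C>0. \<forall>p\<in>P. \<forall>x v b x' v' b'.
      norm x \<le> R \<and> norm (x + h p *\<^sub>R v + (1/2) *\<^sub>R b) \<le> R \<and> norm (x - h p *\<^sub>R v + (1/2) *\<^sub>R b) \<le> R \<and>
      norm x' \<le> R \<and> norm v' \<le> R \<and> norm b' \<le> R \<longrightarrow>
      norm (boris_force p (x, v, b) - boris_force p (x', v', b')) \<le> C * (norm (x - x') + norm (v - v') + norm (b - b'))"
proof -
  obtain c1 where c1: "c1 > 0" "\<And>p x. p \<in> P \<Longrightarrow> norm x \<le> R \<Longrightarrow> norm (Bf p x) \<le> c1"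
    using smf_bound[OF Bf, of R] by blast
  obtain c2 where c2: "c2 > 0" "\<And>p x x'. p \<in> P \<Longrightarrow> norm x \<le> R \<Longrightarrow> norm x' \<le> R \<Longrightarrow> norm (Bf p x - Bf p x') \<le> c2 * norm (x - x')"
    using smf_lipschitz[OF Bf, of R] by blast
  obtain c3 where c3: "c3 > 0" "\<And>p x x'. p \<in> P \<Longrightarrow> norm x \<le> R \<Longrightarrow> norm x' \<le> R \<Longrightarrow> norm (Ef p x - Ef p x') \<le> c3 * norm (x - x')"
    using smf_lipschitz[OF Ef, of R] by blast
  define C where "C = c1 + \<bar>R\<bar> * c2 + c3"
  have C0: "C > 0" unfolding C_def using c1(1) c2(1) c3(1) by (intro add_pos_nonneg add_nonneg_pos) auto
  have "norm (boris_force p (x, v, b) - boris_force p (x', v', b')) \<le> C * (norm (x - x') + norm (v - v') + norm (b - b'))"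
    if p: "p \<in> P" and x: "norm x \<le> R" "norm x' \<le> R" "norm v' \<le> R" for p x v b x' v' b'
  proof -
    have e: "boris_force p (x, v, b) - boris_force p (x', v', b')
      = cross3 (v - v') (Bf p x) + (cross3 v' (Bf p x - Bf p x') + (Ef p x - Ef p x'))"
      by (simp add: boris_force_def cross3_simps)
    have 1: "norm (cross3 (v - v') (Bf p x)) \<le> norm (v - v') * c1"
      by (rule order_trans[OF norm_cross3_le mult_left_mono[OF c1(2)[OF p x(1)]]]) simp
    have 2: "norm (cross3 v' (Bf p x - Bf p x')) \<le> \<bar>R\<bar> * (c2 * norm (x - x'))"
      by (rule order_trans[OF norm_cross3_le mult_mono[OF _ c2(2)[OF p x(1,2)]]]) (use x in auto)
    note 3 = c3(2)[OF p x(1,2)]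
    have "norm (boris_force p (x, v, b) - boris_force p (x', v', b')) \<le> norm (v - v') * c1 + (\<bar>R\<bar> * (c2 * norm (x - x')) + c3 * norm (x - x'))"
      unfolding e by (rule order_trans[OF norm_triangle_ineq add_mono[OF 1 order_trans[OF norm_triangle_ineq add_mono[OF 2 3]]]])
    also have "\<dots> = c1 * norm (v - v') + (\<bar>R\<bar> * c2 + c3) * norm (x - x')" by (simp add: algebra_simps)
    also have "\<dots> \<le> C * norm (v - v') + C * norm (x - x')"
      unfolding C_def using c1(1) c2(1) c3(1) by (intro add_mono mult_right_mono) auto
    also have "\<dots> \<le> C * (norm (x - x') + norm (v - v') + norm (b - b'))"
      using C0 by (simp add: distrib_left)
    finally show ?thesis .
  qed
  then show ?thesis using C0 by blast
qed

lemma boris_modulation: "n \<ge> 1 \<Longrightarrow> two_step_modulation P h \<epsilon> B0 boris_force n Bf Ef"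
proof unfold_locales
  show "\<exists>C>0. \<forall>p\<in>P. \<forall>x v b. norm x \<le> R \<and> norm v \<le> R \<and> norm b \<le> R \<longrightarrow>
      norm (boris_force p (x, v, b) - (cross3 v (Bf p x) + Ef p x)) \<le> C * ((h p)\<^sup>2 + norm b)" for R
    by (rule exI[of _ 1]) (simp add: boris_force_def)
qed (use B0 smf_boris_force Bf Ef boris_lip in auto)

text \<open>Uniform motion along v is the flow of the field (v, 0) on pairs, so the third derivative
  is an iterated Lie derivative with a uniform bound. The even Taylor terms cancel in the
  difference.\<close>

lemma central_difference:
  obtains C where "C > 0" "\<And>p q v. p \<in> P \<Longrightarrow> norm q \<le> R \<Longrightarrow> norm v \<le> R \<Longrightarrow>
    norm ((1 / (2 * h p)) *\<^sub>R (Af p (q + h p *\<^sub>R v) - Af p (q - h p *\<^sub>R v)) - frechet_derivative (Af p) (at q) v) \<le> C * (h p)\<^sup>2"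
proof -
  define F where "F = (\<lambda>p (yv :: (real^3) \<times> (real^3)). Af p (fst yv))"
  define D where "D = (\<lambda>(p::'p) (yv :: (real^3) \<times> (real^3)). (snd yv, 0::real^3))"
  have F: "smf P F" unfolding F_def by (rule smf_compose[OF Af smf_linear[OF bounded_linear_fst smf_id]])
  have D: "smf P D" unfolding D_def by (rule smf_Pair[OF smf_linear[OF bounded_linear_snd smf_id] smf_const[of _ _ 0]]) simp
  obtain C where C: "C > 0" "\<And>p u. p \<in> P \<Longrightarrow> norm u \<le> 3 * \<bar>R\<bar> \<Longrightarrow> norm ((lie D ^^ 3) F p u) \<le> C"
    using smf_bound[OF smf_liepow[OF F D, of 3], of "3 * \<bar>R\<bar>"] by blast
  show thesis
  proof (rule that[OF C(1)])
    fix p and q v :: "real^3" assume p: "p \<in> P" and q: "norm q \<le> R" and v: "norm v \<le> R"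
    \<comment> \<open>The centre q is reached at time 1, because \<open>sol\<close> is formulated on
      intervals that start at 0 while both sides of q are needed.\<close>
    define u where "u = (\<lambda>s::real. (q + (s - 1) *\<^sub>R v, v))"
    define \<phi> where "\<phi> k s = (lie D ^^ k) F p (u s)" for k s
    note hp = h[OF p] h1[OF p]
    have "sol D p 2 u" unfolding sol_def
    proof
      fix t :: real
      show "(u has_vector_derivative D p (u t)) (at t within {0..2})"
        unfolding u_def D_def by (auto intro!: derivative_eq_intros)
    qed
    then have der: "(\<phi> k has_vector_derivative \<phi> (Suc k) t) (at t within {0..2})" if "t \<in> {0..2}" for k t
      unfolding \<phi>_def[abs_def] by (rule sol_chain_pow[OF _ F D p that])
    have bd: "norm (\<phi> (Suc 2) t) \<le> C" if "t \<in> {0..2}" for t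
    proof -
      have "norm ((t - 1) *\<^sub>R v) \<le> 1 * norm v" unfolding norm_scaleR using that by (intro mult_right_mono) auto
      then have "norm (q + (t - 1) *\<^sub>R v) \<le> norm q + norm v" using norm_triangle_ineq[of q "(t - 1) *\<^sub>R v"] by linarith
      then have "norm (u t) \<le> 3 * \<bar>R\<bar>"
        unfolding u_def using norm_Pair_le[of "q + (t - 1) *\<^sub>R v" v] q v by linarith
      from C(2)[OF p this] show ?thesis by (simp add: \<phi>_def numeral_3_eq_3)
    qed
    have T: "norm (\<phi> 0 (1 + s) - (\<phi> 0 1 + s *\<^sub>R \<phi> 1 1 + (s\<^sup>2 / 2) *\<^sub>R \<phi> 2 1)) \<le> C * h p ^ 3" if "s = h p \<or> s = - h p" for s
    proof -
      have "norm (\<phi> 0 (1 + s) - (\<Sum>k\<le>2. ((1 + s - 1) ^ k / fact k) *\<^sub>R \<phi> k 1)) \<le> C * \<bar>1 + s - 1\<bar> ^ Suc 2"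
        by (rule taylor_bound[where S = "{0..2}"]) (use that hp der bd in auto)
      moreover have e: "\<bar>1 + s - 1\<bar> = h p" using that hp by auto
      ultimately show ?thesis unfolding e by (simp add: numeral_2_eq_2 numeral_3_eq_3)
    qed
    have "lie D F p (q, v) = frechet_derivative (Af p) (at q) v"
    proof -
      have "(F p has_derivative (\<lambda>w. frechet_derivative (Af p) (at q) (fst w))) (at (q, v))"
        unfolding F_def
        using has_derivative_compose[OF bounded_linear_imp_has_derivative[OF bounded_linear_fst], of "Af p" "frechet_derivative (Af p) (at q)" "(q, v)" UNIV]
          smf_has_derivative[OF Af p, of q] by simp
      from lie_eqI[where f = F and p = p and G = D, OF this] show ?thesis by (simp add: D_def)
    qed
    then have p1: "\<phi> 1 1 = frechet_derivative (Af p) (at q) v" by (simp add: \<phi>_def u_def)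
    have p0: "\<phi> 0 (1 + s) = Af p (q + s *\<^sub>R v)" for s by (simp add: \<phi>_def u_def F_def)
    have T1: "norm (Af p (q + h p *\<^sub>R v) - (\<phi> 0 1 + h p *\<^sub>R \<phi> 1 1 + ((h p)\<^sup>2 / 2) *\<^sub>R \<phi> 2 1)) \<le> C * h p ^ 3"
      using T[of "h p"] by (simp add: p0)
    have T2: "norm (Af p (q - h p *\<^sub>R v) - (\<phi> 0 1 - h p *\<^sub>R \<phi> 1 1 + ((h p)\<^sup>2 / 2) *\<^sub>R \<phi> 2 1)) \<le> C * h p ^ 3"
      using T[of "- h p"] by (simp add: p0[of "- h p", simplified])
    let ?a = "Af p (q + h p *\<^sub>R v) - (\<phi> 0 1 + h p *\<^sub>R \<phi> 1 1 + ((h p)\<^sup>2 / 2) *\<^sub>R \<phi> 2 1)"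
    let ?b = "Af p (q - h p *\<^sub>R v) - (\<phi> 0 1 - h p *\<^sub>R \<phi> 1 1 + ((h p)\<^sup>2 / 2) *\<^sub>R \<phi> 2 1)"
    have e: "(1 / (2 * h p)) *\<^sub>R (Af p (q + h p *\<^sub>R v) - Af p (q - h p *\<^sub>R v)) - frechet_derivative (Af p) (at q) v
      = (1 / (2 * h p)) *\<^sub>R (?a - ?b)"
      unfolding p1[symmetric] using hp by (simp add: vec_eq_iff field_simps)
    have "norm (?a - ?b) \<le> C * h p ^ 3 + C * h p ^ 3" by (rule order_trans[OF norm_triangle_ineq4 add_mono[OF T1 T2]])
    then have "(1 / (2 * h p)) * norm (?a - ?b) \<le> (1 / (2 * h p)) * (C * h p ^ 3 + C * h p ^ 3)"
      using hp by (intro mult_left_mono) auto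
    also have "\<dots> = C * (h p)\<^sup>2" using hp by (simp add: field_simps power2_eq_square power3_eq_cube)
    finally show "norm ((1 / (2 * h p)) *\<^sub>R (Af p (q + h p *\<^sub>R v) - Af p (q - h p *\<^sub>R v)) - frechet_derivative (Af p) (at q) v) \<le> C * (h p)\<^sup>2"
      unfolding e norm_scaleR using hp(1) by simp
  qed
qed

text \<open>The difference quotient is centred at x + b/2. Replacing it by the derivative there
  costs h^2, moving the centre to x costs |b|, and the curl identity evaluates what is left.\<close>

lemma variational_lead:
  "\<exists>C>0. \<forall>p\<in>P. \<forall>x v b. norm x \<le> R \<and> norm v \<le> R \<and> norm b \<le> R \<longrightarrow>
      norm (variational_force p (x, v, b) - (cross3 v (Bf p x) + Ef p x)) \<le> C * ((h p)\<^sup>2 + norm b)"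
proof -
  obtain c1 where c1: "c1 > 0" "\<And>p q v. p \<in> P \<Longrightarrow> norm q \<le> 2 * \<bar>R\<bar> \<Longrightarrow> norm v \<le> 2 * \<bar>R\<bar> \<Longrightarrow>
    norm ((1 / (2 * h p)) *\<^sub>R (Af p (q + h p *\<^sub>R v) - Af p (q - h p *\<^sub>R v)) - frechet_derivative (Af p) (at q) v) \<le> c1 * (h p)\<^sup>2"
    using central_difference[of "2 * \<bar>R\<bar>"] by blast
  obtain c2 where c2: "c2 > 0" "\<And>p u u' v. p \<in> P \<Longrightarrow> norm u \<le> 2 * \<bar>R\<bar> \<Longrightarrow> norm u' \<le> 2 * \<bar>R\<bar> \<Longrightarrow>
    norm (frechet_derivative (Af p) (at u) v - frechet_derivative (Af p) (at u') v) \<le> c2 * norm (u - u') * norm v"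
    using smf_derivative_lipschitz[OF Af, of "2 * \<bar>R\<bar>"] by blast
  have "norm (variational_force p (x, v, b) - (cross3 v (Bf p x) + Ef p x)) \<le> (c1 + c2 * \<bar>R\<bar>) * ((h p)\<^sup>2 + norm b)"
    if p: "p \<in> P" and R: "norm x \<le> R" "norm v \<le> R" "norm b \<le> R" for p x v b
  proof -
    let ?q = "x + (1/2) *\<^sub>R b"
    have nb: "norm ((1/2) *\<^sub>R b) = norm b / 2" by simp
    have q: "norm ?q \<le> 2 * \<bar>R\<bar>" using norm_triangle_ineq[of x "(1/2) *\<^sub>R b"] R unfolding nb by linarith
    have e: "variational_force p (x, v, b) - (cross3 v (Bf p x) + Ef p x)
      = (frechet_derivative (Af p) (at x) v - frechet_derivative (Af p) (at ?q) v)
        - ((1 / (2 * h p)) *\<^sub>R (Af p (?q + h p *\<^sub>R v) - Af p (?q - h p *\<^sub>R v)) - frechet_derivative (Af p) (at ?q) v)"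
      by (simp add: variational_force_def dquot_def curl[OF p] curl_identity[OF Af_diff[OF p], symmetric])
    have "norm (frechet_derivative (Af p) (at x) v - frechet_derivative (Af p) (at ?q) v) \<le> c2 * norm (x - ?q) * norm v"
      by (rule c2(2)[OF p _ q]) (use R in linarith)
    also have "\<dots> \<le> c2 * norm b * \<bar>R\<bar>"
      using c2(1) R by (intro mult_mono) auto
    finally have 1: "norm (frechet_derivative (Af p) (at x) v - frechet_derivative (Af p) (at ?q) v) \<le> c2 * norm b * \<bar>R\<bar>" .
    have 2: "norm ((1 / (2 * h p)) *\<^sub>R (Af p (?q + h p *\<^sub>R v) - Af p (?q - h p *\<^sub>R v)) - frechet_derivative (Af p) (at ?q) v) \<le> c1 * (h p)\<^sup>2"
      by (rule c1(2)[OF p q]) (use R in linarith)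
    have "norm (variational_force p (x, v, b) - (cross3 v (Bf p x) + Ef p x)) \<le> c2 * norm b * \<bar>R\<bar> + c1 * (h p)\<^sup>2"
      unfolding e by (rule order_trans[OF norm_triangle_ineq4 add_mono[OF 1 2]])
    also have "\<dots> \<le> (c1 + c2 * \<bar>R\<bar>) * ((h p)\<^sup>2 + norm b)"
    proof -
      have "0 \<le> c1 * norm b" "0 \<le> c2 * \<bar>R\<bar> * (h p)\<^sup>2" using c1(1) c2(1) by auto
      then show ?thesis by (simp add: algebra_simps)
    qed
    finally show ?thesis .
  qed
  moreover have "c1 + c2 * \<bar>R\<bar> > 0" using c1(1) c2(1) by (simp add: add_pos_nonneg)
  ultimately show ?thesis by blast
qed

text \<open>Although v may be large, the points x + b/2 + \<theta> h v with |\<theta>| \<le> 1 lie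
  on the segment between the two bounded neighbours. The quotient is estimated by the derivative in
  \<theta>, which carries the factor h that cancels 1/(2h).\<close>

lemma dquot_lip:
  obtains C where "C > 0" "\<And>p x v b x' v' b'. p \<in> P \<Longrightarrow>
      norm (x + h p *\<^sub>R v + (1/2) *\<^sub>R b) \<le> R \<Longrightarrow> norm (x - h p *\<^sub>R v + (1/2) *\<^sub>R b) \<le> R \<Longrightarrow>
      norm x' \<le> R \<Longrightarrow> norm v' \<le> R \<Longrightarrow> norm b' \<le> R \<Longrightarrow>
      norm (dquot p (x, v, b) - dquot p (x', v', b')) \<le> C * (norm (x - x') + norm (v - v') + norm (b - b'))"
proof -
  obtain c1 where c1: "c1 > 0" "\<And>p u v. p \<in> P \<Longrightarrow> norm u \<le> 3 * \<bar>R\<bar> \<Longrightarrow> norm (frechet_derivative (Af p) (at u) v) \<le> c1 * norm v"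
    using smf_derivative_bound[OF Af, of "3 * \<bar>R\<bar>"] by blast
  obtain c2 where c2: "c2 > 0" "\<And>p u u' v. p \<in> P \<Longrightarrow> norm u \<le> 3 * \<bar>R\<bar> \<Longrightarrow> norm u' \<le> 3 * \<bar>R\<bar> \<Longrightarrow>
    norm (frechet_derivative (Af p) (at u) v - frechet_derivative (Af p) (at u') v) \<le> c2 * norm (u - u') * norm v"
    using smf_derivative_lipschitz[OF Af, of "3 * \<bar>R\<bar>"] by blast
  show thesis
  proof (rule that[of "c1 + c2 * \<bar>R\<bar>"])
    show "c1 + c2 * \<bar>R\<bar> > 0" using c1(1) c2(1) by (simp add: add_pos_nonneg)
    fix p and x v b x' v' b' :: "real^3"
    assume p: "p \<in> P" and X: "norm (x + h p *\<^sub>R v + (1/2) *\<^sub>R b) \<le> R" "norm (x - h p *\<^sub>R v + (1/2) *\<^sub>R b) \<le> R"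
      and X': "norm x' \<le> R" "norm v' \<le> R" "norm b' \<le> R"
    let ?q = "x + (1/2) *\<^sub>R b" and ?q' = "x' + (1/2) *\<^sub>R b'"
    let ?S = "norm (x - x') + norm (v - v') + norm (b - b')"
    note hp = h[OF p] h1[OF p]
    have q\<theta>: "norm (?q + \<theta> *\<^sub>R (h p *\<^sub>R v)) \<le> 3 * \<bar>R\<bar>" if "\<theta> \<in> {-1..1}" for \<theta>
    proof -
      have "?q + \<theta> *\<^sub>R (h p *\<^sub>R v) = ((1 + \<theta>) / 2) *\<^sub>R (x + h p *\<^sub>R v + (1/2) *\<^sub>R b) + ((1 - \<theta>) / 2) *\<^sub>R (x - h p *\<^sub>R v + (1/2) *\<^sub>R b)"
        by (simp add: vec_eq_iff field_simps)
      moreover have "norm (((1 + \<theta>) / 2) *\<^sub>R (x + h p *\<^sub>R v + (1/2) *\<^sub>R b)) \<le> 1 * \<bar>R\<bar>"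
        unfolding norm_scaleR using that X by (intro mult_mono) auto
      moreover have "norm (((1 - \<theta>) / 2) *\<^sub>R (x - h p *\<^sub>R v + (1/2) *\<^sub>R b)) \<le> 1 * \<bar>R\<bar>"
        unfolding norm_scaleR using that X by (intro mult_mono) auto
      ultimately show ?thesis
        using norm_triangle_ineq[of "((1 + \<theta>) / 2) *\<^sub>R (x + h p *\<^sub>R v + (1/2) *\<^sub>R b)" "((1 - \<theta>) / 2) *\<^sub>R (x - h p *\<^sub>R v + (1/2) *\<^sub>R b)"] by simp
    qed
    have nw: "norm (\<theta> *\<^sub>R (h p *\<^sub>R w)) \<le> norm w" "norm (h p *\<^sub>R w) = h p * norm w" "norm ((1/2) *\<^sub>R w) = norm w / 2" if "\<theta> \<in> {-1..1}" for \<theta> and w :: "real^3"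
    proof -
      have "\<bar>\<theta>\<bar> * (h p * norm w) \<le> 1 * (1 * norm w)" using that hp by (intro mult_mono) auto
      then show "norm (\<theta> *\<^sub>R (h p *\<^sub>R w)) \<le> norm w" using hp by (simp add: abs_mult)
    qed (use hp in simp_all)
    have q'\<theta>: "norm (?q' + \<theta> *\<^sub>R (h p *\<^sub>R v')) \<le> 3 * \<bar>R\<bar>" if "\<theta> \<in> {-1..1}" for \<theta>
    proof -
      have "norm (?q' + \<theta> *\<^sub>R (h p *\<^sub>R v')) \<le> (norm x' + norm b' / 2) + norm v'"
        by (rule order_trans[OF norm_triangle_ineq add_mono[OF order_trans[OF norm_triangle_ineq] nw(1)[OF that]]]) (simp only: nw(3)[OF that])
      then show ?thesis using X' norm_ge_zero[of b'] by linarith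
    qed
    define K where "K \<theta> = Af p (?q + \<theta> *\<^sub>R (h p *\<^sub>R v)) - Af p (?q' + \<theta> *\<^sub>R (h p *\<^sub>R v'))" for \<theta>
    have der: "((\<lambda>\<theta>. Af p (a + \<theta> *\<^sub>R w)) has_vector_derivative frechet_derivative (Af p) (at (a + \<theta> *\<^sub>R w)) w) (at \<theta> within {-1..1})" for a w \<theta>
    proof -
      have "((\<lambda>\<theta>. a + \<theta> *\<^sub>R w) has_derivative (\<lambda>s. s *\<^sub>R w)) (at \<theta> within {-1..1})" by (auto intro!: derivative_eq_intros)
      from has_derivative_compose[OF this smf_has_derivative[OF Af p]]
      have "((\<lambda>\<theta>. Af p (a + \<theta> *\<^sub>R w)) has_derivative (\<lambda>s. frechet_derivative (Af p) (at (a + \<theta> *\<^sub>R w)) (s *\<^sub>R w))) (at \<theta> within {-1..1})" .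
      then show ?thesis unfolding has_vector_derivative_def linear_scale[OF has_derivative_linear[OF smf_has_derivative[OF Af p]]] .
    qed
    define K' where "K' \<theta> = frechet_derivative (Af p) (at (?q + \<theta> *\<^sub>R (h p *\<^sub>R v))) (h p *\<^sub>R v)
        - frechet_derivative (Af p) (at (?q' + \<theta> *\<^sub>R (h p *\<^sub>R v'))) (h p *\<^sub>R v')" for \<theta>
    have "norm (K 1 - K (-1)) \<le> (h p * ((c1 + c2 * \<bar>R\<bar>) * ?S)) * \<bar>1 - (-1)\<bar>"
    proof (rule vector_derivative_bound[where S = "{-1..1}" and f' = K'])
      show "(K has_vector_derivative K' \<theta>) (at \<theta> within {-1..1})" for \<theta>
        unfolding K_def[abs_def] K'_def by (rule has_vector_derivative_diff[OF der der])
      fix \<theta> :: real assume \<theta>: "\<theta> \<in> {-1..1}"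
      let ?z = "?q + \<theta> *\<^sub>R (h p *\<^sub>R v)" and ?z' = "?q' + \<theta> *\<^sub>R (h p *\<^sub>R v')"
      let ?D = "\<lambda>z. frechet_derivative (Af p) (at z)"
      have lin: "?D z (a - b) = ?D z a - ?D z b" for z a b
        by (rule linear_diff[OF has_derivative_linear[OF smf_has_derivative[OF Af p]]])
      \<comment> \<open>Again the unbounded velocity is confined to v - v'; the difference of
        derivatives acts on the bounded v'.\<close>
      have e: "K' \<theta> = ?D ?z (h p *\<^sub>R (v - v')) + (?D ?z (h p *\<^sub>R v') - ?D ?z' (h p *\<^sub>R v'))"
        unfolding K'_def scaleR_diff_right lin by simp
      have 1: "norm (?D ?z (h p *\<^sub>R (v - v'))) \<le> c1 * (h p * norm (v - v'))"
        using c1(2)[OF p q\<theta>[OF \<theta>], of "h p *\<^sub>R (v - v')"] unfolding nw(2)[OF \<theta>] .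
      have zz: "norm (?z - ?z') \<le> ?S"
      proof -
        have "?z - ?z' = (x - x') + ((1/2) *\<^sub>R (b - b') + \<theta> *\<^sub>R (h p *\<^sub>R (v - v')))" by (simp add: algebra_simps)
        then have "norm (?z - ?z') \<le> norm (x - x') + (norm ((1/2) *\<^sub>R (b - b')) + norm (\<theta> *\<^sub>R (h p *\<^sub>R (v - v'))))"
          by (simp only:) (rule order_trans[OF norm_triangle_ineq add_left_mono[OF norm_triangle_ineq]])
        then show ?thesis using nw(1)[OF \<theta>, of "v - v'"] norm_ge_zero[of "b - b'"] unfolding nw(3)[OF \<theta>] by linarith
      qed
      have "norm (?D ?z (h p *\<^sub>R v') - ?D ?z' (h p *\<^sub>R v')) \<le> c2 * norm (?z - ?z') * norm (h p *\<^sub>R v')"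
        by (rule c2(2)[OF p q\<theta>[OF \<theta>] q'\<theta>[OF \<theta>]])
      also have "\<dots> \<le> (c2 * ?S) * (h p * \<bar>R\<bar>)"
        unfolding nw(2)[OF \<theta>] using zz c2(1) X' hp by (intro mult_mono mult_left_mono) auto
      finally have 2: "norm (?D ?z (h p *\<^sub>R v') - ?D ?z' (h p *\<^sub>R v')) \<le> (c2 * ?S) * (h p * \<bar>R\<bar>)" .
      have "norm (K' \<theta>) \<le> c1 * (h p * norm (v - v')) + (c2 * ?S) * (h p * \<bar>R\<bar>)"
        unfolding e by (rule order_trans[OF norm_triangle_ineq add_mono[OF 1 2]])
      also have "\<dots> \<le> c1 * (h p * ?S) + (c2 * ?S) * (h p * \<bar>R\<bar>)"
        using c1(1) hp by (intro add_right_mono mult_left_mono) auto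
      also have "\<dots> = h p * ((c1 + c2 * \<bar>R\<bar>) * ?S)" by (simp only: distrib_right distrib_left mult_ac)
      finally show "norm (K' \<theta>) \<le> h p * ((c1 + c2 * \<bar>R\<bar>) * ?S)" .
    qed auto
    moreover have "dquot p (x, v, b) - dquot p (x', v', b') = (1 / (2 * h p)) *\<^sub>R (K 1 - K (-1))"
      by (simp add: dquot_def K_def scaleR_diff_right)
    ultimately have "norm (dquot p (x, v, b) - dquot p (x', v', b')) \<le> (1 / (2 * h p)) * ((h p * ((c1 + c2 * \<bar>R\<bar>) * ?S)) * 2)"
      using hp by (simp only: norm_scaleR) (rule mult_mono; simp)
    also have "\<dots> = (c1 + c2 * \<bar>R\<bar>) * ?S" using hp by simp
    finally show "norm (dquot p (x, v, b) - dquot p (x', v', b')) \<le> (c1 + c2 * \<bar>R\<bar>) * ?S" .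
  qed
qed

text \<open>The transposed Jacobian is expanded over the three basis vectors, which explains the
  factors 3; the potential at the neighbours is covered by \<open>dquot_lip\<close>.\<close>

lemma variational_lip:
  "\<exists>C>0. \<forall>p\<in>P. \<forall>x v b x' v' b'.
      norm x \<le> R \<and> norm (x + h p *\<^sub>R v + (1/2) *\<^sub>R b) \<le> R \<and> norm (x - h p *\<^sub>R v + (1/2) *\<^sub>R b) \<le> R \<and>
      norm x' \<le> R \<and> norm v' \<le> R \<and> norm b' \<le> R \<longrightarrow>
      norm (variational_force p (x, v, b) - variational_force p (x', v', b')) \<le> C * (norm (x - x') + norm (v - v') + norm (b - b'))"
proof -
  obtain c1 where c1: "c1 > 0" "\<And>p u v. p \<in> P \<Longrightarrow> norm u \<le> R \<Longrightarrow> norm (frechet_derivative (Af p) (at u) v) \<le> c1 * norm v"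
    using smf_derivative_bound[OF Af, of R] by blast
  obtain c2 where c2: "c2 > 0" "\<And>p u u' v. p \<in> P \<Longrightarrow> norm u \<le> R \<Longrightarrow> norm u' \<le> R \<Longrightarrow>
    norm (frechet_derivative (Af p) (at u) v - frechet_derivative (Af p) (at u') v) \<le> c2 * norm (u - u') * norm v"
    using smf_derivative_lipschitz[OF Af, of R] by blast
  obtain c3 where c3: "c3 > 0" "\<And>p x x'. p \<in> P \<Longrightarrow> norm x \<le> R \<Longrightarrow> norm x' \<le> R \<Longrightarrow> norm (Ef p x - Ef p x') \<le> c3 * norm (x - x')"
    using smf_lipschitz[OF Ef, of R] by blast
  obtain c4 where c4: "c4 > 0" "\<And>p x v b x' v' b'. p \<in> P \<Longrightarrow>
      norm (x + h p *\<^sub>R v + (1/2) *\<^sub>R b) \<le> R \<Longrightarrow> norm (x - h p *\<^sub>R v + (1/2) *\<^sub>R b) \<le> R \<Longrightarrow>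
      norm x' \<le> R \<Longrightarrow> norm v' \<le> R \<Longrightarrow> norm b' \<le> R \<Longrightarrow>
      norm (dquot p (x, v, b) - dquot p (x', v', b')) \<le> c4 * (norm (x - x') + norm (v - v') + norm (b - b'))"
    using dquot_lip[of R] by blast
  define C where "C = 3 * c1 + 3 * c2 * \<bar>R\<bar> + c3 + c4"
  have C0: "C > 0" unfolding C_def using c1(1) c2(1) c3(1) c4(1) by (intro add_pos_nonneg add_nonneg_pos) auto
  have "norm (variational_force p (x, v, b) - variational_force p (x', v', b')) \<le> C * (norm (x - x') + norm (v - v') + norm (b - b'))"
    if p: "p \<in> P" and x: "norm x \<le> R" and X: "norm (x + h p *\<^sub>R v + (1/2) *\<^sub>R b) \<le> R" "norm (x - h p *\<^sub>R v + (1/2) *\<^sub>R b) \<le> R"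
      and X': "norm x' \<le> R" "norm v' \<le> R" "norm b' \<le> R" for p x v b x' v' b'
  proof -
    let ?S = "norm (x - x') + norm (v - v') + norm (b - b')"
    let ?D = "\<lambda>z. frechet_derivative (Af p) (at z)" and ?T = "\<lambda>z w. transpose (jacobian (Af p) (at z)) *v w"
    have T: "norm (?T x v - ?T x' v') \<le> 3 * c1 * norm (v - v') + 3 * c2 * \<bar>R\<bar> * norm (x - x')"
    proof -
      have "?T x v - ?T x' v' = (\<Sum>i\<in>Basis. (?D x i \<bullet> (v - v') + (?D x i - ?D x' i) \<bullet> v') *\<^sub>R i)"
        unfolding transpose_jacobian_sum[OF p] sum_subtractf[symmetric] scaleR_diff_left[symmetric]
        by (simp add: inner_diff_left inner_diff_right)
      also have "norm \<dots> \<le> (\<Sum>i\<in>(Basis::(real^3) set). c1 * norm (v - v') + c2 * norm (x - x') * \<bar>R\<bar>)"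
      proof (rule sum_norm_le)
        fix i :: "real^3" assume i: "i \<in> Basis"
        have "\<bar>?D x i \<bullet> (v - v')\<bar> \<le> c1 * norm (v - v')"
          by (rule order_trans[OF Cauchy_Schwarz_ineq2 mult_right_mono]) (use c1(2)[OF p x, of i] norm_Basis[OF i] in auto)
        moreover have "\<bar>(?D x i - ?D x' i) \<bullet> v'\<bar> \<le> c2 * norm (x - x') * \<bar>R\<bar>"
          by (rule order_trans[OF Cauchy_Schwarz_ineq2 mult_mono]) (use c2(2)[OF p x X'(1), of i] c2(1) norm_Basis[OF i] X' in auto)
        ultimately have "\<bar>?D x i \<bullet> (v - v') + (?D x i - ?D x' i) \<bullet> v'\<bar> \<le> c1 * norm (v - v') + c2 * norm (x - x') * \<bar>R\<bar>"
          using abs_triangle_ineq[of "?D x i \<bullet> (v - v')" "(?D x i - ?D x' i) \<bullet> v'"] by linarith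
        then show "norm ((?D x i \<bullet> (v - v') + (?D x i - ?D x' i) \<bullet> v') *\<^sub>R i) \<le> c1 * norm (v - v') + c2 * norm (x - x') * \<bar>R\<bar>"
          by (simp only: norm_scaleR norm_Basis[OF i] mult_1_right real_norm_def)
      qed
      also have "\<dots> = 3 * c1 * norm (v - v') + 3 * c2 * \<bar>R\<bar> * norm (x - x')" by (simp add: algebra_simps)
      finally show ?thesis .
    qed
    have e: "variational_force p (x, v, b) - variational_force p (x', v', b')
      = ((?T x v - ?T x' v') - (dquot p (x, v, b) - dquot p (x', v', b'))) + (Ef p x - Ef p x')"
      by (simp add: variational_force_def)
    have "norm (variational_force p (x, v, b) - variational_force p (x', v', b'))
      \<le> ((3 * c1 * norm (v - v') + 3 * c2 * \<bar>R\<bar> * norm (x - x')) + c4 * ?S) + c3 * norm (x - x')"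
      unfolding e by (rule order_trans[OF norm_triangle_ineq add_mono[OF order_trans[OF norm_triangle_ineq4 add_mono[OF T c4(2)[OF p X X']]] c3(2)[OF p x X'(1)]]])
    also have "\<dots> \<le> ((3 * c1 * ?S + 3 * c2 * \<bar>R\<bar> * ?S) + c4 * ?S) + c3 * ?S"
      using c1(1) c2(1) c3(1) c4(1) by (intro add_mono mult_left_mono) auto
    also have "\<dots> = C * ?S" unfolding C_def by (simp only: distrib_right)
    finally show ?thesis .
  qed
  then show ?thesis using C0 by blast
qed

lemma variational_modulation: "n \<ge> 1 \<Longrightarrow> two_step_modulation P h \<epsilon> B0 variational_force n Bf Ef"
  by unfold_locales (use B0 smf_variational_force Bf Ef variational_lip variational_lead in auto)

definition force :: "integrator \<Rightarrow> 'p \<Rightarrow> (real^3) \<times> (real^3) \<times> (real^3) \<Rightarrow> real^3" where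
  "force m = (case m of Boris \<Rightarrow> boris_force | Variational \<Rightarrow> variational_force)"

lemma force_modulation: "n \<ge> 1 \<Longrightarrow> two_step_modulation P h \<epsilon> B0 (force m) n Bf Ef"
  by (cases m) (simp_all add: force_def boris_modulation variational_modulation)

lemma two_step_force:
  assumes p: "p \<in> P" and s: "two_step m (\<epsilon> p) (h p) B0 (Af p) (Bf p) (Ef p) x k"
  shows "second_difference (h p) x k = (1 / \<epsilon> p) *\<^sub>R cross3 (velocity (h p) x k) B0
    + force m p (x k, velocity (h p) x k, (h p)\<^sup>2 *\<^sub>R second_difference (h p) x k)"
proof (cases m)
  case Boris
  have "second_difference (h p) x k = cross3 (velocity (h p) x k) (magnetic (\<epsilon> p) B0 (Bf p) (x k)) + Ef p (x k)"
    using s by (simp add: Boris boris_step_def)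
  then show ?thesis
    by (simp add: Boris force_def boris_force_def magnetic_def cross_add_right cross_mult_right)
next
  case Variational
  let ?v = "velocity (h p) x k" and ?a = "second_difference (h p) x k"
  let ?q = "x k + (1/2) *\<^sub>R ((h p)\<^sup>2 *\<^sub>R ?a)"
  have xp: "x (k + 1) = ?q + h p *\<^sub>R ?v" "x (k - 1) = ?q - h p *\<^sub>R ?v"
    using two_step_identities[OF h[OF p], of x k] by (simp_all add: algebra_simps)
  have "?a = (transpose (jacobian (potential (\<epsilon> p) B0 (Af p)) (at (x k))) *v ?v
      - (1 / (2 * h p)) *\<^sub>R (potential (\<epsilon> p) B0 (Af p) (?q + h p *\<^sub>R ?v) - potential (\<epsilon> p) B0 (Af p) (?q - h p *\<^sub>R ?v))) + Ef p (x k)"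
    using s unfolding Variational two_step.simps variational_step_def xp .
  then show ?thesis
    unfolding variational_potential[OF Af_diff[OF p] eps[OF p] h[OF p]]
    by (simp add: Variational force_def variational_force_def dquot_def add.assoc)
qed

end

section \<open>Properties of the modulation functions\<close>

text \<open>Translates the complex state of the statement into the real one (y, B0 . y', z). Along
  solutions it recovers the flow exactly, because z stays orthogonal to B0.\<close>

definition flow_state :: "real^3 \<Rightarrow> mstate \<Rightarrow> modst" where
  "flow_state B0 m = (fst m, B0 \<bullet> fst (snd m), rpart (fst (snd (snd m))) (snd (snd (snd m))))"

lemma bounded_linear_flow_state: "bounded_linear (flow_state B0)"
proof -
  have s: "bounded_linear (\<lambda>m::mstate. snd (snd m))"
    by (rule bounded_linear_compose[OF bounded_linear_snd bounded_linear_snd])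
  have i: "bounded_linear (\<lambda>m::mstate. B0 \<bullet> fst (snd m))"
    by (rule bounded_linear_compose[OF bounded_linear_inner_right bounded_linear_compose[OF bounded_linear_fst bounded_linear_snd]])
  show ?thesis unfolding flow_state_def[abs_def]
    by (rule bounded_linear_Pair[OF bounded_linear_fst bounded_linear_Pair[OF i bounded_linear_compose[OF bounded_linear_rpart s]]])
qed

lemma smf_compose_linear_lipschitz:
  fixes f :: "'p \<Rightarrow> 'a::euclidean_space \<Rightarrow> 'b::real_normed_vector" and A :: "'c::real_normed_vector \<Rightarrow> 'a"
  assumes f: "smf P f" and A: "bounded_linear A"
  obtains L where "\<And>r. L r \<ge> 0" "\<And>r p. p \<in> P \<Longrightarrow> (L r)-lipschitz_on (cball 0 r) (\<lambda>m. f p (A m))"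
proof -
  obtain K where K: "K > 0" "\<And>m. norm (A m) \<le> norm m * K" using bounded_linear.pos_bounded[OF A] by blast
  have "\<forall>r. \<exists>L\<ge>0. \<forall>p\<in>P. L-lipschitz_on (cball 0 r) (\<lambda>m. f p (A m))"
  proof
    fix r
    obtain C where C: "C > 0" "\<And>p u v. p \<in> P \<Longrightarrow> norm u \<le> r * K \<Longrightarrow> norm v \<le> r * K \<Longrightarrow> norm (f p u - f p v) \<le> C * norm (u - v)"
      using smf_lipschitz[OF f, of "r * K"] by blast
    have "(C * K)-lipschitz_on (cball 0 r) (\<lambda>m. f p (A m))" if p: "p \<in> P" for p
    proof (rule lipschitz_onI)
      fix a b :: 'c assume "a \<in> cball 0 r" "b \<in> cball 0 r"
      then have n: "norm a \<le> r" "norm b \<le> r" by auto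
      have nA: "norm (A a) \<le> r * K" if "norm a \<le> r" for a :: 'c
        by (rule order_trans[OF K(2) mult_right_mono[OF that]]) (use K in simp)
      have "norm (f p (A a) - f p (A b)) \<le> C * norm (A a - A b)" by (rule C(2)[OF p nA[OF n(1)] nA[OF n(2)]])
      also have "A a - A b = A (a - b)" by (rule linear_diff[OF bounded_linear.linear[OF A], symmetric])
      also have "C * norm (A (a - b)) \<le> C * (norm (a - b) * K)" by (rule mult_left_mono[OF K(2)]) (use C in simp)
      finally show "dist (f p (A a)) (f p (A b)) \<le> C * K * dist a b" by (simp add: dist_norm mult_ac)
    qed (use C K in simp)
    then show "\<exists>L\<ge>0. \<forall>p\<in>P. L-lipschitz_on (cball 0 r) (\<lambda>m. f p (A m))"
      using C(1) K(1) by (intro exI[of _ "C * K"]) auto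
  qed
  then show thesis using that by metis
qed

context two_step_modulation begin

text \<open>All right-hand sides are smooth families composed with the linear map
  \<open>flow_state\<close>, so their Lipschitz constants on balls do not depend on the
  parameters.\<close>

definition system :: "complex^3 \<Rightarrow> 'p \<Rightarrow> modulation_system" where
  "system v1 p = \<lparr>y0_rhs = \<lambda>m. cW \<Gamma> p (flow_state B0 m) *\<^sub>R B0,
     y_rhs = \<lambda>s m. Ppm v1 s (cvec (\<epsilon> p *\<^sub>R J (cY \<Gamma> p (flow_state B0 m)))),
     z_rhs = \<lambda>s m. Ppm v1 s (cvec (vz \<Gamma> p (flow_state B0 m))),
     z0_expr = \<lambda>m. ((h p)\<^sup>2 * cQ \<Gamma> p (flow_state B0 m)) *\<^sub>R B0\<rparr>"

lemma system_lipschitz: obtains L where "\<And>p. p \<in> P \<Longrightarrow> locally_lipschitz_system L (system v1 p)"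
proof -
  note bl = bounded_linear_flow_state[of B0]
  have s1: "smf P (\<lambda>p u. cW \<Gamma> p u *\<^sub>R B0)" by (rule smf_linear[OF blB0(1) smf_comps(1)[OF sG]])
  have e: "smf P (\<lambda>p u. \<epsilon> p *\<^sub>R J (cY \<Gamma> p u))"
    by (rule smf_scale[where C = 1, OF _ smf_linear[OF blJ smf_comps(2)[OF sG]]]) (use eps eps_le1 in \<open>simp add: abs_of_pos\<close>)
  have s2: "smf P (\<lambda>p u. Ppm v1 s (cvec (\<epsilon> p *\<^sub>R J (cY \<Gamma> p u))))" for s
    by (rule smf_linear[OF bounded_linear_Ppm_cvec e])
  have s3: "smf P (\<lambda>p u. Ppm v1 s (cvec (vz \<Gamma> p u)))" for s
    by (rule smf_linear[OF bounded_linear_Ppm_cvec smf_vz[OF sG]])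
  have s4: "smf P (\<lambda>p u. ((h p)\<^sup>2 *\<^sub>R cQ \<Gamma> p u) *\<^sub>R B0)"
    by (rule smf_linear[OF blB0(1) smf_scale[where C = 1, OF _ smf_comps(4)[OF sG]]]) (rule h_pow_le)
  obtain L1 where L1: "\<And>r. L1 r \<ge> 0" "\<And>r p. p \<in> P \<Longrightarrow> (L1 r)-lipschitz_on (cball 0 r) (\<lambda>m. cW \<Gamma> p (flow_state B0 m) *\<^sub>R B0)"
    by (rule smf_compose_linear_lipschitz[OF s1 bl]) blast
  obtain L2 where L2: "\<And>r. L2 r \<ge> 0" "\<And>r p. p \<in> P \<Longrightarrow> (L2 r)-lipschitz_on (cball 0 r) (\<lambda>m. Ppm v1 1 (cvec (\<epsilon> p *\<^sub>R J (cY \<Gamma> p (flow_state B0 m)))))"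
    by (rule smf_compose_linear_lipschitz[OF s2 bl]) blast
  obtain L3 where L3: "\<And>r. L3 r \<ge> 0" "\<And>r p. p \<in> P \<Longrightarrow> (L3 r)-lipschitz_on (cball 0 r) (\<lambda>m. Ppm v1 (-1) (cvec (\<epsilon> p *\<^sub>R J (cY \<Gamma> p (flow_state B0 m)))))"
    by (rule smf_compose_linear_lipschitz[OF s2 bl]) blast
  obtain L4 where L4: "\<And>r. L4 r \<ge> 0" "\<And>r p. p \<in> P \<Longrightarrow> (L4 r)-lipschitz_on (cball 0 r) (\<lambda>m. Ppm v1 1 (cvec (vz \<Gamma> p (flow_state B0 m))))"
    by (rule smf_compose_linear_lipschitz[OF s3 bl]) blast
  obtain L5 where L5: "\<And>r. L5 r \<ge> 0" "\<And>r p. p \<in> P \<Longrightarrow> (L5 r)-lipschitz_on (cball 0 r) (\<lambda>m. Ppm v1 (-1) (cvec (vz \<Gamma> p (flow_state B0 m))))"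
    by (rule smf_compose_linear_lipschitz[OF s3 bl]) blast
  obtain L6 where L6: "\<And>r. L6 r \<ge> 0" "\<And>r p. p \<in> P \<Longrightarrow> (L6 r)-lipschitz_on (cball 0 r) (\<lambda>m. ((h p)\<^sup>2 *\<^sub>R cQ \<Gamma> p (flow_state B0 m)) *\<^sub>R B0)"
    by (rule smf_compose_linear_lipschitz[OF s4 bl]) blast
  define L where "L r = L1 r + L2 r + L3 r + L4 r + L5 r + L6 r" for r
  have le: "L1 r \<le> L r" "L2 r \<le> L r" "L3 r \<le> L r" "L4 r \<le> L r" "L5 r \<le> L r" "L6 r \<le> L r" for r
    using L1(1)[of r] L2(1)[of r] L3(1)[of r] L4(1)[of r] L5(1)[of r] L6(1)[of r] unfolding L_def by linarith+
  show thesis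
  proof (rule that[of L])
    fix p assume p: "p \<in> P"
    have "\<And>r. (L r)-lipschitz_on (cball 0 r) (\<lambda>m. cW \<Gamma> p (flow_state B0 m) *\<^sub>R B0)"
      "\<And>r. (L r)-lipschitz_on (cball 0 r) (\<lambda>m. Ppm v1 1 (cvec (\<epsilon> p *\<^sub>R J (cY \<Gamma> p (flow_state B0 m)))))"
      "\<And>r. (L r)-lipschitz_on (cball 0 r) (\<lambda>m. Ppm v1 (-1) (cvec (\<epsilon> p *\<^sub>R J (cY \<Gamma> p (flow_state B0 m)))))"
      "\<And>r. (L r)-lipschitz_on (cball 0 r) (\<lambda>m. Ppm v1 1 (cvec (vz \<Gamma> p (flow_state B0 m))))"
      "\<And>r. (L r)-lipschitz_on (cball 0 r) (\<lambda>m. Ppm v1 (-1) (cvec (vz \<Gamma> p (flow_state B0 m))))"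
      "\<And>r. (L r)-lipschitz_on (cball 0 r) (\<lambda>m. ((h p)\<^sup>2 *\<^sub>R cQ \<Gamma> p (flow_state B0 m)) *\<^sub>R B0)"
      by (rule lipschitz_on_mono[OF L1(2)[OF p] order_refl le(1)], rule lipschitz_on_mono[OF L2(2)[OF p] order_refl le(2)],
        rule lipschitz_on_mono[OF L3(2)[OF p] order_refl le(3)], rule lipschitz_on_mono[OF L4(2)[OF p] order_refl le(4)],
        rule lipschitz_on_mono[OF L5(2)[OF p] order_refl le(5)], rule lipschitz_on_mono[OF L6(2)[OF p] order_refl le(6)])
    then show "locally_lipschitz_system L (system v1 p)"
      unfolding locally_lipschitz_system_def system_def by simp
  qed
qed

text \<open>When z = O(h^2), \<open>Xi\<close> reduces to \<open>cY\<close> up to O(h^2), and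
  \<open>cY\<close> is the force at leading order. At time zero its arguments may be replaced by x0
  and P0 v0, since y' differs from P0 v0 by O(h^2).\<close>

lemma lead_est_init:
  assumes A: "A \<ge> 0" and Cv: "Cv \<ge> 0"
  obtains C where "C > 0" "\<And>p u x0 v0. p \<in> P \<Longrightarrow> norm u \<le> r \<Longrightarrow> norm (snd (snd u)) \<le> A * (h p)\<^sup>2 \<Longrightarrow>
    norm (u - (x0, B0 \<bullet> v0, 0)) \<le> A * (h p)\<^sup>2 \<Longrightarrow> norm x0 \<le> r \<Longrightarrow> norm v0 \<le> Cv \<Longrightarrow>
    norm (Xi p u - Fo p (x0, P0 B0 v0)) \<le> C * (h p)\<^sup>2"
proof -
  note sF = smf_vf[OF sG]
  obtain c1 where c1: "c1 > 0" "\<And>p u. p \<in> P \<Longrightarrow> norm u \<le> r \<Longrightarrow> norm (snd (snd u)) \<le> A * (h p)\<^sup>2 \<Longrightarrow>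
      \<bar>cW \<Gamma> p u - B0 \<bullet> Fo p (fst u, vy \<Gamma> p u)\<bar> \<le> c1 * (h p)\<^sup>2 \<and>
      norm (cY \<Gamma> p u - Fo p (fst u, vy \<Gamma> p u)) \<le> c1 * (h p)\<^sup>2"
    using lead_est[OF A, of r] by blast
  obtain c2 where c2: "c2 > 0" "\<And>p u. p \<in> P \<Longrightarrow> norm u \<le> r \<Longrightarrow> norm (Dp n G (cY \<Gamma>) p u) \<le> c2"
    using smf_bound[OF smf_Dp[OF smf_comps(2)[OF sG] sF]] by blast
  obtain c3 where c3: "c3 > 0" "\<And>p u. p \<in> P \<Longrightarrow> norm u \<le> r \<Longrightarrow> norm (Dp n G Zc p u) \<le> c3 * norm (snd (snd u))"
    using van_bound[OF smf_Dp[OF smf_coords(3) sF] van_ops(1)[OF sG smf_coords(3) van_Zc vZ], of r] by blast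
  obtain c4 where c4: "c4 > 0" "\<And>p u. p \<in> P \<Longrightarrow> norm u \<le> r \<Longrightarrow> norm (cdiff n G (cZ \<Gamma>) p u) \<le> c4 * norm (snd (snd u))"
    using van_bound[OF smf_cdiff[OF smf_comps(3)[OF sG] sF] van_ops(3)[OF sG smf_comps(3)[OF sG] vZ vZ], of r] by blast
  obtain c5 where c5: "c5 > 0" "\<And>p u. p \<in> P \<Longrightarrow> norm u \<le> r \<Longrightarrow> norm (cY \<Gamma> p u) \<le> c5"
    using smf_bound[OF smf_comps(2)[OF sG]] by blast
  obtain c6 where c6: "c6 > 0" "\<And>p u. p \<in> P \<Longrightarrow> norm u \<le> r \<Longrightarrow> norm (vy \<Gamma> p u) \<le> c6"
    using smf_bound[OF smf_vy[OF sG]] by blast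
  define \<rho> where "\<rho> = \<bar>r\<bar> + Cv + c6"
  obtain c7 where c7: "c7 > 0" "\<And>p a b. p \<in> P \<Longrightarrow> norm a \<le> \<rho> \<Longrightarrow> norm b \<le> \<rho> \<Longrightarrow> norm (Fo p a - Fo p b) \<le> c7 * norm (a - b)"
    using smf_lipschitz[OF smf_Fo, of \<rho>] by blast
  define C where "C = c1 + c7 * (2 * A + c5) + c2 + 4 * (c3 * A) + c4 * A"
  show thesis
  proof (rule that[of C])
    have "0 \<le> c7 * (2 * A + c5)" "0 \<le> c3 * A" "0 \<le> c4 * A" using c7(1) c5(1) c3(1) c4(1) A by auto
    then show "C > 0" unfolding C_def using c1(1) c2(1) by linarith
    fix p and u :: modst and x0 v0 :: "real^3"
    assume p: "p \<in> P" and u: "norm u \<le> r" and z: "norm (snd (snd u)) \<le> A * (h p)\<^sup>2"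
      and u0: "norm (u - (x0, B0 \<bullet> v0, 0)) \<le> A * (h p)\<^sup>2" and x0: "norm x0 \<le> r" and v0: "norm v0 \<le> Cv"
    let ?h = "(h p)\<^sup>2"
    have h0: "0 \<le> ?h" by simp
    have mz: "norm X \<le> (c * A) * ?h" if "norm X \<le> c * norm (snd (snd u))" "c > 0" for c and X :: "real^3"
      using order_trans[OF that(1) mult_left_mono[OF z less_imp_le[OF that(2)]]] by (simp only: mult.assoc)
    have d: "norm (fst u - x0) \<le> A * ?h" "\<bar>Wc p u - B0 \<bullet> v0\<bar> \<le> A * ?h"
      using norm_state_comps(1,2)[of "u - (x0, B0 \<bullet> v0, 0)"] u0 unfolding Wc_def by simp_all
    have vyd: "vy \<Gamma> p u - P0 B0 v0 = (Wc p u - B0 \<bullet> v0) *\<^sub>R B0 + \<epsilon> p *\<^sub>R J (cY \<Gamma> p u)"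
      by (simp add: vy_def P0_def scaleR_diff_left)
    have eJ: "norm (\<epsilon> p *\<^sub>R J (cY \<Gamma> p u)) \<le> ?h * c5"
      unfolding norm_scaleR using eps[OF p] eps_le[OF p] order_trans[OF norm_J_le c5(2)[OF p u]] by (intro mult_mono) auto
    have wB: "norm ((Wc p u - B0 \<bullet> v0) *\<^sub>R B0) \<le> A * ?h" using d(2) by (simp add: B0)
    have vd: "norm (vy \<Gamma> p u - P0 B0 v0) \<le> A * ?h + ?h * c5"
      unfolding vyd by (rule order_trans[OF norm_triangle_ineq add_mono[OF wB eJ]])
    have P0v: "norm (P0 B0 v0) \<le> Cv" using Cauchy_Schwarz_ineq2[of B0 v0] v0 by (simp add: P0_def B0)
    have Fd: "norm (Fo p (fst u, vy \<Gamma> p u) - Fo p (x0, P0 B0 v0)) \<le> c7 * ((2 * A + c5) * ?h)"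
    proof -
      have a: "norm (fst u, vy \<Gamma> p u) \<le> \<rho>"
        using norm_Pair_le[of "fst u" "vy \<Gamma> p u"] norm_state_comps(1)[of u] u c6(2)[OF p u] Cv unfolding \<rho>_def by linarith
      have b: "norm (x0, P0 B0 v0) \<le> \<rho>"
        using norm_Pair_le[of x0 "P0 B0 v0"] x0 P0v c6(1) unfolding \<rho>_def by linarith
      have "norm ((fst u, vy \<Gamma> p u) - (x0, P0 B0 v0)) \<le> (2 * A + c5) * ?h"
        using norm_Pair_le[of "fst u - x0" "vy \<Gamma> p u - P0 B0 v0"] d(1) vd by (simp add: algebra_simps)
      then show ?thesis using c7(2)[OF p a b] mult_left_mono[OF _ less_imp_le[OF c7(1)]] order_trans by blast
    qed
    have e: "Xi p u - Fo p (x0, P0 B0 v0) = (cY \<Gamma> p u - Fo p (fst u, vy \<Gamma> p u))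
      + ((Fo p (fst u, vy \<Gamma> p u) - Fo p (x0, P0 B0 v0)) + (?h *\<^sub>R Dp n G (cY \<Gamma>) p u + (4 *\<^sub>R Dp n G Zc p u - cdiff n G (cZ \<Gamma>) p u)))"
      by (simp add: Xi_def cdiff_def[of n G "cY \<Gamma>"])
    have n2: "norm (?h *\<^sub>R Dp n G (cY \<Gamma>) p u) \<le> ?h * c2"
      unfolding norm_scaleR using c2(2)[OF p u] by (intro mult_mono) auto
    have n3: "norm (4 *\<^sub>R Dp n G Zc p u) \<le> 4 * ((c3 * A) * ?h)"
      unfolding norm_scaleR using mz[OF c3(2)[OF p u] c3(1)] by simp
    note n4 = mz[OF c4(2)[OF p u] c4(1)]
    have "norm (Xi p u - Fo p (x0, P0 B0 v0)) \<le> c1 * ?h + (c7 * ((2 * A + c5) * ?h) + (?h * c2 + (4 * ((c3 * A) * ?h) + (c4 * A) * ?h)))"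
      unfolding e by (rule order_trans[OF norm_triangle_ineq add_mono[OF conjunct2[OF c1(2)[OF p u z]]
        order_trans[OF norm_triangle_ineq add_mono[OF Fd order_trans[OF norm_triangle_ineq add_mono[OF n2 order_trans[OF norm_triangle_ineq4 add_mono[OF n3 n4]]]]]]]])
    also have "\<dots> = C * ?h" by (simp add: C_def algebra_simps)
    finally show "norm (Xi p u - Fo p (x0, P0 B0 v0)) \<le> C * (h p)\<^sup>2" .
  qed
qed

context
  fixes v1 :: "complex^3" and T :: real
  assumes v1: "unit_eigenvector B0 v1" and T: "T > 0"
begin

lemma Ppm_simps:
  "Ppm v1 s (cvec (a + b)) = Ppm v1 s (cvec a) + Ppm v1 s (cvec b)"
  "Ppm v1 s (cvec (a - b)) = Ppm v1 s (cvec a) - Ppm v1 s (cvec b)"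
  "Ppm v1 s (cvec (c *\<^sub>R a)) = complex_of_real c *s Ppm v1 s (cvec a)"
proof -
  note l = bounded_linear.linear[OF bounded_linear_Ppm_cvec, of v1 s]
  show "Ppm v1 s (cvec (a + b)) = Ppm v1 s (cvec a) + Ppm v1 s (cvec b)" by (rule linear_add[OF l])
  show "Ppm v1 s (cvec (a - b)) = Ppm v1 s (cvec a) - Ppm v1 s (cvec b)" by (rule linear_diff[OF l])
  show "Ppm v1 s (cvec (c *\<^sub>R a)) = complex_of_real c *s Ppm v1 s (cvec a)"
    by (subst linear_scale[OF l]) (simp add: vec_eq_iff scaleR_conv_of_real[where 'a = complex])
qed

lemma Ppm_J: "s \<in> {1, -1} \<Longrightarrow> Ppm v1 s (cvec (J a)) = (of_int s * \<i>) *s Ppm v1 s (cvec a)"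
  unfolding J_def by (rule Ppm_cross3[OF B0 v1])

lemma Ppm_B0: 
  assumes "s \<in> {1, -1}" shows "Ppm v1 s (cvec (c *\<^sub>R B0)) = 0"
proof -
  have "Ppm v1 s (cvec (J (c *\<^sub>R B0))) = 0"
    unfolding J_B0 by (rule linear_0[OF bounded_linear.linear[OF bounded_linear_Ppm_cvec]])
  then show ?thesis using assms unfolding Ppm_J[OF assms] by auto
qed

lemma deriv_on_flow:
  fixes f :: "'p \<Rightarrow> modst \<Rightarrow> 'b::real_normed_vector" and A :: "'b \<Rightarrow> 'c::real_normed_vector"
  assumes p: "p \<in> P" and u: "sol G p T u" and f: "smf P f"
  shows "t \<in> {0..T} \<Longrightarrow> deriv_on T k (\<lambda>t. f p (u t)) t = (lie G ^^ k) f p (u t)"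
    and "Ck_on T N (\<lambda>t. f p (u t))"
    and "bounded_linear A \<Longrightarrow> t \<in> {0..T} \<Longrightarrow> deriv_on T k (\<lambda>t. A (f p (u t))) t = A ((lie G ^^ k) f p (u t))"
proof -
  have der: "((\<lambda>t. (lie G ^^ k) f1 p (u t)) has_vector_derivative (lie G ^^ Suc k) f1 p (u t)) (at t within {0..T})"
    if "smf P f1" "t \<in> {0..T}" for f1 :: "'p \<Rightarrow> modst \<Rightarrow> 'd::real_normed_vector" and k t
    by (rule sol_chain_pow[OF u that(1) smf_vf[OF sG] p that(2)])
  have d: "deriv_on T k (\<lambda>t. f1 p (u t)) t = (lie G ^^ k) f1 p (u t)"
    if "smf P f1" "t \<in> {0..T}" for f1 :: "'p \<Rightarrow> modst \<Rightarrow> 'd::real_normed_vector" and k t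
    by (rule deriv_on_chain(1)[where \<phi> = "\<lambda>k t. (lie G ^^ k) f1 p (u t)", OF T der[OF that(1)] _ that(2)]) auto
  show "t \<in> {0..T} \<Longrightarrow> deriv_on T k (\<lambda>t. f p (u t)) t = (lie G ^^ k) f p (u t)" by (rule d[OF f])
  show "Ck_on T N (\<lambda>t. f p (u t))"
    by (rule Ck_on_chain[where \<phi> = "\<lambda>k t. (lie G ^^ k) f p (u t)", OF T der[OF f]]) auto
  show "deriv_on T k (\<lambda>t. A (f p (u t))) t = A ((lie G ^^ k) f p (u t))" if A: "bounded_linear A" and t: "t \<in> {0..T}"
    using d[OF smf_linear[OF A f] t, of k] liepow_linear[where A = "\<lambda>p. A", OF f smf_vf[OF sG] A p, of k] by simp
qed

lemma flow_derivs:
  assumes p: "p \<in> P" and u: "sol G p T u" and t: "t \<in> {0..T}"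
  shows "deriv_on T 1 (\<lambda>t. Yc p (u t)) t = vy \<Gamma> p (u t)"
    "deriv_on T 1 (\<lambda>t. P0 B0 (Yc p (u t))) t = Wc p (u t) *\<^sub>R B0"
    "deriv_on T 2 (\<lambda>t. P0 B0 (Yc p (u t))) t = cW \<Gamma> p (u t) *\<^sub>R B0"
    "deriv_on T 1 (\<lambda>t. Ppm v1 s (cvec (Yc p (u t)))) t = Ppm v1 s (cvec (vy \<Gamma> p (u t)))"
    "deriv_on T 1 (\<lambda>t. Ppm v1 s (cvec (zt \<Gamma> p (u t)))) t = Ppm v1 s (cvec (zd \<Gamma> p (u t)))"
proof -
  have y1: "(lie G ^^ 1) Yc p (u t) = vy \<Gamma> p (u t)" by (simp add: lie_coords)
  have z1: "(lie G ^^ 1) (zt \<Gamma>) p (u t) = zd \<Gamma> p (u t)" by (simp add: lie_zt[OF sG p])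
  have y2: "B0 \<bullet> (lie G ^^ 2) Yc p (u t) = cW \<Gamma> p (u t)"
  proof -
    have "B0 \<bullet> lie G (vy \<Gamma>) p (u t) = lie G (\<lambda>p u. B0 \<bullet> vy \<Gamma> p u) p (u t)"
      by (rule lie_linear[where A = "\<lambda>p a. B0 \<bullet> a", OF smf_vy[OF sG] blB0(2) p, symmetric])
    also have "\<dots> = lie G Wc p (u t)" by (simp only: B0_vy[OF sG])
    finally show ?thesis by (simp add: lie_coords numeral_2_eq_2)
  qed
  show "deriv_on T 1 (\<lambda>t. Yc p (u t)) t = vy \<Gamma> p (u t)"
    unfolding deriv_on_flow(1)[OF p u smf_coords(1) t] y1 ..
  show "deriv_on T 1 (\<lambda>t. P0 B0 (Yc p (u t))) t = Wc p (u t) *\<^sub>R B0"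
    unfolding deriv_on_flow(3)[OF p u smf_coords(1) bounded_linear_P0 t] y1 unfolding P0_def B0_vy[OF sG] ..
  show "deriv_on T 2 (\<lambda>t. P0 B0 (Yc p (u t))) t = cW \<Gamma> p (u t) *\<^sub>R B0"
    unfolding deriv_on_flow(3)[OF p u smf_coords(1) bounded_linear_P0 t] unfolding P0_def y2 ..
  show "deriv_on T 1 (\<lambda>t. Ppm v1 s (cvec (Yc p (u t)))) t = Ppm v1 s (cvec (vy \<Gamma> p (u t)))"
    unfolding deriv_on_flow(3)[OF p u smf_coords(1) bounded_linear_Ppm_cvec t] y1 ..
  show "deriv_on T 1 (\<lambda>t. Ppm v1 s (cvec (zt \<Gamma> p (u t)))) t = Ppm v1 s (cvec (zd \<Gamma> p (u t)))"
    unfolding deriv_on_flow(3)[OF p u smf_zt[OF sG] bounded_linear_Ppm_cvec t] z1 ..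
qed

lemma Ppm_flow:
  assumes s: "s \<in> {1, -1}"
  shows "Ppm v1 s (cvec (zt \<Gamma> p a)) = Ppm v1 s (cvec (Zc p a))"
    "Ppm v1 s (cvec (vy \<Gamma> p a)) = Ppm v1 s (cvec (\<epsilon> p *\<^sub>R J (cY \<Gamma> p a)))"
    "Ppm v1 s (cvec (zd \<Gamma> p a)) = Ppm v1 s (cvec (vz \<Gamma> p a))"
  unfolding zt_def vy_def zd_def scaleR_scaleR Ppm_simps(1) Ppm_B0[OF s] by simp_all

lemma flow_solves:
  assumes p: "p \<in> P" and u: "sol G p T u" and z: "\<And>t. t \<in> {0..T} \<Longrightarrow> B0 \<bullet> snd (snd (u t)) = 0"
  shows "solves_upto 0 T B0 v1 (system v1 p) (\<lambda>t. Yc p (u t)) (\<lambda>t. zt \<Gamma> p (u t))"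
  unfolding solves_upto_def
proof (intro ballI)
  fix t assume t: "t \<in> {0..T}"
  note d = flow_derivs[OF p u t]
  have z0: "B0 \<bullet> Zc p (u t) = 0" using z[OF t] by (simp add: Zc_def)
  have Bz: "B0 \<bullet> zt \<Gamma> p (u t) = (h p)\<^sup>2 * cQ \<Gamma> p (u t)" by (simp add: zt_def inner_add_right z0 B0B0)
  have st: "flow_state B0 (mstate T B0 v1 (\<lambda>t. Yc p (u t)) (\<lambda>t. zt \<Gamma> p (u t)) t) = u t"
  proof -
    have "rpart (Ppm v1 1 (cvec (Zc p (u t)))) (Ppm v1 (-1) (cvec (Zc p (u t)))) = Zc p (u t)"
      unfolding Ppm_sum[OF B0 v1] z0 by simp
    moreover have "(1::int) \<in> {1, -1}" "(-1::int) \<in> {1, -1}" by simp_all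
    ultimately show ?thesis
      unfolding flow_state_def mstate_def fst_conv snd_conv d(2) Ppm_flow(1)[OF \<open>(1::int) \<in> {1, -1}\<close>] Ppm_flow(1)[OF \<open>(-1::int) \<in> {1, -1}\<close>]
      by (simp add: B0B0 Yc_def Wc_def Zc_def)
  qed
  show "norm (deriv_on T 2 (\<lambda>ua. P0 B0 (Yc p (u ua))) t - y0_rhs (system v1 p) (mstate T B0 v1 (\<lambda>t. Yc p (u t)) (\<lambda>t. zt \<Gamma> p (u t)) t)) \<le> 0 \<and>
     (\<forall>s\<in>{1, -1}.
       norm (deriv_on T 1 (\<lambda>ua. Ppm v1 s (cvec (Yc p (u ua)))) t - y_rhs (system v1 p) s (mstate T B0 v1 (\<lambda>t. Yc p (u t)) (\<lambda>t. zt \<Gamma> p (u t)) t)) \<le> 0 \<and>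
       norm (deriv_on T 1 (\<lambda>ua. Ppm v1 s (cvec (zt \<Gamma> p (u ua)))) t - z_rhs (system v1 p) s (mstate T B0 v1 (\<lambda>t. Yc p (u t)) (\<lambda>t. zt \<Gamma> p (u t)) t)) \<le> 0) \<and>
     norm (P0 B0 (zt \<Gamma> p (u t)) - z0_expr (system v1 p) (mstate T B0 v1 (\<lambda>t. Yc p (u t)) (\<lambda>t. zt \<Gamma> p (u t)) t)) \<le> 0"
    unfolding d unfolding system_def modulation_system.simps st P0_def Bz
    by (intro conjI ballI) (simp_all only: Ppm_flow diff_self norm_zero order_refl)
qed

text \<open>All time derivatives are iterated Lie derivatives. Those of y are bounded on the ball,
  and those of z vanish at z = 0 and hence are O(h^2). The last two bounds reflect the explicit
  factor \<epsilon> in \<open>vy\<close> and the factor h^2 in front of \<open>cQ\<close> =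
  O(|z|).\<close>

lemma flow_bounds:
  assumes A: "A \<ge> 0"
  obtains C where "C > 0" "\<And>p u. p \<in> P \<Longrightarrow> sol G p T u \<Longrightarrow>
      (\<And>t. t \<in> {0..T} \<Longrightarrow> norm (u t) \<le> r \<and> norm (snd (snd (u t))) \<le> A * (h p)\<^sup>2 \<and> B0 \<bullet> snd (snd (u t)) = 0) \<Longrightarrow>
      coeff_bounds T N (h p) C (\<lambda>t. Yc p (u t)) (\<lambda>t. zt \<Gamma> p (u t)) \<and>
      (\<forall>t\<in>{0..T}. norm (cross3 (deriv_on T 1 (\<lambda>t. Yc p (u t)) t) B0) \<le> C * \<epsilon> p \<and> \<bar>zt \<Gamma> p (u t) \<bullet> B0\<bar> \<le> C * h p ^ 4)"
proof -
  have "\<forall>k. \<exists>c>0. \<forall>p\<in>P. \<forall>u. norm u \<le> r \<longrightarrow> norm ((lie G ^^ k) Yc p u) \<le> c"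
  proof
    fix k
    obtain c where "c > 0" "\<And>p u. p \<in> P \<Longrightarrow> norm u \<le> r \<Longrightarrow> norm ((lie G ^^ k) Yc p u) \<le> c"
      using smf_bound[OF smf_liepow[OF smf_coords(1) smf_vf[OF sG]], of r k] by blast
    then show "\<exists>c>0. \<forall>p\<in>P. \<forall>u. norm u \<le> r \<longrightarrow> norm ((lie G ^^ k) Yc p u) \<le> c" by blast
  qed
  then obtain cy where cy: "\<And>k. cy k > 0" "\<And>k p u. p \<in> P \<Longrightarrow> norm u \<le> r \<Longrightarrow> norm ((lie G ^^ k) Yc p u) \<le> cy k" by metis
  have "\<forall>k. \<exists>c>0. \<forall>p\<in>P. \<forall>u. norm u \<le> r \<longrightarrow> norm ((lie G ^^ k) (zt \<Gamma>) p u) \<le> c * norm (snd (snd u))"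
  proof
    fix k
    obtain c where "c > 0" "\<And>p u. p \<in> P \<Longrightarrow> norm u \<le> r \<Longrightarrow> norm ((lie G ^^ k) (zt \<Gamma>) p u) \<le> c * norm (snd (snd u))"
      using van_bound[OF smf_liepow[OF smf_zt[OF sG] smf_vf[OF sG]] van_liepow[OF sG smf_zt[OF sG] van_zt[OF vG] vZ], of r k] by blast
    then show "\<exists>c>0. \<forall>p\<in>P. \<forall>u. norm u \<le> r \<longrightarrow> norm ((lie G ^^ k) (zt \<Gamma>) p u) \<le> c * norm (snd (snd u))" by blast
  qed
  then obtain cz where cz: "\<And>k. cz k > 0" "\<And>k p u. p \<in> P \<Longrightarrow> norm u \<le> r \<Longrightarrow> norm ((lie G ^^ k) (zt \<Gamma>) p u) \<le> cz k * norm (snd (snd u))" by metis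
  obtain c5 where c5: "c5 > 0" "\<And>p u. p \<in> P \<Longrightarrow> norm u \<le> r \<Longrightarrow> norm (cY \<Gamma> p u) \<le> c5"
    using smf_bound[OF smf_comps(2)[OF sG]] by blast
  obtain c6 where c6: "c6 > 0" "\<And>p u. p \<in> P \<Longrightarrow> norm u \<le> r \<Longrightarrow> norm (cQ \<Gamma> p u) \<le> c6 * norm (snd (snd u))"
    using van_bound[OF smf_comps(4)[OF sG] vQ, of r] by blast
  define C where "C = (\<Sum>k\<le>N. cy k) + (\<Sum>k\<le>N. cz k * A) + c5 + c6 * A"
  have sy: "0 \<le> (\<Sum>k\<le>N. cy k)" by (rule sum_nonneg) (use cy(1) less_imp_le in blast)
  have sz: "0 \<le> (\<Sum>k\<le>N. cz k * A)" by (intro sum_nonneg mult_nonneg_nonneg A) (use cz(1) less_imp_le in blast)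
  have c6A: "0 \<le> c6 * A" using c6(1) A by simp
  have ley: "cy k \<le> C" if "k \<le> N" for k
    using member_le_sum[of k "{..N}" cy] that less_imp_le[OF cy(1)] sz c6A c5(1) unfolding C_def by simp
  have lez: "cz k * A \<le> C" if "k \<le> N" for k
    using member_le_sum[of k "{..N}" "\<lambda>k. cz k * A"] that mult_nonneg_nonneg[OF less_imp_le[OF cz(1)] A] sy c6A c5(1) unfolding C_def by simp
  show thesis
  proof (rule that[of C])
    show "C > 0" unfolding C_def using sy sz c6A c5(1) by linarith
    fix p and u :: "real \<Rightarrow> modst" assume p: "p \<in> P" and u: "sol G p T u"
      and b: "\<And>t. t \<in> {0..T} \<Longrightarrow> norm (u t) \<le> r \<and> norm (snd (snd (u t))) \<le> A * (h p)\<^sup>2 \<and> B0 \<bullet> snd (snd (u t)) = 0"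
    have h0: "0 \<le> (h p)\<^sup>2" by simp
    have "coeff_bounds T N (h p) C (\<lambda>t. Yc p (u t)) (\<lambda>t. zt \<Gamma> p (u t))"
      unfolding coeff_bounds_def
    proof (intro conjI allI impI ballI)
      show "Ck_on T N (\<lambda>t. Yc p (u t))" "Ck_on T N (\<lambda>t. zt \<Gamma> p (u t))"
        by (rule deriv_on_flow(2)[OF p u smf_coords(1)], rule deriv_on_flow(2)[OF p u smf_zt[OF sG]])
      fix k t assume k: "k \<le> N" and t: "t \<in> {0..T}"
      have r: "norm (u t) \<le> r" and z: "norm (snd (snd (u t))) \<le> A * (h p)\<^sup>2" using b[OF t] by auto
      show "norm (deriv_on T k (\<lambda>t. Yc p (u t)) t) \<le> C"
        unfolding deriv_on_flow(1)[OF p u smf_coords(1) t] by (rule order_trans[OF cy(2)[OF p r] ley[OF k]])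
      have "norm ((lie G ^^ k) (zt \<Gamma>) p (u t)) \<le> cz k * (A * (h p)\<^sup>2)"
        by (rule order_trans[OF cz(2)[OF p r] mult_left_mono[OF z less_imp_le[OF cz(1)]]])
      also have "\<dots> = (cz k * A) * (h p)\<^sup>2" by (simp only: mult.assoc)
      also have "\<dots> \<le> C * (h p)\<^sup>2" by (rule mult_right_mono[OF lez[OF k] h0])
      finally show "norm (deriv_on T k (\<lambda>t. zt \<Gamma> p (u t)) t) \<le> C * (h p)\<^sup>2"
        unfolding deriv_on_flow(1)[OF p u smf_zt[OF sG] t] .
    qed
    moreover have "norm (cross3 (deriv_on T 1 (\<lambda>t. Yc p (u t)) t) B0) \<le> C * \<epsilon> p \<and> \<bar>zt \<Gamma> p (u t) \<bullet> B0\<bar> \<le> C * h p ^ 4"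
      if t: "t \<in> {0..T}" for t
    proof
      have r: "norm (u t) \<le> r" and z: "norm (snd (snd (u t))) \<le> A * (h p)\<^sup>2" and z0: "B0 \<bullet> Zc p (u t) = 0" using b[OF t] by (auto simp: Zc_def)
      have "norm (cross3 (deriv_on T 1 (\<lambda>t. Yc p (u t)) t) B0) = \<epsilon> p * norm (J (J (cY \<Gamma> p (u t))))"
        unfolding flow_derivs(1)[OF p u t] J_def[symmetric] J_vy[OF sG] norm_scaleR using eps[OF p] by simp
      also have "\<dots> \<le> \<epsilon> p * C"
      proof (rule mult_left_mono)
        show "norm (J (J (cY \<Gamma> p (u t)))) \<le> C"
          using norm_J_le[of "J (cY \<Gamma> p (u t))"] norm_J_le[of "cY \<Gamma> p (u t)"] c5(2)[OF p r] sy sz c6A unfolding C_def by linarith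
      qed (use eps[OF p] in simp)
      finally show "norm (cross3 (deriv_on T 1 (\<lambda>t. Yc p (u t)) t) B0) \<le> C * \<epsilon> p" by (simp only: mult.commute)
      have "zt \<Gamma> p (u t) \<bullet> B0 = (h p)\<^sup>2 * cQ \<Gamma> p (u t)"
        unfolding inner_commute[of _ B0] by (simp add: zt_def inner_add_right z0 B0B0)
      then have "\<bar>zt \<Gamma> p (u t) \<bullet> B0\<bar> = (h p)\<^sup>2 * norm (cQ \<Gamma> p (u t))" by (simp add: abs_mult)
      also have "\<dots> \<le> (h p)\<^sup>2 * (c6 * (A * (h p)\<^sup>2))"
        by (rule mult_left_mono[OF order_trans[OF c6(2)[OF p r] mult_left_mono[OF z less_imp_le[OF c6(1)]]] h0])
      also have "\<dots> = (c6 * A) * h p ^ 4" by (simp add: power4_eq_xxxx power2_eq_square)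
      also have "\<dots> \<le> C * h p ^ 4" by (rule mult_right_mono) (use sy sz c5(1) in \<open>auto simp: C_def\<close>)
      finally show "\<bar>zt \<Gamma> p (u t) \<bullet> B0\<bar> \<le> C * h p ^ 4" .
    qed
    ultimately show "coeff_bounds T N (h p) C (\<lambda>t. Yc p (u t)) (\<lambda>t. zt \<Gamma> p (u t)) \<and>
      (\<forall>t\<in>{0..T}. norm (cross3 (deriv_on T 1 (\<lambda>t. Yc p (u t)) t) B0) \<le> C * \<epsilon> p \<and> \<bar>zt \<Gamma> p (u t) \<bullet> B0\<bar> \<le> C * h p ^ 4)" by blast
  qed
qed

lemma Ppm_bound: obtains K where "K > 0" "\<And>s a. s \<in> {1, -1} \<Longrightarrow> norm (Ppm v1 s (cvec a)) \<le> K * norm a"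
proof -
  obtain K1 where K1: "K1 > 0" "\<And>a. norm (Ppm v1 1 (cvec a)) \<le> norm a * K1"
    using bounded_linear.pos_bounded[OF bounded_linear_Ppm_cvec] by blast
  obtain K2 where K2: "K2 > 0" "\<And>a. norm (Ppm v1 (-1) (cvec a)) \<le> norm a * K2"
    using bounded_linear.pos_bounded[OF bounded_linear_Ppm_cvec] by blast
  show thesis
  proof (rule that[of "K1 + K2"])
    show "K1 + K2 > 0" using K1(1) K2(1) by simp
    fix s :: int and a :: "real^3" assume s: "s \<in> {1, -1}"
    have "0 \<le> norm a * K1" "0 \<le> norm a * K2" using K1(1) K2(1) by auto
    moreover have "(K1 + K2) * norm a = norm a * K1 + norm a * K2" by (simp add: algebra_simps)
    ultimately show "norm (Ppm v1 s (cvec a)) \<le> (K1 + K2) * norm a"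
      using s K1(2)[of a] K2(2)[of a] by auto
  qed
qed

text \<open>The factor \<epsilon> in the orthogonal components is exact, so the relative error
  O(h^2) of \<open>cY\<close> becomes \<epsilon> h^2. For z the linear rotation is exact as well,
  and the rest is \<epsilon> times \<open>cZ\<close> = O(|z|).\<close>

lemma flow_equations:
  assumes A: "A \<ge> 0"
  obtains C where "C > 0" "\<And>p u t. p \<in> P \<Longrightarrow> sol G p T u \<Longrightarrow>
      t \<in> {0..T} \<Longrightarrow> norm (u t) \<le> r \<Longrightarrow> norm (snd (snd (u t))) \<le> A * (h p)\<^sup>2 \<Longrightarrow>
      norm (deriv_on T 2 (\<lambda>t. P0 B0 (Yc p (u t))) t
        - P0 B0 (cross3 (deriv_on T 1 (\<lambda>t. Yc p (u t)) t) (Bf p (Yc p (u t))) + Ef p (Yc p (u t)))) \<le> C * (h p)\<^sup>2"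
    "\<And>p u t s. p \<in> P \<Longrightarrow> sol G p T u \<Longrightarrow> s \<in> {1, -1} \<Longrightarrow>
      t \<in> {0..T} \<Longrightarrow> norm (u t) \<le> r \<Longrightarrow> norm (snd (snd (u t))) \<le> A * (h p)\<^sup>2 \<Longrightarrow>
      norm (deriv_on T 1 (\<lambda>t. Ppm v1 s (cvec (Yc p (u t)))) t - (of_int s * \<i> * of_real (\<epsilon> p)) *s
        Ppm v1 s (cvec (cross3 (deriv_on T 1 (\<lambda>t. Yc p (u t)) t) (Bf p (Yc p (u t))) + Ef p (Yc p (u t))))) \<le> C * (\<epsilon> p * (h p)\<^sup>2)"
    "\<And>p u t s. p \<in> P \<Longrightarrow> sol G p T u \<Longrightarrow> s \<in> {1, -1} \<Longrightarrow>
      t \<in> {0..T} \<Longrightarrow> norm (u t) \<le> r \<Longrightarrow> norm (snd (snd (u t))) \<le> A * (h p)\<^sup>2 \<Longrightarrow>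
      norm (deriv_on T 1 (\<lambda>t. Ppm v1 s (cvec (zt \<Gamma> p (u t)))) t
        - (- of_int s * 4 * \<i> * of_real (\<epsilon> p / (h p)\<^sup>2)) *s Ppm v1 s (cvec (zt \<Gamma> p (u t)))) \<le> C * (\<epsilon> p * (h p)\<^sup>2)"
proof -
  obtain K where K: "K > 0" "\<And>s a. s \<in> {1, -1} \<Longrightarrow> norm (Ppm v1 s (cvec a)) \<le> K * norm a" by (rule Ppm_bound) blast
  obtain c1 where c1: "c1 > 0" "\<And>p u. p \<in> P \<Longrightarrow> norm u \<le> r \<Longrightarrow> norm (snd (snd u)) \<le> A * (h p)\<^sup>2 \<Longrightarrow>
      \<bar>cW \<Gamma> p u - B0 \<bullet> Fo p (fst u, vy \<Gamma> p u)\<bar> \<le> c1 * (h p)\<^sup>2 \<and>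
      norm (cY \<Gamma> p u - Fo p (fst u, vy \<Gamma> p u)) \<le> c1 * (h p)\<^sup>2"
    using lead_est[OF A, of r] by blast
  obtain c2 where c2: "c2 > 0" "\<And>p u. p \<in> P \<Longrightarrow> norm u \<le> r \<Longrightarrow> norm (cZ \<Gamma> p u) \<le> c2 * norm (snd (snd u))"
    using van_bound[OF smf_comps(3)[OF sG] vZ, of r] by blast
  define C where "C = c1 + K * c1 + K * (c2 * A)"
  have nn: "0 \<le> K * c1" "0 \<le> K * (c2 * A)" using K(1) c1(1) c2(1) A by auto
  have le: "c1 \<le> C" "K * c1 \<le> C" "K * (c2 * A) \<le> C" unfolding C_def using nn c1(1) by linarith+
  have eJ: "norm (Ppm v1 s (cvec (\<epsilon> p *\<^sub>R J a))) \<le> C * (\<epsilon> p * (h p)\<^sup>2)"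
    if p: "p \<in> P" and s: "s \<in> {1, -1}" and a: "norm a \<le> c * (h p)\<^sup>2" and c: "K * c \<le> C" for p s a c
  proof -
    have "norm (Ppm v1 s (cvec (\<epsilon> p *\<^sub>R J a))) \<le> K * norm (\<epsilon> p *\<^sub>R J a)" by (rule K(2)[OF s])
    also have "\<dots> \<le> K * (\<epsilon> p * (c * (h p)\<^sup>2))"
      unfolding norm_scaleR using eps[OF p] K(1) order_trans[OF norm_J_le a] by (intro mult_left_mono mult_mono) auto
    also have "\<dots> = (K * c) * (\<epsilon> p * (h p)\<^sup>2)" by (simp only: mult_ac)
    also have "\<dots> \<le> C * (\<epsilon> p * (h p)\<^sup>2)" by (rule mult_right_mono[OF c]) (use eps[OF p] in simp)
    finally show ?thesis .
  qed
  show thesis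
  proof (rule that[of C])
    show "C > 0" using le(1) c1(1) by linarith
    fix p t and s :: int and u :: "real \<Rightarrow> modst"
    assume p: "p \<in> P" and u: "sol G p T u" and t: "t \<in> {0..T}" and r: "norm (u t) \<le> r" and z: "norm (snd (snd (u t))) \<le> A * (h p)\<^sup>2"
    note d = flow_derivs[OF p u t]
    have F: "cross3 (vy \<Gamma> p (u t)) (Bf p (Yc p (u t))) + Ef p (Yc p (u t)) = Fo p (fst (u t), vy \<Gamma> p (u t))"
      by (simp add: Fo_def Yc_def)
    note l = c1(2)[OF p r z]
    show "norm (deriv_on T 2 (\<lambda>t. P0 B0 (Yc p (u t))) t
        - P0 B0 (cross3 (deriv_on T 1 (\<lambda>t. Yc p (u t)) t) (Bf p (Yc p (u t))) + Ef p (Yc p (u t)))) \<le> C * (h p)\<^sup>2"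
    proof -
      have "norm ((cW \<Gamma> p (u t) - B0 \<bullet> Fo p (fst (u t), vy \<Gamma> p (u t))) *\<^sub>R B0) \<le> c1 * (h p)\<^sup>2"
        using l by (simp add: B0)
      also have "\<dots> \<le> C * (h p)\<^sup>2" by (rule mult_right_mono[OF le(1)]) simp
      finally show ?thesis unfolding d F unfolding P0_def scaleR_diff_left .
    qed
    assume s: "s \<in> {1, -1}"
    show "norm (deriv_on T 1 (\<lambda>t. Ppm v1 s (cvec (Yc p (u t)))) t - (of_int s * \<i> * of_real (\<epsilon> p)) *s
        Ppm v1 s (cvec (cross3 (deriv_on T 1 (\<lambda>t. Yc p (u t)) t) (Bf p (Yc p (u t))) + Ef p (Yc p (u t))))) \<le> C * (\<epsilon> p * (h p)\<^sup>2)"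
    proof -
      have "Ppm v1 s (cvec (\<epsilon> p *\<^sub>R J (cY \<Gamma> p (u t)))) - (of_int s * \<i> * of_real (\<epsilon> p)) *s Ppm v1 s (cvec (Fo p (fst (u t), vy \<Gamma> p (u t))))
        = Ppm v1 s (cvec (\<epsilon> p *\<^sub>R J (cY \<Gamma> p (u t) - Fo p (fst (u t), vy \<Gamma> p (u t)))))"
        unfolding Ppm_simps(3) Ppm_J[OF s] Ppm_simps(2) by (simp add: vec_eq_iff algebra_simps)
      then show ?thesis unfolding d F Ppm_flow(2)[OF s] using eJ[OF p s conjunct2[OF l] le(2)] by simp
    qed
    show "norm (deriv_on T 1 (\<lambda>t. Ppm v1 s (cvec (zt \<Gamma> p (u t)))) t
        - (- of_int s * 4 * \<i> * of_real (\<epsilon> p / (h p)\<^sup>2)) *s Ppm v1 s (cvec (zt \<Gamma> p (u t)))) \<le> C * (\<epsilon> p * (h p)\<^sup>2)"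
    proof -
      have e: "Ppm v1 s (cvec (vz \<Gamma> p (u t))) - (- of_int s * 4 * \<i> * of_real (\<epsilon> p / (h p)\<^sup>2)) *s Ppm v1 s (cvec (Zc p (u t)))
        = Ppm v1 s (cvec (\<epsilon> p *\<^sub>R J (cZ \<Gamma> p (u t))))"
        unfolding vz_def Ppm_simps(1,3) Ppm_J[OF s] \<kappa>_def[symmetric] by (simp add: vec_eq_iff algebra_simps)
      have "norm (cZ \<Gamma> p (u t)) \<le> (c2 * A) * (h p)\<^sup>2"
        using order_trans[OF c2(2)[OF p r] mult_left_mono[OF z less_imp_le[OF c2(1)]]] by (simp only: mult.assoc)
      from eJ[OF p s this le(3)] show ?thesis unfolding d unfolding Ppm_flow(1,3)[OF s] e .
    qed
  qed
qed

text \<open>In the projected formula for z(0), \<open>J\<close> becomes multiplication by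
  \<plusminus>i, whose square is -1, and the claimed value appears with \<open>Xi\<close> in place
  of the force F. The two differ by h^2/4 times an error O(h^2).\<close>

lemma initial_z:
  assumes p: "p \<in> P" and s: "s \<in> {1, -1}" and C: "norm (Xi p a - F) \<le> C * (h p)\<^sup>2"
    and K: "\<And>a. norm (Ppm v1 s (cvec a)) \<le> K * norm a" and K0: "K \<ge> 0"
    and a: "snd (snd a) = ((h p)\<^sup>2 / 4) *\<^sub>R J (J (Xi p a) - (1 / \<epsilon> p) *\<^sub>R (v0 - (B0 \<bullet> v0) *\<^sub>R B0))"
  shows "norm (Ppm v1 s (cvec (zt \<Gamma> p a)) - (- of_int s * \<i> * of_real ((h p)\<^sup>2 / (4 * \<epsilon> p))) *s
      Ppm v1 s (cvec v0 - (of_int s * \<i> * of_real (\<epsilon> p)) *s cvec F)) \<le> K * C * h p ^ 4"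
proof -
  have e0: "\<epsilon> p \<noteq> 0" using eps[OF p] by simp
  have ss: "of_int s * \<i> * (of_int s * \<i>) = (-1::complex)" using s by auto
  have v: "Ppm v1 s (cvec (v0 - (B0 \<bullet> v0) *\<^sub>R B0)) = Ppm v1 s (cvec v0)"
    unfolding Ppm_simps(2) Ppm_B0[OF s] by simp
  define X V W where "X = Ppm v1 s (cvec (Xi p a))" and "V = Ppm v1 s (cvec v0)" and "W = Ppm v1 s (cvec F)"
  let ?q = "of_int s * \<i> :: complex" and ?h = "complex_of_real ((h p)\<^sup>2 / 4)" and ?e = "complex_of_real (1 / \<epsilon> p)"
  have lin: "Ppm v1 s (b - c *s b') = Ppm v1 s b - c *s Ppm v1 s b'" for b b' :: "complex^3" and c
    unfolding Ppm_def outer_proj_def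
    by (simp add: vec_eq_iff sum_subtractf sum_distrib_left sum_distrib_right left_diff_distrib right_diff_distrib mult_ac)
  have Zg: "Ppm v1 s (cvec (c *\<^sub>R J (J b - e *\<^sub>R \<eta>)))
      = complex_of_real c *s (?q *s (?q *s Ppm v1 s (cvec b) - complex_of_real e *s Ppm v1 s (cvec \<eta>)))" for c e b \<eta>
    unfolding Ppm_simps(3) Ppm_J[OF s] Ppm_simps(2) Ppm_simps(3) ..
  have Z: "Ppm v1 s (cvec (zt \<Gamma> p a)) = ?h *s (?q *s (?q *s X - ?e *s V))"
    unfolding Ppm_flow(1)[OF s] Zc_def a Zg v X_def V_def ..
  have "Ppm v1 s (cvec (zt \<Gamma> p a)) - (- of_int s * \<i> * of_real ((h p)\<^sup>2 / (4 * \<epsilon> p))) *s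
      Ppm v1 s (cvec v0 - (of_int s * \<i> * of_real (\<epsilon> p)) *s cvec F) = (- ?h) *s (X - W)"
  proof -
    have k: "?h * (?q * (?q * x - ?e * y)) - (- of_int s * \<i> * of_real ((h p)\<^sup>2 / (4 * \<epsilon> p))) * (y - (of_int s * \<i> * of_real (\<epsilon> p)) * w)
      = - ?h * (x - w)" for x y w :: complex
    proof -
      have r: "(h p)\<^sup>2 / (4 * \<epsilon> p) = (h p)\<^sup>2 / 4 * (1 / \<epsilon> p)" "1 / \<epsilon> p * \<epsilon> p = 1" using e0 by simp_all
      have e: "of_real ((h p)\<^sup>2 / (4 * \<epsilon> p)) = ?h * ?e" "?e * of_real (\<epsilon> p) = (1::complex)"
        using arg_cong[OF r(1), of complex_of_real] arg_cong[OF r(2), of complex_of_real] unfolding of_real_mult of_real_1 .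
      have alg: "H * (q * (q * x - E * y)) - (- q * (H * E)) * (y - q * e * w) = - H * (x - w)"
        if "E * e = 1" "q * q = - 1" for H E e q :: complex
      proof -
        have "H * (q * (q * x - E * y)) - (- q * (H * E)) * (y - q * e * w) = H * ((q * q) * x) - H * ((q * q) * ((E * e) * w))"
          by (simp add: algebra_simps)
        then show ?thesis unfolding that by (simp add: algebra_simps)
      qed
      show ?thesis unfolding e(1) using alg[OF e(2) ss, of ?h] by (simp only: mult_minus_left)
    qed
    show ?thesis unfolding Z lin V_def[symmetric] W_def[symmetric] by (simp only: vec_eq_iff vector_minus_component vector_smult_component k simp_thms)
  qed
  also have "(- ?h) *s (X - W) = Ppm v1 s (cvec ((- ((h p)\<^sup>2 / 4)) *\<^sub>R (Xi p a - F)))"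
    unfolding Ppm_simps(2,3) X_def W_def by simp
  also have "norm \<dots> \<le> K * norm ((- ((h p)\<^sup>2 / 4)) *\<^sub>R (Xi p a - F))" by (rule K)
  also have "\<dots> \<le> K * ((h p)\<^sup>2 * (C * (h p)\<^sup>2))"
    unfolding norm_scaleR using C K0 by (intro mult_left_mono mult_mono) auto
  also have "\<dots> = K * C * h p ^ 4" by (simp add: power4_eq_xxxx power2_eq_square)
  finally show ?thesis .
qed

end

end

section \<open>Assembly of the expansion\<close>

lemma close_on_mono: "close_on T d f g \<Longrightarrow> d \<le> d' \<Longrightarrow> close_on T d' f g"
  unfolding close_on_def by (meson order_trans)

lemma unique_decomposition_mono:
  assumes "unique_decomposition U T N h x y z" "\<And>c. U c \<le> U' c" "h \<ge> 0"
  shows "unique_decomposition U' T N h x y z"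
proof -
  have le: "U c * h ^ N \<le> U' c * h ^ N" for c using assms(2)[of c] assms(3) by (simp add: mult_right_mono)
  show ?thesis using assms(1) close_on_mono[OF _ le] unfolding unique_decomposition_def by blast
qed

lemma unique_modulation_mono:
  assumes "unique_modulation U T N \<epsilon> h B0 v1 S y z" "\<And>c. U c \<le> U' c" "\<epsilon> \<ge> 0"
  shows "unique_modulation U' T N \<epsilon> h B0 v1 S y z"
proof -
  have le: "U c * \<epsilon> ^ (N + 2) \<le> U' c * \<epsilon> ^ (N + 2)" for c
    by (rule mult_right_mono[OF assms(2)]) (use assms(3) in simp)
  show ?thesis using assms(1) close_on_mono[OF _ le] unfolding unique_modulation_def by blast
qed

lemma coeff_bounds_mono:
  assumes "coeff_bounds T N h C y z" "C \<le> C'"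
  shows "coeff_bounds T N h C' y z"
proof -
  have "C * h\<^sup>2 \<le> C' * h\<^sup>2" by (rule mult_right_mono[OF assms(2)]) simp
  then show ?thesis using assms unfolding coeff_bounds_def by (meson order_trans)
qed

context fields begin

text \<open>Collects the asserted properties of y and z for one parameter value, with the fields
  taken from the family.\<close>

definition modulated where
  "modulated T v1 N C U S p x0 v0 x y z \<longleftrightarrow>
     coeff_bounds T N (h p) C y z \<and>
     unique_decomposition U T N (h p) x y z \<and>
     unique_modulation U T N (\<epsilon> p) (h p) B0 v1 S y z \<and>
     (\<forall>t\<in>{0..T}. norm (cross3 (deriv_on T 1 y t) B0) \<le> C * \<epsilon> p \<and> \<bar>z t \<bullet> B0\<bar> \<le> C * h p ^ 4) \<and>
     remainder_bound T N (h p) C x y z \<and>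
     solves_upto 0 T B0 v1 S y z \<and>
     (\<forall>t\<in>{0..T}.
       norm (deriv_on T 2 (\<lambda>u. P0 B0 (y u)) t
             - P0 B0 (cross3 (deriv_on T 1 y t) (Bf p (y t)) + Ef p (y t))) \<le> C * (h p)\<^sup>2 \<and>
       (\<forall>s\<in>{1, -1}.
         norm (deriv_on T 1 (\<lambda>u. Ppm v1 s (cvec (y u))) t
               - (of_int s * \<i> * of_real (\<epsilon> p)) *s
                   Ppm v1 s (cvec (cross3 (deriv_on T 1 y t) (Bf p (y t)) + Ef p (y t)))) \<le> C * (\<epsilon> p * (h p)\<^sup>2) \<and>
         norm (deriv_on T 1 (\<lambda>u. Ppm v1 s (cvec (z u))) t
               - (- of_int s * 4 * \<i> * of_real (\<epsilon> p / (h p)\<^sup>2)) *s Ppm v1 s (cvec (z t))) \<le> C * (\<epsilon> p * (h p)\<^sup>2))) \<and>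
     norm (y 0 - x0) \<le> C * (h p)\<^sup>2 \<and>
     norm (deriv_on T 1 (\<lambda>u. P0 B0 (y u)) 0 - P0 B0 v0) \<le> C * (h p)\<^sup>2 \<and>
     (\<forall>s\<in>{1, -1}.
       norm (Ppm v1 s (cvec (z 0))
             - (- of_int s * \<i> * of_real ((h p)\<^sup>2 / (4 * \<epsilon> p))) *s
                 Ppm v1 s (cvec v0 - (of_int s * \<i> * of_real (\<epsilon> p)) *s
                   cvec (cross3 (P0 B0 v0) (Bf p x0) + Ef p x0))) \<le> C * h p ^ 4)"

lemma modulated_expansion:
  fixes v1 :: "complex^3" and K :: "(real^3) set" and T Cv c1 :: real and N :: nat and m :: integrator
  assumes v1: "unit_eigenvector B0 v1" and K: "compact K" and T: "T > 0" and N: "N \<ge> 2"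
  shows "\<exists>h0 > 0. \<exists>C L U. \<forall>p\<in>P. h p \<le> h0 \<longrightarrow>
    (\<exists>S. locally_lipschitz_system L S \<and>
      (\<forall>x0 v0 x.
        numerical_solution m T (\<epsilon> p) (h p) B0 (Af p) (Bf p) (Ef p) x0 v0 x \<and>
        norm v0 \<le> Cv \<and> norm (v0 - P0 B0 v0) \<le> c1 * \<epsilon> p \<and>
        (\<forall>n::nat. real n * h p \<le> T \<longrightarrow> x (int n) \<in> K) \<longrightarrow>
        (\<exists>y z. modulated T v1 N C U S p x0 v0 x y z)))"
proof -
  have N1: "N \<ge> 1" using N by simp
  \<comment> \<open>The truncation index serves both as the number of iterations and as the length
    of the Taylor series, which yields the accuracy h^(2N).\<close>
  interpret Q: two_step_modulation P h \<epsilon> B0 "force m" N Bf Ef by (rule force_modulation[OF N1])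
  obtain R0 where R0: "R0 > 0" "\<And>x. x \<in> K \<Longrightarrow> norm x \<le> R0"
    using compact_imp_bounded[OF K] unfolding bounded_pos by blast
  \<comment> \<open>The construction of the flow works with nonnegative bounds, while
    \<open>Cv\<close> and \<open>c1\<close> are arbitrary reals; they are enlarged if
    necessary.\<close>
  define Cw where "Cw = max 0 Cv"
  define cw where "cw = max 0 c1"
  have Cw: "Cw \<ge> 0" "cw \<ge> 0" "Cv \<le> Cw" "c1 \<le> cw" by (auto simp: Cw_def cw_def)
  show ?thesis
  proof (rule Q.flow_exists[OF T less_imp_le[OF R0(1)] Cw(1,2)], goal_cases)
    case (1 r C1 hf)
    note C1 = 1(2) and hf = 1(3) and flow = 1(4)
    have C1': "C1 \<ge> 0" using C1 by simp
    obtain Cb where Cb: "Cb > 0" and bounds: "\<And>p u. p \<in> P \<Longrightarrow> sol (Q.vf (Q.Gam N)) p T u \<Longrightarrow>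
      (\<And>t. t \<in> {0..T} \<Longrightarrow> norm (u t) \<le> r \<and> norm (snd (snd (u t))) \<le> C1 * (h p)\<^sup>2 \<and> B0 \<bullet> snd (snd (u t)) = 0) \<Longrightarrow>
      coeff_bounds T N (h p) Cb (\<lambda>t. Q.Yc p (u t)) (\<lambda>t. Q.zt (Q.Gam N) p (u t)) \<and>
      (\<forall>t\<in>{0..T}. norm (cross3 (deriv_on T 1 (\<lambda>t. Q.Yc p (u t)) t) B0) \<le> Cb * \<epsilon> p \<and> \<bar>Q.zt (Q.Gam N) p (u t) \<bullet> B0\<bar> \<le> Cb * h p ^ 4)"
      using Q.flow_bounds[OF v1 T C1', where r = r and N = N] by blast
    show ?case
    proof (rule Q.flow_equations[OF v1 T C1', where r = r], goal_cases)
      case (1 Ce)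
      note Ce = 1(1) and eqs = 1(2-4)
      obtain Ci where Ci: "Ci > 0" and ini: "\<And>p u x0 v0. p \<in> P \<Longrightarrow> norm u \<le> max r R0 \<Longrightarrow> norm (snd (snd u)) \<le> C1 * (h p)\<^sup>2 \<Longrightarrow>
        norm (u - (x0, B0 \<bullet> v0, 0)) \<le> C1 * (h p)\<^sup>2 \<Longrightarrow> norm x0 \<le> max r R0 \<Longrightarrow> norm v0 \<le> Cw \<Longrightarrow>
        norm (Q.Xi p u - Q.Fo p (x0, P0 B0 v0)) \<le> Ci * (h p)\<^sup>2"
        by (rule Q.lead_est_init[OF C1' Cw(1), where r = "max r R0"]) blast
      obtain Kp where Kp: "Kp > 0" "\<And>s a. s \<in> {1, -1} \<Longrightarrow> norm (Ppm v1 s (cvec a)) \<le> Kp * norm a"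
        by (rule Q.Ppm_bound[OF v1 T]) blast
      obtain L where L: "\<And>p. p \<in> P \<Longrightarrow> locally_lipschitz_system L (Q.system v1 p)"
        by (rule Q.system_lipschitz) blast
      obtain Ku hd where Ku: "Ku > 0" "hd > 0" and ud: "\<And>C h x y z. 0 < h \<Longrightarrow> h \<le> hd \<Longrightarrow> h \<le> 1 \<Longrightarrow>
        coeff_bounds T N h C y z \<Longrightarrow> remainder_bound T N h C x y z \<Longrightarrow>
        unique_decomposition (\<lambda>c. Ku * (c + C)) T N h x y z"
        by (rule unique_decomposition_of_bounds[OF T, where N = N]) blast
      define C where "C = C1 + Cb + Ce + Kp * Ci"
      have KC: "0 \<le> Kp * Ci" using Kp(1) Ci by simp
      have le: "C1 \<le> C" "Cb \<le> C" "Ce \<le> C" "Kp * Ci \<le> C" "0 \<le> C" unfolding C_def using C1 Cb Ce KC by linarith+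
      obtain Um where um: "\<And>\<epsilon> h S y z. 0 < \<epsilon> \<Longrightarrow> 0 < h \<Longrightarrow> h \<le> 1 \<Longrightarrow> locally_lipschitz_system L S \<Longrightarrow>
        coeff_bounds T N h C y z \<Longrightarrow> solves_upto 0 T B0 v1 S y z \<Longrightarrow> unique_modulation Um T N \<epsilon> h B0 v1 S y z"
        by (rule unique_modulation_of_lipschitz[OF T N B0 v1, where L = L and C = C]) blast
      \<comment> \<open>One function has to serve both notions of uniqueness.\<close>
      define U where "U c = max (Ku * (c + C)) (Um c)" for c
      have leU: "Ku * (c + C) \<le> U c" "Um c \<le> U c" for c by (simp_all add: U_def)
      define h0 where "h0 = min hf hd"
      show ?case
      proof (rule exI[of _ h0], rule conjI, goal_cases)
        case 1
        show ?case using hf Ku(2) by (simp add: h0_def)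
      next
        case 2
        show ?case
        proof (rule exI[of _ C], rule exI[of _ L], rule exI[of _ U], intro ballI impI)
          fix p assume p: "p \<in> P" and hp: "h p \<le> h0"
          note h0p = h[OF p] and h1p = h1[OF p] and ep = eps[OF p]
          have hle: "h p \<le> hf" "h p \<le> hd" using hp by (auto simp: h0_def)
          have hn: "0 \<le> (h p)\<^sup>2" "0 \<le> h p ^ 4" "0 \<le> \<epsilon> p * (h p)\<^sup>2" using ep by simp_all
          show "\<exists>S. locally_lipschitz_system L S \<and>
      (\<forall>x0 v0 x.
        numerical_solution m T (\<epsilon> p) (h p) B0 (Af p) (Bf p) (Ef p) x0 v0 x \<and>
        norm v0 \<le> Cv \<and> norm (v0 - P0 B0 v0) \<le> c1 * \<epsilon> p \<and>
        (\<forall>n::nat. real n * h p \<le> T \<longrightarrow> x (int n) \<in> K) \<longrightarrow>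
        (\<exists>y z. modulated T v1 N C U S p x0 v0 x y z))"
          proof (rule exI[of _ "Q.system v1 p"], intro conjI allI impI)
            show "locally_lipschitz_system L (Q.system v1 p)" by (rule L[OF p])
            fix x0 v0 :: "real^3" and x :: "int \<Rightarrow> real^3"
            assume as: "numerical_solution m T (\<epsilon> p) (h p) B0 (Af p) (Bf p) (Ef p) x0 v0 x \<and>
              norm v0 \<le> Cv \<and> norm (v0 - P0 B0 v0) \<le> c1 * \<epsilon> p \<and> (\<forall>n::nat. real n * h p \<le> T \<longrightarrow> x (int n) \<in> K)"
            then have x0: "x 0 = x0" and v0: "velocity (h p) x 0 = v0" and v0C: "norm v0 \<le> Cv" and v0c: "norm (v0 - P0 B0 v0) \<le> c1 * \<epsilon> p"
              and xK: "\<And>n::nat. real n * h p \<le> T \<Longrightarrow> x (int n) \<in> K"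
              and step: "\<And>n. 0 \<le> n \<Longrightarrow> of_int (n + 1) * h p \<le> T \<Longrightarrow> two_step m (\<epsilon> p) (h p) B0 (Af p) (Bf p) (Ef p) x n"
              unfolding numerical_solution_def by blast+
            have v0w: "norm v0 \<le> Cw" using v0C Cw(3) by linarith
            have "c1 * \<epsilon> p \<le> cw * \<epsilon> p" by (rule mult_right_mono[OF Cw(4)]) (use ep in simp)
            then have v0p: "norm (v0 - (B0 \<bullet> v0) *\<^sub>R B0) \<le> cw * \<epsilon> p" using v0c unfolding P0_def by linarith
            have x0R: "norm x0 \<le> R0" using R0(2)[OF xK[of 0]] T x0 by simp
            have "\<exists>u. sol (Q.vf (Q.Gam N)) p T u \<and>
              (\<forall>t\<in>{0..T}. norm (u t) \<le> r \<and> norm (snd (snd (u t))) \<le> C1 * (h p)\<^sup>2 \<and> B0 \<bullet> snd (snd (u t)) = 0) \<and>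
              norm (u 0 - (x (int 0), B0 \<bullet> velocity (h p) x (int 0), 0)) \<le> C1 * (h p)\<^sup>2 \<and> Q.xs 1 (Q.Gam N) p (u 0) = x (int 0) \<and>
              snd (snd (u 0)) = ((h p)\<^sup>2 / 4) *\<^sub>R Q.J (Q.J (Q.Xi p (u 0)) - (1 / \<epsilon> p) *\<^sub>R (velocity (h p) x (int 0) - (B0 \<bullet> velocity (h p) x (int 0)) *\<^sub>R B0)) \<and>
              (\<forall>m. real m * h p \<le> T \<longrightarrow> norm (x (int m) - Q.xs ((-1) ^ m) (Q.Gam N) p (u (real m * h p))) \<le> C1 * h p ^ (2 * N))"
            proof (rule flow[of p "\<lambda>n. x (int n)" "\<lambda>n. velocity (h p) x (int n)" "\<lambda>n. second_difference (h p) x (int n)"])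
              show "x (int (Suc n)) = x (int n) + h p *\<^sub>R velocity (h p) x (int n) + ((h p)\<^sup>2 / 2) *\<^sub>R second_difference (h p) x (int n)" for n
                using two_step_identities(1)[OF h0p, of x "int n"] by (simp add: add.commute)
              show "x (int n) = x (int (Suc n)) - h p *\<^sub>R velocity (h p) x (int (Suc n)) + ((h p)\<^sup>2 / 2) *\<^sub>R second_difference (h p) x (int (Suc n))" for n
                using two_step_identities(2)[OF h0p, of x "int (Suc n)"] by simp
              show "second_difference (h p) x (int n) = (1 / \<epsilon> p) *\<^sub>R Q.J (velocity (h p) x (int n))
                  + force m p (x (int n), velocity (h p) x (int n), (h p)\<^sup>2 *\<^sub>R second_difference (h p) x (int n))"
                if "real (Suc n) * h p \<le> T" for n
                unfolding Q.J_def by (rule two_step_force[OF p step]) (use that in \<open>simp_all add: add.commute\<close>)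
              show "norm (x (int n)) \<le> R0" if "real n * h p \<le> T" for n by (rule R0(2)[OF xK[OF that]])
            qed (use p hle v0 v0w v0p in simp_all)
            then obtain u where u: "sol (Q.vf (Q.Gam N)) p T u"
              and ub: "\<And>t. t \<in> {0..T} \<Longrightarrow> norm (u t) \<le> r \<and> norm (snd (snd (u t))) \<le> C1 * (h p)\<^sup>2 \<and> B0 \<bullet> snd (snd (u t)) = 0"
              and u0: "norm (u 0 - (x0, B0 \<bullet> v0, 0)) \<le> C1 * (h p)\<^sup>2" and ux: "Q.xs 1 (Q.Gam N) p (u 0) = x0"
              and uz: "snd (snd (u 0)) = ((h p)\<^sup>2 / 4) *\<^sub>R Q.J (Q.J (Q.Xi p (u 0)) - (1 / \<epsilon> p) *\<^sub>R (v0 - (B0 \<bullet> v0) *\<^sub>R B0))"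
              and tr: "\<And>m. real m * h p \<le> T \<Longrightarrow> norm (x (int m) - Q.xs ((-1) ^ m) (Q.Gam N) p (u (real m * h p))) \<le> C1 * h p ^ (2 * N)"
              unfolding of_nat_0 x0 v0 by blast
            let ?y = "\<lambda>t. Q.Yc p (u t)" and ?z = "\<lambda>t. Q.zt (Q.Gam N) p (u t)"
            have T0: "0 \<in> {0..T}" using T by simp
            have cb: "coeff_bounds T N (h p) C ?y ?z" by (rule coeff_bounds_mono[OF conjunct1[OF bounds[OF p u ub]] le(2)])
            have sv: "solves_upto 0 T B0 v1 (Q.system v1 p) ?y ?z"
              by (rule Q.flow_solves[OF v1 T p u]) (use ub in blast)
            have rb: "remainder_bound T N (h p) C x ?y ?z"
              unfolding remainder_bound_def
            proof (intro allI impI)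
              fix k assume k: "real k * h p \<le> T"
              have rem: "remainder (h p) x ?y ?z k = x (int k) - Q.xs ((-1) ^ k) (Q.Gam N) p (u (real k * h p))"
                by (simp add: remainder_def Q.xs_def)
              show "norm (remainder (h p) x ?y ?z k) \<le> C * (real k * h p)\<^sup>2 * h p ^ N"
              \<comment> \<open>At k = 0 the remainder is zero because the start values are matched
                exactly. For k \<ge> 1 the power h^(2N) \<le> h^(N+2) is absorbed by (k h)^2
                h^N.\<close>
              proof (cases "k = 0")
                case True
                then show ?thesis unfolding rem by (simp add: ux x0)
              next
                case False
                have "h p ^ (2 * N) \<le> h p ^ (2 + N)" by (rule Q.h_le[OF p]) (use N in simp)
                also have "h p ^ (2 + N) = (1 * h p)\<^sup>2 * h p ^ N" by (simp only: power_add mult_1)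
                also have "\<dots> \<le> (real k * h p)\<^sup>2 * h p ^ N"
                  using False h0p by (intro mult_right_mono power_mono) auto
                finally have "C1 * h p ^ (2 * N) \<le> C * ((real k * h p)\<^sup>2 * h p ^ N)"
                  using le(1,5) h0p by (intro mult_mono) auto
                then show ?thesis unfolding rem using tr[OF k] by (simp only: mult.assoc)
              qed
            qed
            have F0: "cross3 (P0 B0 v0) (Bf p x0) + Ef p x0 = Q.Fo p (x0, P0 B0 v0)" by (simp add: Q.Fo_def)
            have Xi0: "norm (Q.Xi p (u 0) - Q.Fo p (x0, P0 B0 v0)) \<le> Ci * (h p)\<^sup>2"
              by (rule ini[OF p _ _ u0 _ v0w]) (use ub[OF T0] x0R in auto)
            show "\<exists>y z. modulated T v1 N C U (Q.system v1 p) p x0 v0 x y z"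
              unfolding modulated_def
            proof (rule exI[of _ ?y], rule exI[of _ ?z], intro conjI ballI)
              show "coeff_bounds T N (h p) C ?y ?z" by (rule cb)
              show "unique_decomposition U T N (h p) x ?y ?z"
                by (rule unique_decomposition_mono[OF ud[OF h0p hle(2) h1p cb rb] leU(1)]) (use h0p in simp)
              show "unique_modulation U T N (\<epsilon> p) (h p) B0 v1 (Q.system v1 p) ?y ?z"
                by (rule unique_modulation_mono[OF um[OF ep h0p h1p L[OF p] cb sv] leU(2)]) (use ep in simp)
              show "remainder_bound T N (h p) C x ?y ?z" by (rule rb)
              show "solves_upto 0 T B0 v1 (Q.system v1 p) ?y ?z" by (rule sv)
              fix t assume t: "t \<in> {0..T}"
              have bt: "norm (cross3 (deriv_on T 1 ?y t) B0) \<le> Cb * \<epsilon> p \<and> \<bar>?z t \<bullet> B0\<bar> \<le> Cb * h p ^ 4"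
                by (rule bspec[OF conjunct2[OF bounds[OF p u ub]] t])
              show "norm (cross3 (deriv_on T 1 ?y t) B0) \<le> C * \<epsilon> p"
                by (rule order_trans[OF conjunct1[OF bt] mult_right_mono[OF le(2)]]) (use ep in simp)
              show "\<bar>?z t \<bullet> B0\<bar> \<le> C * h p ^ 4"
                by (rule order_trans[OF conjunct2[OF bt] mult_right_mono[OF le(2) hn(2)]])
              have r: "norm (u t) \<le> r" and z: "norm (snd (snd (u t))) \<le> C1 * (h p)\<^sup>2" using ub[OF t] by auto
              show "norm (deriv_on T 2 (\<lambda>u. P0 B0 (?y u)) t
                  - P0 B0 (cross3 (deriv_on T 1 ?y t) (Bf p (?y t)) + Ef p (?y t))) \<le> C * (h p)\<^sup>2"
                by (rule order_trans[OF eqs(1)[OF p u t r z] mult_right_mono[OF le(3) hn(1)]])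
              fix s :: int assume s: "s \<in> {1, -1}"
              show "norm (deriv_on T 1 (\<lambda>u. Ppm v1 s (cvec (?y u))) t
                    - (of_int s * \<i> * of_real (\<epsilon> p)) *s
                        Ppm v1 s (cvec (cross3 (deriv_on T 1 ?y t) (Bf p (?y t)) + Ef p (?y t)))) \<le> C * (\<epsilon> p * (h p)\<^sup>2)"
                by (rule order_trans[OF eqs(2)[OF p u s t r z] mult_right_mono[OF le(3) hn(3)]])
              show "norm (deriv_on T 1 (\<lambda>u. Ppm v1 s (cvec (?z u))) t
                    - (- of_int s * 4 * \<i> * of_real (\<epsilon> p / (h p)\<^sup>2)) *s Ppm v1 s (cvec (?z t))) \<le> C * (\<epsilon> p * (h p)\<^sup>2)"
                by (rule order_trans[OF eqs(3)[OF p u s t r z] mult_right_mono[OF le(3) hn(3)]])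
            next
              have "norm (fst (u 0) - x0) \<le> C1 * (h p)\<^sup>2"
                using norm_state_comps(1)[of "u 0 - (x0, B0 \<bullet> v0, 0)"] u0 by simp
              then show "norm (?y 0 - x0) \<le> C * (h p)\<^sup>2"
                unfolding Q.Yc_def by (rule order_trans[OF _ mult_right_mono[OF le(1) hn(1)]])
              have "\<bar>fst (snd (u 0)) - B0 \<bullet> v0\<bar> \<le> C1 * (h p)\<^sup>2"
                using norm_state_comps(2)[of "u 0 - (x0, B0 \<bullet> v0, 0)"] u0 by simp
              then have "norm ((fst (snd (u 0)) - B0 \<bullet> v0) *\<^sub>R B0) \<le> C1 * (h p)\<^sup>2" by (simp add: B0)
              then show "norm (deriv_on T 1 (\<lambda>u. P0 B0 (?y u)) 0 - P0 B0 v0) \<le> C * (h p)\<^sup>2"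
                unfolding Q.flow_derivs(2)[OF v1 T p u T0] unfolding Q.Wc_def P0_def scaleR_diff_left
                by (rule order_trans[OF _ mult_right_mono[OF le(1) hn(1)]])
              fix s :: int assume s: "s \<in> {1, -1}"
              show "norm (Ppm v1 s (cvec (?z 0)) - (- of_int s * \<i> * of_real ((h p)\<^sup>2 / (4 * \<epsilon> p))) *s
                      Ppm v1 s (cvec v0 - (of_int s * \<i> * of_real (\<epsilon> p)) *s
                        cvec (cross3 (P0 B0 v0) (Bf p x0) + Ef p x0))) \<le> C * h p ^ 4"
                unfolding F0
                by (rule order_trans[OF Q.initial_z[OF v1 T p s Xi0 Kp(2)[OF s] less_imp_le[OF Kp(1)] uz] mult_right_mono[OF le(4) hn(2)]])
            qed
          qed
        qed
      qed
    qed
  qed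
qed

end

theorem theorem4p2:
  fixes B0 :: "real^3" and v1 :: "complex^3" and K :: "(real^3) set"
    and T Cv c1 :: real and M :: "nat \<Rightarrow> real \<Rightarrow> real" and N :: nat and m :: integrator
  assumes B0: "norm B0 = 1" and v1: "unit_eigenvector B0 v1"
    and K: "compact K" and T: "T > 0" and N: "N \<ge> 2"
  shows "\<exists>h0 > 0. \<exists>C L U. \<forall>\<epsilon> h A1 B1 E.
    0 < \<epsilon> \<and> \<epsilon> \<le> h\<^sup>2 \<and> 0 < h \<and> h \<le> h0 \<and> admissible_fields M A1 B1 E \<longrightarrow>
    (\<exists>S. locally_lipschitz_system L S \<and>
      (\<forall>x0 v0 x.
        numerical_solution m T \<epsilon> h B0 A1 B1 E x0 v0 x \<and>
        norm v0 \<le> Cv \<and> norm (v0 - P0 B0 v0) \<le> c1 * \<epsilon> \<and>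
        (\<forall>n::nat. real n * h \<le> T \<longrightarrow> x (int n) \<in> K) \<longrightarrow>
        (\<exists>y z.
          \<comment> \<open>(a)\<close>
          coeff_bounds T N h C y z \<and>
          unique_decomposition U T N h x y z \<and>
          unique_modulation U T N \<epsilon> h B0 v1 S y z \<and>
          (\<forall>t\<in>{0..T}. norm (cross3 (deriv_on T 1 y t) B0) \<le> C * \<epsilon> \<and> \<bar>z t \<bullet> B0\<bar> \<le> C * h ^ 4) \<and>
          \<comment> \<open>(b)\<close>
          remainder_bound T N h C x y z \<and>
          \<comment> \<open>(c)\<close>
          solves_upto 0 T B0 v1 S y z \<and>
          (\<forall>t\<in>{0..T}.
            norm (deriv_on T 2 (\<lambda>u. P0 B0 (y u)) t
                  - P0 B0 (cross3 (deriv_on T 1 y t) (B1 (y t)) + E (y t))) \<le> C * h\<^sup>2 \<and>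
            (\<forall>s\<in>{1, -1}.
              norm (deriv_on T 1 (\<lambda>u. Ppm v1 s (cvec (y u))) t
                    - (of_int s * \<i> * of_real \<epsilon>) *s
                        Ppm v1 s (cvec (cross3 (deriv_on T 1 y t) (B1 (y t)) + E (y t)))) \<le> C * (\<epsilon> * h\<^sup>2) \<and>
              norm (deriv_on T 1 (\<lambda>u. Ppm v1 s (cvec (z u))) t
                    - (- of_int s * 4 * \<i> * of_real (\<epsilon> / h\<^sup>2)) *s Ppm v1 s (cvec (z t))) \<le> C * (\<epsilon> * h\<^sup>2))) \<and>
          \<comment> \<open>(d)\<close>
          norm (y 0 - x0) \<le> C * h\<^sup>2 \<and>
          norm (deriv_on T 1 (\<lambda>u. P0 B0 (y u)) 0 - P0 B0 v0) \<le> C * h\<^sup>2 \<and>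
          (\<forall>s\<in>{1, -1}.
            norm (Ppm v1 s (cvec (z 0))
                  - (- of_int s * \<i> * of_real (h\<^sup>2 / (4 * \<epsilon>))) *s
                      Ppm v1 s (cvec v0 - (of_int s * \<i> * of_real \<epsilon>) *s
                        cvec (cross3 (P0 B0 v0) (B1 x0) + E x0))) \<le> C * h ^ 4))))"
proof -
  \<comment> \<open>The fields are part of the parameter, so every constant obtained for this family
    is uniform in \<epsilon>, h and all fields that obey the same bounds \<open>M\<close>.\<close>
  define P :: "(real \<times> real \<times> (real^3 \<Rightarrow> real^3) \<times> (real^3 \<Rightarrow> real^3) \<times> (real^3 \<Rightarrow> real^3)) set" where
    "P = {(\<epsilon>, h, A1, B1, E). 0 < \<epsilon> \<and> \<epsilon> \<le> h\<^sup>2 \<and> 0 < h \<and> h \<le> 1 \<and> admissible_fields M A1 B1 E}"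
  have adm: "admissible_fields M (fst (snd (snd p))) (fst (snd (snd (snd p)))) (snd (snd (snd (snd p))))" if "p \<in> P" for p
    using that by (auto simp: P_def)
  interpret fields P "\<lambda>p. fst (snd p)" fst B0 "\<lambda>p. fst (snd (snd p))" "\<lambda>p. fst (snd (snd (snd p)))" "\<lambda>p. snd (snd (snd (snd p)))"
  proof
    show "smf P (\<lambda>p. fst (snd (snd p)))" "smf P (\<lambda>p. fst (snd (snd (snd p))))" "smf P (\<lambda>p. snd (snd (snd (snd p))))"
      by (rule smf_partials[where M = M], use adm in \<open>auto simp: admissible_fields_def\<close>)+
    show "fst (snd (snd (snd p))) x = curl (fst (snd (snd p))) x" if "p \<in> P" for p x
      using adm[OF that] by (simp add: admissible_fields_def)
  qed (use B0 in \<open>auto simp: P_def\<close>)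
  from modulated_expansion[OF v1 K T N, where m = m and Cv = Cv and ?c1.0 = c1, unfolded modulated_def] show ?thesis
  proof (elim exE conjE, goal_cases)
    case (1 h0 C L U)
    note h0 = 1(1) and expansion = 1(2)
    show ?case
    \<comment> \<open>The family contains only step sizes up to 1, so the threshold is lowered
      accordingly.\<close>
    proof (rule exI[of _ "min h0 1"], rule conjI, goal_cases)
      case 1
      show ?case using h0 by simp
    next
      case 2
      show ?case
      proof (rule exI[of _ C], rule exI[of _ L], rule exI[of _ U], intro allI impI, goal_cases)
        case (1 \<epsilon> h A1 B1 E)
        then have pP: "(\<epsilon>, h, A1, B1, E) \<in> P" and le: "h \<le> h0" by (auto simp: P_def)
        show ?case by (rule mp[OF bspec[OF expansion pP, unfolded fst_conv snd_conv] le])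
      qed
    qed
  qed
qed

end
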